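(* Let $N\ge2$ and let $\Omega\subset\mathbb{R}^N$ be a bounded open set with smooth boundary. Let $m\in\mathbb{N}\setminus\{0\}$, $s_1,\dots,s_m\in[0,1]$, $p_1,\dots,p_m\in(1,N)$ be such that $$p^*:=\frac{Np_k}{N-s_kp_k}\quad\text{is the same for every }k\in\{1,\dots,m\},$$ and set $\widehat p:=\max\{p_1,\dots,p_m\}$. Let $f:\Omega\times\mathbb{R}\to\mathbb{R}$ be a Carathéodory function, put $F(x,t):=\int_0^tf(x,\tau)\,d\tau$, and assume that: (i) there exist $a_1,a_2>0$ and $q\in(\widehat p,p^* )$ such that $|f(x,t)|\le a_1+a_2|t|^{q-1}$ for any $t\in\mathbb{R}$ and a.e. $x\in\Omega$; (ii) $\lim_{t\to0}\frac{f(x,t)}{|t|^{\widehat p-2}t}=0$ uniformly for a.e. $x\in\Omega$; (iii) there exist $\vartheta>\widehat p$ and $r\ge0$ such that $0<\vartheta F(x,t)\le f(x,t)t$ for any $t$ with $|t|>r$ and a.e. $x\in\Omega$; (iv) there exist $\widetilde\vartheta>\widehat p$, $a_3>0$ and $a_4\in L^1(\Omega)$ such that $F(x,t)\ge a_3|t|^{\widetilde\vartheta}-a_4(x)$ for any $t\in\mathbb{R}$ and a.e. $x\in\Omega$. Then the problem $$\begin{cases}\displaystyle\sum_{k=1}^m(-\Delta)^{s_k}_{p_k}u=f(x,u)&\text{in }\Omega,\\ u=0&\text{in }\mathbb{R}^N\setminus\Omega\end{cases}$$ admits a weak solution of Mountain Pass type.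
   Context: For $s\in(0,1)$ and $p\in(1,N)$ set $c_{N,s,p}:=\dfrac{s\,2^{2s}\,\Gamma\left(\frac{ps+p+N-2}{2}\right)}{\pi^{N/2}\,\Gamma(1-s)}$ and $$(-\Delta)^s_pu(x):=c_{N,s,p}\lim_{\varepsilon\searrow0}\int_{\mathbb{R}^N\setminus B_\varepsilon(x)}\frac{|u(x)-u(y)|^{p-2}(u(x)-u(y))}{|x-y|^{N+sp}}\,dy;$$ $s=1$ is $-\Delta_pu=-\operatorname{div}(|\nabla u|^{p-2}\nabla u)$, $s=0$ a zero-order term. Equations are understood in the weak sense below. Seminorms: $[u]_{0,p}:=\|u\|_{L^p(\mathbb{R}^N)}$, $[u]_{s,p}:=\Big(c_{N,s,p}\iint_{\mathbb{R}^{2N}}\frac{|u(x)-u(y)|^p}{|x-y|^{N+sp}}\,dx\,dy\Big)^{1/p}$ for $s\in(0,1)$, $[u]_{1,p}:=\|\nabla u\|_{L^p(\mathbb{R}^N)}$. $\mathcal{X}_\mu(\Omega)$ is the completion of $C_0^\infty(\Omega)$ with respect to $\|u\|_\mu:=\sum_{k=1}^m[u]_{s_k,p_k}$ (elements regarded as functions vanishing a.e. outside $\Omega$). Put $\mathcal{E}_{s,p}(u,v):=\frac{c_{N,s,p}}{2}\iint_{\mathbb{R}^{2N}}\frac{|u(x)-u(y)|^{p-2}(u(x)-u(y))(v(x)-v(y))}{|x-y|^{N+sp}}\,dx\,dy$ for $s\in(0,1)$, $\mathcal{E}_{1,p}(u,v):=\frac12\int_\Omega|\nabla u|^{p-2}\nabla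 u\cdot\nabla v\,dx$, $\mathcal{E}_{0,p}(u,v):=\frac12\int_\Omega|u|^{p-2}uv\,dx$. $u\in\mathcal{X}_\mu(\Omega)$ is a weak solution if $\sum_{k=1}^m\mathcal{E}_{s_k,p_k}(u,v)=\int_\Omega f(x,u)v\,dx$ for all $v\in\mathcal{X}_\mu(\Omega)$. Weak solutions are the critical points of $I(u):=\sum_{k=1}^m\frac1{2p_k}[u]^{p_k}_{s_k,p_k}-\int_\Omega F(x,u(x))\,dx$ on $\mathcal{X}_\mu(\Omega)$. "Of Mountain Pass type" means that $u$ is a critical point of $I$ obtained from the Mountain Pass Theorem: there are $\rho,\beta>0$ and $e\in\mathcal{X}_\mu(\Omega)$ with $I\ge\beta$ on $\{\|w\|_\mu=\rho\}$, $\|e\|_\mu>\rho$, $I(e)<\beta$, $I(0)=0$, and $I(u)=\inf_{\sigma}\max_{t\in[0,1]}I(\sigma(t))\ge\beta$, the infimum over continuous $\sigma:[0,1]\to\mathcal{X}_\mu(\Omega)$ with $\sigma(0)=0$, $\sigma(1)=e$. *)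

theory Defs
  imports "HOL-Analysis.Analysis"
begin

section \<open>Smooth functions and domains\<close>

primrec Ck :: "nat \<Rightarrow> ('a::real_normed_vector \<Rightarrow> real) \<Rightarrow> bool" where
  "Ck 0 g \<longleftrightarrow> continuous_on UNIV g"
| "Ck (Suc j) g \<longleftrightarrow>
     (\<forall>x. g differentiable (at x)) \<and> (\<forall>v. Ck j (\<lambda>x. frechet_derivative g (at x) v))"

definition smooth :: "('a::real_normed_vector \<Rightarrow> real) \<Rightarrow> bool" where
  "smooth g \<longleftrightarrow> (\<forall>j. Ck j g)"

text \<open>Near every boundary point the set is, in suitable orthonormal coordinates, the region strictly
  above the graph of a smooth function. Here \<open>v\<close> is the vertical direction and
  \<open>y - (y \<bullet> v) *\<^sub>R v\<close> is the horizontal part of \<open>y\<close>, so only the values of \<open>\<gamma>\<close> on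
  the hyperplane orthogonal to \<open>v\<close> matter.\<close>

definition smooth_boundary :: "'a::euclidean_space set \<Rightarrow> bool" where
  "smooth_boundary \<Omega> \<longleftrightarrow>
     (\<forall>x\<in>frontier \<Omega>. \<exists>r>0. \<exists>v \<gamma>. norm v = 1 \<and> smooth \<gamma> \<and>
        \<Omega> \<inter> ball x r = {y \<in> ball x r. \<gamma> (y - (y \<bullet> v) *\<^sub>R v) < y \<bullet> v})"

definition test_functions :: "'a::euclidean_space set \<Rightarrow> ('a \<Rightarrow> real) set" where
  "test_functions \<Omega> =
     {\<phi>. smooth \<phi> \<and> compact (closure {x. \<phi> x \<noteq> 0}) \<and> closure {x. \<phi> x \<noteq> 0} \<subseteq> \<Omega>}"

section \<open>Weak gradients\<close>

definition locally_integrable ::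
    "('a::euclidean_space \<Rightarrow> 'b::{banach, second_countable_topology}) \<Rightarrow> bool" where
  "locally_integrable g \<longleftrightarrow> (\<forall>K. compact K \<longrightarrow> set_integrable lebesgue K g)"

definition has_weak_gradient ::
    "('a::euclidean_space \<Rightarrow> real) \<Rightarrow> ('a \<Rightarrow> 'a) \<Rightarrow> bool" where
  "has_weak_gradient u g \<longleftrightarrow> locally_integrable u \<and> locally_integrable g \<and>
     (\<forall>\<psi>\<in>test_functions UNIV. \<forall>v.
        (\<integral>x. u x * frechet_derivative \<psi> (at x) v \<partial>lebesgue) =
        - (\<integral>x. (g x \<bullet> v) * \<psi> x \<partial>lebesgue))"

text \<open>Weak gradients are unique up to null sets, so the choice does not affect integrals.\<close>

definition weak_gradient :: "('a::euclidean_space \<Rightarrow> real) \<Rightarrow> 'a \<Rightarrow> 'a" where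
  "weak_gradient u = (SOME g. has_weak_gradient u g)"

section \<open>Seminorms and forms\<close>

text \<open>The constant $c_{N,s,p}$; the dimension $N$ is passed explicitly.\<close>

definition frac_const :: "nat \<Rightarrow> real \<Rightarrow> real \<Rightarrow> real" where
  "frac_const N s p =
     s * 2 powr (2 * s) * Gamma ((p * s + p + real N - 2) / 2) /
     (pi powr (real N / 2) * Gamma (1 - s))"

text \<open>The kernels below take the value 0 on the diagonal (division by zero), which is a null set.\<close>

definition gagliardo :: "real \<Rightarrow> real \<Rightarrow> ('a::euclidean_space \<Rightarrow> real) \<Rightarrow> 'a \<times> 'a \<Rightarrow> real" where
  "gagliardo s p u =
     (\<lambda>(x, y). \<bar>u x - u y\<bar> powr p / norm (x - y) powr (real DIM('a) + s * p))"

definition finite_seminorm :: "real \<Rightarrow> real \<Rightarrow> ('a::euclidean_space \<Rightarrow> real) \<Rightarrow> bool" where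
  "finite_seminorm s p u \<longleftrightarrow>
     (if s = 0 then integrable lebesgue (\<lambda>x. \<bar>u x\<bar> powr p)
      else if s = 1 then
        (\<exists>g. has_weak_gradient u g) \<and> integrable lebesgue (\<lambda>x. norm (weak_gradient u x) powr p)
      else integrable lebesgue (gagliardo s p u))"

text \<open>Meaningful only where \<^const>\<open>finite_seminorm\<close> holds: the Bochner integral of a
  non-integrable function is 0, not \<open>\<infinity>\<close>.\<close>

definition seminorm_sp :: "real \<Rightarrow> real \<Rightarrow> ('a::euclidean_space \<Rightarrow> real) \<Rightarrow> real" where
  "seminorm_sp s p u =
     (if s = 0 then (\<integral>x. \<bar>u x\<bar> powr p \<partial>lebesgue) powr (1 / p)
      else if s = 1 then (\<integral>x. norm (weak_gradient u x) powr p \<partial>lebesgue) powr (1 / p)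
      else (frac_const DIM('a) s p * (\<integral>z. gagliardo s p u z \<partial>lebesgue)) powr (1 / p))"

definition form_sp ::
    "'a::euclidean_space set \<Rightarrow> real \<Rightarrow> real \<Rightarrow> ('a \<Rightarrow> real) \<Rightarrow> ('a \<Rightarrow> real) \<Rightarrow> real" where
  "form_sp \<Omega> s p u v =
     (if s = 0 then 1 / 2 * (\<integral>x. \<bar>u x\<bar> powr (p - 2) * u x * v x \<partial>lebesgue_on \<Omega>)
      else if s = 1 then
        1 / 2 * (\<integral>x. norm (weak_gradient u x) powr (p - 2) *
                      (weak_gradient u x \<bullet> weak_gradient v x) \<partial>lebesgue_on \<Omega>)
      else frac_const DIM('a) s p / 2 *
        (\<integral>(x, y). \<bar>u x - u y\<bar> powr (p - 2) * (u x - u y) * (v x - v y) /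
                  norm (x - y) powr (real DIM('a) + s * p) \<partial>lebesgue))"

section \<open>The energy space\<close>

definition mu_norm ::
    "nat \<Rightarrow> (nat \<Rightarrow> real) \<Rightarrow> (nat \<Rightarrow> real) \<Rightarrow> ('a::euclidean_space \<Rightarrow> real) \<Rightarrow> real" where
  "mu_norm m s p u = (\<Sum>k = 1..m. seminorm_sp (s k) (p k) u)"

text \<open>The completion of the test functions under \<^const>\<open>mu_norm\<close>, realised as a set of
  functions. On measurable functions that vanish a.e. outside a bounded \<open>\<Omega>\<close> and have finite
  seminorms, \<^const>\<open>mu_norm\<close> is a norm modulo a.e. equality, and it is complete (Poincare
  inequality), so the completion is the closure of the test functions in that space. Elements are
  representatives: functions that agree a.e. stand for the same point.\<close>

definition X_mu ::
    "'a::euclidean_space set \<Rightarrow> nat \<Rightarrow> (nat \<Rightarrow> real) \<Rightarrow> (nat \<Rightarrow> real) \<Rightarrow> ('a \<Rightarrow> real) set" where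
  "X_mu \<Omega> m s p =
     {u. u \<in> borel_measurable lebesgue \<and> (AE x in lebesgue. x \<notin> \<Omega> \<longrightarrow> u x = 0) \<and>
         (\<forall>k\<in>{1..m}. finite_seminorm (s k) (p k) u) \<and>
         (\<exists>\<phi> :: nat \<Rightarrow> 'a \<Rightarrow> real. (\<forall>n. \<phi> n \<in> test_functions \<Omega>) \<and>
            (\<lambda>n. mu_norm m s p (\<lambda>x. u x - \<phi> n x)) \<longlonglongrightarrow> 0)}"

section \<open>Weak solutions and the Mountain Pass\<close>

definition caratheodory :: "'a::euclidean_space set \<Rightarrow> ('a \<Rightarrow> real \<Rightarrow> real) \<Rightarrow> bool" where
  "caratheodory \<Omega> f \<longleftrightarrow>
     (\<forall>t. (\<lambda>x. f x t) \<in> borel_measurable (lebesgue_on \<Omega>)) \<and>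
     (AE x in lebesgue_on \<Omega>. continuous_on UNIV (f x))"

definition primitive :: "('a \<Rightarrow> real \<Rightarrow> real) \<Rightarrow> 'a \<Rightarrow> real \<Rightarrow> real" where
  "primitive f x t = (LBINT \<tau>=0..t. f x \<tau>)"

definition weak_solution ::
    "'a::euclidean_space set \<Rightarrow> nat \<Rightarrow> (nat \<Rightarrow> real) \<Rightarrow> (nat \<Rightarrow> real) \<Rightarrow>
     ('a \<Rightarrow> real \<Rightarrow> real) \<Rightarrow> ('a \<Rightarrow> real) \<Rightarrow> bool" where
  "weak_solution \<Omega> m s p f u \<longleftrightarrow> u \<in> X_mu \<Omega> m s p \<and>
     (\<forall>v\<in>X_mu \<Omega> m s p. integrable (lebesgue_on \<Omega>) (\<lambda>x. f x (u x) * v x) \<and>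
        (\<Sum>k = 1..m. form_sp \<Omega> (s k) (p k) u v) = (\<integral>x. f x (u x) * v x \<partial>lebesgue_on \<Omega>))"

definition energy ::
    "'a::euclidean_space set \<Rightarrow> nat \<Rightarrow> (nat \<Rightarrow> real) \<Rightarrow> (nat \<Rightarrow> real) \<Rightarrow>
     ('a \<Rightarrow> real \<Rightarrow> real) \<Rightarrow> ('a \<Rightarrow> real) \<Rightarrow> real" where
  "energy \<Omega> m s p f u =
     (\<Sum>k = 1..m. 1 / (2 * p k) * seminorm_sp (s k) (p k) u powr p k) -
     (\<integral>x. primitive f x (u x) \<partial>lebesgue_on \<Omega>)"

text \<open>The Frechet derivative of \<open>J\<close> at \<open>u\<close>, with respect to \<^const>\<open>mu_norm\<close>, exists and
  is 0.\<close>

definition critical_point ::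
    "'a::euclidean_space set \<Rightarrow> nat \<Rightarrow> (nat \<Rightarrow> real) \<Rightarrow> (nat \<Rightarrow> real) \<Rightarrow>
     (('a \<Rightarrow> real) \<Rightarrow> real) \<Rightarrow> ('a \<Rightarrow> real) \<Rightarrow> bool" where
  "critical_point \<Omega> m s p J u \<longleftrightarrow> u \<in> X_mu \<Omega> m s p \<and>
     (\<forall>\<epsilon>>0. \<exists>\<delta>>0. \<forall>h\<in>X_mu \<Omega> m s p. mu_norm m s p h < \<delta> \<longrightarrow>
        \<bar>J (\<lambda>x. u x + h x) - J u\<bar> \<le> \<epsilon> * mu_norm m s p h)"

definition paths_to ::
    "'a::euclidean_space set \<Rightarrow> nat \<Rightarrow> (nat \<Rightarrow> real) \<Rightarrow> (nat \<Rightarrow> real) \<Rightarrow>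
     ('a \<Rightarrow> real) \<Rightarrow> (real \<Rightarrow> 'a \<Rightarrow> real) set" where
  "paths_to \<Omega> m s p e =
     {\<sigma>. (\<forall>t\<in>{0..1}. \<sigma> t \<in> X_mu \<Omega> m s p \<and>
            ((\<lambda>\<tau>. mu_norm m s p (\<lambda>x. \<sigma> \<tau> x - \<sigma> t x)) \<longlongrightarrow> 0) (at t within {0..1})) \<and>
         \<sigma> 0 = (\<lambda>x. 0) \<and> \<sigma> 1 = e}"

text \<open>The supremum over \<open>t\<close> is the maximum in the usual definition, since the energy is
  continuous along paths.\<close>

definition mountain_pass_type ::
    "'a::euclidean_space set \<Rightarrow> nat \<Rightarrow> (nat \<Rightarrow> real) \<Rightarrow> (nat \<Rightarrow> real) \<Rightarrow>
     ('a \<Rightarrow> real \<Rightarrow> real) \<Rightarrow> ('a \<Rightarrow> real) \<Rightarrow> bool" where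
  "mountain_pass_type \<Omega> m s p f u \<longleftrightarrow>
     critical_point \<Omega> m s p (energy \<Omega> m s p f) u \<and>
     (\<exists>\<rho>>0. \<exists>\<beta>>0. \<exists>e\<in>X_mu \<Omega> m s p.
        (\<forall>w\<in>X_mu \<Omega> m s p. mu_norm m s p w = \<rho> \<longrightarrow> energy \<Omega> m s p f w \<ge> \<beta>) \<and>
        mu_norm m s p e > \<rho> \<and> energy \<Omega> m s p f e < \<beta> \<and> energy \<Omega> m s p f (\<lambda>x. 0) = 0 \<and>
        energy \<Omega> m s p f u =
          (INF \<sigma>\<in>paths_to \<Omega> m s p e. SUP t\<in>{0..1}. energy \<Omega> m s p f (\<sigma> t)) \<and>
        energy \<Omega> m s p f u \<ge> \<beta>)"

end

theory Submission
 imports Defs "HOL-Complex_Analysis.Great_Picard" "HOL-Library.Function_Algebras"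
begin

text \<open>Critical points come from the mountain pass theorem, which is obtained by applying Ekeland's
 principle to the maximum of the energy over the complete space of paths from 0 to \<open>e\<close>.

 For every order \<open>s\<close> in \<open>(0,1]\<close> the seminorm bounds the integral of \<open>\<bar>u x - u y\<bar>\<^sup>p\<close> over
 \<open>norm (x - y) <= l\<close> by a multiple of \<open>l powr (N + s p)\<close>. Comparing averages of \<open>u\<close> over dyadic cubes
 of consecutive generations turns this single bound into both the subcritical Sobolev inequality and
 compactness in \<open>L\<^sup>q\<close>, with no distinction between fractional and integer order.

 Condition (iii) makes Palais-Smale sequences bounded, hence precompact in \<open>L\<^sup>q\<close>, so that the forms
 tested with differences tend to 0; quantitative strict monotonicity of \<open>a \<mapsto> \<bar>a\<bar>\<^sup>p\<^sup>-\<^sup>2 a\<close> then gives a Cauchy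
 subsequence directly, without passing to weak limits.\<close>

section \<open>Vector inequalities for the p-Laplacian\<close>

text \<open>The obstacle is uniformity: each \<open>s k\<close> may be 1 or fractional, the
  \<open>p k\<close> may differ, and every \<open>p k > 1\<close> is allowed, so neither a Hilbert
  structure nor estimates special to \<open>p >= 2\<close> are at hand. The operators are therefore
  analysed pointwise: inequalities for \<open>pmap\<close> carrying an arbitrarily small error
  \<open>e * (norm a powr p + norm b powr p)\<close> are integrated, and boundedness absorbs the
  error. Sums of different powers are handled by singling out one seminorm that carries at least the
  fraction \<open>1 / m\<close> of the norm. For the embedding the index 1 suffices, because the
  critical exponent is common to all \<open>k\<close>; the chain
  \<open>p k <= phat < q < pstar\<close> also excludes order 0. Elements of \<open>X_mu\<close> are
  functions, not classes, so \<open>mu_norm\<close> is only a seminorm; the abstract theorems are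
  stated for seminorms and pseudo-distances and no quotient is formed. Ekeland's principle on paths
  takes the place of a deformation flow, so that a merely continuous derivative is enough.\<close>

definition pmap :: "real => 'v::euclidean_space => 'v" where
 "pmap p a = norm a powr (p - 2) *\<^sub>R a"

lemma norm_pmap: "norm (pmap p a) = norm a powr (p - 1)"
proof (cases "a = 0")
 case False
 hence "norm a powr (p - 2) * norm a powr 1 = norm a powr (p - 1)"
  by (simp only: powr_add[symmetric]) simp
 thus ?thesis using False by (simp add: pmap_def)
qed (simp add: pmap_def)

lemma pmap_inner_self: "pmap p a \<bullet> a = norm a powr p"
proof (cases "a = 0")
 case False
 hence "norm a powr (p - 2) * norm a powr 2 = norm a powr p"
  by (simp only: powr_add[symmetric]) simp
 thus ?thesis using False by (simp add: pmap_def dot_square_norm)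
qed (simp add: pmap_def)

lemma pmap_scaleR: "t > 0 ==> pmap p (t *\<^sub>R a) = t powr (p - 1) *\<^sub>R pmap p a"
proof -
 assume t: "t > 0"
 hence "t powr (p - 1) = t powr (p - 2) * t powr 1"
  by (simp only: powr_add[symmetric]) simp
 thus ?thesis using t by (simp add: pmap_def powr_mult mult_ac)
qed

lemma pmap_inner_le: "\<bar>pmap p a \<bullet> b\<bar> <= norm a powr (p - 1) * norm b"
 using Cauchy_Schwarz_ineq2[of "pmap p a" b] by (simp add: norm_pmap)

lemma continuous_pmap:
 assumes "p > 1" shows "continuous_on UNIV (pmap p :: 'v::euclidean_space => 'v)"
proof -
 have "isCont (pmap p) a" for a :: 'v
 proof (cases "a = 0")
  case False
  thus ?thesis unfolding pmap_def by (intro continuous_intros) auto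
 next
  case True
  have "((%b::'v. norm b powr (p - 1)) \<longlongrightarrow> 0 powr (p - 1)) (at 0)"
   using assms by (intro tendsto_powr') (auto intro!: tendsto_eq_intros)
  hence "((%b::'v. norm (pmap p b)) \<longlongrightarrow> 0) (at 0)"
   using assms by (simp add: norm_pmap)
  hence "((pmap p :: 'v => 'v) \<longlongrightarrow> 0) (at 0)"
   by (simp only: tendsto_norm_zero_iff)
  thus ?thesis using True by (simp add: isCont_def) (simp add: pmap_def)
 qed
 thus ?thesis by (simp add: continuous_on_eq_continuous_at)
qed

lemma borel_measurable_pmap [measurable]:
 "p > 1 ==> (pmap p :: 'v::euclidean_space => 'v) \<in> borel_measurable borel"
 by (intro borel_measurable_continuous_onI continuous_pmap)

text \<open>Young's inequality for \<open>norm b * norm a powr (p - 1)\<close> combined with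
  Cauchy-Schwarz: the graph of \<open>norm a powr p\<close> lies above its tangents, whose slope is
  \<open>p\<close> times \<open>pmap p a\<close>.\<close>

lemma norm_powr_convex:
 assumes "p > 1"
 shows "norm a powr p + p * (pmap p a \<bullet> (b - a)) <= norm b powr p"
proof -
 define q where "q = p / (p - 1)"
 have q: "q > 1" "1/p + 1/q = 1" "(p - 1) * q = p" "p / q = p - 1"
  using assms by (auto simp: q_def field_simps)
 have "norm b * norm a powr (p - 1) <= norm b powr p / p + (norm a powr (p - 1)) powr q / q"
  using assms q by (intro Youngs_inequality) auto
 hence "p * (norm b * norm a powr (p - 1)) <= p * (norm b powr p / p + norm a powr p / q)"
  using assms q by (intro mult_left_mono) (auto simp: powr_powr)
 also have "... = norm b powr p + (p / q) * norm a powr p"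
  using assms by (simp add: distrib_left)
 finally have *: "p * (norm b * norm a powr (p - 1)) <= norm b powr p + (p - 1) * norm a powr p"
  using q by simp
 have "p * (pmap p a \<bullet> b) <= p * (norm b * norm a powr (p - 1))"
  using pmap_inner_le[of p a b] assms by (intro mult_left_mono) (auto simp: mult_ac)
 with * show ?thesis
  by (simp add: inner_diff_right pmap_inner_self algebra_simps)
qed

text \<open>If the norms differ, Cauchy-Schwarz leaves the product of
  \<open>norm a powr (p - 1) - norm b powr (p - 1)\<close> and \<open>norm a - norm b\<close>, two
  factors of equal sign. If they agree, both vectors are scaled by the same factor and a multiple of
  the squared distance remains.\<close>

lemma pmap_strict_mono:
 assumes "p > 1" "a ~= b"
 shows "(pmap p a - pmap p b) \<bullet> (a - b) > 0"
proof -
 have eq: "(pmap p a - pmap p b) \<bullet> (a - b) =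
   norm a powr p + norm b powr p - pmap p a \<bullet> b - pmap p b \<bullet> a"
  by (simp add: inner_diff_left inner_diff_right pmap_inner_self)
 have pw: "norm x powr p = norm x powr (p - 1) * norm x" for x :: 'a
  by (metis assms(1) norm_ge_zero norm_pmap pmap_inner_self powr_mult_base mult.commute
    add_diff_cancel_left' add.commute diff_add_cancel)
 have fac: "norm a powr p + norm b powr p - norm a powr (p - 1) * norm b - norm b powr (p - 1) * norm a
   = (norm a powr (p - 1) - norm b powr (p - 1)) * (norm a - norm b)"
  by (simp add: pw algebra_simps)
 show ?thesis
 proof (cases "norm a = norm b")
  case False
  have "(norm a powr (p - 1) - norm b powr (p - 1)) * (norm a - norm b) > 0"
  proof (cases "norm a < norm b")
   case True
   hence "norm a powr (p - 1) < norm b powr (p - 1)"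
    using assms by (intro powr_less_mono2) auto
   thus ?thesis using True by (intro mult_neg_neg) auto
  next
   case F: False
   hence "norm b powr (p - 1) < norm a powr (p - 1)"
    using assms False by (intro powr_less_mono2) auto
   thus ?thesis using F False by (intro mult_pos_pos) auto
  qed
  thus ?thesis
   using eq fac pmap_inner_le[of p a b] pmap_inner_le[of p b a] by linarith
 next
  case True
  hence a0: "norm a > 0" using assms by auto
  have "(pmap p a - pmap p b) \<bullet> (a - b) = norm a powr (p - 2) * ((a - b) \<bullet> (a - b))"
   using True by (simp add: pmap_def algebra_simps flip: scaleR_diff_right)
  thus ?thesis using a0 assms by simp
 qed
qed

text \<open>By homogeneity the estimates for \<open>pmap\<close> reduce to compactness of the sphere
 \<open>norm a powr p + norm b powr p = 1\<close>.\<close>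

lemma homogeneous_compactness:
 fixes F G :: "'v::euclidean_space => 'v => real"
 assumes p: "p > 1" and cF: "continuous_on UNIV (%(a, b). F a b)"
  and cG: "continuous_on UNIV (%(a, b). G a b)"
  and hF: "!!t a b. t > 0 ==> F (t *\<^sub>R a) (t *\<^sub>R b) = t powr p * F a b"
  and hG: "!!t a b. t > 0 ==> G (t *\<^sub>R a) (t *\<^sub>R b) = t powr p * G a b"
  and G0: "!!a b. G a b >= 0" and F0: "!!a. F a a = 0" and Gpos: "!!a b. a ~= b ==> G a b > 0"
  and e: "e > 0"
 obtains C where "C > 0" "!!a b. F a b <= e * (norm a powr p + norm b powr p) + C * G a b"
proof -
 define S where "S = {z :: 'v \<times> 'v. norm (fst z) powr p + norm (snd z) powr p = 1}"
 \<comment> \<open>Since \<open>F\<close> vanishes on the diagonal, \<open>K\<close> avoids it, so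
   \<open>G\<close> has a positive minimum \<open>m\<close> on \<open>K\<close>. There
   \<open>F <= B = C * m <= C * G\<close>, while elsewhere on the sphere \<open>F < e\<close>
   already suffices.\<close>
 define K where "K = {z \<in> S. F (fst z) (snd z) >= e}"
 have cn: "continuous_on UNIV (%z :: 'v \<times> 'v. norm (fst z) powr p + norm (snd z) powr p)"
  using p by (intro continuous_on_add continuous_on_powr' continuous_intros) auto
 have cF': "continuous_on UNIV (%z. F (fst z) (snd z))" using cF by (simp add: case_prod_unfold)
 have cG': "continuous_on UNIV (%z. G (fst z) (snd z))" using cG by (simp add: case_prod_unfold)
 have clS: "closed S" unfolding S_def
  using continuous_closed_preimage_constant[OF cn] by simp
 have "S \<subseteq> cball 0 1 \<times> cball 0 1"
 proof
  fix z assume z: "z \<in> S"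
  have le: "norm x <= 1" if "norm x powr p <= 1" for x :: 'v
  proof (rule ccontr)
   assume "~ ?thesis"
   hence "norm x powr p > 1 powr p" using p by (intro powr_less_mono2) auto
   thus False using that by simp
  qed
  from z have "norm (fst z) powr p <= 1" "norm (snd z) powr p <= 1"
   unfolding S_def by (smt (verit) mem_Collect_eq powr_ge_zero)+
  thus "z \<in> cball 0 1 \<times> cball 0 1" using le by (auto simp: mem_Times_iff)
 qed
 hence bS: "bounded S" by (rule bounded_subset[rotated]) (auto intro: bounded_Times)
 have compS: "compact S" using clS bS by (simp add: compact_eq_bounded_closed)
 have "closed {z. e <= F (fst z) (snd z)}"
  using cF' by (intro closed_Collect_le continuous_intros)
 moreover have "K = S \<inter> {z. e <= F (fst z) (snd z)}" by (auto simp: K_def)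
 ultimately have compK: "compact K" using compact_Int_closed[OF compS] by simp
 obtain B where B: "!!z. z \<in> S ==> F (fst z) (snd z) <= B" "B > 0"
 proof -
  have "compact ((%z. F (fst z) (snd z)) ` S)"
   using compS cF' by (intro compact_continuous_image) (auto intro: continuous_on_subset)
  then obtain B where "!!z. z \<in> S ==> norm (F (fst z) (snd z)) <= B"
   using compact_imp_bounded bounded_iff by (metis (no_types, lifting) imageI)
  hence "!!z. z \<in> S ==> F (fst z) (snd z) <= \<bar>B\<bar> + 1" by fastforce
  thus ?thesis using that[of "\<bar>B\<bar> + 1"] by simp
 qed
 obtain m where m: "m > 0" "!!z. z \<in> K ==> m <= G (fst z) (snd z)"
 proof (cases "K = {}")
  case True thus ?thesis using that[of 1] by auto
 next
  case False
  obtain z0 where z0: "z0 \<in> K" "!!z. z \<in> K ==> G (fst z0) (snd z0) <= G (fst z) (snd z)"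
   using continuous_attains_inf[OF compK False continuous_on_subset[OF cG']] by auto
  have "fst z0 ~= snd z0"
   using z0(1) F0 e unfolding K_def by force
  thus ?thesis using that[of "G (fst z0) (snd z0)"] z0 Gpos by auto
 qed
 define C where "C = B / m"
 have C: "C > 0" using B m by (simp add: C_def)
 have S_ineq: "F a b <= e + C * G a b" if "(a, b) \<in> S" for a b
 proof (cases "(a, b) \<in> K")
  case True
  have "F a b <= C * m" using B(1)[OF that] m by (simp add: C_def)
  also have "... <= C * G a b" using m(2)[OF True] C by (intro mult_left_mono) auto
  finally show ?thesis using e by simp
 next
  case False
  thus ?thesis using that C G0[of a b] unfolding K_def
   by (smt (verit) fst_conv mem_Collect_eq mult_nonneg_nonneg snd_conv)
 qed
 have "F a b <= e * (norm a powr p + norm b powr p) + C * G a b" for a b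
 proof (cases "a = 0 & b = 0")
  case True
  thus ?thesis using F0 G0 C e by (auto intro!: mult_nonneg_nonneg add_nonneg_nonneg)
 next
  case False
  define r where "r = norm a powr p + norm b powr p"
  have r: "r > 0" using False unfolding r_def
   by (smt (verit) norm_eq_zero powr_ge_zero powr_gt_zero)
  define t where "t = r powr (1 / p)"
  have t: "t > 0" "t powr p = r" using r p by (auto simp: t_def powr_powr)
  have nrm: "norm ((1 / t) *\<^sub>R x) powr p = norm x powr p / r" for x :: 'v
   using t by (simp add: powr_divide)
  have "((1 / t) *\<^sub>R a, (1 / t) *\<^sub>R b) \<in> S"
   unfolding S_def by (simp only: mem_Collect_eq fst_conv snd_conv nrm)
    (use r in \<open>simp add: r_def flip: add_divide_distrib\<close>)
  from S_ineq[OF this] have "F ((1 / t) *\<^sub>R a) ((1 / t) *\<^sub>R b) <= e + C * G ((1 / t) *\<^sub>R a) ((1 / t) *\<^sub>R b)" .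
  moreover have "F a b = r * F ((1 / t) *\<^sub>R a) ((1 / t) *\<^sub>R b)"
   using hF[OF t(1), of "(1/t) *\<^sub>R a" "(1/t) *\<^sub>R b"] t by simp
  moreover have "G a b = r * G ((1 / t) *\<^sub>R a) ((1 / t) *\<^sub>R b)"
   using hG[OF t(1), of "(1/t) *\<^sub>R a" "(1/t) *\<^sub>R b"] t by simp
  ultimately have "F a b <= r * (e + C * G ((1 / t) *\<^sub>R a) ((1 / t) *\<^sub>R b))"
   using r by (metis mult_left_mono less_eq_real_def)
  also have "... = e * r + C * G a b"
   using \<open>G a b = _\<close> by (simp add: algebra_simps)
  finally show ?thesis by (simp add: r_def)
 qed
 with C that show ?thesis by blast
qed

text \<open>The term with \<open>e\<close> lets one statement serve all \<open>p > 1\<close>: for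
  \<open>p < 2\<close> and \<open>a\<close>, \<open>b\<close> close relative to their size, the
  monotonicity gap is of order \<open>norm a powr (p - 2) * (norm (a - b))^2\<close>, far below
  \<open>norm (a - b) powr p\<close>.\<close>

lemma pmap_strong_mono:
 assumes "p > 1" "e > 0"
 obtains C where "C > 0" "!!a b :: 'v::euclidean_space. norm (a - b) powr p <=
   e * (norm a powr p + norm b powr p) + C * ((pmap p a - pmap p b) \<bullet> (a - b))"
proof (rule homogeneous_compactness[where F = "%a b. norm (a - b) powr p"
   and G = "%a b :: 'v. (pmap p a - pmap p b) \<bullet> (a - b)", OF assms(1) _ _ _ _ _ _ _ assms(2)])
 show "continuous_on UNIV (%(a, b :: 'v). norm (a - b) powr p)"
  using assms unfolding case_prod_unfold by (intro continuous_on_powr' continuous_intros) auto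
 show "continuous_on UNIV (%(a, b :: 'v). (pmap p a - pmap p b) \<bullet> (a - b))"
  unfolding case_prod_unfold
  by (intro continuous_intros continuous_on_compose2[OF continuous_pmap[OF assms(1)]]) auto
 fix t :: real and a b :: 'v assume t: "t > 0"
 show "norm (t *\<^sub>R a - t *\<^sub>R b) powr p = t powr p * norm (a - b) powr p"
  using t by (simp add: powr_mult flip: scaleR_diff_right)
 have "t powr p = t powr (p - 1) * t powr 1"
  by (simp only: powr_add[symmetric]) simp
 thus "(pmap p (t *\<^sub>R a) - pmap p (t *\<^sub>R b)) \<bullet> (t *\<^sub>R a - t *\<^sub>R b) =
   t powr p * ((pmap p a - pmap p b) \<bullet> (a - b))"
  using t by (simp add: pmap_scaleR flip: scaleR_diff_right)
next
 fix a b :: 'v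
 show "(pmap p a - pmap p b) \<bullet> (a - b) >= 0"
  using pmap_strict_mono[OF assms(1), of a b] by (cases "a = b") auto
 show "a ~= b ==> (pmap p a - pmap p b) \<bullet> (a - b) > 0"
  by (rule pmap_strict_mono[OF assms(1)])
qed (use assms that in auto)

text \<open>The exponent \<open>p / (p - 1)\<close> is the conjugate one, which makes both sides
  homogeneous of degree \<open>p\<close>. Integrated, this becomes continuity of \<open>pmap\<close>
  from the p-th Lebesgue space to its dual.\<close>

lemma pmap_continuity_estimate:
 assumes "p > 1" "e > 0"
 obtains C where "C > 0" "!!a b :: 'v::euclidean_space. norm (pmap p a - pmap p b) powr (p / (p - 1)) <=
   e * (norm a powr p + norm b powr p) + C * norm (a - b) powr p"
proof (rule homogeneous_compactness[where G = "%a b. norm (a - b) powr p"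
   and F = "%a b :: 'v. norm (pmap p a - pmap p b) powr (p / (p - 1))", OF assms(1) _ _ _ _ _ _ _ assms(2)])
 show "continuous_on UNIV (%(a, b :: 'v). norm (a - b) powr p)"
  using assms unfolding case_prod_unfold by (intro continuous_on_powr' continuous_intros) auto
 show "continuous_on UNIV (%(a, b :: 'v). norm (pmap p a - pmap p b) powr (p / (p - 1)))"
  unfolding case_prod_unfold using assms
  by (intro continuous_intros continuous_on_compose2[OF continuous_pmap[OF assms(1)]] continuous_on_powr') auto
 fix t :: real and a b :: 'v assume t: "t > 0"
 show "norm (t *\<^sub>R a - t *\<^sub>R b) powr p = t powr p * norm (a - b) powr p"
  using t by (simp add: powr_mult flip: scaleR_diff_right)
 show "norm (pmap p (t *\<^sub>R a) - pmap p (t *\<^sub>R b)) powr (p / (p - 1)) =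
   t powr p * norm (pmap p a - pmap p b) powr (p / (p - 1))"
  using t assms by (simp add: pmap_scaleR powr_mult powr_powr flip: scaleR_diff_right)
qed (use assms that in auto)

text \<open>The tangent inequalities at the intermediate point \<open>z\<close> are added with
  weights \<open>t\<close> and \<open>1 - t\<close>; the linear parts cancel.\<close>

lemma powr_convex_combination:
 fixes x y :: real
 assumes "p > 1" "x >= 0" "y >= 0" "0 <= t" "t <= 1"
 shows "(t * x + (1 - t) * y) powr p <= t * x powr p + (1 - t) * y powr p"
proof -
 define z where "z = t * x + (1 - t) * y"
 have z: "z >= 0" using assms by (simp add: z_def)
 have *: "z powr p + p * (pmap p z * (w - z)) <= w powr p" if "w >= 0" for w
  using norm_powr_convex[OF assms(1), of z w] z that by simp
 have "t * (z powr p + p * (pmap p z * (x - z))) + (1 - t) * (z powr p + p * (pmap p z * (y - z)))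
   <= t * x powr p + (1 - t) * y powr p"
  using assms by (intro add_mono mult_left_mono *) auto
 moreover have "t * (z powr p + p * (pmap p z * (x - z))) + (1 - t) * (z powr p + p * (pmap p z * (y - z)))
   = z powr p + p * pmap p z * (t * x + (1 - t) * y - z)"
  by (simp add: algebra_simps)
 ultimately show ?thesis by (simp add: z_def)
qed

lemma powr_add_le:
 fixes x y :: real
 assumes "p > 0" "x >= 0" "y >= 0"
 shows "(x + y) powr p <= 2 powr p * (x powr p + y powr p)"
proof -
 have "(x + y) powr p <= (2 * max x y) powr p" using assms by (intro powr_mono2) auto
 also have "... = 2 powr p * (max x y) powr p" using assms by (simp add: powr_mult)
 also have "... <= 2 powr p * (x powr p + y powr p)"
  by (intro mult_left_mono) (auto simp: max_def)
 finally show ?thesis .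
qed

section \<open>Lebesgue spaces\<close>

definition Lp_mem :: "'x measure => real => ('x => 'v::euclidean_space) => bool" where
 "Lp_mem M p f \<longleftrightarrow> f \<in> borel_measurable M & integrable M (%x. norm (f x) powr p)"

text \<open>Meaningful only together with \<open>Lp_mem\<close>, since the integral of a
  non-integrable function is 0.\<close>

definition Lp_norm :: "'x measure => real => ('x => 'v::euclidean_space) => real" where
 "Lp_norm M p f = (LINT x|M. norm (f x) powr p) powr (1 / p)"

lemma Lp_norm_nonneg [simp]: "Lp_norm M p f >= 0"
 by (simp add: Lp_norm_def)

lemma Lp_norm_powr: "p > 0 ==> Lp_norm M p f powr p = (LINT x|M. norm (f x) powr p)"
 by (simp add: Lp_norm_def powr_powr)

lemma Lp_norm_le_iff:
 assumes "p > 0" "B >= 0"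
 shows "Lp_norm M p f <= B \<longleftrightarrow> (LINT x|M. norm (f x) powr p) <= B powr p"
 using assms by (metis Lp_norm_nonneg Lp_norm_powr powr_less_mono2 powr_mono2 linorder_not_le order_less_imp_le)

lemma Lp_norm_cong_AE:
 assumes "f \<in> borel_measurable M" "g \<in> borel_measurable M" "AE x in M. f x = g x"
 shows "Lp_norm M p f = Lp_norm M p g"
proof -
 have "(LINT x|M. norm (f x) powr p) = (LINT x|M. norm (g x) powr p)"
  using assms(3) by (intro integral_cong_AE measurable_compose[OF assms(1)] measurable_compose[OF assms(2)]) auto
 thus ?thesis by (simp add: Lp_norm_def)
qed

lemma Lp_mem_cong_AE:
 assumes "f \<in> borel_measurable M" "g \<in> borel_measurable M" "AE x in M. f x = g x"
 shows "Lp_mem M p f \<longleftrightarrow> Lp_mem M p g"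
proof -
 have "integrable M (%x. norm (f x) powr p) \<longleftrightarrow> integrable M (%x. norm (g x) powr p)"
  using assms(3) by (intro integrable_cong_AE measurable_compose[OF assms(1)] measurable_compose[OF assms(2)]) auto
 thus ?thesis using assms by (simp add: Lp_mem_def)
qed

lemma Lp_mem_scaleR: "Lp_mem M p f ==> Lp_mem M p (%x. c *\<^sub>R f x)"
 by (auto simp: Lp_mem_def powr_mult)

lemma Lp_norm_scaleR: "p > 0 ==> Lp_norm M p (%x. c *\<^sub>R f x) = \<bar>c\<bar> * Lp_norm M p f"
 by (simp add: Lp_norm_def powr_mult powr_powr)

lemma Lp_mem_uminus: "Lp_mem M p f ==> Lp_mem M p (%x. - f x)"
 by (auto simp: Lp_mem_def)

lemma Lp_norm_uminus: "Lp_norm M p (%x. - f x) = Lp_norm M p f"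
 by (simp add: Lp_norm_def)

lemma Lp_mem_add:
 assumes "p > 0" "Lp_mem M p f" "Lp_mem M p g"
 shows "Lp_mem M p (%x. f x + g x)"
proof -
 have [measurable]: "f \<in> borel_measurable M" "g \<in> borel_measurable M"
  using assms by (auto simp: Lp_mem_def)
 have "integrable M (%x. norm (f x + g x) powr p)"
 proof (rule Bochner_Integration.integrable_bound)
  show "integrable M (%x. 2 powr p * (norm (f x) powr p + norm (g x) powr p))"
   using assms by (auto simp: Lp_mem_def)
  show "AE x in M. norm (norm (f x + g x) powr p) <= norm (2 powr p * (norm (f x) powr p + norm (g x) powr p))"
  proof (rule AE_I2)
   fix x
   have "norm (f x + g x) powr p <= (norm (f x) + norm (g x)) powr p"
    using assms by (intro powr_mono2 norm_triangle_ineq) auto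
   also have "... <= 2 powr p * (norm (f x) powr p + norm (g x) powr p)"
    using assms by (intro powr_add_le) auto
   finally show "norm (norm (f x + g x) powr p) <= norm (2 powr p * (norm (f x) powr p + norm (g x) powr p))"
    by simp
  qed
 qed auto
 thus ?thesis by (simp add: Lp_mem_def)
qed

lemma Lp_mem_diff:
 assumes "p > 0" "Lp_mem M p f" "Lp_mem M p g"
 shows "Lp_mem M p (%x. f x - g x)"
 using Lp_mem_add[OF assms(1,2) Lp_mem_uminus[OF assms(3)]] by simp

lemma Lp_norm_eq_0D:
 assumes "p > 0" "Lp_mem M p f" "Lp_norm M p f = 0"
 shows "AE x in M. f x = 0"
proof -
 have "(LINT x|M. norm (f x) powr p) = 0" using assms by (metis Lp_norm_powr powr_0)
 hence "AE x in M. norm (f x) powr p = 0"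
  using assms by (subst (asm) integral_nonneg_eq_0_iff_AE) (auto simp: Lp_mem_def)
 thus ?thesis by eventually_elim auto
qed

text \<open>Convexity of the p-th power is applied to the normalised functions \<open>f / a\<close>
  and \<open>g / b\<close> with weights \<open>a / (a + b)\<close> and \<open>b / (a + b)\<close>; a
  vanishing norm is treated separately.\<close>

theorem Minkowski_inequality:
 assumes p: "p > 1" and f: "Lp_mem M p f" and g: "Lp_mem M p g"
 shows "Lp_norm M p (%x. f x + g x) <= Lp_norm M p f + Lp_norm M p g"
proof -
 have [measurable]: "f \<in> borel_measurable M" "g \<in> borel_measurable M"
  using f g by (auto simp: Lp_mem_def)
 define a where "a = Lp_norm M p f"
 define b where "b = Lp_norm M p g"
 have ab: "a >= 0" "b >= 0" by (auto simp: a_def b_def)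
 consider "a = 0" | "b = 0" | "a > 0" "b > 0" using ab by fastforce
 thus ?thesis
 proof cases
  case 1
  hence "AE x in M. f x + g x = g x"
   using Lp_norm_eq_0D[OF _ f] p unfolding a_def by auto
  hence "Lp_norm M p (%x. f x + g x) = b" unfolding b_def by (intro Lp_norm_cong_AE) auto
  thus ?thesis using ab by (simp add: a_def b_def)
 next
  case 2
  hence "AE x in M. f x + g x = f x"
   using Lp_norm_eq_0D[OF _ g] p unfolding b_def by auto
  hence "Lp_norm M p (%x. f x + g x) = a" unfolding a_def by (intro Lp_norm_cong_AE) auto
  thus ?thesis using ab by (simp add: a_def b_def)
 next
  case 3
  define t where "t = a / (a + b)"
  have t: "0 <= t" "t <= 1" "1 - t = b / (a + b)" using 3 by (auto simp: t_def field_simps)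
  have pt: "norm (f x + g x) powr p <=
    (a + b) powr p * (t * (norm (f x) powr p / a powr p) + (1 - t) * (norm (g x) powr p / b powr p))" for x
  proof -
   have "norm (f x + g x) <= norm (f x) + norm (g x)" by (rule norm_triangle_ineq)
   also have "... = (a + b) * (t * (norm (f x) / a) + (1 - t) * (norm (g x) / b))"
   proof -
    have "(a + b) * t = a" "(a + b) * (1 - t) = b" using 3 t(3) by (auto simp: t_def)
    hence "(a + b) * (t * x + (1 - t) * y) = a * x + b * y" for x y
     by (metis distrib_left mult.assoc)
    from this[of "norm (f x) / a" "norm (g x) / b"] show ?thesis using 3 by simp
   qed
   finally have "norm (f x + g x) powr p <= ((a + b) * (t * (norm (f x) / a) + (1 - t) * (norm (g x) / b))) powr p"
    using p by (intro powr_mono2) auto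
   also have "... = (a + b) powr p * (t * (norm (f x) / a) + (1 - t) * (norm (g x) / b)) powr p"
    using 3 t by (simp add: powr_mult)
   also have "... <= (a + b) powr p * (t * (norm (f x) / a) powr p + (1 - t) * (norm (g x) / b) powr p)"
    using p t 3 by (intro mult_left_mono powr_convex_combination) auto
   finally show ?thesis using 3 by (simp add: powr_divide)
  qed
  have ip: "a powr p = (LINT x|M. norm (f x) powr p)" "b powr p = (LINT x|M. norm (g x) powr p)"
   using p by (auto simp: a_def b_def Lp_norm_powr)
  have "(LINT x|M. norm (f x + g x) powr p) <=
    (LINT x|M. (a + b) powr p * (t * (norm (f x) powr p / a powr p) + (1 - t) * (norm (g x) powr p / b powr p)))"
   using f g Lp_mem_add[OF _ f g] p by (intro integral_mono pt) (auto simp: Lp_mem_def)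
  also have "... = (a + b) powr p * (t * (a powr p / a powr p) + (1 - t) * (b powr p / b powr p))"
   using f g by (simp add: Lp_mem_def ip)
  also have "... = (a + b) powr p" using 3 by simp
  finally show ?thesis using ab p by (simp add: Lp_norm_le_iff flip: a_def b_def)
 qed
qed

text \<open>Young's inequality as it stands gives integrability; the bound by the product of the
  norms comes from applying it to the normalised functions, hence the separate case of a zero
  norm.\<close>

theorem Hoelder_inequality:
 fixes f :: "'x => 'v::euclidean_space" and g :: "'x => 'w::euclidean_space"
 assumes p: "p > 1" and f: "Lp_mem M (p / (p - 1)) f" and g: "Lp_mem M p g"
 shows "integrable M (%x. norm (f x) * norm (g x))"
  and "(LINT x|M. norm (f x) * norm (g x)) <= Lp_norm M (p / (p - 1)) f * Lp_norm M p g"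
proof -
 define q where "q = p / (p - 1)"
 have q: "q > 1" "1 / q + 1 / p = 1" using p by (auto simp: q_def field_simps)
 have [measurable]: "f \<in> borel_measurable M" "g \<in> borel_measurable M"
  using f g by (auto simp: Lp_mem_def)
 have f': "integrable M (%x. norm (f x) powr q)" and g': "integrable M (%x. norm (g x) powr p)"
  using f g by (auto simp: Lp_mem_def q_def)
 show int: "integrable M (%x. norm (f x) * norm (g x))"
 proof (rule Bochner_Integration.integrable_bound)
  show "integrable M (%x. norm (f x) powr q / q + norm (g x) powr p / p)" using f' g' by auto
  show "AE x in M. norm (norm (f x) * norm (g x)) <= norm (norm (f x) powr q / q + norm (g x) powr p / p)"
   using Youngs_inequality[OF q(1) p q(2)] q p by (intro AE_I2) auto
 qed auto
 define a where "a = Lp_norm M q f"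
 define b where "b = Lp_norm M p g"
 have ab: "a >= 0" "b >= 0" by (auto simp: a_def b_def)
 consider "a = 0 \<or> b = 0" | "a > 0" "b > 0" using ab by fastforce
 hence "(LINT x|M. norm (f x) * norm (g x)) <= a * b"
 proof cases
  case 1
  have "Lp_mem M q f" using f by (simp add: q_def)
  with 1 g q p have "(AE x in M. f x = 0) \<or> (AE x in M. g x = 0)"
   unfolding a_def b_def by (metis Lp_norm_eq_0D less_trans zero_less_one)
  hence "AE x in M. norm (f x) * norm (g x) = 0" by auto
  hence "(LINT x|M. norm (f x) * norm (g x)) = 0"
   by (subst integral_cong_AE[where g = "%_. 0"]) auto
  thus ?thesis using ab by simp
 next
  case 2
  have pt: "norm (f x) * norm (g x) <= a * b * (norm (f x) powr q / a powr q / q + norm (g x) powr p / b powr p / p)" for x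
  proof -
   have "(norm (f x) / a) * (norm (g x) / b) <= (norm (f x) / a) powr q / q + (norm (g x) / b) powr p / p"
    using 2 by (intro Youngs_inequality[OF q(1) p q(2)]) auto
   hence "a * b * ((norm (f x) / a) * (norm (g x) / b)) <=
     a * b * ((norm (f x) / a) powr q / q + (norm (g x) / b) powr p / p)"
    using 2 by (intro mult_left_mono) auto
   thus ?thesis using 2 by (simp add: powr_divide)
  qed
  have ip: "a powr q = (LINT x|M. norm (f x) powr q)" "b powr p = (LINT x|M. norm (g x) powr p)"
   using p q by (auto simp: a_def b_def Lp_norm_powr)
  have "(LINT x|M. norm (f x) * norm (g x)) <=
   (LINT x|M. a * b * (norm (f x) powr q / a powr q / q + norm (g x) powr p / b powr p / p))"
   using f' g' by (intro integral_mono pt int) auto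
  also have "... = a * b * (a powr q / a powr q / q + b powr p / b powr p / p)"
   using f' g' by (simp add: ip)
  also have "... = a * b" using 2 q by simp
  finally show ?thesis .
 qed
 thus "(LINT x|M. norm (f x) * norm (g x)) <= Lp_norm M (p / (p - 1)) f * Lp_norm M p g"
  by (simp add: a_def b_def q_def)
qed

lemma Hoelder_inner:
 fixes f g :: "'x => 'v::euclidean_space"
 assumes p: "p > 1" and f: "Lp_mem M (p / (p - 1)) f" and g: "Lp_mem M p g"
 shows "integrable M (%x. f x \<bullet> g x)"
  and "\<bar>\<integral>x. f x \<bullet> g x \<partial>M\<bar> <= Lp_norm M (p / (p - 1)) f * Lp_norm M p g"
proof -
 have [measurable]: "f \<in> borel_measurable M" "g \<in> borel_measurable M"
  using f g by (auto simp: Lp_mem_def)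
 show int: "integrable M (%x. f x \<bullet> g x)"
  by (rule Bochner_Integration.integrable_bound[OF Hoelder_inequality(1)[OF assms]])
   (auto intro!: AE_I2 Cauchy_Schwarz_ineq2)
 have "\<bar>\<integral>x. f x \<bullet> g x \<partial>M\<bar> <= (LINT x|M. \<bar>f x \<bullet> g x\<bar>)"
  using integral_norm_bound[of M "%x. f x \<bullet> g x"] by simp
 also have "... <= (LINT x|M. norm (f x) * norm (g x))"
  using int by (intro integral_mono Hoelder_inequality(1)[OF assms] Cauchy_Schwarz_ineq2) auto
 also have "... <= Lp_norm M (p / (p - 1)) f * Lp_norm M p g"
  by (rule Hoelder_inequality(2)[OF assms])
 finally show "\<bar>\<integral>x. f x \<bullet> g x \<partial>M\<bar> <= Lp_norm M (p / (p - 1)) f * Lp_norm M p g" .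
qed

lemma Lp_mem_pmap:
 assumes "p > 1" "Lp_mem M p f" shows "Lp_mem M (p / (p - 1)) (%x. pmap p (f x))"
 using assms by (auto simp: Lp_mem_def norm_pmap powr_powr)

lemma Lp_norm_pmap:
 assumes "p > 1" shows "Lp_norm M (p / (p - 1)) (%x. pmap p (f x)) = Lp_norm M p f powr (p - 1)"
 using assms by (simp add: Lp_norm_def norm_pmap powr_powr)

text \<open>Fatou's lemma is applied to the nonnegative extended integral, so that integrability of
  the limit is a conclusion and not an assumption.\<close>

lemma Lp_Fatou:
 fixes f :: "nat => 'x => 'v::euclidean_space"
 assumes "p > 0" and mem: "!!n. Lp_mem M p (f n)" and [measurable]: "g \<in> borel_measurable M"
  and lim: "AE x in M. (%n. f n x) \<longlonglongrightarrow> g x"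
  and bd: "!!n. Lp_norm M p (f n) <= B"
 shows "Lp_mem M p g" "Lp_norm M p g <= B"
proof -
 have [measurable]: "f n \<in> borel_measurable M" for n using mem by (auto simp: Lp_mem_def)
 have B: "B >= 0" using bd[of 0] Lp_norm_nonneg order_trans by blast
 have I: "(\<integral>\<^sup>+x. ennreal (norm (f n x) powr p) \<partial>M) <= ennreal (B powr p)" for n
  using mem[of n] bd[of n] assms(1) B
  by (subst nn_integral_eq_integral) (auto simp: Lp_mem_def Lp_norm_le_iff)
 have "(\<integral>\<^sup>+x. ennreal (norm (g x) powr p) \<partial>M) <= (\<integral>\<^sup>+x. liminf (%n. ennreal (norm (f n x) powr p)) \<partial>M)"
 proof (intro nn_integral_mono_AE)
  show "AE x in M. ennreal (norm (g x) powr p) <= liminf (%n. ennreal (norm (f n x) powr p))"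
   using lim
  proof eventually_elim
   case (elim x)
   have "(%n. ennreal (norm (f n x) powr p)) \<longlonglongrightarrow> ennreal (norm (g x) powr p)"
    using elim assms(1) by (intro tendsto_ennrealI tendsto_powr' tendsto_norm tendsto_intros) auto
   from lim_imp_Liminf[OF trivial_limit_sequentially this] show ?case by simp
  qed
 qed
 also have "... <= liminf (%n. \<integral>\<^sup>+x. ennreal (norm (f n x) powr p) \<partial>M)"
  by (intro nn_integral_liminf) auto
 also have "... <= ennreal (B powr p)"
  using I by (intro Liminf_le) auto
 finally have le: "(\<integral>\<^sup>+x. ennreal (norm (g x) powr p) \<partial>M) <= ennreal (B powr p)" .
 hence int: "integrable M (%x. norm (g x) powr p)"
  by (intro integrableI_nonneg) (auto intro: order.strict_trans1)
 thus "Lp_mem M p g" by (simp add: Lp_mem_def)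
 from le int have "(LINT x|M. norm (g x) powr p) <= B powr p"
  by (subst (asm) nn_integral_eq_integral) (auto simp: ennreal_le_iff)
 thus "Lp_norm M p g <= B" using B assms(1) by (simp add: Lp_norm_le_iff)
qed

lemma Lp_AE_subseq:
 fixes f :: "nat => 'x => 'v::euclidean_space"
 assumes "p > 0" and mem: "!!n. Lp_mem M p (f n)" and lim: "(%n. Lp_norm M p (f n)) \<longlonglongrightarrow> 0"
 obtains r where "strict_mono r" "AE x in M. (%n. f (r n) x) \<longlonglongrightarrow> 0"
proof -
 have "(%n. Lp_norm M p (f n) powr p) \<longlonglongrightarrow> 0 powr p"
  using assms by (intro tendsto_powr' tendsto_intros) auto
 hence "(%n. \<integral>x. norm (norm (f n x) powr p) \<partial>M) \<longlonglongrightarrow> 0"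
  using assms(1) by (simp add: Lp_norm_powr)
 then obtain r where r: "strict_mono r" "AE x in M. (%n. norm (f (r n) x) powr p) \<longlonglongrightarrow> 0"
  using tendsto_L1_AE_subseq[of M "%n x. norm (f n x) powr p"] mem by (auto simp: Lp_mem_def)
 from r(2) have "AE x in M. (%n. f (r n) x) \<longlonglongrightarrow> 0"
 proof eventually_elim
  case (elim x)
  have "(%n. (norm (f (r n) x) powr p) powr (1 / p)) \<longlonglongrightarrow> 0 powr (1 / p)"
   using assms(1) elim by (intro tendsto_powr' tendsto_intros) auto
  thus ?case using assms(1) by (simp add: powr_powr tendsto_norm_zero_iff)
 qed
 with r(1) that show ?thesis by blast
qed

section \<open>Convex functionals of p-homogeneous type\<close>

text \<open>The common frame for both kinds of terms: \<open>D\<close> is the weak gradient with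
  Lebesgue measure on the space, or the weighted difference quotient with Lebesgue measure on the
  product space. Linearity of \<open>D\<close> is required only almost everywhere because a weak
  gradient is an arbitrary choice within its class.\<close>

locale p_form =
 fixes M :: "'x measure" and D :: "'f::real_vector => 'x => 'v::euclidean_space"
  and p c :: real and X :: "'f set"
 assumes p: "1 < p" and c: "0 < c" and X: "subspace X"
  and mem: "u \<in> X ==> Lp_mem M p (D u)"
  and add: "u \<in> X ==> v \<in> X ==> AE x in M. D (u + v) x = D u x + D v x"
  and scale: "u \<in> X ==> AE x in M. D (r *\<^sub>R u) x = r *\<^sub>R D u x"
begin

definition "nrm u = c powr (1 / p) * Lp_norm M p (D u)"
text \<open>The factor 1/2 makes \<open>frm u\<close> the derivative at \<open>u\<close> of
  \<open>nrm u powr p / (2 * p)\<close>, the normalisation used in the energy.\<close>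

definition "frm u v = c / 2 * (LINT x|M. pmap p (D u x) \<bullet> D v x)"

lemma meas: "u \<in> X ==> D u \<in> borel_measurable M"
 using mem by (auto simp: Lp_mem_def)

lemma X_add: "u \<in> X ==> v \<in> X ==> u + v \<in> X" using X by (rule subspace_add)
lemma X_scale: "u \<in> X ==> r *\<^sub>R u \<in> X" using X by (rule subspace_scale)
lemma X_diff: "u \<in> X ==> v \<in> X ==> u - v \<in> X" using X by (rule subspace_diff)

lemma diff_AE:
 assumes "u \<in> X" "v \<in> X" shows "AE x in M. D (u - v) x = D u x - D v x"
 using add[OF assms(1) X_scale[OF assms(2), of "-1"]] scale[OF assms(2), of "-1"]
 by eventually_elim simp

lemma nrm_nonneg [simp]: "nrm u >= 0"
 by (simp add: nrm_def)

lemma nrm_powr: "nrm u powr p = c * (LINT x|M. norm (D u x) powr p)"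
 using p c by (simp add: nrm_def powr_mult powr_powr Lp_norm_powr)

lemma nrm_add: assumes "u \<in> X" "v \<in> X" shows "nrm (u + v) <= nrm u + nrm v"
proof -
 note [measurable] = meas[OF assms(1)] meas[OF assms(2)] meas[OF X_add[OF assms]]
 have "Lp_norm M p (D (u + v)) = Lp_norm M p (%x. D u x + D v x)"
  using add[OF assms] by (intro Lp_norm_cong_AE) auto
 also have "... <= Lp_norm M p (D u) + Lp_norm M p (D v)"
  using assms by (intro Minkowski_inequality p mem)
 finally show ?thesis unfolding nrm_def distrib_left[symmetric] by (intro mult_left_mono) auto
qed

lemma nrm_scale: assumes "u \<in> X" shows "nrm (r *\<^sub>R u) = \<bar>r\<bar> * nrm u"
proof -
 note [measurable] = meas[OF assms] meas[OF X_scale[OF assms]]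
 have "Lp_norm M p (D (r *\<^sub>R u)) = Lp_norm M p (%x. r *\<^sub>R D u x)"
  using scale[OF assms] by (intro Lp_norm_cong_AE) auto
 thus ?thesis using p by (simp add: nrm_def Lp_norm_scaleR)
qed

lemma integrable_frm:
 assumes "u \<in> X" "v \<in> X" shows "integrable M (%x. pmap p (D u x) \<bullet> D v x)"
 using assms by (intro Hoelder_inner(1)[OF p] Lp_mem_pmap p mem)

lemma frm_add:
 assumes "u \<in> X" "v \<in> X" "w \<in> X" shows "frm u (v + w) = frm u v + frm u w"
proof -
 note [measurable] = meas[OF assms(1)] meas[OF assms(2)] meas[OF assms(3)] meas[OF X_add[OF assms(2,3)]]
  borel_measurable_pmap[OF p]
 have "(LINT x|M. pmap p (D u x) \<bullet> D (v + w) x) = (LINT x|M. pmap p (D u x) \<bullet> D v x + pmap p (D u x) \<bullet> D w x)"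
  using add[OF assms(2,3)] by (intro integral_cong_AE) (auto simp: inner_add_right)
 also have "... = (LINT x|M. pmap p (D u x) \<bullet> D v x) + (LINT x|M. pmap p (D u x) \<bullet> D w x)"
  using assms by (intro Bochner_Integration.integral_add integrable_frm)
 finally show ?thesis by (simp add: frm_def distrib_left)
qed

lemma frm_scale:
 assumes "u \<in> X" "v \<in> X" shows "frm u (r *\<^sub>R v) = r * frm u v"
proof -
 note [measurable] = meas[OF assms(1)] meas[OF assms(2)] meas[OF X_scale[OF assms(2)]]
  borel_measurable_pmap[OF p]
 have "(LINT x|M. pmap p (D u x) \<bullet> D (r *\<^sub>R v) x) = (LINT x|M. r * (pmap p (D u x) \<bullet> D v x))"
  using scale[OF assms(2), of r] by (intro integral_cong_AE) auto
 thus ?thesis by (simp add: frm_def)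
qed

lemma frm_self: "frm u u = nrm u powr p / 2"
 by (simp add: frm_def nrm_powr pmap_inner_self)

text \<open>Distributes the constant over the two factors of Hoelder's inequality, in the proportion
  of the conjugate exponents.\<close>

lemma c_split: "c = c powr ((p - 1) / p) * c powr (1 / p)"
 using c p by (simp add: powr_add[symmetric] diff_divide_distrib)

lemma frm_diff_bound:
 assumes "u \<in> X" "v \<in> X" "h \<in> X"
 shows "\<bar>frm v h - frm u h\<bar> <=
  c powr ((p - 1) / p) * Lp_norm M (p / (p - 1)) (%x. pmap p (D v x) - pmap p (D u x)) * nrm h"
proof -
 let ?q = "p / (p - 1)"
 have q: "?q > 0" using p by simp
 have m: "Lp_mem M ?q (%x. pmap p (D v x) - pmap p (D u x))"
  using assms by (intro Lp_mem_diff Lp_mem_pmap p mem q)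
 have "frm v h - frm u h = c / 2 * ((LINT x|M. pmap p (D v x) \<bullet> D h x) - (LINT x|M. pmap p (D u x) \<bullet> D h x))"
  by (simp add: frm_def right_diff_distrib)
 also have "... = c / 2 * (LINT x|M. (pmap p (D v x) - pmap p (D u x)) \<bullet> D h x)"
  using assms by (subst Bochner_Integration.integral_diff[symmetric]) (auto intro: integrable_frm simp: inner_diff_left)
 finally have "frm v h - frm u h = c / 2 * (LINT x|M. (pmap p (D v x) - pmap p (D u x)) \<bullet> D h x)" .
 hence "\<bar>frm v h - frm u h\<bar> = c / 2 * \<bar>\<integral>x. (pmap p (D v x) - pmap p (D u x)) \<bullet> D h x \<partial>M\<bar>"
  using c by (simp only: abs_mult)
 also have "... <= c * \<bar>\<integral>x. (pmap p (D v x) - pmap p (D u x)) \<bullet> D h x \<partial>M\<bar>"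
  using c by (intro mult_right_mono) auto
 also have "... <= c * (Lp_norm M ?q (%x. pmap p (D v x) - pmap p (D u x)) * Lp_norm M p (D h))"
  using c by (intro mult_left_mono Hoelder_inner(2)[OF p m] mem assms) auto
 finally have *: "\<bar>frm v h - frm u h\<bar> <= c * (Lp_norm M ?q (%x. pmap p (D v x) - pmap p (D u x)) * Lp_norm M p (D h))" .
 show ?thesis
  by (rule order_trans[OF *], subst (1) c_split) (simp add: nrm_def mult_ac)
qed

lemma frm_bound:
 assumes "u \<in> X" "h \<in> X"
 shows "\<bar>frm u h\<bar> <= nrm u powr (p - 1) * nrm h"
proof -
 have "\<bar>frm u h\<bar> = c / 2 * \<bar>\<integral>x. pmap p (D u x) \<bullet> D h x \<partial>M\<bar>"
  using c by (simp add: frm_def abs_mult)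
 also have "... <= c * \<bar>\<integral>x. pmap p (D u x) \<bullet> D h x \<partial>M\<bar>"
  using c by (intro mult_right_mono) auto
 also have "... <= c * (Lp_norm M (p / (p - 1)) (%x. pmap p (D u x)) * Lp_norm M p (D h))"
  using c assms by (intro mult_left_mono Hoelder_inner(2)[OF p] mem Lp_mem_pmap p) auto
 also have "... = c * (Lp_norm M p (D u) powr (p - 1) * Lp_norm M p (D h))"
  using p by (simp add: Lp_norm_pmap)
 finally have *: "\<bar>frm u h\<bar> <= c * (Lp_norm M p (D u) powr (p - 1) * Lp_norm M p (D h))" .
 show ?thesis
  by (rule order_trans[OF *], subst (1) c_split) (use c p in \<open>simp add: nrm_def mult_ac powr_mult powr_powr\<close>)
qed

lemma frm_convex:
 assumes "u \<in> X" "h \<in> X"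
 shows "nrm u powr p / (2 * p) + frm u h <= nrm (u + h) powr p / (2 * p)"
proof -
 have uh: "u + h \<in> X" by (intro X_add assms)
 note [measurable] = meas[OF assms(1)] meas[OF assms(2)] meas[OF uh] borel_measurable_pmap[OF p]
 have i: "integrable M (%x. norm (D u x) powr p)" "integrable M (%x. norm (D (u + h) x) powr p)"
  using mem assms uh by (auto simp: Lp_mem_def)
 have "(LINT x|M. norm (D u x) powr p + p * (pmap p (D u x) \<bullet> D h x)) <= (LINT x|M. norm (D (u + h) x) powr p)"
 proof (intro integral_mono_AE)
  show "AE x in M. norm (D u x) powr p + p * (pmap p (D u x) \<bullet> D h x) <= norm (D (u + h) x) powr p"
   using add[OF assms]
  proof eventually_elim
   case (elim x)
   show ?case using norm_powr_convex[OF p, of "D u x" "D u x + D h x"] elim by simp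
  qed
 qed (use i integrable_frm[OF assms] in auto)
 hence "(LINT x|M. norm (D u x) powr p) + p * (LINT x|M. pmap p (D u x) \<bullet> D h x) <= (LINT x|M. norm (D (u + h) x) powr p)"
  using i integrable_frm[OF assms] by simp
 hence "c / (2 * p) * ((LINT x|M. norm (D u x) powr p) + p * (LINT x|M. pmap p (D u x) \<bullet> D h x)) <=
   c / (2 * p) * (LINT x|M. norm (D (u + h) x) powr p)"
  using p c by (intro mult_left_mono) auto
 thus ?thesis using p by (simp add: nrm_powr frm_def distrib_left)
qed

lemma frm_continuous:
 assumes u: "u \<in> X" and e: "e > 0"
 obtains d where "d > 0" "!!v h. v \<in> X ==> h \<in> X ==> nrm (v - u) < d ==> \<bar>frm v h - frm u h\<bar> <= e * nrm h"
proof -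
 let ?q = "p / (p - 1)"
 have q: "?q > 0" using p by simp
 define K where "K = c powr ((p - 1) / p)"
 have K: "K > 0" using c by (simp add: K_def)
 define I where "I = (LINT x|M. norm (D u x) powr p)"
 have I: "I >= 0" by (simp add: I_def)
 define e1 where "e1 = (e / K) powr ?q / 2"
 have e1: "e1 > 0" using e K by (simp add: e1_def)
 \<comment> \<open>Below, \<open>J < 1\<close> bounds the integral of
   \<open>norm (D v x) powr p\<close> by \<open>2 powr p * (1 + I)\<close>, so this denominator
   keeps the \<open>e2\<close> term within \<open>e1\<close>. The choice of \<open>d\<close> keeps
   the \<open>C\<close> term within \<open>e1\<close>, and \<open>2 * e1\<close> is the conjugate
   power of \<open>e / K\<close>.\<close>
 define e2 where "e2 = e1 / (I + 2 powr p * (1 + I) + 1)"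
 have den: "I + 2 powr p * (1 + I) + 1 > 0" using I by (intro add_nonneg_pos add_nonneg_nonneg mult_nonneg_nonneg) auto
 have e2: "e2 > 0" using e1 den by (simp add: e2_def)
 obtain C where C: "C > 0" "!!a b :: 'v. norm (pmap p a - pmap p b) powr (p / (p - 1)) <=
   e2 * (norm a powr p + norm b powr p) + C * norm (a - b) powr p"
  using pmap_continuity_estimate[OF p e2] by blast
 define d where "d = (c * min 1 (e1 / C)) powr (1 / p)"
 have "min 1 (e1 / C) > 0" using e1 C by simp
 hence d: "d > 0" and dp: "d powr p = c * min 1 (e1 / C)"
  using c p unfolding d_def powr_powr by auto
 have "\<bar>frm v h - frm u h\<bar> <= e * nrm h" if v: "v \<in> X" and h: "h \<in> X" and vd: "nrm (v - u) < d" for v h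
 proof -
  have vu: "v - u \<in> X" by (intro X_diff u v)
  note [measurable] = meas[OF u] meas[OF v] meas[OF vu] borel_measurable_pmap[OF p]
  have iu: "integrable M (%x. norm (D u x) powr p)" and iv: "integrable M (%x. norm (D v x) powr p)"
   and ivu: "integrable M (%x. norm (D (v - u) x) powr p)"
   using mem u v vu by (auto simp: Lp_mem_def)
  define J where "J = (LINT x|M. norm (D (v - u) x) powr p)"
  have "nrm (v - u) powr p < d powr p" using vd p by (intro powr_less_mono2) auto
  hence J: "J < min 1 (e1 / C)" using c by (simp add: nrm_powr J_def dp)
  have iv_le: "(LINT x|M. norm (D v x) powr p) <= 2 powr p * (J + I)"
  proof -
   have "(LINT x|M. norm (D v x) powr p) <= (LINT x|M. 2 powr p * (norm (D (v - u) x) powr p + norm (D u x) powr p))"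
   proof (intro integral_mono_AE)
    show "AE x in M. norm (D v x) powr p <= 2 powr p * (norm (D (v - u) x) powr p + norm (D u x) powr p)"
     using diff_AE[OF v u]
    proof eventually_elim
     case (elim x)
     have "norm (D v x) powr p <= (norm (D (v - u) x) + norm (D u x)) powr p"
      using p elim norm_triangle_sub[of "D v x" "D u x"] by (intro powr_mono2) auto
     also have "... <= 2 powr p * (norm (D (v - u) x) powr p + norm (D u x) powr p)"
      using p by (intro powr_add_le) auto
     finally show ?case .
    qed
   qed (use iu iv ivu in auto)
   also have "... = 2 powr p * (J + I)" using iu ivu by (simp add: J_def I_def)
   finally show ?thesis .
  qed
  have m: "Lp_mem M ?q (%x. pmap p (D v x) - pmap p (D u x))"
   by (intro Lp_mem_diff Lp_mem_pmap p mem q u v)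
  have "(LINT x|M. norm (pmap p (D v x) - pmap p (D u x)) powr ?q) <=
    (LINT x|M. e2 * (norm (D v x) powr p + norm (D u x) powr p) + C * norm (D (v - u) x) powr p)"
  proof (intro integral_mono_AE)
   show "AE x in M. norm (pmap p (D v x) - pmap p (D u x)) powr ?q
     <= e2 * (norm (D v x) powr p + norm (D u x) powr p) + C * norm (D (v - u) x) powr p"
    using diff_AE[OF v u] by eventually_elim (use C(2) in auto)
  qed (use m iu iv ivu in \<open>auto simp: Lp_mem_def\<close>)
  also have "... = e2 * ((LINT x|M. norm (D v x) powr p) + I) + C * J"
   using iu iv ivu by (simp add: I_def J_def)
  also have "... <= e2 * (2 powr p * (1 + I) + I) + e1"
  proof (intro add_mono mult_left_mono)
   show "(LINT x|M. norm (D v x) powr p) <= 2 powr p * (1 + I)"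
    using iv_le J by (smt (verit, best) mult_left_mono powr_ge_zero)
   show "C * J <= e1" using J C by (simp add: field_simps)
  qed (use e2 in auto)
  also have "e2 * (2 powr p * (1 + I) + I) <= e1"
   using e1 den by (simp add: e2_def field_simps)
  finally have "(LINT x|M. norm (pmap p (D v x) - pmap p (D u x)) powr ?q) <= (e / K) powr ?q"
   by (simp add: e1_def)
  hence "Lp_norm M ?q (%x. pmap p (D v x) - pmap p (D u x)) <= e / K"
   using q e K by (subst Lp_norm_le_iff) auto
  hence "K * Lp_norm M ?q (%x. pmap p (D v x) - pmap p (D u x)) <= e"
   using K by (simp add: field_simps)
  hence "K * Lp_norm M ?q (%x. pmap p (D v x) - pmap p (D u x)) * nrm h <= e * nrm h"
   by (intro mult_right_mono) auto
  thus ?thesis using frm_diff_bound[OF u v h] by (simp add: K_def)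
 qed
 with d that show ?thesis by blast
qed

text \<open>Convexity sandwiches the remainder between 0 and the increment of the derivative, so
 continuity of the derivative is enough for Frechet differentiability.\<close>

lemma nrm_frechet:
 assumes u: "u \<in> X" and e: "e > 0"
 obtains d where "d > 0" "!!h. h \<in> X ==> nrm h < d ==>
  \<bar>nrm (u + h) powr p / (2 * p) - nrm u powr p / (2 * p) - frm u h\<bar> <= e * nrm h"
proof -
 obtain d where d: "d > 0" "!!v h. v \<in> X ==> h \<in> X ==> nrm (v - u) < d ==> \<bar>frm v h - frm u h\<bar> <= e * nrm h"
  using frm_continuous[OF assms] by blast
 have "\<bar>nrm (u + h) powr p / (2 * p) - nrm u powr p / (2 * p) - frm u h\<bar> <= e * nrm h"
  if h: "h \<in> X" and hd: "nrm h < d" for h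
 proof -
  have 1: "nrm u powr p / (2 * p) + frm u h <= nrm (u + h) powr p / (2 * p)"
   by (rule frm_convex[OF u h])
  have mh: "(-1) *\<^sub>R h \<in> X" by (rule X_scale[OF h])
  have "nrm (u + h) powr p / (2 * p) + frm (u + h) ((-1) *\<^sub>R h) <= nrm u powr p / (2 * p)"
   using frm_convex[OF X_add[OF u h] mh] by simp
  hence 2: "nrm (u + h) powr p / (2 * p) - frm (u + h) h <= nrm u powr p / (2 * p)"
   using frm_scale[OF X_add[OF u h] h, of "-1"] by simp
  have "\<bar>frm (u + h) h - frm u h\<bar> <= e * nrm h" using d(2)[OF X_add[OF u h] h] hd by simp
  with 1 2 show ?thesis by linarith
 qed
 with d that show ?thesis by blast
qed

lemma frm_monotone:
 assumes "u \<in> X" "v \<in> X" shows "frm u (u - v) - frm v (u - v) = c / 2 * (LINT x|M. (pmap p (D u x) - pmap p (D v x)) \<bullet> (D u x - D v x))"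
  and "integrable M (%x. (pmap p (D u x) - pmap p (D v x)) \<bullet> (D u x - D v x))"
  and "frm u (u - v) - frm v (u - v) >= 0"
proof -
 have uv: "u - v \<in> X" by (intro X_diff assms)
 note [measurable] = meas[OF assms(1)] meas[OF assms(2)] meas[OF uv] borel_measurable_pmap[OF p]
 have i: "integrable M (%x. (pmap p (D u x) - pmap p (D v x)) \<bullet> D (u - v) x)"
  using Bochner_Integration.integrable_diff[OF integrable_frm[OF assms(1) uv] integrable_frm[OF assms(2) uv]]
  by (simp add: inner_diff_left)
 show ii: "integrable M (%x. (pmap p (D u x) - pmap p (D v x)) \<bullet> (D u x - D v x))"
  by (rule integrable_cong_AE_imp[OF i]) (use diff_AE[OF assms] in auto)
 have "frm u (u - v) - frm v (u - v) = c / 2 * ((LINT x|M. pmap p (D u x) \<bullet> D (u - v) x) - (LINT x|M. pmap p (D v x) \<bullet> D (u - v) x))"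
  by (simp add: frm_def right_diff_distrib)
 also have "... = c / 2 * (LINT x|M. (pmap p (D u x) - pmap p (D v x)) \<bullet> D (u - v) x)"
  using integrable_frm[OF assms(1) uv] integrable_frm[OF assms(2) uv]
  by (simp add: inner_diff_left)
 also have "(LINT x|M. (pmap p (D u x) - pmap p (D v x)) \<bullet> D (u - v) x) =
   (LINT x|M. (pmap p (D u x) - pmap p (D v x)) \<bullet> (D u x - D v x))"
  using diff_AE[OF assms] by (intro integral_cong_AE) auto
 finally show eq: "frm u (u - v) - frm v (u - v) = c / 2 * (LINT x|M. (pmap p (D u x) - pmap p (D v x)) \<bullet> (D u x - D v x))" .
 have "(pmap p a - pmap p b) \<bullet> (a - b) >= 0" for a b :: 'v
  using pmap_strict_mono[OF p, of a b] by (cases "a = b") auto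
 thus "frm u (u - v) - frm v (u - v) >= 0" unfolding eq using c by simp
qed

text \<open>A quantitative form of the (S+) property: on bounded sets a small monotonicity gap
  forces a small distance. Of \<open>e powr p\<close>, one half is spent on the error term of
  \<open>pmap_strong_mono\<close>, using the bound \<open>B\<close>, and the other half on the
  gap.\<close>

lemma frm_S_plus:
 assumes B: "B > 0" and e: "e > 0"
 obtains d where "d > 0" "!!u v. u \<in> X ==> v \<in> X ==> nrm u <= B ==> nrm v <= B ==>
  frm u (u - v) - frm v (u - v) < d ==> nrm (u - v) < e"
proof -
 define e1 where "e1 = e powr p / (4 * B powr p)"
 have e1: "e1 > 0" using e B by (simp add: e1_def)
 obtain C where C: "C > 0" "!!a b :: 'v::euclidean_space. norm (a - b) powr p <=
   e1 * (norm a powr p + norm b powr p) + C * ((pmap p a - pmap p b) \<bullet> (a - b))"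
  using pmap_strong_mono[OF p e1] by blast
 define d where "d = e powr p / (4 * C)"
 have d: "d > 0" using e C by (simp add: d_def)
 have "nrm (u - v) < e" if u: "u \<in> X" and v: "v \<in> X" and uB: "nrm u <= B" and vB: "nrm v <= B"
  and lt: "frm u (u - v) - frm v (u - v) < d" for u v
 proof -
  have uv: "u - v \<in> X" by (intro X_diff u v)
  note [measurable] = meas[OF u] meas[OF v] meas[OF uv] borel_measurable_pmap[OF p]
  let ?P = "\<integral>x. (pmap p (D u x) - pmap p (D v x)) \<bullet> (D u x - D v x) \<partial>M"
  have iu: "integrable M (%x. norm (D u x) powr p)" and iv: "integrable M (%x. norm (D v x) powr p)"
   and iuv: "integrable M (%x. norm (D (u - v) x) powr p)"
   using mem u v uv by (auto simp: Lp_mem_def)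
  have "(LINT x|M. norm (D (u - v) x) powr p) <=
    (LINT x|M. e1 * (norm (D u x) powr p + norm (D v x) powr p) + C * ((pmap p (D u x) - pmap p (D v x)) \<bullet> (D u x - D v x)))"
  proof (intro integral_mono_AE)
   show "AE x in M. norm (D (u - v) x) powr p
     <= e1 * (norm (D u x) powr p + norm (D v x) powr p) + C * ((pmap p (D u x) - pmap p (D v x)) \<bullet> (D u x - D v x))"
    using diff_AE[OF u v] by eventually_elim (use C(2) in auto)
  qed (use iu iv iuv frm_monotone(2)[OF u v] in auto)
  also have "... = e1 * ((LINT x|M. norm (D u x) powr p) + (LINT x|M. norm (D v x) powr p)) + C * ?P"
   using iu iv frm_monotone(2)[OF u v] by simp
  finally have "c * (LINT x|M. norm (D (u - v) x) powr p) <= c * ..."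
   using c by (intro mult_left_mono) auto
  hence "nrm (u - v) powr p <= e1 * (nrm u powr p + nrm v powr p) + C * (2 * (frm u (u - v) - frm v (u - v)))"
   unfolding frm_monotone(1)[OF u v] nrm_powr by (simp add: algebra_simps)
  also have "... < e1 * (B powr p + B powr p) + C * (2 * d)"
  proof (rule add_le_less_mono)
   have "nrm u powr p <= B powr p" "nrm v powr p <= B powr p"
    using uB vB p by (auto intro!: powr_mono2)
   thus "e1 * (nrm u powr p + nrm v powr p) <= e1 * (B powr p + B powr p)"
    using e1 by (intro mult_left_mono add_mono) auto
  qed (use lt C in auto)
  also have "... = e powr p" using B C by (simp add: e1_def d_def field_simps)
  finally show ?thesis using e p by (meson linorder_not_le nrm_nonneg order_less_imp_le powr_mono2
     order.strict_trans zero_less_one less_le_not_le)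
 qed
 with d that show ?thesis by blast
qed

end

section \<open>The mountain pass theorem\<close>

text \<open>\<open>S x\<close> collects the points that improve \<open>Ph\<close> by at least
  \<open>e\<close> times their distance from \<open>x\<close>. Repeatedly choosing an almost optimal
  point of \<open>S (x n)\<close>, with error \<open>(1/2) ^ n\<close>, gives a Cauchy sequence
  because \<open>Ph\<close> decreases and is bounded below; its limit cannot be improved. Only a
  pseudo-distance on a set is assumed, since paths differing by null functions have distance
  0.\<close>

lemma weak_Ekeland:
 fixes G :: "'b set" and d :: "'b => 'b => real" and Ph :: "'b => real"
 assumes d0: "!!x y. x \<in> G ==> y \<in> G ==> 0 <= d x y" and dxx: "!!x. x \<in> G ==> d x x = 0"
  and sym: "!!x y. x \<in> G ==> y \<in> G ==> d x y = d y x"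
  and tri: "!!x y z. x \<in> G ==> y \<in> G ==> z \<in> G ==> d x z <= d x y + d y z"
  and complete: "!!x. (!!n :: nat. x n \<in> G) ==> (!!eps. eps > 0 ==> \<exists>K. \<forall>i\<ge>K. \<forall>j\<ge>K. d (x i) (x j) < eps) ==>
    \<exists>l\<in>G. (%n. d (x n) l) \<longlonglongrightarrow> 0"
  and lsc: "!!x l a. (!!n :: nat. x n \<in> G) ==> l \<in> G ==> (%n. d (x n) l) \<longlonglongrightarrow> 0 ==> (!!n. Ph (x n) <= a) ==> Ph l <= a"
  and below: "!!x. x \<in> G ==> b <= Ph x" and x0: "x0 \<in> G" and e: "e > 0"
 obtains x where "x \<in> G" "Ph x <= Ph x0" "!!y. y \<in> G ==> Ph x - e * d x y <= Ph y"
proof -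
 define S where "S x = {y \<in> G. Ph y + e * d x y <= Ph x}" for x
 have S_self: "x \<in> S x" if "x \<in> G" for x using that dxx by (simp add: S_def)
 have bdd: "bdd_below (Ph ` S x)" for x using below by (auto simp: S_def intro!: bdd_belowI[of _ b])
 have S_trans: "z \<in> S x" if "x \<in> G" "y \<in> S x" "z \<in> S y" for x y z
 proof -
  have "e * d x z <= e * (d x y + d y z)"
   using that e tri by (intro mult_left_mono) (auto simp: S_def)
  thus ?thesis using that by (auto simp: S_def distrib_left)
 qed
 have "\<exists>x. (\<forall>n. (x n \<in> G & (n = 0 --> x n = x0)) & (x (Suc n) \<in> S (x n) & Ph (x (Suc n)) <= Inf (Ph ` S (x n)) + (1/2) ^ n))"
 proof (rule dependent_nat_choice)
  show "\<exists>x. x \<in> G & (0 = 0 --> x = x0)" using x0 by auto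
  fix x :: 'b and n :: nat assume x: "x \<in> G & (n = 0 --> x = x0)"
  have "Inf (Ph ` S x) < Inf (Ph ` S x) + (1/2) ^ n" by simp
  then obtain y where "y \<in> S x" "Ph y < Inf (Ph ` S x) + (1/2) ^ n"
   using cInf_lessD[of "Ph ` S x" "Inf (Ph ` S x) + (1/2) ^ n"] S_self[of x] x by blast
  thus "\<exists>y. (y \<in> G & (Suc n = 0 --> y = x0)) & y \<in> S x & Ph y <= Inf (Ph ` S x) + (1/2) ^ n"
   by (intro exI[of _ y]) (auto simp: S_def)
 qed
 then obtain x where x: "!!n. x n \<in> G" "x 0 = x0" "!!n. x (Suc n) \<in> S (x n)"
   "!!n. Ph (x (Suc n)) <= Inf (Ph ` S (x n)) + (1/2) ^ n"
  by blast
 have S_le: "x m \<in> S (x n)" if "n <= m" for n m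
  using that
 proof (induction rule: dec_induct)
  case (step m) thus ?case using S_trans x by blast
 qed (use S_self x in auto)
 have "decseq (%n. Ph (x n))"
 proof (intro decseq_SucI)
  fix n
  have "e * d (x n) (x (Suc n)) >= 0" using e d0 x by simp
  thus "Ph (x (Suc n)) <= Ph (x n)" using x(3)[of n] by (simp add: S_def)
 qed
 then obtain L where L: "(%n. Ph (x n)) \<longlonglongrightarrow> L" "!!n. L <= Ph (x n)"
  using decseq_convergent[of "%n. Ph (x n)" b] below x by blast
 have cau: "\<exists>K. \<forall>i\<ge>K. \<forall>j\<ge>K. d (x i) (x j) < eps" if eps: "eps > 0" for eps
 proof -
  have "e * eps / 2 > 0" using e eps by simp
  then obtain K where K: "Ph (x K) - L < e * eps / 2"
   using L LIMSEQ_D[OF L(1)] by (metis abs_of_nonneg diff_ge_0_iff_ge order_refl real_norm_def)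
  have le: "d (x K) (x i) < eps / 2" if "i >= K" for i
  proof -
   have "e * d (x K) (x i) <= Ph (x K) - Ph (x i)" using S_le[OF that] by (simp add: S_def)
   also have "... < e * eps / 2" using K L(2)[of i] by linarith
   finally show ?thesis using e by (simp add: field_simps)
  qed
  have "d (x i) (x j) < eps" if "i >= K" "j >= K" for i j
   using tri[of "x i" "x K" "x j"] sym[of "x i" "x K"] x(1) le[OF that(1)] le[OF that(2)] by fastforce
  thus ?thesis by blast
 qed
 obtain l where l: "l \<in> G" "(%n. d (x n) l) \<longlonglongrightarrow> 0" using complete[OF x(1) cau] by blast
 have lS: "l \<in> S (x n)" for n
 proof -
  have "Ph l <= Ph (x n) - e * d (x n) l"
  proof (rule field_le_epsilon)
   fix eta :: real assume "eta > 0"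
   hence "eta / e > 0" using e by simp
   then obtain K where K: "!!m. m >= K ==> d (x m) l < eta / e"
    using LIMSEQ_D[OF l(2)] d0 x l(1) by (metis abs_of_nonneg diff_zero real_norm_def)
   show "Ph l <= Ph (x n) - e * d (x n) l + eta"
   proof (rule lsc[where x = "%m. x (m + (K + n))"])
    show "(%m. d (x (m + (K + n))) l) \<longlonglongrightarrow> 0" using l(2) by (rule LIMSEQ_ignore_initial_segment)
    fix m
    let ?m = "m + (K + n)"
    have "d (x n) l <= d (x n) (x ?m) + d (x ?m) l" using tri x l by blast
    moreover have "d (x ?m) l < eta / e" using K by simp
    ultimately have "e * d (x n) l <= e * (d (x n) (x ?m) + eta / e)" using e by (intro mult_left_mono) auto
    also have "... = e * d (x n) (x ?m) + eta" using e by (simp add: distrib_left)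
    finally show "Ph (x ?m) <= Ph (x n) - e * d (x n) l + eta"
     using S_le[of n ?m] by (simp add: S_def)
   qed (use x l in auto)
  qed
  thus ?thesis using l by (simp add: S_def)
 qed
 \<comment> \<open>Such a \<open>y\<close> lies in every \<open>S (x n)\<close>, so it is subject to
   all the almost optimal choices; letting the errors tend to 0 gives \<open>L <= Ph y\<close>,
   where \<open>L\<close> is the limit of the values.\<close>
 have min: "Ph l <= Ph y" if y: "y \<in> S l" for y
 proof -
  have "Ph (x (Suc n)) - (1/2) ^ n <= Ph y" for n
  proof -
   have "y \<in> S (x n)" using S_trans[OF x(1) lS y] .
   hence "Inf (Ph ` S (x n)) <= Ph y" using bdd by (intro cInf_lower) auto
   thus ?thesis using x(4)[of n] by linarith
  qed
  moreover have "(%n. Ph (x (Suc n)) - (1/2) ^ n) \<longlonglongrightarrow> L - 0"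
   by (intro tendsto_diff LIMSEQ_Suc L LIMSEQ_power_zero) auto
  ultimately have "L - 0 <= Ph y" by (intro LIMSEQ_le_const2) auto
  hence "L <= Ph y" by simp
  moreover have "Ph l <= L"
  proof (rule LIMSEQ_le_const[OF L(1)])
   have "Ph l <= Ph (x n)" for n using lS[of n] e d0[OF x(1)[of n] l(1)]
    by (simp add: S_def) (smt (verit) mult_nonneg_nonneg)
   thus "\<exists>N. \<forall>n\<ge>N. Ph l <= Ph (x n)" by blast
  qed
  ultimately show ?thesis by linarith
 qed
 show ?thesis
 proof (rule that[OF l(1)])
  show "Ph l <= Ph x0" using lS[of 0] e d0[OF x(1)[of 0] l(1)] x(2)
   by (simp add: S_def) (smt (verit) mult_nonneg_nonneg)
  fix y assume y: "y \<in> G"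
  have "e * d l y >= 0" using e d0[OF l(1) y] by simp
  thus "Ph l - e * d l y <= Ph y"
   using min[of y] y by (cases "y \<in> S l") (auto simp: S_def)
 qed
qed

text \<open>Continuous differentiability is expressed by inequalities in \<open>N\<close>, which
  replace the norm of a dual space. \<open>N\<close> is not assumed definite, so limits in the
  completeness assumption need not be unique.\<close>

locale C1_functional =
 fixes X :: "'f::real_vector set" and N :: "'f => real" and J :: "'f => real" and DJ :: "'f => 'f => real"
 assumes X: "subspace X"
  and N_nonneg: "u \<in> X ==> 0 <= N u"
  and N_add: "u \<in> X ==> v \<in> X ==> N (u + v) <= N u + N v"
  and N_scale: "u \<in> X ==> N (r *\<^sub>R u) = \<bar>r\<bar> * N u"
  and complete: "(!!n :: nat. w n \<in> X) ==> (!!eps. eps > 0 ==> \<exists>K. \<forall>i\<ge>K. \<forall>j\<ge>K. N (w i - w j) < eps) ==>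
    \<exists>l\<in>X. (%n. N (w n - l)) \<longlonglongrightarrow> 0"
  and DJ_add: "u \<in> X ==> v \<in> X ==> w' \<in> X ==> DJ u (v + w') = DJ u v + DJ u w'"
  and DJ_scale: "u \<in> X ==> v \<in> X ==> DJ u (r *\<^sub>R v) = r * DJ u v"
  and DJ_bound: "u \<in> X ==> \<exists>C. \<forall>h\<in>X. \<bar>DJ u h\<bar> <= C * N h"
  and DJ_cont: "u \<in> X ==> eps > 0 ==> \<exists>d>0. \<forall>v\<in>X. N (v - u) < d --> (\<forall>h\<in>X. \<bar>DJ v h - DJ u h\<bar> <= eps * N h)"
  and frechet: "u \<in> X ==> eps > 0 ==> \<exists>d>0. \<forall>h\<in>X. N h < d --> \<bar>J (u + h) - J u - DJ u h\<bar> <= eps * N h"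
begin

lemmas X_add = subspace_add[OF X] and X_scale = subspace_scale[OF X] and X_diff = subspace_diff[OF X]
 and X_0 = subspace_0[OF X] and X_sum = subspace_sum[OF X]

lemma N_0 [simp]: "N 0 = 0"
 using N_scale[OF X_0, of 0] by simp

lemma N_uminus: "u \<in> X ==> N (- u) = N u"
 using N_scale[of u "-1"] by simp

lemma N_minus_commute: "u \<in> X ==> v \<in> X ==> N (u - v) = N (v - u)"
 using N_uminus[OF X_diff, of u v] by simp

lemma N_triangle: "u \<in> X ==> v \<in> X ==> w \<in> X ==> N (u - w) <= N (u - v) + N (v - w)"
 using N_add[OF X_diff X_diff, of u v v w] by simp

lemma N_abs_diff: "u \<in> X ==> v \<in> X ==> \<bar>N u - N v\<bar> <= N (u - v)"
 using N_triangle[of u v 0] N_triangle[of v u 0] N_minus_commute[of u v] X_0 by force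

lemma N_sum:
 assumes "finite A" "!!i. i \<in> A ==> g i \<in> X" shows "N (\<Sum>i\<in>A. g i) <= (\<Sum>i\<in>A. N (g i))"
 using assms
proof (induction A rule: finite_induct)
 case (insert a A)
 thus ?case using N_add[of "g a" "sum g A"] X_sum[of A g] by force
qed auto

lemma DJ_sum:
 assumes "finite A" "u \<in> X" "!!i. i \<in> A ==> g i \<in> X" shows "DJ u (\<Sum>i\<in>A. g i) = (\<Sum>i\<in>A. DJ u (g i))"
 using assms
proof (induction A rule: finite_induct)
 case empty
 thus ?case using DJ_scale[OF assms(2) X_0, of 0] by simp
next
 case (insert a A)
 thus ?case using DJ_add[of u "g a" "sum g A"] X_sum[of A g] by force
qed

lemma DJ_bound_pos: assumes "u \<in> X" obtains C where "C > 0" "!!h. h \<in> X ==> \<bar>DJ u h\<bar> <= C * N h"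
proof -
 obtain C where C: "\<forall>h\<in>X. \<bar>DJ u h\<bar> <= C * N h" using DJ_bound[OF assms] by blast
 have "\<bar>DJ u h\<bar> <= (\<bar>C\<bar> + 1) * N h" if "h \<in> X" for h
 proof -
  have "C * N h <= (\<bar>C\<bar> + 1) * N h" using N_nonneg[OF that] by (intro mult_right_mono) auto
  thus ?thesis using C that by force
 qed
 thus ?thesis using that[of "\<bar>C\<bar> + 1"] by force
qed

lemma DJ_diff: "u \<in> X ==> v \<in> X ==> w \<in> X ==> DJ u (v - w) = DJ u v - DJ u w"
 using DJ_add[of u v "(-1) *\<^sub>R w"] DJ_scale[of u w "-1"] X_scale[of w "-1"] by simp

lemma N_tendsto:
 assumes "\<forall>\<^sub>F x in F. g x \<in> X" "u \<in> X" "((%x. N (g x - u)) \<longlongrightarrow> 0) F"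
 shows "((%x. N (g x)) \<longlongrightarrow> N u) F"
proof -
 have "\<forall>\<^sub>F x in F. norm (N (g x) - N u) <= N (g x - u)"
  using assms(1) by eventually_elim (use N_abs_diff[OF _ assms(2)] in auto)
 hence "((%x. N (g x) - N u) \<longlongrightarrow> 0) F" using assms(3) by (rule Lim_null_comparison)
 thus ?thesis by (simp add: LIM_zero_iff)
qed

lemma J_tendsto:
 assumes "\<forall>\<^sub>F x in F. g x \<in> X" "u \<in> X" "((%x. N (g x - u)) \<longlongrightarrow> 0) F"
 shows "((%x. J (g x)) \<longlongrightarrow> J u) F"
proof -
 obtain C where C: "C > 0" "!!h. h \<in> X ==> \<bar>DJ u h\<bar> <= C * N h" using DJ_bound_pos[OF assms(2)] by blast
 obtain d where d: "d > 0" "!!h. h \<in> X ==> N h < d ==> \<bar>J (u + h) - J u - DJ u h\<bar> <= 1 * N h"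
  using frechet[OF assms(2), of 1] by auto
 have "\<forall>\<^sub>F x in F. N (g x - u) < d" using assms(3) d(1) by (rule order_tendstoD)
 with assms(1) have "\<forall>\<^sub>F x in F. norm (J (g x) - J u) <= (C + 1) * N (g x - u)"
 proof eventually_elim
  case (elim x)
  hence "g x - u \<in> X" using X_diff assms by blast
  thus ?case using C(2)[of "g x - u"] d(2)[of "g x - u"] elim by (simp add: distrib_right)
 qed
 moreover have "((%x. (C + 1) * N (g x - u)) \<longlongrightarrow> 0) F"
  using assms(3) by (auto intro!: tendsto_eq_intros)
 ultimately have "((%x. J (g x) - J u) \<longlongrightarrow> 0) F" by (rule Lim_null_comparison)
 thus ?thesis by (simp add: LIM_zero_iff)
qed

lemma DJ_tendsto:
 assumes g: "\<forall>\<^sub>F x in F. g x \<in> X" "u \<in> X" "((%x. N (g x - u)) \<longlongrightarrow> 0) F"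
  and k: "\<forall>\<^sub>F x in F. k x \<in> X" "h \<in> X" "((%x. N (k x - h)) \<longlongrightarrow> 0) F"
 shows "((%x. DJ (g x) (k x)) \<longlongrightarrow> DJ u h) F"
proof -
 obtain C where C: "C > 0" "!!h. h \<in> X ==> \<bar>DJ u h\<bar> <= C * N h" using DJ_bound_pos[OF g(2)] by blast
 have "((%x. DJ (g x) (k x) - DJ u h) \<longlongrightarrow> 0) F"
 proof (rule tendstoI)
  fix e :: real assume e: "e > 0"
  define e1 where "e1 = e / (2 * (N h + 1))"
  have den: "N h + 1 > 0" using N_nonneg[OF k(2)] by simp
  hence e1: "e1 > 0" using e by (simp add: e1_def)
  obtain d where d: "d > 0" "!!v h. v \<in> X ==> N (v - u) < d ==> h \<in> X ==> \<bar>DJ v h - DJ u h\<bar> <= e1 * N h"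
   using DJ_cont[OF g(2) e1] by blast
  have "\<forall>\<^sub>F x in F. N (g x - u) < d" using g(3) d(1) by (rule order_tendstoD)
  moreover have "min 1 (e / (2 * C)) > 0" using e C by simp
  hence "\<forall>\<^sub>F x in F. N (k x - h) < min 1 (e / (2 * C))" using k(3) by (rule order_tendstoD(2)[rotated])
  ultimately show "\<forall>\<^sub>F x in F. dist (DJ (g x) (k x) - DJ u h) 0 < e"
   using g(1) k(1)
  proof eventually_elim
   case (elim x)
   have "N (k x) <= N h + 1" using N_abs_diff[OF elim(4) k(2)] elim(2) by (simp, linarith)
   hence "e1 * N (k x) <= e1 * (N h + 1)" using e1 by (intro mult_left_mono) auto
   also have "... = e / 2" using den by (simp add: e1_def field_simps)
   finally have 1: "\<bar>DJ (g x) (k x) - DJ u (k x)\<bar> <= e / 2"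
    using d(2)[OF elim(3) elim(1) elim(4)] by linarith
   have "\<bar>DJ u (k x) - DJ u h\<bar> <= C * N (k x - h)"
    using C(2)[OF X_diff[OF elim(4) k(2)]] DJ_diff[OF g(2) elim(4) k(2)] by simp
   also have "... < e / 2" using elim(2) C by (simp add: field_simps)
   finally have "\<bar>DJ (g x) (k x) - DJ u h\<bar> < e" using 1 by linarith
   thus ?case by (simp add: dist_real_def)
  qed
 qed
 thus ?thesis by (simp add: LIM_zero_iff)
qed

lemma J_mean_value:
 assumes u: "u \<in> X" and h: "h \<in> X" and l: "l > 0"
 obtains xi where "0 < xi" "xi < l" "J (u + l *\<^sub>R h) - J u = l * DJ (u + xi *\<^sub>R h) h"
proof -
 have "((%s. J (u + s *\<^sub>R h)) has_real_derivative DJ (u + s *\<^sub>R h) h) (at s)" for s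
  unfolding has_field_derivative_iff
 proof (rule LIM_I)
  fix e :: real assume e: "e > 0"
  have us: "u + s *\<^sub>R h \<in> X" by (intro X_add X_scale u h)
  \<comment> \<open>Dividing by \<open>N h + 1\<close> instead of \<open>N h\<close> covers
    directions of zero seminorm.\<close>
  have den: "N h + 1 > 0" using N_nonneg[OF h] by simp
  hence "e / (2 * (N h + 1)) > 0" using e by simp
  then obtain d where d: "d > 0" "!!k. k \<in> X ==> N k < d ==>
    \<bar>J (u + s *\<^sub>R h + k) - J (u + s *\<^sub>R h) - DJ (u + s *\<^sub>R h) k\<bar> <= e / (2 * (N h + 1)) * N k"
   using frechet[OF us] by blast
  have "norm ((J (u + y *\<^sub>R h) - J (u + s *\<^sub>R h)) / (y - s) - DJ (u + s *\<^sub>R h) h) < e"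
   if y: "y ~= s" "norm (y - s) < d / (N h + 1)" for y
  proof -
   have "\<bar>y - s\<bar> * N h <= \<bar>y - s\<bar> * (N h + 1)" by (intro mult_left_mono) auto
   also have "... < d" using y den by (simp add: field_simps)
   finally have "N ((y - s) *\<^sub>R h) < d" by (simp add: N_scale[OF h])
   have eq: "u + s *\<^sub>R h + (y - s) *\<^sub>R h = u + y *\<^sub>R h" by (simp add: algebra_simps)
   from d(2)[OF X_scale[OF h] \<open>N ((y - s) *\<^sub>R h) < d\<close>]
   have "\<bar>J (u + y *\<^sub>R h) - J (u + s *\<^sub>R h) - (y - s) * DJ (u + s *\<^sub>R h) h\<bar> <= e / (2 * (N h + 1)) * (\<bar>y - s\<bar> * N h)"
    unfolding eq by (simp only: N_scale[OF h] DJ_scale[OF us h])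
   also have "... <= e / (2 * (N h + 1)) * (\<bar>y - s\<bar> * (N h + 1))"
    using e den by (intro mult_left_mono) auto
   also have "... = e / 2 * \<bar>y - s\<bar>" using den by (simp add: field_simps)
   also have "... < e * \<bar>y - s\<bar>" using e y by simp
   finally have "\<bar>(J (u + y *\<^sub>R h) - J (u + s *\<^sub>R h) - (y - s) * DJ (u + s *\<^sub>R h) h) / (y - s)\<bar> < e"
    using y by (simp add: abs_divide field_simps)
   moreover have "(J (u + y *\<^sub>R h) - J (u + s *\<^sub>R h) - (y - s) * DJ (u + s *\<^sub>R h) h) / (y - s) =
     (J (u + y *\<^sub>R h) - J (u + s *\<^sub>R h)) / (y - s) - DJ (u + s *\<^sub>R h) h"
    using y by (simp add: diff_divide_distrib)
   ultimately show ?thesis by simp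
  qed
  thus "\<exists>r>0. \<forall>y. y ~= s & norm (y - s) < r -->
    norm ((J (u + y *\<^sub>R h) - J (u + s *\<^sub>R h)) / (y - s) - DJ (u + s *\<^sub>R h) h) < e"
   using d(1) den by (intro exI[of _ "d / (N h + 1)"]) auto
 qed
 then obtain xi where "0 < xi" "xi < l" "J (u + l *\<^sub>R h) - J (u + 0 *\<^sub>R h) = (l - 0) * DJ (u + xi *\<^sub>R h) h"
  using MVT2[OF l, of "%s. J (u + s *\<^sub>R h)" "%s. DJ (u + s *\<^sub>R h) h"] by blast
 thus ?thesis using that by simp
qed

section \<open>Paths with fixed endpoints under the uniform distance\<close>

definition paths :: "'f => (real => 'f) set" where
 "paths e = {sig. (\<forall>t\<in>{0..1}. sig t \<in> X & ((%tau. N (sig tau - sig t)) \<longlongrightarrow> 0) (at t within {0..1})) &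
   sig 0 = 0 & sig 1 = e}"

definition peak :: "(real => 'f) => real" where
 "peak sig = (SUP t\<in>{0..1}. J (sig t))"

text \<open>Only a pseudo-distance: \<open>N\<close> may vanish on nonzero elements, and values of a
  path outside \<open>{0..1}\<close> are arbitrary.\<close>

definition path_dist :: "(real => 'f) => (real => 'f) => real" where
 "path_dist sig tau = (SUP t\<in>{0..1}. N (sig t - tau t))"

lemma path_X: "sig \<in> paths e ==> t \<in> {0..1} ==> sig t \<in> X"
 by (auto simp: paths_def)

lemma path_tendsto: "sig \<in> paths e ==> t \<in> {0..1} ==> ((%tau. N (sig tau - sig t)) \<longlongrightarrow> 0) (at t within {0..1})"
 by (auto simp: paths_def)

lemma ev_in_unit: "(!!tau. tau \<in> {0..1 :: real} ==> P tau) ==> \<forall>\<^sub>F tau in at t within {0..1}. P tau"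
 by (auto simp: eventually_at_filter)

lemma path_J_continuous:
 assumes "sig \<in> paths e" shows "continuous_on {0..1} (%t. J (sig t))"
 unfolding continuous_on_def
 by (intro ballI J_tendsto ev_in_unit path_X[OF assms] path_tendsto[OF assms])

lemma path_N_continuous:
 assumes "sig \<in> paths e" shows "continuous_on {0..1} (%t. N (sig t))"
 unfolding continuous_on_def
 by (intro ballI N_tendsto ev_in_unit path_X[OF assms] path_tendsto[OF assms])

lemma path_diff_N_continuous:
 assumes sig: "sig \<in> paths e" and tau: "tau \<in> paths e" shows "continuous_on {0..1} (%t. N (sig t - tau t))"
 unfolding continuous_on_def
proof (intro ballI N_tendsto ev_in_unit)
 fix t :: real assume t: "t \<in> {0..1}"
 have A: "((%s. N (sig s - sig t) + N (tau s - tau t)) \<longlongrightarrow> 0 + 0) (at t within {0..1})"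
  by (intro tendsto_add path_tendsto[OF sig t] path_tendsto[OF tau t])
 have B: "\<forall>\<^sub>F s in at t within {0..1}. norm (N ((sig s - tau s) - (sig t - tau t))) <= N (sig s - sig t) + N (tau s - tau t)"
 proof (rule ev_in_unit)
  fix s :: real assume s: "s \<in> {0..1}"
  note m = path_X[OF sig s] path_X[OF sig t] path_X[OF tau s] path_X[OF tau t]
  have "N ((sig s - tau s) - (sig t - tau t)) = N ((sig s - sig t) + (tau t - tau s))" by (simp add: algebra_simps)
  also have "... <= N (sig s - sig t) + N (tau t - tau s)" using m by (intro N_add X_diff)
  finally show "norm (N ((sig s - tau s) - (sig t - tau t))) <= N (sig s - sig t) + N (tau s - tau t)"
   using N_minus_commute[OF m(3,4)] N_nonneg[OF X_diff[OF X_diff[OF m(1,3)] X_diff[OF m(2,4)]]] by simp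
 qed
 show "((%s. N ((sig s - tau s) - (sig t - tau t))) \<longlongrightarrow> 0) (at t within {0..1})"
  by (rule Lim_null_comparison[OF B]) (use A in simp)
qed (intro X_diff path_X[OF sig] path_X[OF tau]; assumption)+

lemma sup_attained:
 fixes g :: "real => real"
 assumes "continuous_on {0..1} g"
 shows "t \<in> {0..1} ==> g t <= (SUP t\<in>{0..1}. g t)"
  and "\<exists>t\<in>{0..1}. g t = (SUP t\<in>{0..1}. g t)"
proof -
 obtain t0 where t0: "t0 \<in> {0..1}" "!!t. t \<in> {0..1} ==> g t <= g t0"
  using continuous_attains_sup[OF compact_Icc _ assms] by auto
 have "(SUP t\<in>{0..1}. g t) = g t0"
  using t0 by (intro cSup_eq_maximum) auto
 thus "t \<in> {0..1} ==> g t <= (SUP t\<in>{0..1}. g t)"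
  and "\<exists>t\<in>{0..1}. g t = (SUP t\<in>{0..1}. g t)" using t0 by auto
qed

lemmas J_le_peak = sup_attained(1)[OF path_J_continuous, folded peak_def]
 and peak_attained = sup_attained(2)[OF path_J_continuous, folded peak_def]
 and N_le_path_dist = sup_attained(1)[OF path_diff_N_continuous, folded path_dist_def]
 and path_dist_attained = sup_attained(2)[OF path_diff_N_continuous, folded path_dist_def]

lemma path_dist_leI:
 assumes "sig \<in> paths e" "tau \<in> paths e" "!!t. t \<in> {0..1} ==> N (sig t - tau t) <= r"
 shows "path_dist sig tau <= r"
proof -
 obtain t where "t \<in> {0..1}" "N (sig t - tau t) = path_dist sig tau"
  using path_dist_attained[OF assms(1,2)] by blast
 thus ?thesis using assms(3)[of t] by simp
qed

lemma path_dist_nonneg: "sig \<in> paths e ==> tau \<in> paths e ==> 0 <= path_dist sig tau"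
 by (rule order_trans[OF N_nonneg[OF X_diff[OF path_X path_X]] N_le_path_dist[where t = 0]]) auto

lemma path_dist_self: "sig \<in> paths e ==> path_dist sig sig = 0"
 by (simp add: path_dist_def)

lemma path_dist_commute: "sig \<in> paths e ==> tau \<in> paths e ==> path_dist sig tau = path_dist tau sig"
 unfolding path_dist_def by (intro SUP_cong refl N_minus_commute path_X) auto

lemma path_dist_triangle:
 assumes "sig \<in> paths e" "tau \<in> paths e" "\<upsilon> \<in> paths e"
 shows "path_dist sig \<upsilon> <= path_dist sig tau + path_dist tau \<upsilon>"
proof (rule path_dist_leI[OF assms(1,3)])
 fix t :: real assume t: "t \<in> {0..1}"
 show "N (sig t - \<upsilon> t) <= path_dist sig tau + path_dist tau \<upsilon>"
  using N_triangle[OF path_X[OF assms(1) t] path_X[OF assms(2) t] path_X[OF assms(3) t]]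
   N_le_path_dist[OF assms(1,2) t] N_le_path_dist[OF assms(2,3) t] by linarith
qed

lemma paths_complete:
 assumes e: "e \<in> X" and sig: "!!n :: nat. sig n \<in> paths e"
  and cau: "!!eps. eps > 0 ==> \<exists>K. \<forall>i\<ge>K. \<forall>j\<ge>K. path_dist (sig i) (sig j) < eps"
 shows "\<exists>l\<in>paths e. (%n. path_dist (sig n) l) \<longlonglongrightarrow> 0"
proof -
 \<comment> \<open>A limit in \<open>N\<close> is determined only up to elements of zero seminorm,
   so the endpoint values have to be prescribed for the limit path to belong to
   \<open>paths e\<close>.\<close>
 have "\<exists>x. x \<in> X & (t = 0 --> x = 0) & (t = 1 --> x = e) & (%n. N (sig n t - x)) \<longlonglongrightarrow> 0" if t: "t \<in> {0..1}" for t
 proof (cases "t = 0 \<or> t = 1")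
  case True
  thus ?thesis using sig e X_0 by (auto simp: paths_def)
 next
  case False
  have "\<exists>x\<in>X. (%n. N (sig n t - x)) \<longlonglongrightarrow> 0"
  proof (rule complete)
   fix eps :: real assume "eps > 0"
   then obtain K where K: "\<forall>i\<ge>K. \<forall>j\<ge>K. path_dist (sig i) (sig j) < eps" using cau by blast
   have "N (sig i t - sig j t) < eps" if "i >= K" "j >= K" for i j
    using N_le_path_dist[OF sig sig t, of i j] K that by (meson le_less_trans)
   thus "\<exists>K. \<forall>i\<ge>K. \<forall>j\<ge>K. N (sig i t - sig j t) < eps" by blast
  qed (use path_X sig t in auto)
  thus ?thesis using False by auto
 qed
 then obtain l where l: "!!t. t \<in> {0..1} ==> l t \<in> X" "l 0 = 0" "l 1 = e"
   "!!t. t \<in> {0..1} ==> (%n. N (sig n t - l t)) \<longlonglongrightarrow> 0"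
  by (metis atLeastAtMost_iff order_refl zero_le_one)
 have unif: "\<exists>K. \<forall>n\<ge>K. \<forall>t\<in>{0..1}. N (sig n t - l t) <= eps" if eps: "eps > 0" for eps
 proof -
  obtain K where K: "\<forall>i\<ge>K. \<forall>j\<ge>K. path_dist (sig i) (sig j) < eps" using cau eps by blast
  have "N (sig n t - l t) <= eps" if n: "n >= K" and t: "t \<in> {0..1}" for n t
  proof (rule LIMSEQ_le_const)
   show "(%j. eps + N (sig j t - l t)) \<longlonglongrightarrow> eps"
    using l(4)[OF t] by (auto intro!: tendsto_eq_intros)
   show "\<exists>K'. \<forall>j\<ge>K'. N (sig n t - l t) <= eps + N (sig j t - l t)"
   proof (intro exI[of _ K] allI impI)
    fix j assume "j >= K"
    hence "path_dist (sig n) (sig j) < eps" using K n by blast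
    thus "N (sig n t - l t) <= eps + N (sig j t - l t)"
     using N_le_path_dist[OF sig sig t, of n j] N_triangle[OF path_X[OF sig t] path_X[OF sig t] l(1)[OF t], of n j]
     by linarith
   qed
  qed
  thus ?thesis by blast
 qed
 have lp: "l \<in> paths e"
  unfolding paths_def
 proof (intro CollectI conjI ballI l)
  fix t :: real assume t: "t \<in> {0..1}"
  show "((%tau. N (l tau - l t)) \<longlongrightarrow> 0) (at t within {0..1})"
  proof (rule tendstoI)
   fix eps :: real assume eps: "eps > 0"
   then obtain n where n: "\<forall>t\<in>{0..1}. N (sig n t - l t) <= eps / 4" using unif[of "eps / 4"] by force
   have "\<forall>\<^sub>F s in at t within {0..1}. N (sig n s - sig n t) < eps / 4"
    using path_tendsto[OF sig t, of n] eps by (intro order_tendstoD) auto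
   moreover have "\<forall>\<^sub>F s in at t within {0..1}. s \<in> {0..1}" by (rule ev_in_unit)
   ultimately show "\<forall>\<^sub>F s in at t within {0..1}. dist (N (l s - l t)) 0 < eps"
   proof eventually_elim
    case (elim s)
    note m = path_X[OF sig elim(2), of n] path_X[OF sig t, of n] l(1)[OF t] l(1)[OF elim(2)]
    have "N (l s - l t) <= N (l s - sig n s) + N (sig n s - sig n t) + N (sig n t - l t)"
     using N_triangle[OF m(4,1,3)] N_triangle[OF m(1,2,3)] by linarith
    moreover have "N (l s - sig n s) <= eps / 4" using n elim(2) N_minus_commute[OF m(4,1)] by simp
    moreover have "N (sig n t - l t) <= eps / 4" using n t by simp
    ultimately have "N (l s - l t) < eps" using elim(1) eps by linarith
    thus ?case using N_nonneg[OF X_diff[OF m(4,3)]] by (simp add: dist_real_def)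
   qed
  qed
 qed
 have "(%n. path_dist (sig n) l) \<longlonglongrightarrow> 0"
 proof (rule LIMSEQ_I)
  fix r :: real assume r: "r > 0"
  then obtain K where K: "\<forall>n\<ge>K. \<forall>t\<in>{0..1}. N (sig n t - l t) <= r / 2" using unif[of "r / 2"] by force
  have "norm (path_dist (sig n) l - 0) < r" if "n >= K" for n
   using path_dist_leI[OF sig lp, of n "r / 2"] K that path_dist_nonneg[OF sig lp, of n] r by force
  thus "\<exists>no. \<forall>n\<ge>no. norm (path_dist (sig n) l - 0) < r" by blast
 qed
 with lp show ?thesis by blast
qed

lemma peak_lsc:
 assumes sig: "!!n :: nat. sig n \<in> paths e" and l: "l \<in> paths e" and lim: "(%n. path_dist (sig n) l) \<longlonglongrightarrow> 0"
  and a: "!!n. peak (sig n) <= a"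
 shows "peak l <= a"
proof -
 obtain t where t: "t \<in> {0..1}" "J (l t) = peak l" using peak_attained[OF l] by blast
 have "(%n. J (sig n t)) \<longlonglongrightarrow> J (l t)"
 proof (rule J_tendsto)
  show "(%n. N (sig n t - l t)) \<longlonglongrightarrow> 0"
  proof (rule Lim_null_comparison[OF _ lim])
   show "\<forall>\<^sub>F n in sequentially. norm (N (sig n t - l t)) <= path_dist (sig n) l"
    using N_le_path_dist[OF sig l t(1)] N_nonneg[OF X_diff[OF path_X[OF sig t(1)] path_X[OF l t(1)]]] by auto
  qed
 qed (use path_X[OF sig t(1)] path_X[OF l t(1)] in auto)
 moreover have "J (sig n t) <= a" for n using J_le_peak[OF sig t(1), of n] a[of n] by linarith
 ultimately show ?thesis using t(2) by (metis LIMSEQ_le_const2)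
qed

text \<open>If the derivative were large at every maximum point of \<open>J\<close> along \<open>sig\<close>, a
 partition of unity over the compact set of maximum points would give a field along which
 \<open>sig\<close> can be lowered faster than \<open>eps\<close>.\<close>

lemma almost_critical_point_on_path:
 assumes sig: "sig \<in> paths e" and ends: "J 0 < peak sig" "J e < peak sig" and eps: "eps > 0"
  and ek: "!!tau. tau \<in> paths e ==> peak sig - eps * path_dist sig tau <= peak tau"
 shows "\<exists>t\<in>{0..1}. J (sig t) = peak sig & (\<forall>h\<in>X. \<bar>DJ (sig t) h\<bar> <= 2 * eps * N h)"
proof (rule ccontr)
 assume neg: "~ ?thesis"
 define M where "M = {t \<in> {0..1}. J (sig t) = peak sig}"
 have cM: "compact M"
 proof -
  have "closed M" unfolding M_def
   by (rule continuous_closed_preimage_constant[OF path_J_continuous[OF sig]]) auto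
  hence "compact ({0..1} \<inter> M)" by (rule compact_Int_closed[OF compact_Icc])
  moreover have "{0..1} \<inter> M = M" by (auto simp: M_def)
  ultimately show ?thesis by simp
 qed
 have M01: "t \<in> {0..1}" "t ~= 0" "t ~= 1" if "t \<in> M" for t
  using that ends sig by (auto simp: M_def paths_def)
 have "\<exists>h. h \<in> X & N h <= 1 & DJ (sig t) h < - 2 * eps" if t: "t \<in> M" for t
 proof -
  have sigt: "sig t \<in> X" using path_X[OF sig] M01[OF t] by blast
  obtain k where k: "k \<in> X" "\<bar>DJ (sig t) k\<bar> > 2 * eps * N k"
   using neg M01(1)[OF t] t by (force simp: M_def)
  \<comment> \<open>The bound in \<open>DJ_bound\<close> makes the derivative vanish on directions
    of zero seminorm.\<close>
  have "N k ~= 0"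
   using k DJ_bound[OF sigt] by force
  hence Nk: "N k > 0" using N_nonneg[OF k(1)] by simp
  define r where "r = - sgn (DJ (sig t) k) / N k"
  have "DJ (sig t) k ~= 0" using k Nk eps by (metis abs_zero less_asym mult_pos_pos zero_less_numeral)
  hence "\<bar>r\<bar> = 1 / N k" using Nk by (simp add: r_def abs_divide abs_sgn_eq)
  hence n1: "N (r *\<^sub>R k) = 1" using Nk unfolding N_scale[OF k(1)] by simp
  have n2: "DJ (sig t) (r *\<^sub>R k) = - (\<bar>DJ (sig t) k\<bar> / N k)"
   unfolding DJ_scale[OF sigt k(1)] r_def by (simp add: abs_sgn)
  have "2 * eps < \<bar>DJ (sig t) k\<bar> / N k" using k(2) Nk by (simp add: field_simps)
  with n1 n2 X_scale[OF k(1), of r] show ?thesis by (intro exI[of _ "r *\<^sub>R k"] conjI) linarith+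
 qed
 then obtain H where H: "!!t. t \<in> M ==> H t \<in> X" "!!t. t \<in> M ==> N (H t) <= 1"
   "!!t. t \<in> M ==> DJ (sig t) (H t) < - 2 * eps"
  by metis
 \<comment> \<open>The bounds by \<open>t\<close> and \<open>1 - t\<close> make the hat functions
   built from these radii vanish at 0 and 1, so that the deformed path keeps its endpoints. They are
   available because both ends lie below the peak.\<close>
 have "\<exists>d. 0 < d & d <= t & d <= 1 - t & (\<forall>s\<in>{0..1}. \<bar>s - t\<bar> < d --> DJ (sig s) (H t) < - 2 * eps)" if t: "t \<in> M" for t
 proof -
  have "((%s. DJ (sig s) (H t)) \<longlongrightarrow> DJ (sig t) (H t)) (at t within {0..1})"
   using path_X[OF sig] path_tendsto[OF sig] M01[OF t] H(1)[OF t]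
   by (intro DJ_tendsto ev_in_unit) auto
  hence "\<forall>\<^sub>F s in at t within {0..1}. DJ (sig s) (H t) < - 2 * eps"
   using H(3)[OF t] by (rule order_tendstoD)
  then obtain d where d: "d > 0" "\<forall>s\<in>{0..1}. s ~= t & dist s t < d --> DJ (sig s) (H t) < - 2 * eps"
   unfolding eventually_at by blast
  have "\<forall>s\<in>{0..1}. \<bar>s - t\<bar> < d --> DJ (sig s) (H t) < - 2 * eps"
   using d(2) H(3)[OF t] by (metis dist_real_def)
  moreover have "0 < t" "t < 1" using M01[OF t] by auto
  ultimately show ?thesis using d(1) by (intro exI[of _ "min d (min t (1 - t))"] conjI) (simp_all add: min_def)
 qed
 hence "\<forall>t\<in>M. \<exists>d. 0 < d & d <= t & d <= 1 - t & (\<forall>s\<in>{0..1}. \<bar>s - t\<bar> < d --> DJ (sig s) (H t) < - 2 * eps)"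
  by blast
 from bchoice[OF this] obtain dlt where dlt': "\<forall>t\<in>M. 0 < dlt t & dlt t <= t & dlt t <= 1 - t &
   (\<forall>s\<in>{0..1}. \<bar>s - t\<bar> < dlt t --> DJ (sig s) (H t) < - 2 * eps)" ..
 hence dlt: "!!t. t \<in> M ==> dlt t > 0" "!!t. t \<in> M ==> dlt t <= t" "!!t. t \<in> M ==> dlt t <= 1 - t"
   "!!t s. t \<in> M ==> s \<in> {0..1} ==> \<bar>s - t\<bar> < dlt t ==> DJ (sig s) (H t) < - 2 * eps"
  by blast+
 have cover: "M \<subseteq> (\<Union>t\<in>M. ball t (dlt t))" using dlt(1) by force
 obtain T where T: "T \<subseteq> M" "finite T" "M \<subseteq> (\<Union>t\<in>T. ball t (dlt t))"
  by (rule compactE_image[OF cM _ cover]) auto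
 define w where "w t s = max 0 (dlt t - \<bar>s - t\<bar>)" for t s :: real
 define W where "W s = (\<Sum>t\<in>T. w t s)" for s
 have w0: "w t s >= 0" for t s by (simp add: w_def)
 have cw: "continuous_on A (w t)" for t A unfolding w_def by (intro continuous_intros)
 have cW: "continuous_on A W" for A unfolding W_def by (intro continuous_intros cw)
 have Wpos: "W s > 0" if "s \<in> M" for s
 proof -
  from subsetD[OF T(3) that] obtain t where t: "t \<in> T" "s \<in> ball t (dlt t)" by (rule UN_E)
  hence "\<bar>t - s\<bar> < dlt t" by (simp add: dist_real_def)
  hence "w t s > 0" unfolding w_def by linarith
  thus ?thesis unfolding W_def by (rule sum_pos2[OF T(2) t(1)]) (rule w0)
 qed
 have Mne: "M ~= {}" using peak_attained[OF sig] by (auto simp: M_def)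
 obtain m where m: "m > 0" "!!s. s \<in> M ==> m <= W s"
  using continuous_attains_inf[OF cM Mne cW] Wpos by blast
 \<comment> \<open>Replacing \<open>W s\<close> by \<open>max (W s) m\<close> keeps the weights
   continuous where all hats vanish; on \<open>M\<close> it changes nothing, so the weights sum to 1
   there and to at most 1 elsewhere.\<close>
 define a where "a t s = w t s / max (W s) m" for t s
 have a0: "a t s >= 0" for t s using w0 m by (simp add: a_def)
 have ca: "continuous_on A (a t)" for t A
  unfolding a_def using m by (intro continuous_intros cw cW) (auto simp: max_def)
 have a_sum: "(\<Sum>t\<in>T. a t s) <= 1" for s
  unfolding a_def sum_divide_distrib[symmetric] W_def[symmetric] using m by (simp add: divide_le_eq)
 define h where "h s = (\<Sum>t\<in>T. a t s *\<^sub>R H t)" for s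
 have HT: "t \<in> T ==> H t \<in> X" for t using T H by blast
 have hX: "h s \<in> X" for s unfolding h_def by (intro X_sum X_scale HT)
 have hN: "N (h s) <= 1" for s
 proof -
  have "N (h s) <= (\<Sum>t\<in>T. N (a t s *\<^sub>R H t))" unfolding h_def by (intro N_sum T X_scale HT)
  also have "... <= (\<Sum>t\<in>T. a t s * 1)"
  proof (intro sum_mono)
   fix t assume t: "t \<in> T"
   hence "N (H t) <= 1" using H(2) T(1) by blast
   hence "a t s * N (H t) <= a t s * 1" using a0 by (rule mult_left_mono)
   thus "N (a t s *\<^sub>R H t) <= a t s * 1" using a0[of t s] by (simp add: N_scale[OF HT[OF t]])
  qed
  finally show ?thesis using a_sum[of s] by simp
 qed
 have hDJ: "DJ (sig s) (h s) <= - 2 * eps" if s: "s \<in> M" for s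
 proof -
  have sigs: "sig s \<in> X" using path_X[OF sig] M01[OF s] by blast
  have "DJ (sig s) (h s) = (\<Sum>t\<in>T. a t s * DJ (sig s) (H t))"
  proof -
   have "DJ (sig s) (h s) = (\<Sum>t\<in>T. DJ (sig s) (a t s *\<^sub>R H t))"
    unfolding h_def by (intro DJ_sum T sigs X_scale HT)
   also have "... = (\<Sum>t\<in>T. a t s * DJ (sig s) (H t))"
    by (intro sum.cong refl DJ_scale sigs HT)
   finally show ?thesis .
  qed
  also have "... <= (\<Sum>t\<in>T. a t s * (- 2 * eps))"
  proof (intro sum_mono)
   fix t assume t: "t \<in> T"
   show "a t s * DJ (sig s) (H t) <= a t s * (- 2 * eps)"
   proof (cases "\<bar>s - t\<bar> < dlt t")
    case True
    hence "DJ (sig s) (H t) < - 2 * eps" using dlt(4) t T M01[OF s] by blast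
    thus ?thesis using a0 by (intro mult_left_mono) auto
   qed (simp add: a_def w_def)
  qed
  also have "... = - 2 * eps * (\<Sum>t\<in>T. a t s)" by (simp add: sum_distrib_left mult_ac)
  also have "(\<Sum>t\<in>T. a t s) = 1"
   unfolding a_def sum_divide_distrib[symmetric] W_def[symmetric] using m(2)[OF s] Wpos[OF s] by (simp add: max_def)
  finally show ?thesis by simp
 qed
 have hends: "h 0 = 0" "h 1 = 0"
 proof -
  have "w t 0 = 0" "w t 1 = 0" if "t \<in> T" for t
  proof -
   have "t \<in> M" using T(1) that by blast
   from dlt(2,3)[OF this] show "w t 0 = 0" "w t 1 = 0" unfolding w_def by linarith+
  qed
  thus "h 0 = 0" "h 1 = 0" by (auto simp: h_def a_def)
 qed
 have h_tendsto: "((%s. N (h s - h t)) \<longlongrightarrow> 0) (at t within A)" for t A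
 proof (rule Lim_null_comparison)
  have "N (h s - h t) <= (\<Sum>i\<in>T. \<bar>a i s - a i t\<bar> * N (H i))" for s
  proof -
   have "h s - h t = (\<Sum>i\<in>T. (a i s - a i t) *\<^sub>R H i)"
    by (simp add: h_def scaleR_diff_left sum_subtractf)
   also have "N ... <= (\<Sum>i\<in>T. N ((a i s - a i t) *\<^sub>R H i))" by (intro N_sum T X_scale HT)
   also have "... = (\<Sum>i\<in>T. \<bar>a i s - a i t\<bar> * N (H i))"
    by (intro sum.cong refl N_scale HT)
   finally show ?thesis .
  qed
  thus "\<forall>\<^sub>F s in at t within A. norm (N (h s - h t)) <= (\<Sum>i\<in>T. \<bar>a i s - a i t\<bar> * N (H i))"
   using N_nonneg[OF X_diff[OF hX hX]] by auto
  have "((%s. \<Sum>i\<in>T. \<bar>a i s - a i t\<bar> * N (H i)) \<longlongrightarrow> (\<Sum>i\<in>T. \<bar>a i t - a i t\<bar> * N (H i))) (at t within A)"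
  proof (intro tendsto_intros)
   fix i
   have "continuous (at t within A) (a i)"
    using ca[of UNIV i] by (simp add: continuous_on_eq_continuous_at continuous_at_imp_continuous_at_within)
   thus "(a i \<longlongrightarrow> a i t) (at t within A)" by (simp add: continuous_within)
  qed
  thus "((%s. \<Sum>i\<in>T. \<bar>a i s - a i t\<bar> * N (H i)) \<longlongrightarrow> 0) (at t within A)" by simp
 qed
 have path: "(%s. sig s + r *\<^sub>R h s) \<in> paths e" for r
  unfolding paths_def
 proof (intro CollectI conjI ballI)
  fix t :: real assume t: "t \<in> {0..1}"
  show "sig t + r *\<^sub>R h t \<in> X" using path_X[OF sig t] hX X_add X_scale by blast
  show "((%s. N (sig s + r *\<^sub>R h s - (sig t + r *\<^sub>R h t))) \<longlongrightarrow> 0) (at t within {0..1})"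
  proof (rule Lim_null_comparison)
   have "((%s. N (sig s - sig t) + \<bar>r\<bar> * N (h s - h t)) \<longlongrightarrow> 0 + \<bar>r\<bar> * 0) (at t within {0..1})"
    by (intro tendsto_intros path_tendsto[OF sig t] h_tendsto)
   thus "((%s. N (sig s - sig t) + \<bar>r\<bar> * N (h s - h t)) \<longlongrightarrow> 0) (at t within {0..1})" by simp
   show "\<forall>\<^sub>F s in at t within {0..1}. norm (N (sig s + r *\<^sub>R h s - (sig t + r *\<^sub>R h t))) <= N (sig s - sig t) + \<bar>r\<bar> * N (h s - h t)"
   proof (rule ev_in_unit)
    fix s :: real assume s: "s \<in> {0..1}"
    have 1: "sig s - sig t \<in> X" "h s - h t \<in> X" by (intro X_diff hX path_X[OF sig] s t)+
    have "N (sig s + r *\<^sub>R h s - (sig t + r *\<^sub>R h t)) = N ((sig s - sig t) + r *\<^sub>R (h s - h t))"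
     by (simp add: algebra_simps)
    also have "... <= N (sig s - sig t) + N (r *\<^sub>R (h s - h t))" by (intro N_add X_scale 1)
    finally show "norm (N (sig s + r *\<^sub>R h s - (sig t + r *\<^sub>R h t))) <= N (sig s - sig t) + \<bar>r\<bar> * N (h s - h t)"
     using N_nonneg[of "sig s + r *\<^sub>R h s - (sig t + r *\<^sub>R h t)"] path_X[OF sig s] path_X[OF sig t] hX
     by (simp add: N_scale[OF 1(2)] X_add X_scale X_diff)
   qed
  qed
 qed (use sig hends in \<open>auto simp: paths_def\<close>)
 \<comment> \<open>The path \<open>sig s + lam n *\<^sub>R h s\<close> has distance at most
   \<open>lam n\<close> from \<open>sig\<close>, so \<open>ek\<close> lets its peak drop by at most
   \<open>eps * lam n\<close>. The points \<open>t n\<close> chosen next attain that peak.\<close>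
 define lam where "lam n = 1 / real (Suc n)" for n
 have lam: "lam n > 0" for n by (simp add: lam_def)
 have lam0: "lam \<longlonglongrightarrow> 0" unfolding lam_def using LIMSEQ_inverse_real_of_nat by (simp add: inverse_eq_divide)
 have "\<exists>t. t \<in> {0..1} & J (sig t + lam n *\<^sub>R h t) >= peak sig - eps * lam n" for n
 proof -
  obtain t where t: "t \<in> {0..1}" "J (sig t + lam n *\<^sub>R h t) = peak (%s. sig s + lam n *\<^sub>R h s)"
   using peak_attained[OF path] by blast
  have "path_dist sig (%s. sig s + lam n *\<^sub>R h s) <= lam n"
  proof (rule path_dist_leI[OF sig path])
   fix s :: real assume s: "s \<in> {0..1}"
   have "N (sig s - (sig s + lam n *\<^sub>R h s)) = N ((- lam n) *\<^sub>R h s)" by simp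
   also have "... <= lam n * 1" unfolding N_scale[OF hX] using lam[of n] hN[of s] by (intro mult_mono) (auto simp: N_nonneg hX)
   finally show "N (sig s - (sig s + lam n *\<^sub>R h s)) <= lam n" by simp
  qed
  hence "eps * path_dist sig (%s. sig s + lam n *\<^sub>R h s) <= eps * lam n" using eps by (intro mult_left_mono) auto
  thus ?thesis using ek[OF path, of "lam n"] t by (intro exI[of _ t]) auto
 qed
 then obtain t where t: "!!n. t n \<in> {0..1}" "!!n. J (sig (t n) + lam n *\<^sub>R h (t n)) >= peak sig - eps * lam n"
  by metis
 have "\<exists>xi. 0 < xi & xi < lam n & DJ (sig (t n) + xi *\<^sub>R h (t n)) (h (t n)) >= - eps" for n
 proof -
  obtain xi where xi: "0 < xi" "xi < lam n" "J (sig (t n) + lam n *\<^sub>R h (t n)) - J (sig (t n)) = lam n * DJ (sig (t n) + xi *\<^sub>R h (t n)) (h (t n))"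
   using J_mean_value[OF path_X[OF sig t(1)] hX lam] by blast
  have "lam n * - eps <= lam n * DJ (sig (t n) + xi *\<^sub>R h (t n)) (h (t n))"
   using xi(3) t(2)[of n] J_le_peak[OF sig t(1), of n] by (simp add: mult.commute)
  hence "- eps <= DJ (sig (t n) + xi *\<^sub>R h (t n)) (h (t n))" using lam[of n] mult_le_cancel_left_pos by blast
  with xi show ?thesis by blast
 qed
 then obtain xi where xi: "!!n. 0 < xi n" "!!n. xi n < lam n" "!!n. DJ (sig (t n) + xi n *\<^sub>R h (t n)) (h (t n)) >= - eps"
  by metis
 \<comment> \<open>The limit \<open>t0\<close> turns out to be a maximum point of \<open>J\<close>
   along \<open>sig\<close>. Passing to the limit, the derivative along \<open>h t0\<close> is at
   least \<open>- eps\<close>, against the bound \<open>- 2 * eps\<close> of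
   \<open>hDJ\<close>.\<close>
 obtain t0 r where t0: "t0 \<in> {0..1}" "strict_mono (r :: nat => nat)" "(t \<circ> r) \<longlonglongrightarrow> t0"
  using compact_Icc[of 0 "1 :: real", unfolded compact_def] t(1) by (metis (no_types, lifting))
 have comp: "(%n. N (g (t (r n)) - g t0)) \<longlonglongrightarrow> 0" if "((%s. N (g s - g t0)) \<longlongrightarrow> 0) (at t0 within {0..1})" for g
 proof -
  have "continuous (at t0 within {0..1}) (%s. N (g s - g t0))" using that by (simp add: continuous_within)
  thus ?thesis using t0 t(1) unfolding continuous_within_sequentially
   by (auto simp: o_def)
 qed
 have csig: "(%n. N (sig (t (r n)) - sig t0)) \<longlonglongrightarrow> 0" by (intro comp path_tendsto[OF sig t0(1)])
 have ch: "(%n. N (h (t (r n)) - h t0)) \<longlonglongrightarrow> 0" by (intro comp h_tendsto)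
 have lamr: "(%n. lam (r n)) \<longlonglongrightarrow> 0" using LIMSEQ_subseq_LIMSEQ[OF lam0 t0(2)] by (simp add: o_def)
 have cc: "(%n. N (sig (t (r n)) + b n *\<^sub>R h (t (r n)) - sig t0)) \<longlonglongrightarrow> 0" if b: "!!n. 0 <= b n" "!!n. b n <= lam (r n)" for b
 proof (rule Lim_null_comparison)
  show "(%n. N (sig (t (r n)) - sig t0) + lam (r n)) \<longlonglongrightarrow> 0"
   using tendsto_add[OF csig lamr] by simp
  have "N (sig (t (r n)) + b n *\<^sub>R h (t (r n)) - sig t0) <= N (sig (t (r n)) - sig t0) + lam (r n)" for n
  proof -
   have 1: "sig (t (r n)) - sig t0 \<in> X" by (intro X_diff path_X[OF sig] t t0)
   have "N (sig (t (r n)) + b n *\<^sub>R h (t (r n)) - sig t0) = N ((sig (t (r n)) - sig t0) + b n *\<^sub>R h (t (r n)))"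
    by (simp add: algebra_simps)
   also have "... <= N (sig (t (r n)) - sig t0) + N (b n *\<^sub>R h (t (r n)))" by (intro N_add 1 X_scale hX)
   also have "N (b n *\<^sub>R h (t (r n))) <= lam (r n) * 1"
    unfolding N_scale[OF hX] using b[of n] hN[of "t (r n)"] by (intro mult_mono) (auto simp: N_nonneg hX)
   finally show ?thesis by simp
  qed
  thus "\<forall>\<^sub>F n in sequentially. norm (N (sig (t (r n)) + b n *\<^sub>R h (t (r n)) - sig t0)) <= N (sig (t (r n)) - sig t0) + lam (r n)"
   using N_nonneg[OF X_diff[OF X_add[OF path_X[OF sig t(1)] X_scale[OF hX]] path_X[OF sig t0(1)]]] by auto
 qed
 have sig0: "sig t0 \<in> X" by (rule path_X[OF sig t0(1)])
 have evX: "sig (t n) + b *\<^sub>R h (t n) \<in> X" for n b by (intro X_add X_scale hX path_X[OF sig] t)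
 have "(%n. J (sig (t (r n)) + lam (r n) *\<^sub>R h (t (r n)))) \<longlonglongrightarrow> J (sig t0)"
  using lam evX by (intro J_tendsto sig0 cc) (auto simp: less_imp_le)
 moreover have "(%n. peak sig - eps * lam (r n)) \<longlonglongrightarrow> peak sig - eps * 0" by (intro tendsto_intros lamr)
 ultimately have "peak sig - eps * 0 <= J (sig t0)" using t(2) by (intro LIMSEQ_le) auto
 hence t0M: "t0 \<in> M" using J_le_peak[OF sig t0(1)] t0(1) by (simp add: M_def)
 have "(%n. DJ (sig (t (r n)) + xi (r n) *\<^sub>R h (t (r n))) (h (t (r n)))) \<longlonglongrightarrow> DJ (sig t0) (h t0)"
  using xi evX hX by (intro DJ_tendsto sig0 cc hX ch) (auto simp: less_imp_le)
 hence "- eps <= DJ (sig t0) (h t0)" using xi(3) by (intro LIMSEQ_le_const) auto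
 with hDJ[OF t0M] eps show False by simp
qed

text \<open>Every path crosses the sphere of radius \<open>rho\<close> by the intermediate value
  theorem, so its peak is at least \<open>bet\<close> and exceeds the values at both ends. The
  Palais-Smale condition is assumed in the form of a Cauchy subsequence; completeness then supplies
  the critical point.\<close>

theorem mountain_pass:
 assumes e: "e \<in> X" and geo: "!!w. w \<in> X ==> N w = rho ==> bet <= J w" "rho > 0" "rho < N e" "J e < bet" "J 0 < bet"
  and PS: "!!(w :: nat => 'f) eps b. (!!n. w n \<in> X) ==> (!!n. \<bar>J (w n)\<bar> <= b) ==>
    (!!n h. h \<in> X ==> \<bar>DJ (w n) h\<bar> <= eps n * N h) ==> eps \<longlonglongrightarrow> 0 ==>
    \<exists>r. strict_mono (r :: nat => nat) & (\<forall>d>0. \<exists>K. \<forall>i\<ge>K. \<forall>j\<ge>K. N (w (r i) - w (r j)) < d)"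
 obtains u where "u \<in> X" "J u = (INF sig\<in>paths e. peak sig)" "bet <= J u" "!!h. h \<in> X ==> DJ u h = 0"
proof -
 define c where "c = (INF sig\<in>paths e. peak sig)"
 have peak_ge: "bet <= peak sig" if sig: "sig \<in> paths e" for sig
 proof -
  have "N (sig 0) <= rho" "rho <= N (sig 1)" using sig geo by (auto simp: paths_def)
  then obtain t where "0 <= t" "t <= 1" "N (sig t) = rho"
   using IVT'[of "%t. N (sig t)" 0 rho 1] path_N_continuous[OF sig] by auto
  thus ?thesis using geo(1)[OF path_X[OF sig], of t] J_le_peak[OF sig, of t] by force
 qed
 have "(%t. t *\<^sub>R e) \<in> paths e"
  unfolding paths_def
 proof (intro CollectI conjI ballI)
  fix t :: real
  show "((%tau. N (tau *\<^sub>R e - t *\<^sub>R e)) \<longlongrightarrow> 0) (at t within {0..1})"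
   unfolding scaleR_diff_left[symmetric] N_scale[OF e] by (auto intro!: tendsto_eq_intros)
 qed (simp_all add: X_scale[OF e])
 hence ne: "paths e ~= {}" by auto
 have bdd: "bdd_below (peak ` paths e)" using peak_ge by (auto intro!: bdd_belowI[of _ bet])
 have cbet: "bet <= c" unfolding c_def using ne peak_ge by (intro cINF_greatest)
 have c_le: "c <= peak sig" if "sig \<in> paths e" for sig unfolding c_def using bdd that by (rule cINF_lower)
 define eps where "eps n = 1 / real (Suc n)" for n
 have eps: "eps n > 0" for n by (simp add: eps_def)
 have eps0: "eps \<longlonglongrightarrow> 0" unfolding eps_def using LIMSEQ_inverse_real_of_nat by (simp add: inverse_eq_divide)
 have "\<exists>u. u \<in> X & c <= J u & J u <= c + eps n & (\<forall>h\<in>X. \<bar>DJ u h\<bar> <= 2 * eps n * N h)" for n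
 proof -
  have "Inf (peak ` paths e) < c + eps n" using eps[of n] by (simp add: c_def)
  then obtain sig0 where sig0: "sig0 \<in> paths e" "peak sig0 < c + eps n"
   using cInf_lessD[of "peak ` paths e" "c + eps n"] ne by blast
  obtain sig where sig: "sig \<in> paths e" "peak sig <= peak sig0" "!!tau. tau \<in> paths e ==> peak sig - eps n * path_dist sig tau <= peak tau"
  proof (rule weak_Ekeland[of "paths e" path_dist peak bet sig0 "eps n"])
   fix x :: "nat => real => 'f" assume "!!n. x n \<in> paths e" "!!eps. 0 < eps ==> \<exists>K. \<forall>i\<ge>K. \<forall>j\<ge>K. path_dist (x i) (x j) < eps"
   thus "\<exists>l\<in>paths e. (%n. path_dist (x n) l) \<longlonglongrightarrow> 0" by (rule paths_complete[OF e])
  next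
   fix x :: "nat => real => 'f" and l a assume "!!n. x n \<in> paths e" "l \<in> paths e" "(%n. path_dist (x n) l) \<longlonglongrightarrow> 0" "!!n. peak (x n) <= a"
   thus "peak l <= a" by (rule peak_lsc)
  qed (use sig0 eps peak_ge path_dist_nonneg path_dist_self path_dist_commute path_dist_triangle in auto)
  have "J 0 < peak sig" "J e < peak sig" using peak_ge[OF sig(1)] geo by auto
  then obtain t where t: "t \<in> {0..1}" "J (sig t) = peak sig" "\<forall>h\<in>X. \<bar>DJ (sig t) h\<bar> <= 2 * eps n * N h"
   using almost_critical_point_on_path[OF sig(1) _ _ eps sig(3)] by blast
  thus ?thesis using path_X[OF sig(1) t(1)] c_le[OF sig(1)] sig(2) sig0(2) by (intro exI[of _ "sig t"]) auto
 qed
 then obtain w where w: "!!n. w n \<in> X" "!!n. c <= J (w n)" "!!n. J (w n) <= c + eps n"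
   "!!n h. h \<in> X ==> \<bar>DJ (w n) h\<bar> <= 2 * eps n * N h"
  by metis
 have Jb: "\<bar>J (w n)\<bar> <= \<bar>c\<bar> + 1" for n
 proof -
  have "eps n <= 1" by (simp add: eps_def)
  thus ?thesis using w(2,3)[of n] by linarith
 qed
 have "(%n. 2 * eps n) \<longlonglongrightarrow> 0" using eps0 by (auto intro!: tendsto_eq_intros)
 from PS[OF w(1) Jb w(4) this] obtain r where r: "strict_mono (r :: nat => nat)"
   "!!d. d > 0 ==> \<exists>K. \<forall>i\<ge>K. \<forall>j\<ge>K. N (w (r i) - w (r j)) < d"
  by blast
 obtain u where u: "u \<in> X" "(%n. N (w (r n) - u)) \<longlonglongrightarrow> 0" using complete[of "%n. w (r n)", OF w(1) r(2)] by blast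
 have epsr: "(%n. eps (r n)) \<longlonglongrightarrow> 0" using LIMSEQ_subseq_LIMSEQ[OF eps0 r(1)] by (simp add: o_def)
 have Ju: "(%n. J (w (r n))) \<longlonglongrightarrow> J u" using w u by (intro J_tendsto) auto
 have "(%n. c + eps (r n)) \<longlonglongrightarrow> c + 0" by (intro tendsto_intros epsr)
 hence "J u <= c" using Ju w(3) by (auto intro: LIMSEQ_le)
 moreover have "c <= J u" using Ju w(2) by (auto intro: LIMSEQ_le_const)
 ultimately have Jc: "J u = c" by simp
 have "DJ u h = 0" if h: "h \<in> X" for h
 proof -
  have "(%n. DJ (w (r n)) h) \<longlonglongrightarrow> DJ u h" using w u h by (intro DJ_tendsto) auto
  moreover have "(%n. DJ (w (r n)) h) \<longlonglongrightarrow> 0"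
  proof (rule Lim_null_comparison)
   show "\<forall>\<^sub>F n in sequentially. norm (DJ (w (r n)) h) <= 2 * eps (r n) * N h" using w(4)[OF h] by auto
   show "(%n. 2 * eps (r n) * N h) \<longlonglongrightarrow> 0" using epsr by (auto intro!: tendsto_eq_intros)
  qed
  ultimately show ?thesis by (rule LIMSEQ_unique)
 qed
 thus ?thesis using that[OF u(1)] Jc cbet by (simp add: c_def)
qed

end

section \<open>Smooth functions\<close>

lemma Ck_differentiable: "Ck (Suc j) g ==> (g has_derivative frechet_derivative g (at x)) (at x)"
 using frechet_derivative_works by auto

lemma Ck_continuous: "Ck j g ==> continuous_on UNIV g"
 by (cases j) (auto intro: continuous_at_imp_continuous_on differentiable_imp_continuous_within)

lemma Ck_Suc_imp: "Ck (Suc j) g ==> Ck j g"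
proof (induction j arbitrary: g)
 case 0
 thus ?case using Ck_continuous[of "Suc 0" g] by simp
qed auto

lemma Ck_const [simp]: "Ck j (%x. c)"
 by (induction j arbitrary: c) auto

lemma Ck_add: "Ck j f ==> Ck j g ==> Ck j (%x. f x + g x)"
proof (induction j arbitrary: f g)
 case (Suc j)
 have d: "((%x. f x + g x) has_derivative (%v. frechet_derivative f (at x) v + frechet_derivative g (at x) v)) (at x)" for x
  by (intro has_derivative_add Ck_differentiable[OF Suc.prems(1)] Ck_differentiable[OF Suc.prems(2)])
 show ?case unfolding Ck.simps
 proof (intro conjI allI)
  show "(%x. f x + g x) differentiable at x" for x using d by (rule differentiableI)
  show "Ck j (%x. frechet_derivative (%x. f x + g x) (at x) v)" for v
   unfolding frechet_derivative_at[OF d, symmetric] using Suc by auto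
 qed
qed (auto intro: continuous_intros)

lemma Ck_mult: "Ck j f ==> Ck j g ==> Ck j (%x. f x * g x)"
proof (induction j arbitrary: f g)
 case (Suc j)
 have d: "((%x. f x * g x) has_derivative (%v. f x * frechet_derivative g (at x) v + frechet_derivative f (at x) v * g x)) (at x)" for x
  by (intro has_derivative_mult Ck_differentiable[OF Suc.prems(1)] Ck_differentiable[OF Suc.prems(2)])
 show ?case unfolding Ck.simps
 proof (intro conjI allI)
  show "(%x. f x * g x) differentiable at x" for x using d by (rule differentiableI)
  show "Ck j (%x. frechet_derivative (%x. f x * g x) (at x) v)" for v
   unfolding frechet_derivative_at[OF d, symmetric]
   using Suc.prems Suc.prems[THEN Ck_Suc_imp] by (intro Ck_add Suc.IH) simp_all
 qed
qed (auto intro: continuous_intros)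

lemma Ck_cmult: "Ck j g ==> Ck j (%x. c * g x)"
 by (intro Ck_mult Ck_const)

lemma Ck_prod: "finite I ==> (!!i. i \<in> I ==> Ck j (f i)) ==> Ck j (%x. \<Prod>i\<in>I. f i x)"
 by (induction I rule: finite_induct) (auto intro: Ck_mult)

lemma has_derivative_translation:
 fixes g :: "'a::real_normed_vector => 'b::real_normed_vector"
 assumes "g differentiable (at (x + h))"
 shows "((%x. g (x + h)) has_derivative frechet_derivative g (at (x + h))) (at x)"
proof -
 have 1: "((%x. x + h) has_derivative (%v. v)) (at x)" by (auto intro!: derivative_eq_intros)
 have 2: "(g has_derivative frechet_derivative g (at (x + h))) (at (x + h))"
  using assms frechet_derivative_works by blast
 show ?thesis using has_derivative_compose[OF 1, of g "frechet_derivative g (at (x + h))"] 2 by simp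
qed

lemma frechet_derivative_translation:
 assumes "g differentiable (at (x + h))"
 shows "frechet_derivative (%x. g (x + h)) (at x) = frechet_derivative g (at (x + h))"
 using frechet_derivative_at[OF has_derivative_translation[OF assms]] by simp

lemma Ck_translation: "Ck j g ==> Ck j (%x. g (x + h))"
proof (induction j arbitrary: g)
 case (Suc j)
 have d: "g differentiable (at x)" for x using Suc.prems by simp
 show ?case unfolding Ck.simps
 proof (intro conjI allI)
  show "(%x. g (x + h)) differentiable at x" for x
   using has_derivative_translation[OF d] by (rule differentiableI)
  show "Ck j (%x. frechet_derivative (%x. g (x + h)) (at x) v)" for v
   unfolding frechet_derivative_translation[OF d] using Suc by auto
 qed
next
 case 0
 have "continuous_on UNIV (g \<circ> (%x. x + h))"
  using 0 by (intro continuous_on_compose) (auto intro!: continuous_intros intro: continuous_on_subset)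
 thus ?case by (simp add: o_def)
qed

subsection \<open>Bump functions\<close>

text \<open>The polynomial factor makes the family closed under differentiation, so smoothness
  follows by induction on the order with \<open>P\<close> arbitrary.\<close>

definition exp_inv :: "real poly => real => real" where
 "exp_inv P t = (if t <= 0 then 0 else poly P (1 / t) * exp (- (1 / t)))"

lemma poly_div_exp_tendsto_0: "((%x. poly Q x * exp (- x)) \<longlongrightarrow> (0::real)) at_top"
proof -
 have "((%x. \<Sum>i\<le>degree Q. coeff Q i * (x ^ i / exp x)) \<longlongrightarrow> (\<Sum>i\<le>degree Q. coeff Q i * 0)) at_top"
  by (intro tendsto_intros tendsto_power_div_exp_0)
 thus ?thesis
  by (simp add: poly_altdef exp_minus sum_distrib_right divide_inverse mult.assoc)
qed

text \<open>With \<open>X = 1 / t\<close>, differentiating gives the factor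
  \<open>X^2 * (P - P')\<close>, and \<open>[:0, 0, 1:]\<close> is \<open>X^2\<close>. At 0 the
  difference quotient from the right is again a polynomial in \<open>1 / h\<close> times
  \<open>exp (- (1 / h))\<close>, hence tends to 0.\<close>

lemma exp_inv_deriv:
 "(exp_inv P has_real_derivative exp_inv ([:0, 0, 1:] * (P - pderiv P)) t) (at t)"
proof -
 let ?Q = "[:0, 0, 1:] * (P - pderiv P)"
 consider "t < 0" | "t = 0" | "t > 0" by linarith
 thus ?thesis
 proof cases
  case 1
  have "((%t. 0) has_real_derivative 0) (at t)" by simp
  hence "(exp_inv P has_real_derivative 0) (at t)"
   by (rule DERIV_cong_ev[THEN iffD1, rotated -1])
    (use 1 in \<open>auto simp: exp_inv_def intro: eventually_mono[OF order_tendstoD(2)[OF tendsto_ident_at]]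
     intro!: eventually_nhds_in_open[of "{..<0}", THEN eventually_mono]\<close>)
  thus ?thesis using 1 by (simp add: exp_inv_def)
 next
  case 3
  have "((%t. poly P (1 / t) * exp (- (1 / t))) has_real_derivative
    poly (pderiv P) (1 / t) * (- 1 / t\<^sup>2) * exp (- (1 / t)) + exp (- (1 / t)) * (1 / t\<^sup>2) * poly P (1 / t)) (at t)"
   using 3 by (auto intro!: derivative_eq_intros DERIV_chain'[OF _ poly_DERIV] simp: power2_eq_square)
  also have "poly (pderiv P) (1 / t) * (- 1 / t\<^sup>2) * exp (- (1 / t)) + exp (- (1 / t)) * (1 / t\<^sup>2) * poly P (1 / t) = exp_inv ?Q t"
   using 3 by (simp add: exp_inv_def power2_eq_square algebra_simps)
  finally show ?thesis
   by (rule DERIV_cong_ev[THEN iffD1, rotated -1])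
    (use 3 in \<open>auto simp: exp_inv_def intro!: eventually_nhds_in_open[of "{0<..}", THEN eventually_mono]\<close>)
 next
  case 2
  have "((%h. exp_inv P h / h) \<longlongrightarrow> 0) (at 0)"
  proof (rule filterlim_split_at)
   show "((%h. exp_inv P h / h) \<longlongrightarrow> 0) (at_left 0)"
    by (rule tendsto_eventually) (auto simp: exp_inv_def eventually_at_filter)
   have "((%h. poly ([:0, 1:] * P) (inverse h) * exp (- inverse h)) \<longlongrightarrow> 0) (at_right 0)"
    by (rule filterlim_compose[OF poly_div_exp_tendsto_0 filterlim_inverse_at_top_right])
   thus "((%h. exp_inv P h / h) \<longlongrightarrow> 0) (at_right 0)"
    by (rule Lim_transform_eventually)
     (auto simp: exp_inv_def eventually_at_filter divide_inverse mult_ac)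
  qed
  thus ?thesis using 2 by (simp add: has_field_derivative_iff exp_inv_def)
 qed
qed

lemma Ck_exp_inv_affine: "Ck j (%x :: 'a::real_inner. exp_inv P (x \<bullet> w + b))"
proof (induction j arbitrary: P)
 case 0
 have "continuous_on UNIV (exp_inv P)"
  using exp_inv_deriv by (intro continuous_at_imp_continuous_on ballI DERIV_isCont)
 thus ?case by (auto intro!: continuous_on_compose2[of UNIV "exp_inv P"] continuous_intros)
next
 case (Suc j)
 let ?Q = "[:0, 0, 1:] * (P - pderiv P)"
 have d: "((%x. exp_inv P (x \<bullet> w + b)) has_derivative (%v. (v \<bullet> w) * exp_inv ?Q (x \<bullet> w + b))) (at x)" for x :: 'a
 proof -
  have 1: "((%x. x \<bullet> w + b) has_derivative (%v. v \<bullet> w)) (at x)" by (auto intro!: derivative_eq_intros)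
  have 2: "(exp_inv P has_derivative (%t. t * exp_inv ?Q (x \<bullet> w + b))) (at (x \<bullet> w + b))"
   using exp_inv_deriv[of P "x \<bullet> w + b"] by (simp add: has_field_derivative_def mult_commute_abs)
  show ?thesis using has_derivative_compose[OF 1, of "exp_inv P"] 2 by simp
 qed
 show ?case unfolding Ck.simps
 proof (intro conjI allI)
  show "(%x. exp_inv P (x \<bullet> w + b)) differentiable at x" for x :: 'a using d by (rule differentiableI)
  show "Ck j (%x. frechet_derivative (%x. exp_inv P (x \<bullet> w + b)) (at x) v)" for v :: 'a
   unfolding frechet_derivative_at[OF d, symmetric] using Suc by (intro Ck_cmult)
 qed
qed

text \<open>For \<open>n > 0\<close> it is positive exactly on the open box, and the steepness
  \<open>n\<close> makes it tend to the indicator of that box. For \<open>n = 0\<close> it vanishes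
  identically.\<close>

definition box_bump :: "'a::euclidean_space => 'a => nat => 'a => real" where
 "box_bump a b n x = (\<Prod>i\<in>Basis. exp_inv [:1:] (x \<bullet> (real n *\<^sub>R i) + (- real n * (a \<bullet> i))) *
   exp_inv [:1:] (x \<bullet> (- real n *\<^sub>R i) + real n * (b \<bullet> i)))"

lemma exp_inv_1: "0 <= exp_inv [:1:] t" "exp_inv [:1:] t <= 1" "exp_inv [:1:] t > 0 \<longleftrightarrow> t > 0"
 by (auto simp: exp_inv_def)

lemma smooth_box_bump: "smooth (box_bump a b n)"
 unfolding smooth_def box_bump_def by (intro allI Ck_prod Ck_mult Ck_exp_inv_affine) auto

lemma box_bump_bounds: "0 <= box_bump a b n x" "box_bump a b n x <= 1"
proof -
 have "0 <= exp_inv [:1:] s * exp_inv [:1:] t" "exp_inv [:1:] s * exp_inv [:1:] t <= 1" for s t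
  using mult_nonneg_nonneg[of "exp_inv [:1:] s" "exp_inv [:1:] t"] mult_le_one[of "exp_inv [:1:] s" "exp_inv [:1:] t"] exp_inv_1(1,2)
  by blast+
 thus "0 <= box_bump a b n x" "box_bump a b n x <= 1"
  unfolding box_bump_def by (intro prod_nonneg prod_le_1 conjI; blast)+
qed

lemma box_bump_pos_iff: "n > 0 ==> box_bump a b n x ~= 0 \<longleftrightarrow> x \<in> box a b"
proof -
 assume n: "n > 0"
 have "exp_inv [:1:] t ~= 0 \<longleftrightarrow> t > 0" for t using exp_inv_1(1,3)[of t] by linarith
 moreover have "x \<bullet> (real n *\<^sub>R i) + (- real n * (a \<bullet> i)) = real n * (x \<bullet> i - a \<bullet> i)"
   "x \<bullet> (- real n *\<^sub>R i) + real n * (b \<bullet> i) = real n * (b \<bullet> i - x \<bullet> i)" for i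
  by (simp_all add: algebra_simps)
 ultimately show ?thesis using n
  by (auto simp: box_bump_def prod_zero_iff mem_box zero_less_mult_iff)
qed

lemma box_bump_tendsto: "(%n. box_bump a b n x) \<longlonglongrightarrow> indicator (box a b) x"
proof (cases "x \<in> box a b")
 case True
 have lim: "(%n. exp_inv [:1:] (real n * c)) \<longlonglongrightarrow> 1" if c: "c > 0" for c
 proof -
  have "(%n. exp (- (inverse (real n) * (1 / c)))) \<longlonglongrightarrow> exp (- (0 * (1 / c)))"
   by (intro tendsto_intros lim_inverse_n)
  hence "(%n. exp (- (inverse (real n) * (1 / c)))) \<longlonglongrightarrow> 1" by simp
  thus ?thesis
   by (rule Lim_transform_eventually)
    (use c in \<open>auto simp: exp_inv_def field_simps mult_le_0_iff eventually_at_top_linorder intro!: exI[of _ 1]\<close>)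
 qed
 have "(%n. box_bump a b n x) \<longlonglongrightarrow> (\<Prod>i\<in>(Basis::'a set). 1 * 1)"
  unfolding box_bump_def
 proof (intro tendsto_prod tendsto_mult)
  fix i :: 'a assume i: "i \<in> Basis"
  have "x \<bullet> i - a \<bullet> i > 0" "b \<bullet> i - x \<bullet> i > 0" using True i by (auto simp: mem_box)
  moreover have "x \<bullet> (real n *\<^sub>R i) + (- real n * (a \<bullet> i)) = real n * (x \<bullet> i - a \<bullet> i)"
   "x \<bullet> (- real n *\<^sub>R i) + real n * (b \<bullet> i) = real n * (b \<bullet> i - x \<bullet> i)" for n
   by (simp_all add: algebra_simps)
  ultimately show "(%n. exp_inv [:1:] (x \<bullet> (real n *\<^sub>R i) + (- real n * (a \<bullet> i)))) \<longlonglongrightarrow> 1"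
   "(%n. exp_inv [:1:] (x \<bullet> (- real n *\<^sub>R i) + real n * (b \<bullet> i))) \<longlonglongrightarrow> 1"
   using lim by simp_all
 qed
 thus ?thesis using True by simp
next
 case False
 have "\<forall>\<^sub>F n in sequentially. box_bump a b n x = 0"
  using eventually_gt_at_top[of 0] by eventually_elim (use False box_bump_pos_iff in blast)
 thus ?thesis using False by (simp add: tendsto_eventually)
qed

subsection \<open>Test functions\<close>

lemma test_functionsD:
 assumes "phi \<in> test_functions \<Omega>"
 shows "Ck j phi" "continuous_on A phi" "phi differentiable (at x)" "continuous_on A (%x. frechet_derivative phi (at x) v)"
proof -
 have s: "Ck j phi" for j using assms by (auto simp: test_functions_def smooth_def)
 show "Ck j phi" by (rule s)
 show "continuous_on A phi" using Ck_continuous[OF s] continuous_on_subset by blast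
 show "phi differentiable (at x)" using s[of 1] by simp
 have "Ck 0 (%x. frechet_derivative phi (at x) v)" using s[of "Suc 0"] by simp
 thus "continuous_on A (%x. frechet_derivative phi (at x) v)" using continuous_on_subset by auto
qed

lemma test_functionsI:
 assumes "!!j. Ck j phi" "compact K" "K \<subseteq> \<Omega>" "!!x. x \<notin> K ==> phi x = 0"
 shows "phi \<in> test_functions \<Omega>"
proof -
 have "closure {x. phi x ~= 0} \<subseteq> K"
  using assms by (intro closure_minimal) (auto simp: compact_imp_closed)
 moreover have "compact (closure {x. phi x ~= 0})"
  using calculation assms(2) by (metis closed_closure compact_Int_closed inf.absorb_iff2)
 ultimately show ?thesis using assms by (auto simp: test_functions_def smooth_def)
qed

lemma test_functions_support:
 assumes "phi \<in> test_functions \<Omega>"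
 obtains K where "compact K" "K \<subseteq> \<Omega>" "!!x. x \<notin> K ==> phi x = 0"
proof (rule that[of "closure {x. phi x ~= 0}"])
 show "compact (closure {x. phi x ~= 0})" "closure {x. phi x ~= 0} \<subseteq> \<Omega>"
  using assms by (auto simp: test_functions_def)
 show "phi x = 0" if "x \<notin> closure {x. phi x ~= 0}" for x
  using that subsetD[OF closure_subset, of x "{x. phi x ~= 0}"] by auto
qed

lemma test_functions_support_deriv:
 assumes "phi \<in> test_functions \<Omega>"
 obtains K where "compact K" "K \<subseteq> \<Omega>" "!!x. x \<notin> K ==> phi x = 0" "!!x v. x \<notin> K ==> frechet_derivative phi (at x) v = 0"
proof -
 obtain K where K: "compact K" "K \<subseteq> \<Omega>" "!!x. x \<notin> K ==> phi x = 0"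
  by (rule test_functions_support[OF assms]) blast
 have "frechet_derivative phi (at x) v = 0" if "x \<notin> K" for x v
 proof -
  have "frechet_derivative phi (at x) = frechet_derivative (%x. 0) (at x)"
   using K that test_functionsD(3)[OF assms]
   by (intro frechet_derivative_transform_within_open[of _ _ "- K"]) (auto simp: compact_imp_closed open_Compl)
  thus ?thesis by simp
 qed
 with K that show ?thesis by blast
qed

lemma test_functions_add:
 assumes "phi \<in> test_functions \<Omega>" "psi \<in> test_functions \<Omega>" shows "(%x. phi x + psi x) \<in> test_functions \<Omega>"
proof -
 obtain K where K: "compact K" "K \<subseteq> \<Omega>" "!!x. x \<notin> K ==> phi x = 0" by (rule test_functions_support[OF assms(1)]) blast
 obtain L where L: "compact L" "L \<subseteq> \<Omega>" "!!x. x \<notin> L ==> psi x = 0" by (rule test_functions_support[OF assms(2)]) blast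
 show ?thesis
  by (rule test_functionsI[of _ "K \<union> L"])
   (use K L assms[THEN test_functionsD(1)] in \<open>auto intro: Ck_add compact_Un\<close>)
qed

lemma test_functions_mult:
 assumes "phi \<in> test_functions \<Omega>" "!!j. Ck j psi" shows "(%x. psi x * phi x) \<in> test_functions \<Omega>"
proof -
 obtain K where K: "compact K" "K \<subseteq> \<Omega>" "!!x. x \<notin> K ==> phi x = 0" by (rule test_functions_support[OF assms(1)]) blast
 show ?thesis
  by (rule test_functionsI[of _ K]) (use K assms(2) assms(1)[THEN test_functionsD(1)] in \<open>auto intro: Ck_mult\<close>)
qed

lemma test_functions_scale: "phi \<in> test_functions \<Omega> ==> (%x. c * phi x) \<in> test_functions \<Omega>"
 by (rule test_functions_mult) auto

lemma test_functions_0: "(%x. 0) \<in> test_functions \<Omega>"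
 by (rule test_functionsI[of _ "{}"]) auto

lemma test_functions_translation:
 assumes "phi \<in> test_functions UNIV" shows "(%x. phi (x + h)) \<in> test_functions UNIV"
proof -
 obtain K where K: "compact K" "!!x. x \<notin> K ==> phi x = 0" by (rule test_functions_support[OF assms(1)]) blast
 show ?thesis
 proof (rule test_functionsI[of _ "(%x. x - h) ` K"])
  show "compact ((%x. x - h) ` K)" using K by (intro compact_continuous_image continuous_intros)
  show "phi (x + h) = 0" if "x \<notin> (%x. x - h) ` K" for x
   using K(2)[of "x + h"] that by (metis add_diff_cancel_right' imageI)
 qed (use assms[THEN test_functionsD(1)] in \<open>auto intro: Ck_translation\<close>)
qed

lemma box_bump_test: "n > 0 ==> cbox a b \<subseteq> \<Omega> ==> box_bump a b n \<in> test_functions \<Omega>"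
 by (rule test_functionsI[of _ "cbox a b"])
  (use smooth_box_bump[of a b n] box_bump_pos_iff[of n a b] box_subset_cbox[of a b] in \<open>auto simp: smooth_def\<close>)

section \<open>Weak gradients\<close>

lemma borel_imp_lebesgue_measurable:
 "f \<in> borel_measurable borel ==> f \<in> borel_measurable lebesgue"
 by (rule measurable_completion) (subst measurable_lborel2)

lemma locally_integrable_measurable:
 fixes g :: "'a::euclidean_space => 'b::{banach, second_countable_topology}"
 assumes "locally_integrable g" shows "g \<in> borel_measurable lebesgue"
proof (rule borel_measurable_LIMSEQ_metric)
 fix n :: nat
 have "set_integrable lebesgue (cball 0 (real n)) g" using assms by (simp add: locally_integrable_def)
 thus "(%x. indicat_real (cball 0 (real n)) x *\<^sub>R g x) \<in> borel_measurable lebesgue"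
  by (simp add: set_integrable_def)
next
 fix x :: 'a
 have "\<forall>\<^sub>F n in sequentially. norm x <= real n"
  by (rule eventually_sequentiallyI[of "nat \<lceil>norm x\<rceil>"]) linarith
 hence "\<forall>\<^sub>F n in sequentially. indicat_real (cball 0 (real n)) x *\<^sub>R g x = g x"
  by eventually_elim simp
 thus "(%n. indicat_real (cball 0 (real n)) x *\<^sub>R g x) \<longlonglongrightarrow> g x"
  by (rule tendsto_eventually)
qed

text \<open>The integral estimates below use Fubini and translations for \<open>lborel\<close>; they
  are proved for Borel representatives and then carried back to Lebesgue measurable
  functions.\<close>

lemma lebesgue_Borel_representative:
 fixes g :: "'a::euclidean_space => 'b::euclidean_space"
 assumes "g \<in> borel_measurable lebesgue"
 obtains g' where "g' \<in> borel_measurable borel" "AE x in lebesgue. g x = g' x" "AE x in lborel. g x = g' x"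
proof -
 have "\<exists>f. f \<in> borel_measurable borel & (AE x in lborel. g x \<bullet> i = f x)" for i
 proof -
  have "(%x. g x \<bullet> i) \<in> borel_measurable lebesgue" using assms by simp
  from completion_ex_borel_measurable_real[OF this] show ?thesis by auto
 qed
 then obtain f where f: "!!i. f i \<in> borel_measurable borel" "!!i. AE x in lborel. g x \<bullet> i = f i x" by metis
 define g' where "g' x = (\<Sum>i\<in>Basis. f i x *\<^sub>R i)" for x
 have "AE x in lborel. \<forall>i\<in>Basis. g x \<bullet> i = f i x"
  using f(2) by (subst AE_finite_all) auto
 hence ae: "AE x in lborel. g x = g' x"
 proof eventually_elim
  case (elim x)
  have "g' x = (\<Sum>i\<in>Basis. (g x \<bullet> i) *\<^sub>R i)" unfolding g'_def using elim by (intro sum.cong) auto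
  thus ?case by (simp add: euclidean_representation)
 qed
 have "g' \<in> borel_measurable borel" unfolding g'_def using f(1) by measurable
 thus ?thesis using that ae AE_completion[OF ae] by blast
qed

lemma locally_integrable_mult:
 fixes g :: "'a::euclidean_space => 'b::{banach, second_countable_topology}"
 assumes g: "locally_integrable g" and phi: "continuous_on UNIV phi" and K: "compact K" "!!x. x \<notin> K ==> phi x = (0 :: real)"
 shows "integrable lebesgue (%x. phi x *\<^sub>R g x)"
proof -
 obtain B where B: "!!x. x \<in> K ==> norm (phi x) <= B"
  using compact_imp_bounded[OF compact_continuous_image[OF continuous_on_subset[OF phi] K(1)]]
  by (auto simp: bounded_iff)
 have [measurable]: "phi \<in> borel_measurable borel" using phi by (rule borel_measurable_continuous_onI)
 have [measurable]: "phi \<in> borel_measurable lebesgue"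
  by (rule borel_imp_lebesgue_measurable) measurable
 have [measurable]: "g \<in> borel_measurable lebesgue" by (rule locally_integrable_measurable[OF g])
 have "set_integrable lebesgue K g" using g K by (simp add: locally_integrable_def)
 hence "integrable lebesgue (%x. B *\<^sub>R (indicat_real K x *\<^sub>R g x))"
  unfolding set_integrable_def by (rule integrable_scaleR_right)
 thus ?thesis
 proof (rule Bochner_Integration.integrable_bound)
  show "AE x in lebesgue. norm (phi x *\<^sub>R g x) <= norm (B *\<^sub>R indicat_real K x *\<^sub>R g x)"
  proof (rule AE_I2)
   fix x show "norm (phi x *\<^sub>R g x) <= norm (B *\<^sub>R indicat_real K x *\<^sub>R g x)"
    using B[of x] K(2)[of x] by (cases "x \<in> K") (auto intro!: mult_right_mono)
  qed
 qed auto
qed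

lemma locally_integrable_add:
 fixes f g :: "'a::euclidean_space => 'b::{banach, second_countable_topology}"
 assumes "locally_integrable f" "locally_integrable g" shows "locally_integrable (%x. f x + g x)"
 unfolding locally_integrable_def
proof (intro allI impI)
 fix K :: "'a set" assume K: "compact K"
 show "set_integrable lebesgue K (%x. f x + g x)"
  using assms K unfolding locally_integrable_def by (intro set_integral_add(1)) simp_all
qed

lemma locally_integrable_scaleR:
 fixes f :: "'a::euclidean_space => 'b::{banach, second_countable_topology}"
 assumes "locally_integrable f" shows "locally_integrable (%x. c *\<^sub>R f x)"
 using assms unfolding locally_integrable_def by simp

lemma locally_integrable_continuous:
 fixes g :: "'a::euclidean_space => 'b::euclidean_space"
 assumes "continuous_on UNIV g" shows "locally_integrable g"
 unfolding locally_integrable_def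
proof (intro allI impI)
 fix K :: "'a set" assume K: "compact K"
 have "set_integrable lborel K g"
  unfolding set_integrable_def
  by (rule borel_integrable_compact[OF K continuous_on_subset[OF assms subset_UNIV]])
 thus "set_integrable lebesgue K g"
  unfolding set_integrable_def by (subst integrable_completion) (auto dest: borel_measurable_integrable)
qed

lemma locally_integrable_cong_AE:
 fixes f g :: "'a::euclidean_space => 'b::{banach, second_countable_topology}"
 assumes "locally_integrable f" "g \<in> borel_measurable lebesgue" "AE x in lebesgue. f x = g x"
 shows "locally_integrable g"
 unfolding locally_integrable_def set_integrable_def
proof (intro allI impI)
 fix K :: "'a set" assume K: "compact K"
 have [measurable]: "f \<in> borel_measurable lebesgue" by (rule locally_integrable_measurable[OF assms(1)])
 have [measurable]: "K \<in> sets lebesgue" using K by (simp add: borel_compact)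
 note [measurable] = assms(2)
 have "integrable lebesgue (%x. indicat_real K x *\<^sub>R f x)"
  using assms(1) K by (simp add: locally_integrable_def set_integrable_def)
 thus "integrable lebesgue (%x. indicat_real K x *\<^sub>R g x)"
  by (rule integrable_cong_AE_imp) (use assms(3) in auto)
qed

text \<open>Testing with \<open>box_bump a b n\<close> and letting \<open>n\<close> grow shows that
  the integral over every open box vanishes. Boxes are closed under intersection and generate the
  Borel sets, so the integrals over all Borel sets vanish as well.\<close>

theorem fundamental_lemma_calculus_of_variations:
 fixes w :: "'a::euclidean_space => real"
 assumes w: "locally_integrable w" and 0: "!!phi. phi \<in> test_functions UNIV ==> (LINT x|lebesgue. w x * phi x) = 0"
 shows "AE x in lebesgue. w x = 0"
proof -
 have [measurable]: "w \<in> borel_measurable lebesgue" by (rule locally_integrable_measurable[OF w])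
 have box0: "(LINT x|lebesgue. indicator (box a b) x * w x) = 0" for a b
 proof -
  have int: "integrable lebesgue (%x. indicat_real (cbox a b) x *\<^sub>R w x)"
   using w compact_cbox[of a b] unfolding locally_integrable_def set_integrable_def by simp
  have mb: "box_bump a b n \<in> borel_measurable lebesgue" for n
  proof -
   have "Ck 0 (box_bump a b n)" using smooth_box_bump[of a b n] unfolding smooth_def by (rule spec)
   hence "continuous_on UNIV (box_bump a b n)" by (rule Ck_continuous)
   thus ?thesis by (intro borel_imp_lebesgue_measurable borel_measurable_continuous_onI)
  qed
  have "(%n. \<integral>x. w x * box_bump a b (Suc n) x \<partial>lebesgue) \<longlonglongrightarrow> (LINT x|lebesgue. w x * indicator (box a b) x)"
  proof (rule integral_dominated_convergence[where w = "%x. norm (indicat_real (cbox a b) x *\<^sub>R w x)"])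
   show "integrable lebesgue (%x. norm (indicat_real (cbox a b) x *\<^sub>R w x))" using int by (rule integrable_norm)
   show "AE x in lebesgue. (%n. w x * box_bump a b (Suc n) x) \<longlonglongrightarrow> w x * indicator (box a b) x"
    by (intro AE_I2 tendsto_mult tendsto_const LIMSEQ_Suc box_bump_tendsto)
   show "AE x in lebesgue. norm (w x * box_bump a b (Suc n) x) <= norm (indicat_real (cbox a b) x *\<^sub>R w x)" for n
   proof (rule AE_I2)
    fix x
    show "norm (w x * box_bump a b (Suc n) x) <= norm (indicat_real (cbox a b) x *\<^sub>R w x)"
    proof (cases "x \<in> box a b")
     case True
     hence "x \<in> cbox a b" using box_subset_cbox by blast
     thus ?thesis using box_bump_bounds[of a b "Suc n" x] by (simp add: abs_mult mult_left_le)
    next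
     case False
     hence "box_bump a b (Suc n) x = 0" using box_bump_pos_iff[of "Suc n" a b x] by blast
     thus ?thesis by simp
    qed
   qed
   show "(%x. w x * box_bump a b (Suc n) x) \<in> borel_measurable lebesgue" for n
    using mb[of "Suc n"] by simp
   show "(%x. w x * indicator (box a b) x) \<in> borel_measurable lebesgue"
    by (intro borel_measurable_times borel_measurable_indicator) auto
  qed
  moreover have "(LINT x|lebesgue. w x * box_bump a b (Suc n) x) = 0" for n
   by (intro 0 box_bump_test) auto
  ultimately have "(LINT x|lebesgue. w x * indicator (box a b) x) = 0" by (simp only: LIMSEQ_const_iff)
  thus ?thesis by (simp add: mult.commute)
 qed
 obtain v where v[measurable]: "v \<in> borel_measurable borel" and vw: "AE x in lebesgue. w x = v x" "AE x in lborel. w x = v x"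
  using lebesgue_Borel_representative[OF \<open>w \<in> borel_measurable lebesgue\<close>] by blast
 have v'[measurable]: "v \<in> borel_measurable lebesgue" by (rule borel_imp_lebesgue_measurable[OF v])
 \<comment> \<open>Localising to a box makes the function globally integrable, which the complement
   and countable union steps of the induction over Borel sets require.\<close>
 have zero: "AE x in lborel. indicat_real (box a b) x *\<^sub>R v x = 0" for a b
 proof (rule sigma_finite_measure.density_zero[OF sigma_finite_lborel])
  let ?f = "%x. indicat_real (box a b) x *\<^sub>R v x"
  have boxv: "(LINT x|lborel. indicator (box c d) x * v x) = 0" for c d
  proof -
   have "(LINT x|lborel. indicator (box c d) x * v x) = (LINT x|lebesgue. indicator (box c d) x * v x)"
    by (subst integral_completion) auto
   also have "... = (LINT x|lebesgue. indicator (box c d) x * w x)"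
    using vw(1) by (intro integral_cong_AE borel_measurable_times borel_measurable_indicator) auto
   finally show ?thesis by (simp add: box0)
  qed
  have "set_integrable lebesgue (cbox a b) w" using w by (simp add: locally_integrable_def)
  hence "set_integrable lebesgue (box a b) w" by (rule set_integrable_subset) (auto simp: box_subset_cbox)
  hence "integrable lebesgue ?f" unfolding set_integrable_def
  proof (rule integrable_cong_AE_imp)
   show "?f \<in> borel_measurable lebesgue"
    by (intro borel_measurable_scaleR borel_measurable_indicator) auto
  qed (use vw(1) in auto)
  thus int: "integrable lborel ?f" by (subst (asm) integrable_completion) auto
  have intA: "integrable lborel (%x. indicat_real A x *\<^sub>R ?f x)" if "A \<in> sets borel" for A
   using integrable_mult_indicator[OF _ int, of A] that by simp
  fix A :: "'a set" assume "A \<in> sets lborel"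
  hence sA: "A \<in> sigma_sets UNIV (range (%(a, b). box a b :: 'a set))"
   using borel_eq_box by (metis sets_lborel sets_measure_of subset_UNIV Pow_UNIV)
  have Is: "Int_stable (range (%(a, b). box a b :: 'a set))"
   by (auto simp: Int_stable_def box_Int_box)
  have Pw: "range (%(a, b). box a b :: 'a set) \<subseteq> Pow UNIV" by simp
  from Is Pw sA show "set_lebesgue_integral lborel A ?f = 0"
  proof (induction rule: sigma_sets_induct_disjoint)
   case (basic A)
   then obtain c d where A: "A = box c d" by auto
   obtain a' b' where ab': "A \<inter> box a b = box a' b'" unfolding A box_Int_box by blast
   have "set_lebesgue_integral lborel A ?f = (LINT x|lborel. indicator (A \<inter> box a b) x * v x)"
    unfolding set_lebesgue_integral_def by (intro Bochner_Integration.integral_cong) (auto simp: indicator_def)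
   thus ?case unfolding ab' boxv .
  next
   case empty
   show ?case by (simp add: set_lebesgue_integral_def)
  next
   case (compl A)
   hence mA: "A \<in> sets borel" using borel_eq_box by (metis sets_measure_of subset_UNIV Pow_UNIV)
   have "(LINT x|lborel. indicat_real (UNIV - A) x *\<^sub>R ?f x) = (LINT x|lborel. ?f x - indicat_real A x *\<^sub>R ?f x)"
    by (intro Bochner_Integration.integral_cong) (auto simp: indicator_def)
   also have "... = (LINT x|lborel. ?f x) - (LINT x|lborel. indicat_real A x *\<^sub>R ?f x)"
    by (intro Bochner_Integration.integral_diff int intA mA)
   also have "... = 0" using boxv compl.IH by (simp add: set_lebesgue_integral_def)
   finally show ?case by (simp add: set_lebesgue_integral_def)
  next
   case (union A)
   have mA: "A i \<in> sets borel" for i using union.hyps borel_eq_box by (metis sets_measure_of subset_UNIV Pow_UNIV range_subsetD)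
   have "set_lebesgue_integral lborel (\<Union>i. A i) ?f = (\<Sum>i. set_lebesgue_integral lborel (A i) ?f)"
   proof (rule lebesgue_integral_countable_add)
    show "set_integrable lborel (\<Union> (range A)) ?f"
     unfolding set_integrable_def using mA by (intro intA) auto
   qed (use mA union.hyps in \<open>auto simp: disjoint_family_on_def\<close>)
   thus ?case using union.IH by simp
  qed
 qed
 have "AE x in lborel. \<forall>n. indicat_real (box (- (real n *\<^sub>R One)) (real n *\<^sub>R One)) x *\<^sub>R v x = 0"
  using zero by (subst AE_all_countable) blast
 hence "AE x in lborel. v x = 0"
 proof eventually_elim
  case (elim x)
  obtain n where "x \<in> box (- (real n *\<^sub>R One)) (real n *\<^sub>R One)"
   using UN_box_eq_UNIV by blast
  thus ?case using elim[rule_format, of n] by simp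
 qed
 hence "AE x in lebesgue. v x = 0" by (rule AE_completion)
 with vw(1) show ?thesis by eventually_elim simp
qed

lemma lebesgue_integral_borel:
 fixes f :: "'a::euclidean_space => 'b::{banach, second_countable_topology}"
 assumes "f \<in> borel_measurable borel"
 shows "(LINT x|lebesgue. f x) = (LINT x|lborel. f x)" "integrable lebesgue f \<longleftrightarrow> integrable lborel f"
 using integral_completion[of f lborel] integrable_completion[of f lborel] assms by simp_all

lemma lborel_integral_translation:
 fixes f :: "'a::euclidean_space => 'b::{banach, second_countable_topology}"
 assumes "f \<in> borel_measurable borel"
 shows "(LINT x|lborel. f (x + h)) = (LINT x|lborel. f x)"
proof -
 have "(LINT x|lborel. f x) = (\<integral>x. f x \<partial>(distr lborel borel ((+) h)))" by (simp add: lborel_distr_plus)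
 also have "... = (LINT x|lborel. f (h + x))" using assms by (subst integral_distr) auto
 finally show ?thesis by (simp add: add.commute)
qed

lemma nn_integral_lborel_translation:
 fixes f :: "'a::euclidean_space => ennreal"
 assumes "f \<in> borel_measurable borel"
 shows "(\<integral>\<^sup>+x. f (x + h) \<partial>lborel) = (\<integral>\<^sup>+x. f x \<partial>lborel)"
proof -
 have "(\<integral>\<^sup>+x. f x \<partial>lborel) = (\<integral>\<^sup>+x. f x \<partial>(distr lborel borel ((+) h)))" by (simp add: lborel_distr_plus)
 also have "... = (\<integral>\<^sup>+x. f (h + x) \<partial>lborel)" using assms by (subst nn_integral_distr) auto
 finally show ?thesis by (simp add: add.commute)
qed

lemma bounded_of_compact_support:
 fixes f :: "'a::euclidean_space => 'b::real_normed_vector"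
 assumes "continuous_on UNIV f" "compact K" "!!x. x \<notin> K ==> f x = 0"
 obtains B where "B > 0" "!!x. norm (f x) <= B"
proof -
 obtain B where B: "!!x. x \<in> K ==> norm (f x) <= B"
  using compact_imp_bounded[OF compact_continuous_image[OF continuous_on_subset[OF assms(1)] assms(2)]]
  by (auto simp: bounded_iff)
 have "norm (f x) <= \<bar>B\<bar> + 1" for x
  using B[of x] assms(3)[of x] by (cases "x \<in> K") auto
 thus ?thesis using that[of "\<bar>B\<bar> + 1"] by force
qed

lemma integrable_compact_support:
 fixes f :: "'a::euclidean_space => 'b::euclidean_space"
 assumes "continuous_on UNIV f" "compact K" "!!x. x \<notin> K ==> f x = 0"
 shows "integrable lborel f"
proof -
 have "integrable lborel (%x. indicat_real K x *\<^sub>R f x)"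
  by (rule borel_integrable_compact[OF assms(2) continuous_on_subset[OF assms(1) subset_UNIV]])
 moreover have "(%x. indicat_real K x *\<^sub>R f x) = f"
  using assms(3) by (auto simp: indicator_def)
 ultimately show ?thesis by simp
qed

lemma line_derivative:
 assumes "phi differentiable (at (x + t *\<^sub>R v))"
 shows "((%t. phi (x + t *\<^sub>R v)) has_real_derivative frechet_derivative phi (at (x + t *\<^sub>R v)) v) (at t)"
proof -
 have 1: "((%t. x + t *\<^sub>R v) has_derivative (%t. t *\<^sub>R v)) (at t)" by (auto intro!: derivative_eq_intros)
 have 2: "(phi has_derivative frechet_derivative phi (at (x + t *\<^sub>R v))) (at (x + t *\<^sub>R v))"
  using assms frechet_derivative_works by blast
 have "((%t. phi (x + t *\<^sub>R v)) has_derivative (%s. frechet_derivative phi (at (x + t *\<^sub>R v)) (s *\<^sub>R v))) (at t)"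
  using has_derivative_compose[OF 1, of phi "frechet_derivative phi (at (x + t *\<^sub>R v))"] 2 by simp
 moreover have "frechet_derivative phi (at (x + t *\<^sub>R v)) (s *\<^sub>R v) = frechet_derivative phi (at (x + t *\<^sub>R v)) v * s" for s
  using linear_frechet_derivative[OF assms] by (simp add: linear_cmul)
 ultimately show ?thesis by (simp add: has_field_derivative_def)
qed

lemma test_function_Lipschitz:
 assumes phi: "phi \<in> test_functions \<Omega>"
 obtains L where "L > 0" "!!x y. \<bar>phi x - phi y\<bar> <= L * norm (x - y)"
proof -
 obtain K where K: "compact K" "K \<subseteq> \<Omega>" "!!x. x \<notin> K ==> phi x = 0" "!!x v. x \<notin> K ==> frechet_derivative phi (at x) v = 0"
  by (rule test_functions_support_deriv[OF phi]) blast
 have "\<exists>B>0. \<forall>x. norm (frechet_derivative phi (at x) i) <= B" for i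
  using bounded_of_compact_support[OF test_functionsD(4)[OF phi] K(1) K(4), of i] by metis
 then obtain B where B: "!!i. B i > 0" "!!i x. norm (frechet_derivative phi (at x) i) <= B i" by metis
 define L where "L = (\<Sum>i\<in>Basis. B i)"
 have L: "L > 0" unfolding L_def using B by (intro sum_pos) auto
 have bd: "\<bar>frechet_derivative phi (at x) v\<bar> <= L * norm v" for x v
 proof -
  have lin: "linear (frechet_derivative phi (at x))" by (rule linear_frechet_derivative[OF test_functionsD(3)[OF phi]])
  have "frechet_derivative phi (at x) v = frechet_derivative phi (at x) (\<Sum>i\<in>Basis. (v \<bullet> i) *\<^sub>R i)"
   by (simp add: euclidean_representation)
  also have "... = (\<Sum>i\<in>Basis. (v \<bullet> i) * frechet_derivative phi (at x) i)"
   using lin by (simp add: linear_sum linear_cmul)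
  finally have "\<bar>frechet_derivative phi (at x) v\<bar> <= (\<Sum>i\<in>Basis. \<bar>(v \<bullet> i) * frechet_derivative phi (at x) i\<bar>)"
   by (metis sum_abs)
  also have "... <= (\<Sum>i\<in>Basis. norm v * B i)"
   using B(2)[of x] by (intro sum_mono) (auto simp: abs_mult Basis_le_norm intro!: mult_mono)
  finally show ?thesis by (simp add: L_def sum_distrib_left mult.commute)
 qed
 have "\<bar>phi x - phi y\<bar> <= L * norm (x - y)" for x y
 proof -
  have "\<exists>z::real. 0 < z & z < 1 & phi (y + 1 *\<^sub>R (x - y)) - phi (y + 0 *\<^sub>R (x - y)) = (1 - 0) * frechet_derivative phi (at (y + z *\<^sub>R (x - y))) (x - y)"
   by (intro MVT2[where f = "%t. phi (y + t *\<^sub>R (x - y))"] line_derivative test_functionsD(3)[OF phi]) auto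
  then obtain z where "phi x - phi y = frechet_derivative phi (at (y + z *\<^sub>R (x - y))) (x - y)" by auto
  thus ?thesis using bd by simp
 qed
 with L that show ?thesis by blast
qed

text \<open>Difference quotients have integral 0 by translation invariance. The Lipschitz constant
  of \<open>phi\<close> dominates them, and since \<open>t n <= 1\<close> they all vanish off the
  ball of radius \<open>R + norm v\<close>.\<close>

lemma integral_directional_derivative_eq_0:
 fixes phi :: "'a::euclidean_space => real"
 assumes phi: "phi \<in> test_functions UNIV"
 shows "(LINT x|lborel. frechet_derivative phi (at x) v) = 0"
proof -
 obtain K where K: "compact K" "!!x. x \<notin> K ==> phi x = 0"
  by (rule test_functions_support[OF phi]) blast
 obtain R where R: "R > 0" "K \<subseteq> ball 0 R" using compact_imp_bounded[OF K(1)] bounded_subset_ballD by blast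
 obtain L where L: "L > 0" "!!x y. \<bar>phi x - phi y\<bar> <= L * norm (x - y)" by (rule test_function_Lipschitz[OF phi]) blast
 define t where "t n = 1 / real (Suc n)" for n
 have t: "t n > 0" "t n <= 1" for n by (auto simp: t_def)
 have t0: "t \<longlonglongrightarrow> 0" unfolding t_def using LIMSEQ_inverse_real_of_nat by (simp add: inverse_eq_divide)
 have [measurable]: "phi \<in> borel_measurable borel" using test_functionsD(2)[OF phi] by (rule borel_measurable_continuous_onI)
 have int: "integrable lborel phi" by (rule integrable_compact_support[OF test_functionsD(2)[OF phi] K])
 let ?B = "cball 0 (R + norm v) :: 'a set"
 have "(%n. \<integral>x. (phi (x + t n *\<^sub>R v) - phi x) / t n \<partial>lborel) \<longlonglongrightarrow> (LINT x|lborel. frechet_derivative phi (at x) v)"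
 proof (rule integral_dominated_convergence[where w = "%x. L * norm v * indicator ?B x"])
  show "(%x. frechet_derivative phi (at x) v) \<in> borel_measurable lborel"
   using test_functionsD(4)[OF phi] by (simp add: borel_measurable_continuous_onI)
  show "(%x. (phi (x + t n *\<^sub>R v) - phi x) / t n) \<in> borel_measurable lborel" for n by measurable
  have "emeasure lborel ?B < \<infinity>" by (rule emeasure_lborel_cball_finite)
  thus "integrable lborel (%x. L * norm v * indicator ?B x)"
   by (intro integrable_mult_right integrable_real_indicator) auto
  show "AE x in lborel. (%n. (phi (x + t n *\<^sub>R v) - phi x) / t n) \<longlonglongrightarrow> frechet_derivative phi (at x) v"
  proof (rule AE_I2)
   fix x
   have "((%t. phi (x + t *\<^sub>R v)) has_real_derivative frechet_derivative phi (at (x + 0 *\<^sub>R v)) v) (at 0)"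
    by (intro line_derivative test_functionsD(3)[OF phi])
   hence "((%s. (phi (x + s *\<^sub>R v) - phi x) / s) \<longlongrightarrow> frechet_derivative phi (at x) v) (at 0)"
    by (simp add: has_field_derivative_iff)
   hence "((%s. (phi (x + s *\<^sub>R v) - phi x) / s) \<circ> t) \<longlonglongrightarrow> frechet_derivative phi (at x) v"
    using t0 t(1) by (intro tendsto_at_iff_sequentially[THEN iffD1, rule_format]) (auto simp: less_imp_neq[symmetric])
   thus "(%n. (phi (x + t n *\<^sub>R v) - phi x) / t n) \<longlonglongrightarrow> frechet_derivative phi (at x) v" by (simp add: o_def)
  qed
  show "AE x in lborel. norm ((phi (x + t n *\<^sub>R v) - phi x) / t n) <= L * norm v * indicator ?B x" for n
  proof (rule AE_I2)
   fix x
   show "norm ((phi (x + t n *\<^sub>R v) - phi x) / t n) <= L * norm v * indicator ?B x"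
   proof (cases "x \<in> ?B")
    case True
    have "\<bar>phi (x + t n *\<^sub>R v) - phi x\<bar> <= L * (t n * norm v)" using L(2)[of "x + t n *\<^sub>R v" x] t(1)[of n] by simp
    thus ?thesis using True t(1)[of n] by (simp add: abs_divide field_simps)
   next
    case False
    hence 1: "norm x > R + norm v" by simp
    have "norm (t n *\<^sub>R v) <= norm v" using t[of n] mult_right_mono[of "t n" 1 "norm v"] by simp
    hence "norm (x + t n *\<^sub>R v) > R" using 1 norm_triangle_ineq2[of x "- (t n *\<^sub>R v)"] by simp
    moreover have "norm x > R" using 1 norm_ge_zero[of v] by linarith
    ultimately have "x + t n *\<^sub>R v \<notin> K" "x \<notin> K" using R(2) by auto
    thus ?thesis using K(2) False by simp
   qed
  qed
 qed
 moreover have "(LINT x|lborel. (phi (x + t n *\<^sub>R v) - phi x) / t n) = 0" for n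
 proof -
  have "integrable lborel (%x. phi (x + t n *\<^sub>R v))"
  proof -
   have "integrable (distr lborel borel ((+) (t n *\<^sub>R v))) phi" using int by (simp add: lborel_distr_plus)
   thus ?thesis by (subst (asm) integrable_distr_eq) (auto simp: add.commute)
  qed
  thus ?thesis using int by (simp add: lborel_integral_translation)
 qed
 ultimately show ?thesis by (simp only: LIMSEQ_const_iff)
qed

definition classical_gradient :: "('a::euclidean_space => real) => 'a => 'a" where
 "classical_gradient phi x = (\<Sum>i\<in>Basis. frechet_derivative phi (at x) i *\<^sub>R i)"

lemma classical_gradient_inner:
 assumes "phi differentiable (at x)" shows "classical_gradient phi x \<bullet> v = frechet_derivative phi (at x) v"
proof -
 have "frechet_derivative phi (at x) v = frechet_derivative phi (at x) (\<Sum>i\<in>Basis. (v \<bullet> i) *\<^sub>R i)"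
  by (simp add: euclidean_representation)
 also have "... = (\<Sum>i\<in>Basis. (v \<bullet> i) * frechet_derivative phi (at x) i)"
  using linear_frechet_derivative[OF assms] by (simp add: linear_sum linear_cmul)
 finally show ?thesis by (simp add: classical_gradient_def inner_sum_left inner_commute[of v] mult.commute)
qed

lemma continuous_classical_gradient:
 assumes "phi \<in> test_functions \<Omega>" shows "continuous_on UNIV (classical_gradient phi)"
 unfolding classical_gradient_def by (intro continuous_intros test_functionsD(4)[OF assms])

text \<open>The product \<open>phi * psi\<close> is a test function, so its directional derivative
  has integral 0; the product rule turns this into integration by parts.\<close>

lemma has_weak_gradient_test_function:
 fixes phi :: "'a::euclidean_space => real"
 assumes phi: "phi \<in> test_functions \<Omega>" shows "has_weak_gradient phi (classical_gradient phi)"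
 unfolding has_weak_gradient_def
proof (intro conjI ballI allI)
 show "locally_integrable phi" by (rule locally_integrable_continuous[OF test_functionsD(2)[OF phi]])
 show "locally_integrable (classical_gradient phi)"
  by (rule locally_integrable_continuous[OF continuous_classical_gradient[OF phi]])
 fix psi :: "'a => real" and v :: 'a assume psi: "psi \<in> test_functions UNIV"
 obtain K where K: "compact K" "!!x. x \<notin> K ==> psi x = 0" "!!x v. x \<notin> K ==> frechet_derivative psi (at x) v = 0"
  by (rule test_functions_support_deriv[OF psi]) blast
 let ?d = "%phi x. frechet_derivative phi (at x) v"
 have cs: "continuous_on UNIV phi" "continuous_on UNIV psi" "continuous_on UNIV (?d phi)" "continuous_on UNIV (?d psi)"
  using test_functionsD(2,4)[OF phi] test_functionsD(2,4)[OF psi] by auto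
 have prod: "(%x. phi x * psi x) \<in> test_functions UNIV" by (rule test_functions_mult[OF psi test_functionsD(1)[OF phi]])
 have dp: "frechet_derivative (%x. phi x * psi x) (at x) v = phi x * ?d psi x + ?d phi x * psi x" for x
 proof -
  have "((%x. phi x * psi x) has_derivative (%v. phi x * frechet_derivative psi (at x) v + frechet_derivative phi (at x) v * psi x)) (at x)"
   using test_functionsD(3)[OF phi] test_functionsD(3)[OF psi] frechet_derivative_works
   by (intro has_derivative_mult) auto
  from frechet_derivative_at[OF this, symmetric] show ?thesis by simp
 qed
 have i1: "integrable lborel (%x. phi x * ?d psi x)" and i2: "integrable lborel (%x. ?d phi x * psi x)"
  using K cs by (auto intro!: integrable_compact_support[OF _ K(1)] continuous_intros)
 have "(LINT x|lborel. phi x * ?d psi x) + (LINT x|lborel. ?d phi x * psi x) = (LINT x|lborel. frechet_derivative (%x. phi x * psi x) (at x) v)"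
  unfolding dp using i1 i2 by simp
 also have "... = 0" by (rule integral_directional_derivative_eq_0[OF prod])
 finally have "(LINT x|lborel. phi x * ?d psi x) = - (LINT x|lborel. (classical_gradient phi x \<bullet> v) * psi x)"
  by (simp add: classical_gradient_inner[OF test_functionsD(3)[OF phi]])
 thus "(LINT x|lebesgue. phi x * ?d psi x) = - (LINT x|lebesgue. (classical_gradient phi x \<bullet> v) * psi x)"
  using i1 i2 by (subst (1 2) lebesgue_integral_borel)
   (auto simp: classical_gradient_inner[OF test_functionsD(3)[OF phi]] dest: borel_measurable_integrable)
qed

lemma has_weak_gradient_integrable:
 assumes "has_weak_gradient u g" "psi \<in> test_functions UNIV"
 shows "integrable lebesgue (%x. u x * frechet_derivative psi (at x) v)" "integrable lebesgue (%x. (g x \<bullet> v) * psi x)"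
proof -
 obtain K where K: "compact K" "!!x. x \<notin> K ==> psi x = 0" "!!x v. x \<notin> K ==> frechet_derivative psi (at x) v = 0"
  by (rule test_functions_support_deriv[OF assms(2)]) blast
 have "integrable lebesgue (%x. frechet_derivative psi (at x) v *\<^sub>R u x)"
  using assms(1) by (intro locally_integrable_mult[OF _ test_functionsD(4)[OF assms(2)] K(1) K(3)]) (auto simp: has_weak_gradient_def)
 thus "integrable lebesgue (%x. u x * frechet_derivative psi (at x) v)" by (simp add: mult.commute)
 have "integrable lebesgue (%x. psi x *\<^sub>R g x)"
  using assms(1) by (intro locally_integrable_mult[OF _ test_functionsD(2)[OF assms(2)] K(1) K(2)]) (auto simp: has_weak_gradient_def)
 from integrable_inner_left[OF this, of v] show "integrable lebesgue (%x. (g x \<bullet> v) * psi x)" by (simp add: mult.commute)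
qed

lemma has_weak_gradient_add:
 fixes u :: "'a::euclidean_space => real"
 assumes u: "has_weak_gradient u g" and w: "has_weak_gradient w k"
 shows "has_weak_gradient (%x. u x + w x) (%x. g x + k x)"
 unfolding has_weak_gradient_def
proof (intro conjI ballI allI)
 show "locally_integrable (%x. u x + w x)" "locally_integrable (%x. g x + k x)"
  using u w by (auto simp: has_weak_gradient_def intro: locally_integrable_add)
 fix psi :: "'a => real" and v :: 'a assume psi: "psi \<in> test_functions UNIV"
 have "(LINT x|lebesgue. u x * frechet_derivative psi (at x) v) = - (LINT x|lebesgue. (g x \<bullet> v) * psi x)"
   "(LINT x|lebesgue. w x * frechet_derivative psi (at x) v) = - (LINT x|lebesgue. (k x \<bullet> v) * psi x)"
  using u w psi by (auto simp: has_weak_gradient_def)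
 thus "(LINT x|lebesgue. (u x + w x) * frechet_derivative psi (at x) v) = - (LINT x|lebesgue. ((g x + k x) \<bullet> v) * psi x)"
  using has_weak_gradient_integrable[OF u psi, of v] has_weak_gradient_integrable[OF w psi, of v]
  by (simp add: distrib_right inner_add_left)
qed

lemma has_weak_gradient_scale:
 fixes u :: "'a::euclidean_space => real"
 assumes u: "has_weak_gradient u g"
 shows "has_weak_gradient (%x. c * u x) (%x. c *\<^sub>R g x)"
 unfolding has_weak_gradient_def
proof (intro conjI ballI allI)
 show "locally_integrable (%x. c * u x)" "locally_integrable (%x. c *\<^sub>R g x)"
  using u locally_integrable_scaleR[of u c] by (auto simp: has_weak_gradient_def intro: locally_integrable_scaleR)
 fix psi :: "'a => real" and v :: 'a assume psi: "psi \<in> test_functions UNIV"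
 have "(LINT x|lebesgue. u x * frechet_derivative psi (at x) v) = - (LINT x|lebesgue. (g x \<bullet> v) * psi x)"
  using u psi by (auto simp: has_weak_gradient_def)
 thus "(LINT x|lebesgue. (c * u x) * frechet_derivative psi (at x) v) = - (LINT x|lebesgue. ((c *\<^sub>R g x) \<bullet> v) * psi x)"
  by (simp add: mult.assoc)
qed

lemma locally_integrable_inner:
 fixes g :: "'a::euclidean_space => 'a"
 assumes "locally_integrable g" shows "locally_integrable (%x. g x \<bullet> i)"
 unfolding locally_integrable_def set_integrable_def
proof (intro allI impI)
 fix K :: "'a set" assume "compact K"
 hence "integrable lebesgue (%x. indicat_real K x *\<^sub>R g x)"
  using assms by (simp add: locally_integrable_def set_integrable_def)
 from integrable_inner_left[OF this, of i] show "integrable lebesgue (%x. indicat_real K x *\<^sub>R (g x \<bullet> i))"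
  by simp
qed

text \<open>The fundamental lemma is applied to each component of the difference. Allowing
  \<open>u\<close> and \<open>w\<close> to differ on a null set permits a change of
  representative.\<close>

lemma has_weak_gradient_unique:
 fixes u :: "'a::euclidean_space => real"
 assumes u: "has_weak_gradient u g" and w: "has_weak_gradient w k" and uw: "AE x in lebesgue. u x = w x"
 shows "AE x in lebesgue. g x = k x"
proof -
 have d: "has_weak_gradient (%x. u x + (-1) * w x) (%x. g x + (-1) *\<^sub>R k x)"
  by (intro has_weak_gradient_add u has_weak_gradient_scale w)
 have "AE x in lebesgue. (g x + (-1) *\<^sub>R k x) \<bullet> i = 0" for i
 proof (rule fundamental_lemma_calculus_of_variations)
  have "locally_integrable (%x. g x + (-1) *\<^sub>R k x)" using d by (simp add: has_weak_gradient_def)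
  thus "locally_integrable (%x. (g x + (-1) *\<^sub>R k x) \<bullet> i)"
   by (rule locally_integrable_inner)
  fix phi :: "'a => real" assume phi: "phi \<in> test_functions UNIV"
  have "(LINT x|lebesgue. (u x + (-1) * w x) * frechet_derivative phi (at x) i) = 0"
   by (rule integral_eq_zero_AE) (use uw in auto)
  thus "(LINT x|lebesgue. ((g x + (-1) *\<^sub>R k x) \<bullet> i) * phi x) = 0"
  proof -
   have "(LINT x|lebesgue. (u x + (-1) * w x) * frechet_derivative phi (at x) i) = - (LINT x|lebesgue. ((g x + (-1) *\<^sub>R k x) \<bullet> i) * phi x)"
    using d phi unfolding has_weak_gradient_def by blast
   with \<open>(LINT x|lebesgue. (u x + (-1) * w x) * frechet_derivative phi (at x) i) = 0\<close> show ?thesis by linarith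
  qed
 qed
 hence "AE x in lebesgue. \<forall>i\<in>Basis. (g x + (-1) *\<^sub>R k x) \<bullet> i = 0"
  by (subst AE_finite_all) auto
 thus ?thesis
 proof eventually_elim
  case (elim x)
  hence "g x + (-1) *\<^sub>R k x = 0" by (simp only: euclidean_all_zero_iff)
  thus ?case by simp
 qed
qed

lemma weak_gradient_works: "has_weak_gradient u g ==> has_weak_gradient u (weak_gradient u)"
 unfolding weak_gradient_def by (rule someI[of "has_weak_gradient u" g])

lemma weak_gradient_AE_eq: "has_weak_gradient u g ==> AE x in lebesgue. weak_gradient u x = g x"
 using has_weak_gradient_unique[OF weak_gradient_works] by blast

section \<open>Increments of functions with a weak gradient\<close>

lemma pred_cball [measurable (raw)]:
 fixes f :: "'x => 'a::euclidean_space"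
 assumes [measurable]: "f \<in> borel_measurable M" shows "Measurable.pred M (%x. f x \<in> cball 0 R)"
 unfolding mem_cball_0 by measurable

lemma compact_subset_cball:
 fixes K :: "'a::real_normed_vector set"
 assumes "compact K" obtains R where "R > 0" "K \<subseteq> cball 0 R"
 using bounded_subset_ballD[OF compact_imp_bounded[OF assms], of 0] ball_subset_cball by blast

lemma locally_integrable_cballI:
 fixes g :: "'a::euclidean_space => 'b::{banach, second_countable_topology}"
 assumes "!!R. set_integrable lebesgue (cball 0 R) g" shows "locally_integrable g"
 unfolding locally_integrable_def
proof (intro allI impI)
 fix K :: "'a set" assume K: "compact K"
 then obtain R where "K \<subseteq> cball 0 R"
  using compact_subset_cball by blast
 moreover have "K \<in> sets lebesgue" using K by (simp add: borel_compact)
 ultimately show "set_integrable lebesgue K g"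
  by (intro set_integrable_subset[OF assms])
qed

lemma locally_integrable_Borel_iff:
 fixes g :: "'a::euclidean_space => 'b::{banach, second_countable_topology}"
 assumes [measurable]: "g \<in> borel_measurable borel"
 shows "locally_integrable g \<longleftrightarrow> (\<forall>R. integrable lborel (%x. indicat_real (cball 0 R) x *\<^sub>R g x))"
proof -
 have eq: "set_integrable lebesgue (cball 0 R) g \<longleftrightarrow> integrable lborel (%x. indicat_real (cball 0 R) x *\<^sub>R g x)" for R
  unfolding set_integrable_def by (rule lebesgue_integral_borel(2)) measurable
 show ?thesis
  using locally_integrable_cballI[of g] unfolding eq[symmetric] by (auto simp: locally_integrable_def)
qed

lemma integrable_translation:
 fixes f :: "'a::euclidean_space => 'b::{banach, second_countable_topology}"
 assumes "integrable lborel f" shows "integrable lborel (%x. f (x + h))"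
proof -
 have [measurable]: "f \<in> borel_measurable borel" using borel_measurable_integrable[OF assms] by simp
 have "integrable (distr lborel borel ((+) h)) f" using assms by (simp add: lborel_distr_plus)
 thus ?thesis by (subst (asm) integrable_distr_eq) (auto simp: add.commute)
qed

lemma locally_integrable_translation:
 fixes g :: "'a::euclidean_space => 'b::{banach, second_countable_topology}"
 assumes [measurable]: "g \<in> borel_measurable borel" and "locally_integrable g"
 shows "locally_integrable (%x. g (x + h))"
proof -
 have "integrable lborel (%x. indicat_real (cball 0 R) x *\<^sub>R g (x + h))" for R
 proof (rule Bochner_Integration.integrable_bound)
  have "integrable lborel (%x. indicat_real (cball 0 (R + norm h)) x *\<^sub>R g x)"
   using assms by (simp add: locally_integrable_Borel_iff)
  thus "integrable lborel (%x. indicat_real (cball 0 (R + norm h)) (x + h) *\<^sub>R g (x + h))"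
   by (rule integrable_translation)
  show "AE x in lborel. norm (indicat_real (cball 0 R) x *\<^sub>R g (x + h)) <= norm (indicat_real (cball 0 (R + norm h)) (x + h) *\<^sub>R g (x + h))"
  proof (rule AE_I2)
   fix x show "norm (indicat_real (cball 0 R) x *\<^sub>R g (x + h)) <= norm (indicat_real (cball 0 (R + norm h)) (x + h) *\<^sub>R g (x + h))"
    using norm_triangle_ineq[of x h] by (cases "x \<in> cball 0 R") auto
  qed
 qed measurable
 thus ?thesis by (subst locally_integrable_Borel_iff) auto
qed

text \<open>For \<open>t\<close> in the unit interval the shift by \<open>t *\<^sub>R h\<close>
  moves \<open>cball 0 R\<close> into \<open>cball 0 (R + norm h)\<close>, where \<open>g\<close> is
  integrable. This justifies exchanging the two integrals in the increment formula.\<close>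

lemma integrable_line_average:
 fixes g :: "'a::euclidean_space => 'b::euclidean_space"
 assumes [measurable]: "g \<in> borel_measurable borel" and g: "locally_integrable g"
 shows "integrable (lborel \<Otimes>\<^sub>M lborel) (%(x, t). (indicat_real (cball 0 R) x * indicat_real {0..1} t) *\<^sub>R g (x + t *\<^sub>R h))"
proof (rule integrableI_bounded)
 show "(%(x, t). (indicat_real (cball 0 R) x * indicat_real {0..1} t) *\<^sub>R g (x + t *\<^sub>R h)) \<in> borel_measurable (lborel \<Otimes>\<^sub>M lborel)"
  by measurable
 define C where "C = (\<integral>\<^sup>+x. ennreal (norm (indicat_real (cball 0 (R + norm h)) x *\<^sub>R g x)) \<partial>lborel)"
 have "integrable lborel (%x. indicat_real (cball 0 (R + norm h)) x *\<^sub>R g x)"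
  using g by (simp add: locally_integrable_Borel_iff)
 hence C: "C < \<infinity>" unfolding C_def by (simp add: integrable_iff_bounded)
 have "(\<integral>\<^sup>+z. ennreal (norm (case z of (x, t) => (indicat_real (cball 0 R) x * indicat_real {0..1} t) *\<^sub>R g (x + t *\<^sub>R h))) \<partial>(lborel \<Otimes>\<^sub>M lborel))
   = (\<integral>\<^sup>+t. \<integral>\<^sup>+x. ennreal (norm ((indicat_real (cball 0 R) x * indicat_real {0..1} t) *\<^sub>R g (x + t *\<^sub>R h))) \<partial>lborel \<partial>(lborel :: real measure))"
  by (subst lborel_pair.nn_integral_snd[symmetric]) (auto simp: case_prod_unfold)
 also have "... <= (\<integral>\<^sup>+t. C * indicator {0..1 :: real} t \<partial>lborel)"
 proof (rule nn_integral_mono)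
  fix t :: real
  show "(\<integral>\<^sup>+x. ennreal (norm ((indicat_real (cball 0 R) x * indicat_real {0..1} t) *\<^sub>R g (x + t *\<^sub>R h))) \<partial>lborel) <= C * indicator {0..1} t"
  proof (cases "t \<in> {0..1}")
   case True
   have "(\<integral>\<^sup>+x. ennreal (norm ((indicat_real (cball 0 R) x * indicat_real {0..1} t) *\<^sub>R g (x + t *\<^sub>R h))) \<partial>lborel)
    <= (\<integral>\<^sup>+x. ennreal (norm (indicat_real (cball 0 (R + norm h)) (x + t *\<^sub>R h) *\<^sub>R g (x + t *\<^sub>R h))) \<partial>lborel)"
   proof (intro nn_integral_mono ennreal_leI)
    fix x
    have "norm (t *\<^sub>R h) <= norm h" using True mult_right_mono[of t 1 "norm h"] by simp
    thus "norm ((indicat_real (cball 0 R) x * indicat_real {0..1} t) *\<^sub>R g (x + t *\<^sub>R h))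
      <= norm (indicat_real (cball 0 (R + norm h)) (x + t *\<^sub>R h) *\<^sub>R g (x + t *\<^sub>R h))"
     using True norm_triangle_ineq[of x "t *\<^sub>R h"] by (cases "x \<in> cball 0 R") auto
   qed
   also have "... = C" unfolding C_def
    by (rule nn_integral_lborel_translation[of "%x. ennreal (norm (indicat_real (cball 0 (R + norm h)) x *\<^sub>R g x))"]) measurable
   finally show ?thesis using True by simp
  qed simp
 qed
 also have "... = C" by (subst nn_integral_cmult_indicator) auto
 finally show "(\<integral>\<^sup>+z. ennreal (norm (case z of (x, t) => (indicat_real (cball 0 R) x * indicat_real {0..1} t) *\<^sub>R g (x + t *\<^sub>R h))) \<partial>(lborel \<Otimes>\<^sub>M lborel)) < \<infinity>"
  using C by (rule order.strict_trans1)
qed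

lemma integrable_mult_bounded:
 fixes f :: "'x => real"
 assumes "integrable M f" "k \<in> borel_measurable M" "!!x. \<bar>k x\<bar> <= B"
 shows "integrable M (%x. f x * k x)"
proof (rule Bochner_Integration.integrable_bound)
 show "integrable M (%x. B * f x)" using assms by simp
 show "(%x. f x * k x) \<in> borel_measurable M" using assms by (intro borel_measurable_times) auto
 show "AE x in M. norm (f x * k x) <= norm (B * f x)"
 proof (rule AE_I2)
  fix x
  have "\<bar>k x\<bar> <= \<bar>B\<bar>" using assms(3)[of x] by linarith
  from mult_right_mono[OF this, of "\<bar>f x\<bar>"] show "norm (f x * k x) <= norm (B * f x)" by (simp add: abs_mult mult.commute)
 qed
qed

text \<open>The fundamental theorem of calculus along segments is applied to the test function
  instead of \<open>u\<close>. Fubini, the definition of the weak gradient and a translation move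
  the derivative back onto \<open>u\<close>, and the fundamental lemma removes the test function; no
  mollification of \<open>u\<close> is involved.\<close>

theorem weak_gradient_increment:
 fixes u :: "'a::euclidean_space => real"
 assumes u[measurable]: "u \<in> borel_measurable borel" and g[measurable]: "g \<in> borel_measurable borel"
  and ug: "has_weak_gradient u g"
 shows "AE x in lborel. u (x + h) - u x = (LINT t|lborel. indicator {0..1} t * (g (x + t *\<^sub>R h) \<bullet> h))"
proof -
 define G where "G x = (LINT t|lborel. indicator {0..1} t * (g (x + t *\<^sub>R h) \<bullet> h))" for x
 have lu: "locally_integrable u" and lg: "locally_integrable g" using ug by (auto simp: has_weak_gradient_def)
 have [measurable]: "G \<in> borel_measurable borel" unfolding G_def by measurable
 have Gint: "integrable (lborel \<Otimes>\<^sub>M lborel) (%(x, t). (indicat_real (cball 0 R) x * indicat_real {0..1} t) * (g (x + t *\<^sub>R h) \<bullet> h))" for R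
  using integrable_inner_left[OF integrable_line_average[OF g lg, of R h], of h] by (simp add: case_prod_unfold)
 have lG: "locally_integrable G"
 proof -
  have "integrable lborel (%x. indicat_real (cball 0 R) x *\<^sub>R G x)" for R
   using lborel_pair.integrable_fst'[OF Gint[of R]] by (simp add: G_def mult.assoc)
  thus ?thesis by (subst locally_integrable_Borel_iff) auto
 qed
 let ?w = "%x. (u (x + h) + (-1) *\<^sub>R u x) + (-1) *\<^sub>R G x"
 have lw: "locally_integrable ?w"
  by (intro locally_integrable_add locally_integrable_scaleR lu lG locally_integrable_translation u)
 have "AE x in lebesgue. ?w x = 0"
 proof (rule fundamental_lemma_calculus_of_variations[OF lw])
  fix eta :: "'a => real" assume eta: "eta \<in> test_functions UNIV"
  obtain K where K: "compact K" "!!x. x \<notin> K ==> eta x = 0" "!!x v. x \<notin> K ==> frechet_derivative eta (at x) v = 0"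
   by (rule test_functions_support_deriv[OF eta]) blast
  obtain R where R: "R > 0" "K \<subseteq> cball 0 R" by (rule compact_subset_cball[OF K(1)]) blast
  let ?d = "%x. frechet_derivative eta (at x) (- h)"
  have [measurable]: "eta \<in> borel_measurable borel" "?d \<in> borel_measurable borel"
   using test_functionsD(2,4)[OF eta] by (auto intro: borel_measurable_continuous_onI)
  obtain B where B: "B > 0" "!!x. norm (eta x) <= B"
   using bounded_of_compact_support[OF test_functionsD(2)[OF eta] K(1,2)] by blast
  obtain B' where B': "B' > 0" "!!x. norm (?d x) <= B'"
   using bounded_of_compact_support[OF test_functionsD(4)[OF eta] K(1) K(3), of "- h"] by blast
  have d0: "?d (x - t *\<^sub>R h) = 0" if "t \<in> {0..1}" "x \<notin> cball 0 (R + norm h)" for x t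
  proof (rule K(3))
   have "norm (t *\<^sub>R h) <= norm h" using that mult_right_mono[of t 1 "norm h"] by simp
   hence "norm (x - t *\<^sub>R h) > R" using that(2) norm_triangle_ineq2[of x "t *\<^sub>R h"] by simp
   thus "x - t *\<^sub>R h \<notin> K" using R(2) by auto
  qed
  have FTC: "eta (x - h) - eta x = (LINT t|lborel. indicator {0..1} t * ?d (x - t *\<^sub>R h))" for x
  proof -
   have der: "((%t. eta (x + t *\<^sub>R (- h))) has_real_derivative ?d (x + t *\<^sub>R (- h))) (at t)" for t
    by (rule line_derivative[OF test_functionsD(3)[OF eta]])
   have cont: "isCont (%t. ?d (x + t *\<^sub>R (- h))) t" for t
   proof -
    have "continuous_on UNIV (%t. ?d (x + t *\<^sub>R (- h)))"
     by (rule continuous_on_compose2[OF test_functionsD(4)[OF eta, of UNIV]]) (auto intro!: continuous_intros)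
    thus ?thesis by (simp add: continuous_on_eq_continuous_at)
   qed
   have "(LINT t|lborel. ?d (x + t *\<^sub>R (- h)) * indicator {0..1} t) = eta (x + 1 *\<^sub>R (- h)) - eta (x + 0 *\<^sub>R (- h))"
    by (rule integral_FTC_Icc_real[OF _ der cont]) simp
   thus ?thesis by (simp add: mult.commute)
  qed
  let ?A = "%x t. indicat_real {0..1} t * (u x * ?d (x - t *\<^sub>R h))"
  let ?C = "%x t. indicat_real {0..1} t * ((g (x + t *\<^sub>R h) \<bullet> h) * eta x)"
  have iA: "integrable (lborel \<Otimes>\<^sub>M lborel) (%(x, t). ?A x t)"
  proof -
   have "integrable (lborel \<Otimes>\<^sub>M lborel) (%(x, t). (indicat_real (cball 0 (R + norm h)) x * indicat_real {0..1} t) *\<^sub>R u (x + t *\<^sub>R 0))"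
    by (rule integrable_line_average[OF u lu])
   hence "integrable (lborel \<Otimes>\<^sub>M lborel) (%z. (case z of (x, t) => (indicat_real (cball 0 (R + norm h)) x * indicat_real {0..1} t) *\<^sub>R u (x + t *\<^sub>R 0)) * (case z of (x, t) => ?d (x - t *\<^sub>R h)))"
    by (rule integrable_mult_bounded) (use B' in auto)
   moreover have "(case z of (x, t) => (indicat_real (cball 0 (R + norm h)) x * indicat_real {0..1} t) *\<^sub>R u (x + t *\<^sub>R 0)) * (case z of (x, t) => ?d (x - t *\<^sub>R h)) = (case z of (x, t) => ?A x t)" for z
    using d0[of "snd z" "fst z"] by (cases z) (auto simp: indicator_def)
   ultimately show ?thesis by simp
  qed
  have iC: "integrable (lborel \<Otimes>\<^sub>M lborel) (%(x, t). ?C x t)"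
  proof -
   have "integrable (lborel \<Otimes>\<^sub>M lborel) (%z. (case z of (x, t) => (indicat_real (cball 0 R) x * indicat_real {0..1} t) * (g (x + t *\<^sub>R h) \<bullet> h)) * (case z of (x, t) => eta x))"
    by (rule integrable_mult_bounded[OF Gint]) (use B in auto)
   moreover have "(case z of (x, t) => (indicat_real (cball 0 R) x * indicat_real {0..1} t) * (g (x + t *\<^sub>R h) \<bullet> h)) * (case z of (x, t) => eta x) = (case z of (x, t) => ?C x t)" for z
    using K(2)[of "fst z"] subsetD[OF R(2), of "fst z"] by (cases z) (auto simp: indicator_def)
   ultimately show ?thesis by simp
  qed
  \<comment> \<open>For fixed \<open>t\<close> the weak gradient is tested with the translate of
    \<open>eta\<close> by \<open>t *\<^sub>R h\<close>, and then the variable is shifted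
    back.\<close>
  have inner_eq: "(LINT x|lborel. ?A x t) = (LINT x|lborel. ?C x t)" for t
  proof -
   have tr: "(%x. eta (x + - (t *\<^sub>R h))) \<in> test_functions UNIV" by (rule test_functions_translation[OF eta])
   have fd: "frechet_derivative (%x. eta (x + - (t *\<^sub>R h))) (at x) (- h) = ?d (x - t *\<^sub>R h)" for x
    using frechet_derivative_translation[of eta x "- (t *\<^sub>R h)", OF test_functionsD(3)[OF eta]] by simp
   have "(LINT x|lebesgue. u x * ?d (x - t *\<^sub>R h)) = - (LINT x|lebesgue. (g x \<bullet> - h) * eta (x + - (t *\<^sub>R h)))"
    using ug tr unfolding has_weak_gradient_def fd[symmetric] by blast
   hence "(LINT x|lborel. u x * ?d (x - t *\<^sub>R h)) = - (LINT x|lborel. (g x \<bullet> - h) * eta (x + - (t *\<^sub>R h)))"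
    by (subst (asm) (1 2) lebesgue_integral_borel(1)) measurable
   also have "... = (LINT x|lborel. (g x \<bullet> h) * eta (x + - (t *\<^sub>R h)))" by simp
   also have "... = (LINT x|lborel. (g (x + t *\<^sub>R h) \<bullet> h) * eta ((x + t *\<^sub>R h) + - (t *\<^sub>R h)))"
    by (rule lborel_integral_translation[symmetric]) measurable
   also have "... = (LINT x|lborel. (g (x + t *\<^sub>R h) \<bullet> h) * eta x)" by simp
   finally show ?thesis by simp
  qed
  have "(LINT x|lborel. u x * (eta (x - h) - eta x)) = (LINT x|lborel. \<integral>t. ?A x t \<partial>lborel)"
  proof (intro Bochner_Integration.integral_cong refl)
   fix x
   have "(LINT t|lborel. ?A x t) = (LINT t|lborel. u x * (indicator {0..1} t * ?d (x - t *\<^sub>R h)))"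
    by (intro Bochner_Integration.integral_cong) auto
   thus "u x * (eta (x - h) - eta x) = (LINT t|lborel. ?A x t)" unfolding FTC by simp
  qed
  also have "... = (LINT t|lborel. \<integral>x. ?A x t \<partial>lborel)" by (rule lborel_pair.Fubini_integral[OF iA, symmetric])
  also have "... = (LINT t|lborel. \<integral>x. ?C x t \<partial>lborel)" unfolding inner_eq ..
  also have "... = (LINT x|lborel. \<integral>t. ?C x t \<partial>lborel)" by (rule lborel_pair.Fubini_integral[OF iC])
  also have "... = (LINT x|lborel. G x * eta x)"
  proof (intro Bochner_Integration.integral_cong refl)
   fix x
   have "(LINT t|lborel. ?C x t) = (LINT t|lborel. (indicator {0..1} t * (g (x + t *\<^sub>R h) \<bullet> h)) * eta x)"
    by (intro Bochner_Integration.integral_cong) auto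
   thus "(LINT t|lborel. ?C x t) = G x * eta x" by (simp add: G_def)
  qed
  finally have main: "(LINT x|lborel. u x * (eta (x - h) - eta x)) = (LINT x|lborel. G x * eta x)" .
  have ml: "integrable lborel (%x. f x * psi x)" if lf: "locally_integrable f" and mf[measurable]: "f \<in> borel_measurable borel" and psi: "psi \<in> test_functions UNIV" for f psi :: "'a => real"
  proof -
   obtain L where L: "compact L" "!!x. x \<notin> L ==> psi x = 0" by (rule test_functions_support[OF psi]) blast
   have [measurable]: "psi \<in> borel_measurable borel" using test_functionsD(2)[OF psi] by (rule borel_measurable_continuous_onI)
   have "integrable lebesgue (%x. psi x *\<^sub>R f x)"
    by (rule locally_integrable_mult[OF lf test_functionsD(2)[OF psi] L])
   thus ?thesis by (subst (asm) lebesgue_integral_borel(2)) (auto simp: mult.commute)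
  qed
  have i1: "integrable lborel (%x. u x * eta x)" by (intro ml lu u eta)
  have i2: "integrable lborel (%x. G x * eta x)" by (intro ml lG eta) measurable
  have i3: "integrable lborel (%x. u (x + h) * eta x)"
   by (intro ml locally_integrable_translation lu u eta) measurable
  have i4: "integrable lborel (%x. u x * eta (x - h))"
   using ml[OF lu u test_functions_translation[OF eta, of "- h"]] by simp
  have "(LINT x|lborel. u (x + h) * eta x) = (LINT x|lborel. u (x + h) * eta ((x + h) - h))" by simp
  also have "... = (LINT x|lborel. u x * eta (x - h))"
   by (rule lborel_integral_translation[of "%x. u x * eta (x - h)"]) measurable
  finally have shift: "(LINT x|lborel. u (x + h) * eta x) = (LINT x|lborel. u x * eta (x - h))" .
  have "(LINT x|lebesgue. ?w x * eta x) = (LINT x|lborel. ?w x * eta x)" by (rule lebesgue_integral_borel(1)) measurable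
  also have "... = (LINT x|lborel. u (x + h) * eta x - u x * eta x - G x * eta x)"
   by (intro Bochner_Integration.integral_cong) (auto simp: algebra_simps)
  also have "... = (LINT x|lborel. u x * eta (x - h)) - (LINT x|lborel. u x * eta x) - (LINT x|lborel. G x * eta x)"
   using i1 i2 i3 shift by simp
  also have "... = (LINT x|lborel. u x * (eta (x - h) - eta x)) - (LINT x|lborel. G x * eta x)"
   using i1 i4 by (simp add: right_diff_distrib)
  also have "... = 0" using main by simp
  finally show "(LINT x|lebesgue. ?w x * eta x) = 0" .
 qed
 hence "AE x in lborel. ?w x = 0"
  by (subst (asm) AE_completion_iff) (auto simp: AE_completion_iff)
 thus ?thesis by eventually_elim (simp add: G_def)
qed

text \<open>Hoelder's inequality against the indicator of \<open>A\<close>. The extended right-hand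
  side admits functions of infinite p-th mean, so that no integrability has to be checked where the
  lemma is applied.\<close>

lemma Jensen_powr:
 fixes f :: "'x => real"
 assumes p: "p > 1" and [measurable]: "f \<in> borel_measurable M" "A \<in> sets M" and c: "emeasure M A = ennreal c" "c >= 0"
 shows "ennreal (\<bar>\<integral>x. indicator A x * f x \<partial>M\<bar> powr p) <=
  ennreal (c powr (p - 1)) * (\<integral>\<^sup>+x. indicator A x * ennreal (\<bar>f x\<bar> powr p) \<partial>M)"
proof -
 let ?q = "p / (p - 1)"
 have q: "?q > 0" using p by simp
 let ?I = "\<integral>\<^sup>+x. indicator A x * ennreal (\<bar>f x\<bar> powr p) \<partial>M"
 have eqp: "ennreal (\<bar>indicator A x * f x\<bar> powr p) = indicator A x * ennreal (\<bar>f x\<bar> powr p)" for x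
  by (simp add: indicator_def)
 show ?thesis
 proof (cases "?I = \<infinity>")
  case True
  show ?thesis
  \<comment> \<open>For \<open>c = 0\<close> the right-hand side is 0 times infinity, that is 0, so
    the left-hand side has to be shown to vanish.\<close>
  proof (cases "c = 0")
   case c0: True
   hence "A \<in> null_sets M" using c by (simp add: null_sets_def)
   hence "AE x in M. indicator A x * f x = 0" using AE_not_in[of A M] by (auto simp: indicator_def elim!: eventually_mono)
   hence "(LINT x|M. indicator A x * f x) = 0" by (rule integral_eq_zero_AE)
   thus ?thesis by simp
  next
   case False
   hence "c powr (p - 1) > 0" using c by simp
   thus ?thesis using True by (simp add: ennreal_mult_top)
  qed
 next
  case False
  have m2: "Lp_mem M p (%x. indicator A x * f x)"
   unfolding Lp_mem_def
  proof
   show "integrable M (%x. norm (indicator A x * f x) powr p)"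
    using False by (intro integrableI_nonneg) (auto simp: eqp top.not_eq_extremum)
  qed measurable
  have m1: "Lp_mem M ?q (indicator A :: 'x => real)"
   unfolding Lp_mem_def
  proof
   have "integrable M (indicat_real A)" using c by (intro integrable_real_indicator) auto
   moreover have "(%x. norm (indicat_real A x) powr ?q) = indicat_real A" by (auto simp: indicator_def)
   ultimately show "integrable M (%x. norm (indicat_real A x) powr ?q)" by simp
  qed measurable
  have n1: "Lp_norm M ?q (indicator A :: 'x => real) = c powr ((p - 1) / p)"
  proof -
   have "(%x. norm (indicat_real A x) powr ?q) = indicat_real A" by (auto simp: indicator_def)
   thus ?thesis using c p by (simp add: Lp_norm_def measure_def)
  qed
  have "\<bar>\<integral>x. indicator A x \<bullet> (indicator A x * f x) \<partial>M\<bar> <= c powr ((p - 1) / p) * Lp_norm M p (%x. indicator A x * f x)"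
   using Hoelder_inner(2)[OF p m1 m2] n1 by simp
  also have "(LINT x|M. indicator A x \<bullet> (indicator A x * f x)) = (LINT x|M. indicator A x * f x)"
   by (intro Bochner_Integration.integral_cong) (auto simp: indicator_def)
  finally have "\<bar>\<integral>x. indicator A x * f x \<partial>M\<bar> powr p <= (c powr ((p - 1) / p) * Lp_norm M p (%x. indicator A x * f x)) powr p"
   using p by (intro powr_mono2) auto
  also have "... = c powr (p - 1) * (LINT x|M. norm (indicator A x * f x) powr p)"
   using p by (simp add: powr_mult powr_powr Lp_norm_powr)
  finally have "ennreal (\<bar>\<integral>x. indicator A x * f x \<partial>M\<bar> powr p) <= ennreal (c powr (p - 1)) * ennreal (LINT x|M. norm (indicator A x * f x) powr p)"
   by (subst ennreal_mult[symmetric]) (auto intro: ennreal_leI)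
  also have "ennreal (LINT x|M. norm (indicator A x * f x) powr p) = ?I"
   using m2 by (subst nn_integral_eq_integral[symmetric]) (auto simp: Lp_mem_def eqp)
  finally show ?thesis .
 qed
qed

text \<open>Jensen's inequality in the segment parameter, exchange of the integrals, and translation
  invariance.\<close>

theorem weak_gradient_increment_Lp:
 fixes u :: "'a::euclidean_space => real"
 assumes u[measurable]: "u \<in> borel_measurable borel" and g[measurable]: "g \<in> borel_measurable borel"
  and ug: "has_weak_gradient u g" and p: "p > 1"
 shows "(\<integral>\<^sup>+x. ennreal (\<bar>u (x + h) - u x\<bar> powr p) \<partial>lborel) <=
  ennreal (norm h powr p) * (\<integral>\<^sup>+x. ennreal (norm (g x) powr p) \<partial>lborel)"
proof -
 have "(\<integral>\<^sup>+x. ennreal (\<bar>u (x + h) - u x\<bar> powr p) \<partial>lborel)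
   <= (\<integral>\<^sup>+x. \<integral>\<^sup>+t. indicator {0..1} t * ennreal (\<bar>g (x + t *\<^sub>R h) \<bullet> h\<bar> powr p) \<partial>lborel \<partial>lborel)"
 proof (intro nn_integral_mono_AE)
  show "AE x in lborel. ennreal (\<bar>u (x + h) - u x\<bar> powr p) <= (\<integral>\<^sup>+t. indicator {0..1} t * ennreal (\<bar>g (x + t *\<^sub>R h) \<bullet> h\<bar> powr p) \<partial>lborel)"
   using weak_gradient_increment[OF u g ug, of h]
  proof eventually_elim
   case (elim x)
   show ?case unfolding elim
    using Jensen_powr[OF p, of "%t. g (x + t *\<^sub>R h) \<bullet> h" lborel "{0..1}" 1] by simp
  qed
 qed
 also have "... = (\<integral>\<^sup>+t. \<integral>\<^sup>+x. indicator {0..1} t * ennreal (\<bar>g (x + t *\<^sub>R h) \<bullet> h\<bar> powr p) \<partial>lborel \<partial>lborel)"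
  by (rule lborel_pair.Fubini'[symmetric]) measurable
 also have "... <= (\<integral>\<^sup>+t. indicator {0..1 :: real} t * (ennreal (norm h powr p) * (\<integral>\<^sup>+x. ennreal (norm (g x) powr p) \<partial>lborel)) \<partial>lborel)"
 proof (intro nn_integral_mono)
  fix t :: real
  have "(\<integral>\<^sup>+x. indicator {0..1} t * ennreal (\<bar>g (x + t *\<^sub>R h) \<bullet> h\<bar> powr p) \<partial>lborel)
    <= (\<integral>\<^sup>+x. indicator {0..1} t * (ennreal (norm h powr p) * ennreal (norm (g (x + t *\<^sub>R h)) powr p)) \<partial>lborel)"
  proof (intro nn_integral_mono mult_left_mono)
   fix x
   have "\<bar>g (x + t *\<^sub>R h) \<bullet> h\<bar> powr p <= (norm (g (x + t *\<^sub>R h)) * norm h) powr p"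
    using p by (intro powr_mono2 Cauchy_Schwarz_ineq2) auto
   thus "ennreal (\<bar>g (x + t *\<^sub>R h) \<bullet> h\<bar> powr p) <= ennreal (norm h powr p) * ennreal (norm (g (x + t *\<^sub>R h)) powr p)"
    by (subst ennreal_mult[symmetric]) (auto simp: powr_mult mult.commute intro: ennreal_leI)
  qed simp
  also have "... = indicator {0..1} t * (ennreal (norm h powr p) * (\<integral>\<^sup>+x. ennreal (norm (g (x + t *\<^sub>R h)) powr p) \<partial>lborel))"
   by (simp add: nn_integral_cmult)
  also have "(\<integral>\<^sup>+x. ennreal (norm (g (x + t *\<^sub>R h)) powr p) \<partial>lborel) = (\<integral>\<^sup>+x. ennreal (norm (g x) powr p) \<partial>lborel)"
   by (rule nn_integral_lborel_translation[of "%x. ennreal (norm (g x) powr p)"]) measurable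
  finally show "(\<integral>\<^sup>+x. indicator {0..1} t * ennreal (\<bar>g (x + t *\<^sub>R h) \<bullet> h\<bar> powr p) \<partial>lborel)
    <= indicator {0..1} t * (ennreal (norm h powr p) * (\<integral>\<^sup>+x. ennreal (norm (g x) powr p) \<partial>lborel))" .
 qed
 also have "... = ennreal (norm h powr p) * (\<integral>\<^sup>+x. ennreal (norm (g x) powr p) \<partial>lborel)"
  by (subst nn_integral_multc) auto
 finally show ?thesis .
qed

section \<open>Embedding and compactness via dyadic averages\<close>

definition modulus :: "real => real => ('a::euclidean_space => real) => ennreal" where
 "modulus p l u = (\<integral>\<^sup>+x. \<integral>\<^sup>+y. indicator {..l} (norm (x - y)) * ennreal (\<bar>u x - u y\<bar> powr p) \<partial>lborel \<partial>lborel)"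

text \<open>\<open>A\<close> plays the role of the p-th power of a seminorm of order
  \<open>s\<close>. In the exponent, the dimension accounts for the volume of a ball of radius
  \<open>l\<close>, and \<open>s * p\<close> for the p-th power of an increment of order
  \<open>s\<close>.\<close>

definition modulus_bound :: "real => real => real => ('a::euclidean_space => real) => bool" where
 "modulus_bound p s A u \<longleftrightarrow> A >= 0 & (\<forall>l>0. modulus p l u <= ennreal (A * l powr (real DIM('a) + s * p)))"

subsection \<open>Dyadic cubes\<close>

text \<open>Comparing floors makes the cubes half-open, so that each generation is the partition
  belonging to an equivalence relation.\<close>

definition same_cube :: "nat => 'a::euclidean_space => 'a => bool" where
 "same_cube j x y \<longleftrightarrow> (\<forall>i\<in>Basis. \<lfloor>2 ^ j * (x \<bullet> i)\<rfloor> = \<lfloor>2 ^ j * (y \<bullet> i)\<rfloor>)"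

definition cube :: "nat => 'a::euclidean_space => 'a set" where
 "cube j x = {y. same_cube j x y}"

definition inv_vol :: "'a::euclidean_space itself => nat => real" where
 "inv_vol _ j = (2 ^ j) ^ DIM('a)"

lemma inv_vol_pos: "inv_vol TYPE('a::euclidean_space) j > 0"
 by (simp add: inv_vol_def)

lemma inv_vol_eq_powr: "inv_vol TYPE('a::euclidean_space) j = 2 powr (real j * real DIM('a))"
proof -
 have "inv_vol TYPE('a) j = 2 ^ (j * DIM('a))" by (simp add: inv_vol_def power_mult)
 also have "... = 2 powr real (j * DIM('a))" by (rule powr_realpow[symmetric]) simp
 finally show ?thesis by simp
qed

lemma same_cube_sym: "same_cube j x y ==> same_cube j y x"
 and same_cube_refl: "same_cube j x x"
 and same_cube_trans: "same_cube j x y ==> same_cube j y z ==> same_cube j x z"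
 by (auto simp: same_cube_def)

lemma cube_eq: "same_cube j x y ==> cube j x = cube j y"
 unfolding cube_def using same_cube_sym same_cube_trans by blast

text \<open>The coarser floor is the finer one divided by 2 in the integers.\<close>

lemma same_cube_Suc: "same_cube (Suc j) x y ==> same_cube j x y"
 unfolding same_cube_def
proof
 fix i :: 'a assume "\<forall>i\<in>Basis. \<lfloor>2 ^ Suc j * (x \<bullet> i)\<rfloor> = \<lfloor>2 ^ Suc j * (y \<bullet> i)\<rfloor>" "i \<in> Basis"
 hence *: "\<lfloor>2 ^ Suc j * (x \<bullet> i)\<rfloor> = \<lfloor>2 ^ Suc j * (y \<bullet> i)\<rfloor>" by blast
 have "\<lfloor>2 ^ j * (z \<bullet> i)\<rfloor> = \<lfloor>2 ^ Suc j * (z \<bullet> i)\<rfloor> div 2" for z :: 'a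
  using floor_divide_real_eq_div[of 2 "2 ^ Suc j * (z \<bullet> i)"] by simp
 thus "\<lfloor>2 ^ j * (x \<bullet> i)\<rfloor> = \<lfloor>2 ^ j * (y \<bullet> i)\<rfloor>" using * by metis
qed

lemma same_cube_norm:
 assumes "same_cube j x (y :: 'a::euclidean_space)" shows "norm (x - y) <= real DIM('a) / 2 ^ j"
proof -
 have "norm (x - y) <= (\<Sum>i\<in>Basis. \<bar>(x - y) \<bullet> i\<bar>)" by (rule norm_le_l1)
 also have "... <= (\<Sum>i\<in>(Basis::'a set). 1 / 2 ^ j)"
 proof (rule sum_mono)
  fix i :: 'a assume "i \<in> Basis"
  hence "\<lfloor>2 ^ j * (x \<bullet> i)\<rfloor> = \<lfloor>2 ^ j * (y \<bullet> i)\<rfloor>" using assms by (auto simp: same_cube_def)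
  hence "\<bar>2 ^ j * (x \<bullet> i) - 2 ^ j * (y \<bullet> i)\<bar> <= 1" by linarith
  hence "2 ^ j * \<bar>(x - y) \<bullet> i\<bar> <= 1"
   by (simp add: inner_diff_left abs_mult flip: right_diff_distrib)
  thus "\<bar>(x - y) \<bullet> i\<bar> <= 1 / 2 ^ j" by (simp add: field_simps)
 qed
 finally show ?thesis by simp
qed

lemma pred_same_cube [measurable (raw)]:
 assumes [measurable]: "f \<in> borel_measurable M" "g \<in> borel_measurable M"
 shows "Measurable.pred M (%x. same_cube j (f x) (g x :: 'a::euclidean_space))"
 unfolding same_cube_def by measurable

lemma cube_sets [measurable]: "cube j x \<in> sets borel"
proof -
 have "Measurable.pred borel (%y. same_cube j x y)" by measurable
 thus ?thesis by (simp add: cube_def pred_def)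
qed

text \<open>The half-open cube lies between an open and a closed box of the same volume.\<close>

lemma emeasure_cube: "emeasure lborel (cube j (x :: 'a::euclidean_space)) = ennreal (1 / inv_vol TYPE('a) j)"
proof -
 define a where "a = (\<Sum>i\<in>(Basis :: 'a set). (of_int \<lfloor>2 ^ j * (x \<bullet> i)\<rfloor> / 2 ^ j) *\<^sub>R i)"
 define b where "b = (\<Sum>i\<in>(Basis :: 'a set). ((of_int \<lfloor>2 ^ j * (x \<bullet> i)\<rfloor> + 1) / 2 ^ j) *\<^sub>R i)"
 have ab: "a \<bullet> i = of_int \<lfloor>2 ^ j * (x \<bullet> i)\<rfloor> / 2 ^ j" "b \<bullet> i = (of_int \<lfloor>2 ^ j * (x \<bullet> i)\<rfloor> + 1) / 2 ^ j" if "i \<in> Basis" for i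
  using that by (auto simp: a_def b_def)
 have mem: "\<lfloor>2 ^ j * (x \<bullet> i)\<rfloor> = \<lfloor>2 ^ j * (y \<bullet> i)\<rfloor> \<longleftrightarrow> a \<bullet> i <= y \<bullet> i & y \<bullet> i < b \<bullet> i" if "i \<in> Basis" for i y
  unfolding ab[OF that] by (simp add: field_simps) linarith
 have sub: "box a b \<subseteq> cube j x" "cube j x \<subseteq> cbox a b"
  using mem by (auto simp: cube_def same_cube_def mem_box less_imp_le)
 have le: "a \<bullet> i <= b \<bullet> i" "b \<bullet> i - a \<bullet> i = 1 / 2 ^ j" if "i \<in> Basis" for i
  unfolding ab[OF that] by (auto simp: field_simps)
 have "(\<Prod>i\<in>Basis. (b - a) \<bullet> i) = (\<Prod>i\<in>(Basis :: 'a set). 1 / 2 ^ j)"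
  using le by (intro prod.cong) (auto simp: inner_diff_left)
 also have "... = 1 / inv_vol TYPE('a) j" by (simp add: inv_vol_def power_divide)
 finally have vol: "(\<Prod>i\<in>Basis. (b - a) \<bullet> i) = 1 / inv_vol TYPE('a) j" .
 have "emeasure lborel (box a b) = ennreal (1 / inv_vol TYPE('a) j)" "emeasure lborel (cbox a b) = ennreal (1 / inv_vol TYPE('a) j)"
  using le by (auto simp: vol)
 moreover have "emeasure lborel (box a b) <= emeasure lborel (cube j x)" "emeasure lborel (cube j x) <= emeasure lborel (cbox a b)"
  using sub by (auto intro!: emeasure_mono)
 ultimately show ?thesis by simp
qed

definition cube_avg :: "nat => ('a::euclidean_space => real) => 'a => real" where
 "cube_avg j u x = inv_vol TYPE('a) j * (LINT y|lborel. indicator (cube j x) y * u y)"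

lemma cube_avg_const: "same_cube j x y ==> cube_avg j u x = cube_avg j u y"
 by (simp add: cube_avg_def cube_eq[of j x y])

lemma cube_avg_measurable [measurable]:
 assumes [measurable]: "u \<in> borel_measurable borel" shows "cube_avg j u \<in> borel_measurable borel"
proof -
 have "cube_avg j u = (%x. inv_vol TYPE('a) j * (LINT y|lborel. (if same_cube j x y then 1 else 0) * u y))"
  by (auto simp: cube_avg_def cube_def indicator_def of_bool_def fun_eq_iff)
 also have "... \<in> borel_measurable borel" by measurable
 finally show ?thesis .
qed

text \<open>The error at \<open>x\<close> is the mean of \<open>u x - u y\<close> over the cube
  containing \<open>x\<close>. Jensen bounds its p-th power by the mean of p-th powers, and that
  cube stays within distance \<open>real DIM('a) / 2 ^ j\<close> of \<open>x\<close>.\<close>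

lemma cube_avg_error:
 fixes u :: "'a::euclidean_space => real"
 assumes u: "integrable lborel u" and p: "p > 1"
 shows "(\<integral>\<^sup>+x. ennreal (\<bar>u x - cube_avg j u x\<bar> powr p) \<partial>lborel) <=
  ennreal (inv_vol TYPE('a) j) * modulus p (real DIM('a) / 2 ^ j) u"
proof -
 have [measurable]: "u \<in> borel_measurable borel" using borel_measurable_integrable[OF u] by simp
 let ?k = "inv_vol TYPE('a) j"
 have k: "?k > 0" by (rule inv_vol_pos)
 have "(\<integral>\<^sup>+x. ennreal (\<bar>u x - cube_avg j u x\<bar> powr p) \<partial>lborel) <=
   (\<integral>\<^sup>+x. ennreal ?k * (\<integral>\<^sup>+y. indicator {..real DIM('a) / 2 ^ j} (norm (x - y)) * ennreal (\<bar>u x - u y\<bar> powr p) \<partial>lborel) \<partial>lborel)"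
 proof (rule nn_integral_mono)
  fix x :: 'a
  have cu: "integrable lborel (%y. indicator (cube j x) y * u y)"
   using integrable_mult_indicator[OF _ u, of "cube j x"] by simp
  have ic: "integrable lborel (indicat_real (cube j x))" "(LINT y|lborel. indicat_real (cube j x) y) = 1 / ?k"
   using emeasure_cube[of j x] k by (auto simp: measure_def intro!: integrable_real_indicator)
  have "u x - cube_avg j u x = ?k * (u x * (LINT y|lborel. indicat_real (cube j x) y) - (LINT y|lborel. indicator (cube j x) y * u y))"
   unfolding ic(2) using k by (simp add: cube_avg_def field_simps)
  also have "u x * (LINT y|lborel. indicat_real (cube j x) y) - (LINT y|lborel. indicator (cube j x) y * u y)
    = (LINT y|lborel. u x * indicat_real (cube j x) y - indicator (cube j x) y * u y)"
   using Bochner_Integration.integral_diff[OF integrable_mult_right[OF ic(1), of "u x"] cu] by (simp only: integral_mult_right_zero)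
  also have "... = (LINT y|lborel. indicator (cube j x) y * (u x - u y))"
   by (intro Bochner_Integration.integral_cong) (auto simp: algebra_simps)
  finally have "\<bar>u x - cube_avg j u x\<bar> powr p = ?k powr p * \<bar>\<integral>y. indicator (cube j x) y * (u x - u y) \<partial>lborel\<bar> powr p"
   using k by (simp add: abs_mult powr_mult)
  hence "ennreal (\<bar>u x - cube_avg j u x\<bar> powr p) = ennreal (?k powr p) * ennreal (\<bar>\<integral>y. indicator (cube j x) y * (u x - u y) \<partial>lborel\<bar> powr p)"
   by (simp add: ennreal_mult)
  also have "... <= ennreal (?k powr p) * (ennreal ((1 / ?k) powr (p - 1)) * (\<integral>\<^sup>+y. indicator (cube j x) y * ennreal (\<bar>u x - u y\<bar> powr p) \<partial>lborel))"
   using k by (intro mult_left_mono Jensen_powr[OF p] emeasure_cube) auto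
  also have "... = ennreal (?k powr p * (1 / ?k) powr (p - 1)) * (\<integral>\<^sup>+y. indicator (cube j x) y * ennreal (\<bar>u x - u y\<bar> powr p) \<partial>lborel)"
   by (simp add: ennreal_mult mult.assoc)
  also have "?k powr p * (1 / ?k) powr (p - 1) = ?k"
   using k by (simp add: powr_divide powr_diff)
  also have "(\<integral>\<^sup>+y. indicator (cube j x) y * ennreal (\<bar>u x - u y\<bar> powr p) \<partial>lborel) <=
    (\<integral>\<^sup>+y. indicator {..real DIM('a) / 2 ^ j} (norm (x - y)) * ennreal (\<bar>u x - u y\<bar> powr p) \<partial>lborel)"
   using same_cube_norm[of j x] by (intro nn_integral_mono mult_right_mono) (auto simp: indicator_def cube_def)
  finally show "ennreal (\<bar>u x - cube_avg j u x\<bar> powr p) <=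
    ennreal ?k * (\<integral>\<^sup>+y. indicator {..real DIM('a) / 2 ^ j} (norm (x - y)) * ennreal (\<bar>u x - u y\<bar> powr p) \<partial>lborel)"
   by (simp add: mult_left_mono)
 qed
 also have "... = ennreal ?k * modulus p (real DIM('a) / 2 ^ j) u"
  unfolding modulus_def by (rule nn_integral_cmult) measurable
 finally show ?thesis .
qed

text \<open>An inverse inequality: the p-th power mass on a single cube bounds the supremum by
  \<open>inv_vol\<close> to the power \<open>1 / p\<close> times the norm, and the q-th power is
  then estimated between the supremum and the p-th power.\<close>

lemma cube_const_Lq:
 fixes w :: "'a::euclidean_space => real"
 assumes p: "p > 1" and q: "p <= q" and w: "Lp_mem lborel p w" and const: "!!x y. same_cube j x y ==> w x = w y"
 shows "Lp_mem lborel q w" "Lp_norm lborel q w <= inv_vol TYPE('a) j powr (1 / p - 1 / q) * Lp_norm lborel p w"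
proof -
 let ?k = "inv_vol TYPE('a) j"
 have k: "?k > 0" by (rule inv_vol_pos)
 have [measurable]: "w \<in> borel_measurable borel" using w by (simp add: Lp_mem_def)
 define n where "n = Lp_norm lborel p w"
 have n: "n >= 0" by (simp add: n_def)
 have np: "n powr p = (LINT x|lborel. \<bar>w x\<bar> powr p)" using p by (simp add: n_def Lp_norm_powr)
 have iw: "integrable lborel (%x. \<bar>w x\<bar> powr p)" using w by (simp add: Lp_mem_def)
 have sup: "\<bar>w x\<bar> <= ?k powr (1 / p) * n" for x
 proof -
  have ic: "integrable lborel (indicat_real (cube j x))" "(LINT y|lborel. indicat_real (cube j x) y) = 1 / ?k"
   using emeasure_cube[of j x] k by (auto simp: measure_def intro!: integrable_real_indicator)
  have "\<bar>w x\<bar> powr p * (1 / ?k) = (LINT y|lborel. \<bar>w x\<bar> powr p * indicat_real (cube j x) y)" using ic by simp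
  also have "... <= (LINT y|lborel. \<bar>w y\<bar> powr p)"
  proof (intro integral_mono)
   fix y show "\<bar>w x\<bar> powr p * indicat_real (cube j x) y <= \<bar>w y\<bar> powr p"
    using const[of x y] by (cases "y \<in> cube j x") (auto simp: cube_def)
  qed (use ic(1) iw in auto)
  finally have "\<bar>w x\<bar> powr p <= ?k * n powr p" using k by (simp add: np field_simps)
  also have "... = (?k powr (1 / p) * n) powr p" using k p by (simp add: powr_mult powr_powr)
  finally have le: "\<bar>w x\<bar> powr p <= (?k powr (1 / p) * n) powr p" .
  show ?thesis
  proof (rule ccontr)
   assume "~ ?thesis"
   hence "(?k powr (1 / p) * n) powr p < \<bar>w x\<bar> powr p" using p n by (intro powr_less_mono2) auto
   with le show False by simp
  qed
 qed
 have pt: "\<bar>w x\<bar> powr q <= (?k powr (1 / p) * n) powr (q - p) * \<bar>w x\<bar> powr p" for x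
 proof -
  have "\<bar>w x\<bar> powr q = \<bar>w x\<bar> powr (q - p) * \<bar>w x\<bar> powr p" by (simp flip: powr_add)
  also have "... <= (?k powr (1 / p) * n) powr (q - p) * \<bar>w x\<bar> powr p"
   using q sup by (intro mult_right_mono powr_mono2) auto
  finally show ?thesis .
 qed
 show mq: "Lp_mem lborel q w"
  unfolding Lp_mem_def
 proof
  show "integrable lborel (%x. norm (w x) powr q)"
   by (rule Bochner_Integration.integrable_bound[OF integrable_mult_right[OF iw, of "(?k powr (1 / p) * n) powr (q - p)"]])
    (use pt in auto)
 qed simp
 have "(LINT x|lborel. \<bar>w x\<bar> powr q) <= (LINT x|lborel. (?k powr (1 / p) * n) powr (q - p) * \<bar>w x\<bar> powr p)"
  using mq iw pt by (intro integral_mono) (auto simp: Lp_mem_def)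
 also have "... = (?k powr (1 / p) * n) powr (q - p) * n powr p" by (simp add: np)
 also have "... = ?k powr (1 / p * (q - p)) * (n powr (q - p) * n powr p)"
  using k n by (simp add: powr_mult powr_powr)
 also have "n powr (q - p) * n powr p = n powr q" by (simp flip: powr_add)
 also have "1 / p * (q - p) = (1 / p - 1 / q) * q" using p q by (simp add: field_simps)
 also have "?k powr ((1 / p - 1 / q) * q) * n powr q = (?k powr (1 / p - 1 / q) * n) powr q"
  using k n by (simp add: powr_mult powr_powr)
 finally show "Lp_norm lborel q w <= ?k powr (1 / p - 1 / q) * Lp_norm lborel p w"
  using p q k n unfolding n_def by (subst Lp_norm_le_iff) auto
qed

text \<open>The reciprocal volume of a cube cancels the dimensional part of the modulus bound at
  \<open>l = real DIM('a) / 2 ^ j\<close>, leaving pure decay of order \<open>s\<close>.\<close>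

lemma cube_avg_error_Lp:
 fixes u :: "'a::euclidean_space => real"
 assumes u: "integrable lborel u" and p: "p > 1" and A: "modulus_bound p s A u"
 shows "Lp_mem lborel p (%x. u x - cube_avg j u x)"
  "Lp_norm lborel p (%x. u x - cube_avg j u x) <= real DIM('a) powr ((real DIM('a) + s * p) / p) * A powr (1 / p) * (2 powr (- s)) ^ j"
proof -
 let ?N = "real DIM('a)"
 let ?k = "inv_vol TYPE('a) j"
 have [measurable]: "u \<in> borel_measurable borel" using borel_measurable_integrable[OF u] by simp
 have N: "?N > 0" by simp
 have A0: "A >= 0" using A by (simp add: modulus_bound_def)
 define E where "E = ?N powr (?N + s * p) * A * (2 powr (- s)) powr (real j * p)"
 have "ennreal ?k * modulus p (?N / 2 ^ j) u <= ennreal ?k * ennreal (A * (?N / 2 ^ j) powr (?N + s * p))"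
  using A N by (intro mult_left_mono) (auto simp: modulus_bound_def)
 also have "... = ennreal (?k * (A * (?N / 2 ^ j) powr (?N + s * p)))"
  using inv_vol_pos[of j, where ?'a='a] by (simp add: ennreal_mult')
 also have "?k * (A * (?N / 2 ^ j) powr (?N + s * p)) = E"
 proof -
  have 1: "(2::real) ^ j = 2 powr real j" by (simp add: powr_realpow)
  have 2: "?k = 2 powr (real j * ?N)" by (rule inv_vol_eq_powr)
  have "(?N / 2 ^ j) powr (?N + s * p) = ?N powr (?N + s * p) * 2 powr (- (real j * (?N + s * p)))"
  proof -
   have "(?N / 2 ^ j) powr (?N + s * p) = ?N powr (?N + s * p) / (2 ^ j) powr (?N + s * p)" by (rule powr_divide)
   thus ?thesis unfolding 1 by (simp add: powr_powr powr_minus divide_inverse)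
  qed
  moreover have "2 powr (real j * ?N) * 2 powr (- (real j * (?N + s * p))) = (2 powr (- s)) powr (real j * p)"
   by (simp add: powr_powr algebra_simps flip: powr_add)
  moreover have "a * (A * (b * c)) = b * A * (a * c)" for a b c :: real by simp
  ultimately show ?thesis unfolding E_def 2 by simp
 qed
 finally have "(\<integral>\<^sup>+x. ennreal (\<bar>u x - cube_avg j u x\<bar> powr p) \<partial>lborel) <= ennreal E"
  using cube_avg_error[OF u p, of j] by simp
 moreover from this have int: "integrable lborel (%x. \<bar>u x - cube_avg j u x\<bar> powr p)"
  by (intro integrableI_nonneg) (auto intro: order.strict_trans1)
 moreover have E0: "E >= 0" using A0 by (simp add: E_def)
 ultimately have le: "(LINT x|lborel. \<bar>u x - cube_avg j u x\<bar> powr p) <= E"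
  by (subst (asm) nn_integral_eq_integral) auto
 show "Lp_mem lborel p (%x. u x - cube_avg j u x)" using int by (simp add: Lp_mem_def)
 have "Lp_norm lborel p (%x. u x - cube_avg j u x) <= E powr (1 / p)"
  using le p E0 by (subst Lp_norm_le_iff) (auto simp: powr_powr)
 also have "E powr (1 / p) = ?N powr ((?N + s * p) / p) * A powr (1 / p) * (2 powr (- s)) ^ j"
  using p A0 by (simp add: E_def powr_mult powr_powr flip: powr_realpow)
 finally show "Lp_norm lborel p (%x. u x - cube_avg j u x) <= ?N powr ((?N + s * p) / p) * A powr (1 / p) * (2 powr (- s)) ^ j" .
qed

text \<open>The increments \<open>cube_avg (j+1) u - cube_avg j u\<close> are constant on cubes of side \<open>2\<^sup>-\<^sup>j\<^sup>-\<^sup>1\<close>,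
 so passing from \<open>L\<^sup>p\<close> to \<open>L\<^sup>q\<close> costs a factor \<open>2 powr (j N (1/p - 1/q))\<close>, which is beaten by
 the decay \<open>2 powr (- j s)\<close> exactly below the critical exponent.\<close>

theorem cube_avg_error_Lq:
 assumes p: "p > 1" and q: "p <= q" and s: "s > 0" and sub: "real DIM('a::euclidean_space) * (1 / p - 1 / q) < s"
 obtains C r where "C > 0" "0 < r" "r < 1"
  "!!(u :: 'a => real) A J. integrable lborel u ==> modulus_bound p s A u ==>
    Lp_mem lborel q (%x. u x - cube_avg J u x) & Lp_norm lborel q (%x. u x - cube_avg J u x) <= C * A powr (1 / p) * r ^ J"
proof -
 let ?N = "real DIM('a)"
 define d where "d = 1 / p - 1 / q"
 have d: "d >= 0" using p q by (simp add: d_def frac_le)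
 define c where "c = ?N powr ((?N + s * p) / p)"
 have c: "c > 0" by (simp add: c_def)
 define r where "r = 2 powr (?N * d - s)"
 have r: "0 < r" "r < 1" using sub powr_less_mono[of "?N * d - s" 0 2] by (auto simp: r_def d_def)
 have s2: "2 powr (- s) < 1" using s powr_less_mono[of "- s" 0 2] by simp
 \<comment> \<open>The 2 comes from two consecutive errors, \<open>2 powr (?N * d)\<close> from the
   increment being constant only on the finer generation \<open>Suc j\<close>, and
   \<open>1 / (1 - r)\<close> from the geometric series.\<close>
 define C where "C = 2 * c * 2 powr (?N * d) / (1 - r)"
 have C: "C > 0" using c r by (simp add: C_def)
 have q1: "q > 1" using p q by simp
 have main: "Lp_mem lborel q (%x. u x - cube_avg J u x) & Lp_norm lborel q (%x. u x - cube_avg J u x) <= C * A powr (1 / p) * r ^ J"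
  if u: "integrable lborel u" and A: "modulus_bound p s A u" for u :: "'a => real" and A J
 proof -
  have [measurable]: "u \<in> borel_measurable borel" using borel_measurable_integrable[OF u] by simp
  define e where "e j = (%x. u x - cube_avg j u x)" for j
  have e: "Lp_mem lborel p (e j)" "Lp_norm lborel p (e j) <= c * A powr (1 / p) * (2 powr (- s)) ^ j" for j
   using cube_avg_error_Lp[OF u p A, of j] by (auto simp: e_def c_def)
  define w where "w j = (%x. e j x - e (Suc j) x)" for j
  have wq: "Lp_mem lborel q (w j)" "Lp_norm lborel q (w j) <= 2 * c * 2 powr (?N * d) * A powr (1 / p) * r ^ j" for j
  proof -
   have wp: "Lp_mem lborel p (w j)" unfolding w_def using p by (intro Lp_mem_diff e) auto
   have const: "w j x = w j y" if "same_cube (Suc j) x y" for x y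
    using cube_avg_const[OF that, of u] cube_avg_const[OF same_cube_Suc[OF that], of u] by (simp add: w_def e_def)
   have "Lp_norm lborel p (w j) <= Lp_norm lborel p (e j) + Lp_norm lborel p (e (Suc j))"
    using Minkowski_inequality[OF p e(1)[of j] Lp_mem_uminus[OF e(1)[of "Suc j"]]] by (simp add: w_def Lp_norm_uminus)
   also have "... <= c * A powr (1 / p) * (2 powr (- s)) ^ j + c * A powr (1 / p) * (2 powr (- s)) ^ j"
   proof (rule add_mono[OF e(2)])
    have "(2 powr (- s)) ^ Suc j <= (2 powr (- s)) ^ j" using s2 by (intro power_decreasing) auto
    hence "c * A powr (1 / p) * (2 powr (- s)) ^ Suc j <= c * A powr (1 / p) * (2 powr (- s)) ^ j"
     using c by (intro mult_left_mono) auto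
    thus "Lp_norm lborel p (e (Suc j)) <= c * A powr (1 / p) * (2 powr (- s)) ^ j"
     using e(2)[of "Suc j"] by linarith
   qed
   finally have n: "Lp_norm lborel p (w j) <= 2 * c * A powr (1 / p) * (2 powr (- s)) ^ j" by simp
   show "Lp_mem lborel q (w j)" by (rule cube_const_Lq(1)[OF p q wp const])
   have "Lp_norm lborel q (w j) <= inv_vol TYPE('a) (Suc j) powr d * Lp_norm lborel p (w j)"
    unfolding d_def by (rule cube_const_Lq(2)[OF p q wp const])
   also have "... <= inv_vol TYPE('a) (Suc j) powr d * (2 * c * A powr (1 / p) * (2 powr (- s)) ^ j)"
    using n by (intro mult_left_mono) auto
   also have "inv_vol TYPE('a) (Suc j) powr d = 2 powr (?N * d) * (2 powr (?N * d)) ^ j"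
   proof -
    have "inv_vol TYPE('a) (Suc j) powr d = 2 powr (?N * d + ?N * d * real j)"
     unfolding inv_vol_eq_powr powr_powr by (rule arg_cong[of _ _ "(powr) 2"]) (simp add: algebra_simps)
    also have "... = 2 powr (?N * d) * (2 powr (?N * d)) powr real j" unfolding powr_add powr_powr ..
    also have "(2 powr (?N * d)) powr real j = (2 powr (?N * d)) ^ j" by (rule powr_realpow) simp
    finally show ?thesis .
   qed
   also have "2 powr (?N * d) * (2 powr (?N * d)) ^ j * (2 * c * A powr (1 / p) * (2 powr (- s)) ^ j) =
     2 * c * 2 powr (?N * d) * A powr (1 / p) * (2 powr (?N * d) * 2 powr (- s)) ^ j"
    by (simp add: power_mult_distrib)
   also have "2 powr (?N * d) * 2 powr (- s) = r" by (simp add: r_def flip: powr_add)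
   finally show "Lp_norm lborel q (w j) <= 2 * c * 2 powr (?N * d) * A powr (1 / p) * r ^ j" .
  qed
  have tel: "Lp_mem lborel q (%x. e J x - e (J + n) x) &
    Lp_norm lborel q (%x. e J x - e (J + n) x) <= (\<Sum>j<n. 2 * c * 2 powr (?N * d) * A powr (1 / p) * r ^ (J + j))" for n
  proof (induction n)
   case 0
   thus ?case using q1 by (simp add: Lp_mem_def Lp_norm_def)
  next
   case (Suc n)
   have eq: "(%x. e J x - e (J + Suc n) x) = (%x. (e J x - e (J + n) x) + w (J + n) x)" by (auto simp: w_def)
   have "Lp_norm lborel q (%x. e J x - e (J + Suc n) x) <= Lp_norm lborel q (%x. e J x - e (J + n) x) + Lp_norm lborel q (w (J + n))"
    unfolding eq using Suc wq by (intro Minkowski_inequality q1) auto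
   moreover have "Lp_mem lborel q (%x. e J x - e (J + Suc n) x)" unfolding eq using Suc wq q1 by (intro Lp_mem_add) auto
   ultimately show ?case using Suc wq(2)[of "J + n"] by auto
  qed
  have "(\<Sum>j<n. 2 * c * 2 powr (?N * d) * A powr (1 / p) * r ^ (J + j)) <= C * A powr (1 / p) * r ^ J" for n
  proof -
   define B where "B = 2 * c * 2 powr (?N * d) * A powr (1 / p)"
   have B: "B >= 0" using c by (simp add: B_def)
   have "(\<Sum>j<n. B * r ^ (J + j)) = B * r ^ J * (\<Sum>j<n. r ^ j)"
    by (simp add: power_add sum_distrib_left mult.assoc)
   also have "... <= B * r ^ J * (1 / (1 - r))"
   proof (intro mult_left_mono)
    show "(\<Sum>j<n. r ^ j) <= 1 / (1 - r)" using r by (simp add: sum_gp_strict divide_right_mono)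
   qed (use B r in auto)
   also have "... = C * A powr (1 / p) * r ^ J" by (simp add: B_def C_def)
   finally show ?thesis by (simp add: B_def)
  qed
  with tel have tel': "Lp_mem lborel q (%x. e J x - e (J + n) x)" "Lp_norm lborel q (%x. e J x - e (J + n) x) <= C * A powr (1 / p) * r ^ J" for n
   by (auto intro: order_trans)
  have "(%j. c * A powr (1 / p) * (2 powr (- s)) ^ j) \<longlonglongrightarrow> c * A powr (1 / p) * 0"
   using s2 by (intro tendsto_intros LIMSEQ_power_zero) auto
  hence "(%j. Lp_norm lborel p (e j)) \<longlonglongrightarrow> 0"
   by (intro Lim_null_comparison[of "%j. Lp_norm lborel p (e j)"]) (use e(2) in auto)
  hence lim: "(%j. Lp_norm lborel p (e (J + j))) \<longlonglongrightarrow> 0"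
   using LIMSEQ_ignore_initial_segment[of _ 0 J] by (simp add: add.commute)
  \<comment> \<open>The telescoped sums miss \<open>e J\<close> by the error
    \<open>e (J + n)\<close>, which is known to vanish only in the p-th norm. An almost everywhere
    convergent subsequence and Fatou carry the bound in the q-th norm over to
    \<open>e J\<close>.\<close>
  obtain k where k: "strict_mono k" "AE x in lborel. (%n. e (J + k n) x) \<longlonglongrightarrow> 0"
   using Lp_AE_subseq[OF _ e(1) lim] p by auto
  have ae: "AE x in lborel. (%n. e J x - e (J + k n) x) \<longlonglongrightarrow> e J x"
   using k(2) by eventually_elim (auto intro!: tendsto_eq_intros)
  have "e J \<in> borel_measurable lborel" unfolding e_def by measurable
  from Lp_Fatou[OF _ tel'(1) this ae tel'(2)] q1 show ?thesis by (simp add: e_def)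
 qed
 show ?thesis by (rule that[OF C r main])
qed

section \<open>Modulus bounds from gradients and from Gagliardo kernels\<close>

lemma modulus_bound_mono:
 assumes "modulus_bound p s A u" "A <= B" shows "modulus_bound p s B u"
proof -
 have "ennreal (A * l powr (real DIM('a) + s * p)) <= ennreal (B * l powr (real DIM('a) + s * p))" for l
  using assms(2) by (intro ennreal_leI mult_right_mono) auto
 thus ?thesis using assms by (auto simp: modulus_bound_def intro: order_trans)
qed

text \<open>After substituting \<open>y = x + h\<close>, the translation estimate gives
  \<open>l powr p\<close> for each shift of length at most \<open>l\<close>. The shifts fill a ball
  contained in a cube of side \<open>2 * l\<close>, which is the source of
  \<open>2 ^ DIM('a)\<close>.\<close>

lemma modulus_bound_gradient:
 fixes u :: "'a::euclidean_space => real"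
 assumes u[measurable]: "u \<in> borel_measurable borel" and g[measurable]: "g \<in> borel_measurable borel"
  and ug: "has_weak_gradient u g" and p: "p > 1" and G: "integrable lborel (%x. norm (g x) powr p)"
 shows "modulus_bound p 1 (2 ^ DIM('a) * (LINT x|lborel. norm (g x) powr p)) u"
proof -
 define I where "I = (LINT x|lborel. norm (g x) powr p)"
 have I0: "I >= 0" by (simp add: I_def)
 have GI: "(\<integral>\<^sup>+x. ennreal (norm (g x) powr p) \<partial>lborel) = ennreal I"
  unfolding I_def by (rule nn_integral_eq_integral[OF G]) simp
 have "modulus p l u <= ennreal (2 ^ DIM('a) * I * l powr (real DIM('a) + 1 * p))" if l: "l > 0" for l
 proof -
  have "modulus p l u = (\<integral>\<^sup>+x. \<integral>\<^sup>+h. indicator {..l} (norm h) * ennreal (\<bar>u (x + h) - u x\<bar> powr p) \<partial>lborel \<partial>lborel)"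
   unfolding modulus_def
  proof (rule nn_integral_cong)
   fix x :: 'a
   have "(\<integral>\<^sup>+y. indicator {..l} (norm (x - y)) * ennreal (\<bar>u x - u y\<bar> powr p) \<partial>lborel)
    = (\<integral>\<^sup>+h. indicator {..l} (norm (x - (h + x))) * ennreal (\<bar>u x - u (h + x)\<bar> powr p) \<partial>lborel)"
    by (rule nn_integral_lborel_translation[symmetric]) measurable
   also have "... = (\<integral>\<^sup>+h. indicator {..l} (norm h) * ennreal (\<bar>u (x + h) - u x\<bar> powr p) \<partial>lborel)"
    by (intro nn_integral_cong) (simp add: add.commute abs_minus_commute)
   finally show "(\<integral>\<^sup>+y. indicator {..l} (norm (x - y)) * ennreal (\<bar>u x - u y\<bar> powr p) \<partial>lborel)
    = (\<integral>\<^sup>+h. indicator {..l} (norm h) * ennreal (\<bar>u (x + h) - u x\<bar> powr p) \<partial>lborel)" .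
  qed
  also have "... = (\<integral>\<^sup>+h. \<integral>\<^sup>+x. indicator {..l} (norm h) * ennreal (\<bar>u (x + h) - u x\<bar> powr p) \<partial>lborel \<partial>lborel)"
   by (rule lborel_pair.Fubini'[symmetric]) measurable
  also have "... <= (\<integral>\<^sup>+h. ennreal (l powr p * I) * indicator (cball (0::'a) l) h \<partial>lborel)"
  proof (rule nn_integral_mono)
   fix h :: 'a
   have "(\<integral>\<^sup>+x. indicator {..l} (norm h) * ennreal (\<bar>u (x + h) - u x\<bar> powr p) \<partial>lborel)
     = indicator {..l} (norm h) * (\<integral>\<^sup>+x. ennreal (\<bar>u (x + h) - u x\<bar> powr p) \<partial>lborel)"
    by (rule nn_integral_cmult) measurable
   also have "... <= indicator {..l} (norm h) * (ennreal (norm h powr p) * ennreal I)"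
    using weak_gradient_increment_Lp[OF u g ug p, of h] GI by (intro mult_left_mono) auto
   also have "... <= ennreal (l powr p * I) * indicator (cball 0 l) h"
    using I0 p l by (auto simp: indicator_def ennreal_mult[symmetric] intro!: ennreal_leI mult_right_mono powr_mono2)
   finally show "(\<integral>\<^sup>+x. indicator {..l} (norm h) * ennreal (\<bar>u (x + h) - u x\<bar> powr p) \<partial>lborel)
     <= ennreal (l powr p * I) * indicator (cball 0 l) h" .
  qed
  also have "... = ennreal (l powr p * I) * emeasure lborel (cball (0::'a) l)"
   by (subst nn_integral_cmult_indicator) auto
  also have "... <= ennreal (l powr p * I) * ennreal ((2 * l) ^ DIM('a))"
  proof (rule mult_left_mono)
   have "cball (0::'a) l \<subseteq> cbox (- (l *\<^sub>R One)) (l *\<^sub>R One)"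
   proof
    fix x :: 'a assume "x \<in> cball 0 l"
    hence "\<bar>x \<bullet> i\<bar> <= l" if "i \<in> Basis" for i using Basis_le_norm[OF that, of x] by simp
    thus "x \<in> cbox (- (l *\<^sub>R One)) (l *\<^sub>R One)" by (auto simp: mem_box abs_le_iff) (metis minus_le_iff)
   qed
   hence "emeasure lborel (cball (0::'a) l) <= emeasure lborel (cbox (- (l *\<^sub>R One)) (l *\<^sub>R One :: 'a))"
    by (intro emeasure_mono) auto
   also have "... = ennreal (\<Prod>i\<in>(Basis::'a set). 2 * l)"
   proof -
    have "(\<Prod>i\<in>Basis. (l *\<^sub>R One - - (l *\<^sub>R One :: 'a)) \<bullet> i) = (\<Prod>i\<in>(Basis::'a set). 2 * l)"
     by (intro prod.cong refl) (simp add: inner_add_left)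
    thus ?thesis using l by (subst emeasure_lborel_cbox) auto
   qed
   finally show "emeasure lborel (cball (0::'a) l) <= ennreal ((2 * l) ^ DIM('a))" by simp
  qed simp
  also have "... = ennreal (l powr p * I * (2 * l) ^ DIM('a))" using I0 l by (simp add: ennreal_mult)
  also have "l powr p * I * (2 * l) ^ DIM('a) = 2 ^ DIM('a) * I * l powr (real DIM('a) + 1 * p)"
   using l by (simp add: powr_add powr_realpow power_mult_distrib)
  finally show ?thesis .
 qed
 thus ?thesis using I0 by (simp add: modulus_bound_def I_def)
qed

lemma gagliardo_measurable [measurable]:
 assumes [measurable]: "u \<in> borel_measurable borel" shows "gagliardo s p u \<in> borel_measurable (borel \<Otimes>\<^sub>M borel)"
 unfolding gagliardo_def by measurable

text \<open>Where \<open>norm (x - y) <= l\<close> the denominator of the kernel is at most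
  \<open>l powr (real DIM('a) + s * p)\<close>; on the diagonal the increment is 0.\<close>

lemma modulus_bound_gagliardo:
 fixes u :: "'a::euclidean_space => real"
 assumes u[measurable]: "u \<in> borel_measurable borel" and p: "p > 1" and s: "s > 0"
  and G: "integrable lborel (gagliardo s p u)"
 shows "modulus_bound p s (LINT z|lborel. gagliardo s p u z) u"
proof -
 define I where "I = (LINT z|lborel. gagliardo s p u z)"
 let ?e = "real DIM('a) + s * p"
 have e: "?e > 0" using p s by (intro add_pos_pos) auto
 have g0: "gagliardo s p u z >= 0" for z by (cases z) (simp add: gagliardo_def)
 have I0: "I >= 0" using g0 by (simp add: I_def)
 have "(\<integral>\<^sup>+z. ennreal (gagliardo s p u z) \<partial>lborel) = ennreal I"
  unfolding I_def using g0 by (intro nn_integral_eq_integral[OF G]) simp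
 hence GI: "(\<integral>\<^sup>+z. ennreal (gagliardo s p u z) \<partial>(lborel \<Otimes>\<^sub>M lborel)) = ennreal I" by (simp add: lborel_prod)
 have "modulus p l u <= ennreal (I * l powr ?e)" if l: "l > 0" for l
 proof -
  have "modulus p l u <= (\<integral>\<^sup>+x. \<integral>\<^sup>+y. ennreal (l powr ?e) * ennreal (gagliardo s p u (x, y)) \<partial>lborel \<partial>lborel)"
   unfolding modulus_def
  proof (intro nn_integral_mono)
   fix x y :: 'a
   show "indicator {..l} (norm (x - y)) * ennreal (\<bar>u x - u y\<bar> powr p) <= ennreal (l powr ?e) * ennreal (gagliardo s p u (x, y))"
   proof (cases "norm (x - y) <= l & x ~= y")
    case True
    have "\<bar>u x - u y\<bar> powr p = norm (x - y) powr ?e * gagliardo s p u (x, y)"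
     using True by (simp add: gagliardo_def)
    also have "... <= l powr ?e * gagliardo s p u (x, y)"
     using True e g0 by (intro mult_right_mono powr_mono2) auto
    finally have "ennreal (\<bar>u x - u y\<bar> powr p) <= ennreal (l powr ?e * gagliardo s p u (x, y))" by (rule ennreal_leI)
    thus ?thesis using True g0 by (simp add: ennreal_mult)
   qed (auto simp: indicator_def)
  qed
  also have "... = (\<integral>\<^sup>+z. ennreal (l powr ?e) * ennreal (gagliardo s p u z) \<partial>(lborel \<Otimes>\<^sub>M lborel))"
   by (rule lborel.nn_integral_fst) measurable
  also have "... = ennreal (l powr ?e) * ennreal I" unfolding GI[symmetric] by (rule nn_integral_cmult) measurable
  finally show ?thesis using I0 by (simp add: ennreal_mult mult.commute)
 qed
 thus ?thesis using I0 by (simp add: modulus_bound_def I_def)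
qed

section \<open>Sobolev inequality and precompactness for functions with a modulus bound\<close>

lemma integrable_of_bounded_support:
 fixes u :: "'a::euclidean_space => real"
 assumes u: "Lp_mem lborel p u" and p: "p >= 1" and supp: "AE x in lborel. x \<notin> cball 0 R --> u x = 0"
 shows "integrable lborel u"
  "(LINT x|lborel. \<bar>u x\<bar>) <= measure lborel (cball (0::'a) R) + (LINT x|lborel. \<bar>u x\<bar> powr p)"
proof -
 have [measurable]: "u \<in> borel_measurable borel" using u by (simp add: Lp_mem_def)
 have iu: "integrable lborel (%x. \<bar>u x\<bar> powr p)" using u by (simp add: Lp_mem_def)
 have ic: "integrable lborel (indicat_real (cball (0::'a) R))"
  using emeasure_lborel_cball_finite[of "0::'a" R] by (intro integrable_real_indicator) auto
 have ae: "AE x in lborel. \<bar>u x\<bar> <= indicator (cball 0 R) x + \<bar>u x\<bar> powr p"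
  using supp
 proof eventually_elim
  case (elim x)
  have "\<bar>u x\<bar> <= 1 + \<bar>u x\<bar> powr p"
  proof (cases "\<bar>u x\<bar> <= 1")
   case False
   hence "\<bar>u x\<bar> powr 1 <= \<bar>u x\<bar> powr p" using p by (intro powr_mono) auto
   thus ?thesis using False by simp
  qed (use powr_ge_zero[of "\<bar>u x\<bar>" p] in linarith)
  thus ?case using elim by (cases "x \<in> cball 0 R") auto
 qed
 show iu1: "integrable lborel u"
  by (rule Bochner_Integration.integrable_bound[OF Bochner_Integration.integrable_add[OF ic iu]]) (use ae in auto)
 have "(LINT x|lborel. \<bar>u x\<bar>) <= (LINT x|lborel. indicator (cball 0 R) x + \<bar>u x\<bar> powr p)"
  using iu1 ic iu ae by (intro integral_mono_AE) auto
 also have "... = measure lborel (cball (0::'a) R) + (LINT x|lborel. \<bar>u x\<bar> powr p)" using ic iu by simp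
 finally show "(LINT x|lborel. \<bar>u x\<bar>) <= measure lborel (cball (0::'a) R) + (LINT x|lborel. \<bar>u x\<bar> powr p)" .
qed

text \<open>A function vanishing off \<open>cball 0 R\<close> is compared with its zero values on a disjoint ball.\<close>

lemma Poincare_modulus:
 assumes p: "p > 1" and R: "R > 0"
 obtains C where "C > 0" "!!(u :: 'a::euclidean_space => real) A. u \<in> borel_measurable borel ==> modulus_bound p s A u ==>
   (AE x in lborel. x \<notin> cball 0 R --> u x = 0) ==> Lp_mem lborel p u & (LINT x|lborel. \<bar>u x\<bar> powr p) <= C * A"
proof -
 obtain i :: 'a where i: "i \<in> Basis" using nonempty_Basis by blast
 \<comment> \<open>The ball of radius \<open>R\<close> around \<open>z\<close> stays at distance at
   least \<open>2 * R\<close> from the origin, so the function vanishes on it almost everywhere, and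
   its points are within \<open>5 * R\<close> of those of \<open>cball 0 R\<close>.\<close>
 define z where "z = (3 * R) *\<^sub>R i"
 have nz: "norm z = 3 * R" using i R by (simp add: z_def)
 define V where "V = unit_ball_vol (real DIM('a)) * R ^ DIM('a)"
 have V: "V > 0" using R by (simp add: V_def)
 have eV: "emeasure lborel (cball z R) = ennreal V" using R by (simp add: V_def emeasure_cball)
 define C where "C = (5 * R) powr (real DIM('a) + s * p) / V"
 have C: "C > 0" using V R by (simp add: C_def)
 have "Lp_mem lborel p u & (LINT x|lborel. \<bar>u x\<bar> powr p) <= C * A"
  if [measurable]: "u \<in> borel_measurable borel" and A: "modulus_bound p s A u" and supp: "AE x in lborel. x \<notin> cball 0 R --> u x = 0"
  for u :: "'a => real" and A
 proof -
  have A0: "A >= 0" using A by (simp add: modulus_bound_def)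
  have "ennreal V * (\<integral>\<^sup>+x. ennreal (\<bar>u x\<bar> powr p) \<partial>lborel) = (\<integral>\<^sup>+x. ennreal V * ennreal (\<bar>u x\<bar> powr p) \<partial>lborel)"
   by (rule nn_integral_cmult[symmetric]) measurable
  also have "... <= modulus p (5 * R) u"
   unfolding modulus_def
  proof (rule nn_integral_mono_AE)
   show "AE x in lborel. ennreal V * ennreal (\<bar>u x\<bar> powr p) <= (\<integral>\<^sup>+y. indicator {..5 * R} (norm (x - y)) * ennreal (\<bar>u x - u y\<bar> powr p) \<partial>lborel)"
    using supp
   proof eventually_elim
    case (elim x)
    show ?case
    proof (cases "x \<in> cball 0 R")
     case True
     have "ennreal V * ennreal (\<bar>u x\<bar> powr p) = (\<integral>\<^sup>+y. ennreal (\<bar>u x\<bar> powr p) * indicator (cball z R) y \<partial>lborel)"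
      by (subst nn_integral_cmult_indicator) (auto simp: eV mult.commute)
     also have "... <= (\<integral>\<^sup>+y. indicator {..5 * R} (norm (x - y)) * ennreal (\<bar>u x - u y\<bar> powr p) \<partial>lborel)"
     proof (rule nn_integral_mono_AE)
      show "AE y in lborel. ennreal (\<bar>u x\<bar> powr p) * indicator (cball z R) y <= indicator {..5 * R} (norm (x - y)) * ennreal (\<bar>u x - u y\<bar> powr p)"
       using supp
      proof eventually_elim
       case (elim y)
       show ?case
       proof (cases "y \<in> cball z R")
        case ball: True
        hence d: "norm (z - y) <= R" by (simp add: dist_norm)
        have "norm y >= 2 * R" using norm_triangle_ineq2[of z "z - y"] d nz by simp
        hence "u y = 0" using elim R by simp
        moreover have "norm (x - y) <= norm x + norm z + norm (z - y)"
         using norm_triangle_ineq4[of x y] norm_triangle_ineq4[of z "z - y"] by simp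
        hence "norm (x - y) <= 5 * R" using True d nz by simp
        ultimately show ?thesis using ball by simp
       qed simp
      qed
     qed
     finally show ?thesis .
    qed (use elim in simp)
   qed
  qed
  also have "... <= ennreal (A * (5 * R) powr (real DIM('a) + s * p))" using A R by (simp add: modulus_bound_def)
  finally have 1: "ennreal V * (\<integral>\<^sup>+x. ennreal (\<bar>u x\<bar> powr p) \<partial>lborel) <= ennreal (A * (5 * R) powr (real DIM('a) + s * p))" .
  have int: "integrable lborel (%x. \<bar>u x\<bar> powr p)"
  proof (rule integrableI_nonneg)
   have "ennreal V * (\<integral>\<^sup>+x. ennreal (\<bar>u x\<bar> powr p) \<partial>lborel) < \<infinity>" using 1 by (rule order.strict_trans1) simp
   thus "(\<integral>\<^sup>+x. ennreal (\<bar>u x\<bar> powr p) \<partial>lborel) < \<infinity>"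
    using V by (auto simp: ennreal_mult_less_top)
  qed auto
  from 1 have "ennreal (V * (LINT x|lborel. \<bar>u x\<bar> powr p)) <= ennreal (A * (5 * R) powr (real DIM('a) + s * p))"
   using V by (subst (asm) nn_integral_eq_integral[OF int]) (auto simp: ennreal_mult)
  hence "V * (LINT x|lborel. \<bar>u x\<bar> powr p) <= A * (5 * R) powr (real DIM('a) + s * p)"
   using A0 by (subst (asm) ennreal_le_iff) auto
  hence "(LINT x|lborel. \<bar>u x\<bar> powr p) <= C * A" using V by (simp add: C_def field_simps)
  thus ?thesis using int by (simp add: Lp_mem_def)
 qed
 with C that show ?thesis by blast
qed

text \<open>The function is split into its averages over cubes of generation 0 and the error. Those
  cubes have volume 1, so raising the exponent of the averages costs no factor; their p-th norm is
  controlled by \<open>Poincare_modulus\<close>.\<close>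

theorem Sobolev_modulus:
 assumes p: "p > 1" and q: "p <= q" and s: "s > 0" and sub: "real DIM('a::euclidean_space) * (1 / p - 1 / q) < s" and R: "R > 0"
 obtains C where "C > 0" "!!(u :: 'a => real) A. u \<in> borel_measurable borel ==> modulus_bound p s A u ==>
   (AE x in lborel. x \<notin> cball 0 R --> u x = 0) ==> Lp_mem lborel q u & Lp_norm lborel q u <= C * A powr (1 / p)"
proof -
 obtain C1 where C1: "C1 > 0" "!!(u :: 'a => real) A. u \<in> borel_measurable borel ==> modulus_bound p s A u ==>
   (AE x in lborel. x \<notin> cball 0 R --> u x = 0) ==> Lp_mem lborel p u & (LINT x|lborel. \<bar>u x\<bar> powr p) <= C1 * A"
  using Poincare_modulus[OF p R, where s = s] by blast
 obtain C2 r where C2: "C2 > 0" "0 < r" "r < 1"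
  "!!(u :: 'a => real) A J. integrable lborel u ==> modulus_bound p s A u ==>
    Lp_mem lborel q (%x. u x - cube_avg J u x) & Lp_norm lborel q (%x. u x - cube_avg J u x) <= C2 * A powr (1 / p) * r ^ J"
  using cube_avg_error_Lq[OF p q s sub] by blast
 define c where "c = real DIM('a) powr ((real DIM('a) + s * p) / p)"
 define C where "C = C2 + C1 powr (1 / p) + c"
 have C: "C > 0" using C1 C2 by (simp add: C_def c_def add_pos_nonneg)
 have q1: "q > 1" using p q by simp
 have "Lp_mem lborel q u & Lp_norm lborel q u <= C * A powr (1 / p)"
  if [measurable]: "u \<in> borel_measurable borel" and A: "modulus_bound p s A u" and supp: "AE x in lborel. x \<notin> cball 0 R --> u x = 0"
  for u :: "'a => real" and A
 proof -
  have A0: "A >= 0" using A by (simp add: modulus_bound_def)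
  have up: "Lp_mem lborel p u" "(LINT x|lborel. \<bar>u x\<bar> powr p) <= C1 * A" using C1(2)[OF _ A supp] by auto
  have u1: "integrable lborel u" using integrable_of_bounded_support(1)[OF up(1) _ supp] p by simp
  have n1: "Lp_norm lborel p u <= C1 powr (1 / p) * A powr (1 / p)"
   using up(2) p C1(1) A0 by (subst Lp_norm_le_iff) (auto simp: powr_powr powr_mult[symmetric])
  have e: "Lp_mem lborel p (%x. u x - cube_avg 0 u x)" "Lp_norm lborel p (%x. u x - cube_avg 0 u x) <= c * A powr (1 / p)"
   using cube_avg_error_Lp[OF u1 p A, of 0] by (auto simp: c_def)
  have a: "Lp_mem lborel p (cube_avg 0 u)" "Lp_norm lborel p (cube_avg 0 u) <= C1 powr (1 / p) * A powr (1 / p) + c * A powr (1 / p)"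
  proof -
   have eq: "cube_avg 0 u = (%x. u x + - (u x - cube_avg 0 u x))" by auto
   show "Lp_mem lborel p (cube_avg 0 u)" using Lp_mem_add[OF _ up(1) Lp_mem_uminus[OF e(1)]] p by (subst eq) simp
   have "Lp_norm lborel p (%x. u x + - (u x - cube_avg 0 u x)) <= Lp_norm lborel p u + Lp_norm lborel p (%x. - (u x - cube_avg 0 u x))"
    by (rule Minkowski_inequality[OF p up(1) Lp_mem_uminus[OF e(1)]])
   also have "Lp_norm lborel p (%x. - (u x - cube_avg 0 u x)) = Lp_norm lborel p (%x. u x - cube_avg 0 u x)"
    by (rule Lp_norm_uminus)
   finally show "Lp_norm lborel p (cube_avg 0 u) <= C1 powr (1 / p) * A powr (1 / p) + c * A powr (1 / p)"
    using n1 e(2) by simp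
  qed
  have aq: "Lp_mem lborel q (cube_avg 0 u)" by (rule cube_const_Lq(1)[OF p q a(1) cube_avg_const])
  have "Lp_norm lborel q (cube_avg 0 u) <= inv_vol TYPE('a) 0 powr (1 / p - 1 / q) * Lp_norm lborel p (cube_avg 0 u)"
   by (rule cube_const_Lq(2)[OF p q a(1) cube_avg_const])
  hence aqn: "Lp_norm lborel q (cube_avg 0 u) <= C1 powr (1 / p) * A powr (1 / p) + c * A powr (1 / p)"
   using a(2) by (simp add: inv_vol_def)
  have eq: "Lp_mem lborel q (%x. u x - cube_avg 0 u x)" "Lp_norm lborel q (%x. u x - cube_avg 0 u x) <= C2 * A powr (1 / p)"
   using C2(4)[OF u1 A, of 0] by auto
  have "Lp_mem lborel q (%x. (u x - cube_avg 0 u x) + cube_avg 0 u x)" using q1 by (intro Lp_mem_add eq aq) auto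
  moreover have "Lp_norm lborel q (%x. (u x - cube_avg 0 u x) + cube_avg 0 u x) <= C2 * A powr (1 / p) + (C1 powr (1 / p) * A powr (1 / p) + c * A powr (1 / p))"
   using Minkowski_inequality[OF q1 eq(1) aq] eq(2) aqn by linarith
  ultimately show ?thesis by (simp add: C_def distrib_right)
 qed
 with C that show ?thesis by blast
qed

text \<open>Indexes cubes by integer vectors; \<open>restrict\<close> makes the index an extensional
  function on \<open>Basis\<close>, so that counting arguments for such functions apply.\<close>

lemma cube_key: "cube j x = {y. \<forall>i\<in>Basis. \<lfloor>2 ^ j * (y \<bullet> i)\<rfloor> = restrict (%i. \<lfloor>2 ^ j * (x \<bullet> i)\<rfloor>) Basis i}"
 by (auto simp: cube_def same_cube_def)

lemma countable_cubes: "countable (\<Union>j. range (cube j :: 'a::euclidean_space => 'a set))"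
proof (intro countable_UN countableI_type)
 fix j
 let ?K = "%k. {y :: 'a. \<forall>i\<in>Basis. \<lfloor>2 ^ j * (y \<bullet> i)\<rfloor> = k i}"
 have "range (cube j :: 'a => 'a set) \<subseteq> ?K ` (PiE Basis (%_. UNIV))"
  using cube_key by (auto intro!: image_eqI)
 moreover have "countable (PiE (Basis :: 'a set) (%_. UNIV :: int set))" by (intro countable_PiE) auto
 ultimately show "countable (range (cube j :: 'a => 'a set))" by (meson countable_image countable_subset)
qed

lemma finite_cubes: "finite (cube j ` cball (0 :: 'a::euclidean_space) R)"
proof -
 let ?K = "%k. {y :: 'a. \<forall>i\<in>Basis. \<lfloor>2 ^ j * (y \<bullet> i)\<rfloor> = k i}"
 have "cube j ` cball (0 :: 'a) R \<subseteq> ?K ` (PiE Basis (%_. {\<lfloor>- (2 ^ j * R)\<rfloor>..\<lfloor>2 ^ j * R\<rfloor>}))"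
 proof
  fix Q assume "Q \<in> cube j ` cball (0 :: 'a) R"
  then obtain x :: 'a where x: "norm x <= R" "Q = cube j x" by auto
  have "restrict (%i. \<lfloor>2 ^ j * (x \<bullet> i)\<rfloor>) Basis \<in> PiE Basis (%_. {\<lfloor>- (2 ^ j * R)\<rfloor>..\<lfloor>2 ^ j * R\<rfloor>})"
  proof (intro restrict_PiE_iff[THEN iffD2] ballI)
   fix i :: 'a assume "i \<in> Basis"
   hence "\<bar>x \<bullet> i\<bar> <= R" using Basis_le_norm[of i x] x by simp
   hence "2 ^ j * (x \<bullet> i) <= 2 ^ j * R" "- (2 ^ j * R) <= 2 ^ j * (x \<bullet> i)"
    using mult_left_mono[of "x \<bullet> i" R "2 ^ j"] mult_left_mono[of "- R" "x \<bullet> i" "2 ^ j"] by auto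
   thus "\<lfloor>2 ^ j * (x \<bullet> i)\<rfloor> \<in> {\<lfloor>- (2 ^ j * R)\<rfloor>..\<lfloor>2 ^ j * R\<rfloor>}" using floor_mono by auto
  qed
  thus "Q \<in> ?K ` (PiE Basis (%_. {\<lfloor>- (2 ^ j * R)\<rfloor>..\<lfloor>2 ^ j * R\<rfloor>}))"
   unfolding x(2) cube_key by (rule imageI)
 qed
 moreover have "finite (PiE (Basis :: 'a set) (%_. {\<lfloor>- (2 ^ j * R)\<rfloor>..\<lfloor>2 ^ j * R\<rfloor>}))" by (intro finite_PiE) auto
 ultimately show ?thesis by (meson finite_imageI finite_subset)
qed

text \<open>At a fine generation the error of averaging is small for all differences at once, which
  is why a modulus bound for differences is assumed. What remains are averages over the finitely
  many cubes meeting the ball, and these converge along a diagonal subsequence.\<close>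

theorem compactness_modulus:
 fixes u :: "nat => 'a::euclidean_space => real"
 assumes p: "p > 1" and q: "p <= q" and s: "s > 0" and sub: "real DIM('a) * (1 / p - 1 / q) < s" and R: "R > 0"
  and u[measurable]: "!!n. u n \<in> borel_measurable borel" and supp: "!!n. AE x in lborel. x \<notin> cball 0 R --> u n x = 0"
  and bd: "!!n. modulus_bound p s A (u n)" and bd2: "!!n m. modulus_bound p s A (%x. u n x - u m x)"
 obtains k :: "nat => nat" where "strict_mono k" "!!e. e > 0 ==> \<exists>K. \<forall>i\<ge>K. \<forall>j\<ge>K. Lp_norm lborel q (%x. u (k i) x - u (k j) x) < e"
proof -
 have q1: "q > 1" using p q by simp
 obtain C1 where C1: "C1 > 0" "!!(u :: 'a => real) A. u \<in> borel_measurable borel ==> modulus_bound p s A u ==>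
   (AE x in lborel. x \<notin> cball 0 R --> u x = 0) ==> Lp_mem lborel p u & (LINT x|lborel. \<bar>u x\<bar> powr p) <= C1 * A"
  using Poincare_modulus[OF p R, where s = s] by blast
 obtain C2 r where C2: "C2 > 0" "0 < r" "r < 1"
  "!!(u :: 'a => real) A J. integrable lborel u ==> modulus_bound p s A u ==>
    Lp_mem lborel q (%x. u x - cube_avg J u x) & Lp_norm lborel q (%x. u x - cube_avg J u x) <= C2 * A powr (1 / p) * r ^ J"
  using cube_avg_error_Lq[OF p q s sub] by blast
 have up: "Lp_mem lborel p (u n)" "(LINT x|lborel. \<bar>u n x\<bar> powr p) <= C1 * A" for n
  using C1(2)[OF u bd supp] by auto
 have u1: "integrable lborel (u n)" for n using integrable_of_bounded_support(1)[OF up(1) _ supp] p by simp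
 define B where "B = measure lborel (cball (0::'a) R) + C1 * A"
 have uB: "(LINT x|lborel. \<bar>u n x\<bar>) <= B" for n
  using integrable_of_bounded_support(2)[OF up(1) _ supp, of n] p up(2)[of n] by (simp add: B_def)
 define I where "I n Q = (LINT x|lborel. indicator Q x * u n x)" for n and Q :: "'a set"
 have iI: "integrable lborel (%x. indicator (cube j z) x * u n x)" for n j z
  using integrable_mult_indicator[OF _ u1, of "cube j z"] by simp
 have IB: "norm (I n Q) <= B" if Q': "Q \<in> (\<Union>j. range (cube j))" for n Q
 proof -
  obtain j z where Q: "Q = cube j z" using Q' by auto
  have "norm (I n Q) <= (LINT x|lborel. norm (indicator Q x * u n x))" unfolding I_def by (rule integral_norm_bound)
  also have "... <= (LINT x|lborel. \<bar>u n x\<bar>)"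
   unfolding Q using iI[of j z n] u1[of n] by (intro integral_mono) (auto simp: indicator_def)
  finally show ?thesis using uB[of n] by linarith
 qed
 \<comment> \<open>The diagonal argument runs over the cubes of all generations, so the subsequence
   does not depend on the later tolerance \<open>e\<close>.\<close>
 obtain k where k: "strict_mono (k :: nat => nat)" "!!Q. Q \<in> (\<Union>j. range (cube j)) ==> \<exists>l. (%n. I (k n) Q) \<longlonglongrightarrow> l"
  using function_convergent_subsequence[OF countable_cubes, of I B] IB by blast
 have res: "\<exists>K. \<forall>i\<ge>K. \<forall>j\<ge>K. Lp_norm lborel q (%x. u (k i) x - u (k j) x) < e" if e: "e > 0" for e
 proof -
  have "(%J. C2 * A powr (1 / p) * r ^ J) \<longlonglongrightarrow> C2 * A powr (1 / p) * 0"
   using C2 by (intro tendsto_intros LIMSEQ_power_zero) auto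
  hence "\<forall>\<^sub>F J in sequentially. C2 * A powr (1 / p) * r ^ J < e / 2" using e by (intro order_tendstoD(2)) auto
  then obtain J where J: "C2 * A powr (1 / p) * r ^ J < e / 2" by (auto simp: eventually_sequentially)
  let ?k = "inv_vol TYPE('a) J"
  have k0: "?k > 0" by (rule inv_vol_pos)
  let ?B = "cball (0::'a) (R + real DIM('a) / 2 ^ J)"
  define V where "V = measure lborel ?B"
  have V0: "V >= 0" by (simp add: V_def)
  \<comment> \<open>Averages are bounded by \<open>?k * dlt\<close> and supported in a ball of
    measure \<open>V\<close>, so this value makes their q-th norm at most
    \<open>e / 4\<close>.\<close>
  define dlt where "dlt = e / (4 * ?k * (V powr (1 / q) + 1))"
  have den: "4 * ?k * (V powr (1 / q) + 1) > 0" using k0 by (intro mult_pos_pos add_nonneg_pos) auto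
  have dlt: "dlt > 0" using e den by (simp add: dlt_def)
  have "\<forall>Q\<in>cube J ` cball 0 R. \<exists>K. \<forall>i\<ge>K. \<forall>j\<ge>K. \<bar>I (k i) Q - I (k j) Q\<bar> < dlt"
  proof
   fix Q :: "'a set" assume "Q \<in> cube J ` cball 0 R"
   hence "Q \<in> (\<Union>j. range (cube j))" by auto
   hence "Cauchy (%n. I (k n) Q)" using k(2) LIMSEQ_imp_Cauchy by blast
   thus "\<exists>K. \<forall>i\<ge>K. \<forall>j\<ge>K. \<bar>I (k i) Q - I (k j) Q\<bar> < dlt"
    using dlt by (auto simp: Cauchy_def dist_real_def)
  qed
  from bchoice[OF this] obtain KQ where KQ: "!!Q i j. Q \<in> cube J ` cball 0 R ==> i >= KQ Q ==> j >= KQ Q ==> \<bar>I (k i) Q - I (k j) Q\<bar> < dlt"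
   by blast
  define K where "K = (\<Sum>Q\<in>cube J ` cball 0 R. KQ Q)"
  have K: "KQ Q <= K" if "Q \<in> cube J ` cball 0 R" for Q
   unfolding K_def using finite_cubes that by (intro member_le_sum) auto
  have "Lp_norm lborel q (%x. u (k i) x - u (k j) x) < e" if ij: "i >= K" "j >= K" for i j
  proof -
   define w where "w = (%x. u (k i) x - u (k j) x)"
   have [measurable]: "w \<in> borel_measurable borel" unfolding w_def by measurable
   have w1: "integrable lborel w" unfolding w_def by (intro Bochner_Integration.integrable_diff u1)
   have wsupp: "AE x in lborel. x \<notin> cball 0 R --> w x = 0"
    using supp[of "k i"] supp[of "k j"] by eventually_elim (simp add: w_def)
   have wA: "modulus_bound p s A w" unfolding w_def by (rule bd2)
   have e1: "Lp_mem lborel q (%x. w x - cube_avg J w x)" "Lp_norm lborel q (%x. w x - cube_avg J w x) < e / 2"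
    using C2(4)[OF w1 wA, of J] J by auto
   have avg: "\<bar>cube_avg J w x\<bar> <= ?k * dlt * indicator ?B x" for x
   proof (cases "\<exists>y\<in>cball 0 R. same_cube J x y")
    case True
    then obtain y where y: "y \<in> cball 0 R" "same_cube J x y" by blast
    have "norm x <= norm y + norm (x - y)" using norm_triangle_ineq[of y "x - y"] by simp
    hence xB: "x \<in> ?B" using y same_cube_norm[OF y(2)] by simp
    have Q: "cube J x \<in> cube J ` cball 0 R" using cube_eq[OF y(2)] y(1) by auto
    have "(LINT y|lborel. indicator (cube J x) y * w y) = I (k i) (cube J x) - I (k j) (cube J x)"
     unfolding I_def w_def using iI by (simp add: right_diff_distrib)
    hence "\<bar>\<integral>y. indicator (cube J x) y * w y \<partial>lborel\<bar> <= dlt"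
     using KQ[OF Q, of i j] K[OF Q] ij by simp
    hence "?k * \<bar>\<integral>y. indicator (cube J x) y * w y \<partial>lborel\<bar> <= ?k * dlt" using k0 by (intro mult_left_mono) auto
    thus ?thesis using xB k0 by (simp add: cube_avg_def abs_mult)
   next
    case False
    have "(LINT y|lborel. indicator (cube J x) y * w y) = 0"
    proof (rule integral_eq_zero_AE)
     show "AE y in lborel. indicator (cube J x) y * w y = 0"
      using wsupp by eventually_elim (use False in \<open>auto simp: indicator_def cube_def\<close>)
    qed
    thus ?thesis using k0 dlt by (simp add: cube_avg_def)
   qed
   have iB: "integrable lborel (indicat_real ?B)"
    using emeasure_lborel_cball_finite[of "0::'a" "R + real DIM('a) / 2 ^ J"] by (intro integrable_real_indicator) auto
   have pt: "\<bar>cube_avg J w x\<bar> powr q <= (?k * dlt) powr q * indicat_real ?B x" for x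
   proof (cases "x \<in> ?B")
    case True
    thus ?thesis using avg[of x] q1 by (auto intro: powr_mono2)
   qed (use avg[of x] in simp)
   have a: "Lp_mem lborel q (cube_avg J w)"
    unfolding Lp_mem_def
   proof
    show "integrable lborel (%x. norm (cube_avg J w x) powr q)"
     by (rule Bochner_Integration.integrable_bound[OF integrable_mult_right[OF iB, of "(?k * dlt) powr q"]]) (use pt in auto)
   qed measurable
   have "(LINT x|lborel. \<bar>cube_avg J w x\<bar> powr q) <= (LINT x|lborel. (?k * dlt) powr q * indicat_real ?B x)"
    using a pt iB by (intro integral_mono) (auto simp: Lp_mem_def)
   also have "... = (?k * dlt) powr q * V" using iB by (simp add: V_def)
   also have "... = (?k * dlt * V powr (1 / q)) powr q" using k0 dlt V0 q1 by (simp add: powr_mult powr_powr)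
   finally have "Lp_norm lborel q (cube_avg J w) <= ?k * dlt * V powr (1 / q)"
    using q1 k0 dlt by (subst Lp_norm_le_iff) auto
   also have "... <= ?k * dlt * (V powr (1 / q) + 1)" using k0 dlt by (intro mult_left_mono) auto
   also have "... = e / 4" using den k0 by (simp add: dlt_def field_simps)
   finally have an: "Lp_norm lborel q (cube_avg J w) <= e / 4" .
   have "Lp_norm lborel q (%x. (w x - cube_avg J w x) + cube_avg J w x) < e"
    using Minkowski_inequality[OF q1 e1(1) a] e1(2) an e by linarith
   thus ?thesis by (simp add: w_def)
  qed
  thus ?thesis by blast
 qed
 show ?thesis by (rule that[OF k(1)]) (rule res)
qed

section \<open>The energy space\<close>

text \<open>The pointwise structure lets the abstract locales, which work on subspaces of a real
  vector space, be applied directly to sets of functions.\<close>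

instantiation "fun" :: (type, real_vector) real_vector
begin
definition scaleR_fun where "scaleR_fun r f = (%x. r *\<^sub>R f x)"
instance
 by standard (auto simp: scaleR_fun_def fun_eq_iff scaleR_add_right scaleR_add_left)
end

section \<open>Both kinds of seminorm as instances of \<open>p_form\<close>\<close>

lemma AE_lborel_fst_snd:
 fixes P :: "'a::euclidean_space => bool"
 assumes "AE x in lborel. P x"
 shows "AE z in lborel. P (fst (z :: 'a \<times> 'a)) & P (snd z)"
proof -
 obtain A where A: "A \<in> null_sets lborel" "{x. ~ P x} \<subseteq> A" using assms by (auto simp: eventually_ae_filter)
 have "emeasure (lborel \<Otimes>\<^sub>M lborel) (A \<times> (UNIV :: 'a set)) = 0" "emeasure (lborel \<Otimes>\<^sub>M lborel) ((UNIV :: 'a set) \<times> A) = 0"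
  using A by (auto simp: lborel.emeasure_pair_measure_Times null_sets_def)
 hence "A \<times> (UNIV :: 'a set) \<in> null_sets lborel" "(UNIV :: 'a set) \<times> A \<in> null_sets lborel"
  using A by (auto simp: null_sets_def lborel_prod borel_prod[symmetric])
 hence "AE z in lborel. z \<notin> A \<times> (UNIV :: 'a set)" "AE z in lborel. z \<notin> (UNIV :: 'a set) \<times> A"
  by (auto intro: AE_not_in)
 thus ?thesis by eventually_elim (use A in auto)
qed

lemma AE_lebesgue_iff: "(AE x in lebesgue. P x) \<longleftrightarrow> (AE x in lborel. P (x :: 'a::euclidean_space))"
 by (rule AE_completion_iff)

lemma lebesgue_measurable_fst_snd:
 fixes u :: "'a::euclidean_space => real"
 assumes "u \<in> borel_measurable lebesgue"
 shows "(%z :: 'a \<times> 'a. u (fst z)) \<in> borel_measurable lebesgue" "(%z :: 'a \<times> 'a. u (snd z)) \<in> borel_measurable lebesgue"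
proof -
 obtain v where v[measurable]: "v \<in> borel_measurable borel" and uv: "AE x in lborel. u x = v x"
  using lebesgue_Borel_representative[OF assms] by blast
 have "AE z in lebesgue. v (fst z) = u (fst z) & v (snd z) = u (snd (z :: 'a \<times> 'a))"
  unfolding AE_lebesgue_iff using AE_lborel_fst_snd[OF uv] by eventually_elim auto
 moreover have "(%z :: 'a \<times> 'a. v (fst z)) \<in> borel_measurable lebesgue" "(%z :: 'a \<times> 'a. v (snd z)) \<in> borel_measurable lebesgue"
  by (intro borel_imp_lebesgue_measurable, simp add: borel_prod[symmetric])+
 ultimately show "(%z :: 'a \<times> 'a. u (fst z)) \<in> borel_measurable lebesgue" "(%z :: 'a \<times> 'a. u (snd z)) \<in> borel_measurable lebesgue"
  using borel_measurable_AE[of "%z :: 'a \<times> 'a. v (fst z)" "%z. u (fst z)"] borel_measurable_AE[of "%z :: 'a \<times> 'a. v (snd z)" "%z. u (snd z)"]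
  by auto
qed

text \<open>The p-th root of the Gagliardo weight is divided out, so that this quotient depends
  linearly on \<open>u\<close> and the p-th power of its modulus is
  \<open>gagliardo s p u\<close>.\<close>

definition quotient_sp :: "real => real => ('a::euclidean_space => real) => 'a \<times> 'a => real" where
 "quotient_sp s p u = (%(x, y). (u x - u y) / norm (x - y) powr ((real DIM('a) + s * p) / p))"

lemma quotient_sp_powr: "p > 0 ==> \<bar>quotient_sp s p u z\<bar> powr p = gagliardo s p u z"
 by (cases z) (simp add: quotient_sp_def gagliardo_def abs_divide powr_divide powr_powr)

definition dom_sp :: "real => real => ('a::euclidean_space => real) set" where
 "dom_sp s p = {u \<in> borel_measurable lebesgue. finite_seminorm s p u}"

lemma quotient_sp_measurable:
 assumes "u \<in> borel_measurable lebesgue" shows "quotient_sp s p u \<in> borel_measurable lebesgue"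
proof -
 have "(%z :: 'a \<times> 'a. norm (fst z - snd z) powr ((real DIM('a) + s * p) / p)) \<in> borel_measurable lebesgue"
  by (intro borel_imp_lebesgue_measurable) (simp add: borel_prod[symmetric])
 thus ?thesis unfolding quotient_sp_def case_prod_unfold
  by (intro borel_measurable_divide borel_measurable_diff lebesgue_measurable_fst_snd assms)
qed

lemma dom_sp_frac_iff:
 assumes "0 < s" "s < 1" "p > 1"
 shows "u \<in> dom_sp s p \<longleftrightarrow> u \<in> borel_measurable lebesgue & Lp_mem lebesgue p (quotient_sp s p u)"
 using assms quotient_sp_measurable[of u s p] quotient_sp_powr[of p s u]
 by (auto simp: dom_sp_def finite_seminorm_def Lp_mem_def)

lemma dom_sp_grad_iff:
 "u \<in> dom_sp 1 p \<longleftrightarrow> u \<in> borel_measurable lebesgue & (\<exists>g. has_weak_gradient u g & Lp_mem lebesgue p g)"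
proof
 assume u: "u \<in> dom_sp 1 p"
 then obtain g where "has_weak_gradient u g" by (auto simp: dom_sp_def finite_seminorm_def)
 hence w: "has_weak_gradient u (weak_gradient u)" by (rule weak_gradient_works)
 hence "Lp_mem lebesgue p (weak_gradient u)"
  using u by (auto simp: dom_sp_def finite_seminorm_def Lp_mem_def has_weak_gradient_def intro: locally_integrable_measurable)
 with w u show "u \<in> borel_measurable lebesgue & (\<exists>g. has_weak_gradient u g & Lp_mem lebesgue p g)"
  by (auto simp: dom_sp_def)
next
 assume "u \<in> borel_measurable lebesgue & (\<exists>g. has_weak_gradient u g & Lp_mem lebesgue p g)"
 then obtain g where u: "u \<in> borel_measurable lebesgue" and g: "has_weak_gradient u g" "Lp_mem lebesgue p g" by blast
 have "weak_gradient u \<in> borel_measurable lebesgue"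
  using weak_gradient_works[OF g(1)] by (auto simp: has_weak_gradient_def intro: locally_integrable_measurable)
 hence "Lp_mem lebesgue p (weak_gradient u)"
  using Lp_mem_cong_AE[of "weak_gradient u" lebesgue g p] g weak_gradient_AE_eq[OF g(1)] by (auto simp: Lp_mem_def)
 thus "u \<in> dom_sp 1 p" using u g by (auto simp: dom_sp_def finite_seminorm_def Lp_mem_def)
qed

lemma dom_sp_gradD:
 assumes "u \<in> dom_sp 1 p"
 shows "has_weak_gradient u (weak_gradient u)" "Lp_mem lebesgue p (weak_gradient u)"
proof -
 obtain g where g: "has_weak_gradient u g" using assms by (auto simp: dom_sp_grad_iff)
 show w: "has_weak_gradient u (weak_gradient u)" by (rule weak_gradient_works[OF g])
 thus "Lp_mem lebesgue p (weak_gradient u)"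
  using assms by (auto simp: dom_sp_def finite_seminorm_def Lp_mem_def has_weak_gradient_def intro: locally_integrable_measurable)
qed

lemma frac_const_pos: "0 < s ==> s < 1 ==> p > 1 ==> N >= 1 ==> frac_const N s p > 0"
proof -
 assume a: "0 < s" "s < 1" "p > 1" "N >= 1"
 have "0 < p * s" "real N >= 1" using a by auto
 have "0 < p + real N - 2" using \<open>real N >= 1\<close> a(3) by linarith
 with \<open>0 < p * s\<close> have "0 < p * s + (p + real N - 2)" by (rule add_pos_pos)
 hence "0 < (p * s + p + real N - 2) / 2" by (simp add: algebra_simps)
 thus ?thesis
  unfolding frac_const_def using a(1,2) by (intro divide_pos_pos mult_pos_pos Gamma_real_pos) auto
qed

lemma quotient_sp_add: "quotient_sp s p (u + v) z = quotient_sp s p u z + quotient_sp s p v z"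
 by (cases z) (simp add: quotient_sp_def add_divide_distrib[symmetric])

lemma quotient_sp_scale: "quotient_sp s p (r *\<^sub>R u) z = r *\<^sub>R quotient_sp s p u z"
 by (cases z) (simp add: quotient_sp_def scaleR_fun_def algebra_simps)

lemma p_form_frac:
 assumes s: "0 < s" "s < 1" and p: "p > 1"
 shows "p_form lebesgue (quotient_sp s p :: ('a::euclidean_space => real) => _) p (frac_const DIM('a) s p) (dom_sp s p)"
proof
 show "1 < p" by (rule p)
 show "0 < frac_const DIM('a) s p" using s p by (intro frac_const_pos) auto
 note iff = dom_sp_frac_iff[OF s p]
 show "subspace (dom_sp s p :: ('a => real) set)"
  unfolding subspace_def
 proof (intro conjI ballI allI)
  have "quotient_sp s p (0 :: 'a => real) = (%z. 0)" by (auto simp: quotient_sp_def)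
  thus "(0 :: 'a => real) \<in> dom_sp s p" unfolding iff by (simp add: Lp_mem_def zero_fun_def)
 next
  fix u v :: "'a => real" assume "u \<in> dom_sp s p" "v \<in> dom_sp s p"
  moreover have "quotient_sp s p (u + v) = (%z. quotient_sp s p u z + quotient_sp s p v z)" by (rule ext) (rule quotient_sp_add)
  ultimately show "u + v \<in> dom_sp s p"
   using Lp_mem_add[of p lebesgue "quotient_sp s p u" "quotient_sp s p v"] p unfolding iff by (auto simp: plus_fun_def)
 next
  fix r and u :: "'a => real" assume u: "u \<in> dom_sp s p"
  have "quotient_sp s p (r *\<^sub>R u) = (%z. r *\<^sub>R quotient_sp s p u z)" by (rule ext) (rule quotient_sp_scale)
  thus "r *\<^sub>R u \<in> dom_sp s p"
   using u Lp_mem_scaleR[of lebesgue p "quotient_sp s p u" r] unfolding iff by (auto simp: scaleR_fun_def)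
 qed
 fix u v :: "'a => real" and r :: real assume u: "u \<in> dom_sp s p"
 thus "Lp_mem lebesgue p (quotient_sp s p u)" by (simp add: iff)
 show "AE x in lebesgue. quotient_sp s p (u + v) x = quotient_sp s p u x + quotient_sp s p v x"
  by (simp add: quotient_sp_add)
 show "AE x in lebesgue. quotient_sp s p (r *\<^sub>R u) x = r *\<^sub>R quotient_sp s p u x"
  by (simp only: quotient_sp_scale) simp
qed

lemma p_form_grad:
 assumes p: "p > 1"
 shows "p_form lebesgue (weak_gradient :: ('a::euclidean_space => real) => _) p 1 (dom_sp 1 p)"
proof
 show "1 < p" by (rule p)
 show "(0::real) < 1" by simp
 have p0: "p > 0" using p by simp
 have A: "has_weak_gradient (u + v) (%x. weak_gradient u x + weak_gradient v x)" "Lp_mem lebesgue p (%x. weak_gradient u x + weak_gradient v x)"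
   "u + v \<in> borel_measurable lebesgue"
  if "u \<in> dom_sp 1 p" "v \<in> dom_sp 1 p" for u v :: "'a => real"
  using has_weak_gradient_add[OF dom_sp_gradD(1)[OF that(1)] dom_sp_gradD(1)[OF that(2)]]
   Lp_mem_add[OF p0 dom_sp_gradD(2)[OF that(1)] dom_sp_gradD(2)[OF that(2)]] that
  by (auto simp: plus_fun_def dom_sp_def)
 have S: "has_weak_gradient (r *\<^sub>R u) (%x. r *\<^sub>R weak_gradient u x)" "Lp_mem lebesgue p (%x. r *\<^sub>R weak_gradient u x)"
   "r *\<^sub>R u \<in> borel_measurable lebesgue"
  if "u \<in> dom_sp 1 p" for u :: "'a => real" and r
  using has_weak_gradient_scale[OF dom_sp_gradD(1)[OF that], of r] Lp_mem_scaleR[OF dom_sp_gradD(2)[OF that], of r] that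
  by (auto simp: scaleR_fun_def dom_sp_def)
 show "subspace (dom_sp 1 p :: ('a => real) set)"
  unfolding subspace_def
 proof (intro conjI ballI allI)
  have "has_weak_gradient (%x :: 'a. 0) (classical_gradient (%x. 0))"
   by (rule has_weak_gradient_test_function[OF test_functions_0[of UNIV]])
  moreover have "classical_gradient (%x :: 'a. 0) = (%x. 0)" by (auto simp: classical_gradient_def)
  ultimately show "(0 :: 'a => real) \<in> dom_sp 1 p" by (auto simp: dom_sp_grad_iff zero_fun_def Lp_mem_def)
 next
  fix u v :: "'a => real" assume "u \<in> dom_sp 1 p" "v \<in> dom_sp 1 p"
  from A[OF this] show "u + v \<in> dom_sp 1 p" unfolding dom_sp_grad_iff by blast
 next
  fix r and u :: "'a => real" assume "u \<in> dom_sp 1 p"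
  from S[OF this, of r] show "r *\<^sub>R u \<in> dom_sp 1 p" unfolding dom_sp_grad_iff by blast
 qed
 fix u v :: "'a => real" and r :: real assume u: "u \<in> dom_sp 1 p"
 thus "Lp_mem lebesgue p (weak_gradient u)" by (rule dom_sp_gradD)
 show "AE x in lebesgue. weak_gradient (r *\<^sub>R u) x = r *\<^sub>R weak_gradient u x"
  by (rule weak_gradient_AE_eq[OF S(1)[OF u]])
 assume v: "v \<in> dom_sp 1 p"
 show "AE x in lebesgue. weak_gradient (u + v) x = weak_gradient u x + weak_gradient v x"
  by (rule weak_gradient_AE_eq[OF A(1)[OF u v]])
qed

lemma seminorm_frac_eq:
 assumes s: "0 < s" "s < 1" and p: "p > 1"
 shows "seminorm_sp s p (u :: 'a::euclidean_space => real) = p_form.nrm lebesgue (quotient_sp s p) p (frac_const DIM('a) s p) u"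
proof -
 have "(LINT z|lebesgue. gagliardo s p u z) >= 0" by (rule Bochner_Integration.integral_nonneg) (auto simp: gagliardo_def split: prod.splits)
 moreover have "frac_const DIM('a) s p > 0" using s p by (intro frac_const_pos) auto
 ultimately show ?thesis using s p
  by (simp add: p_form.nrm_def[OF p_form_frac[OF s p]] seminorm_sp_def Lp_norm_def quotient_sp_powr powr_mult)
qed

lemma form_frac_eq:
 assumes s: "0 < s" "s < 1" and p: "p > 1"
 shows "form_sp \<Omega> s p (u :: 'a::euclidean_space => real) v = p_form.frm lebesgue (quotient_sp s p) p (frac_const DIM('a) s p) u v"
proof -
 let ?e = "real DIM('a) + s * p"
 have "pmap p (quotient_sp s p u (x, y)) \<bullet> quotient_sp s p v (x, y) =
   \<bar>u x - u y\<bar> powr (p - 2) * (u x - u y) * (v x - v y) / norm (x - y) powr ?e" for x y :: 'a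
 proof (cases "x = y")
  case False
  define n where "n = norm (x - y) powr (?e / p)"
  have n: "n > 0" using False by (simp add: n_def)
  have np: "norm (x - y) powr ?e = n powr p" using p by (simp add: n_def powr_powr)
  have "n powr p = n powr (p - 2) * n powr 2" by (simp flip: powr_add)
  also have "n powr 2 = n * n" using n by (simp add: power2_eq_square)
  finally have *: "n powr p = n powr (p - 2) * (n * n)" .
  show ?thesis using n
   by (simp add: np quotient_sp_def pmap_def abs_divide powr_divide * flip: n_def)
 qed (simp add: quotient_sp_def)
 hence "(LINT z|lebesgue. pmap p (quotient_sp s p u z) \<bullet> quotient_sp s p v z) =
   (\<integral>(x, y). \<bar>u x - u y\<bar> powr (p - 2) * (u x - u y) * (v x - v y) / norm (x - y) powr ?e \<partial>lebesgue)"
  by (intro Bochner_Integration.integral_cong) auto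
 thus ?thesis using s
  by (simp add: p_form.frm_def[OF p_form_frac[OF s p]] form_sp_def)
qed

lemma seminorm_grad_eq:
 assumes p: "p > 1"
 shows "seminorm_sp 1 p u = p_form.nrm lebesgue weak_gradient p 1 u"
 by (simp add: p_form.nrm_def[OF p_form_grad[OF p]] seminorm_sp_def Lp_norm_def)

lemma form_grad_eq:
 assumes p: "p > 1"
 shows "form_sp UNIV 1 p u v = p_form.frm lebesgue weak_gradient p 1 u v"
 by (simp add: p_form.frm_def[OF p_form_grad[OF p]] form_sp_def pmap_def lebesgue_on_UNIV_eq)

text \<open>Facts shared by orders below 1 and order 1, each read off from the corresponding
  instance of \<open>p_form\<close>. The forms are taken with \<open>UNIV\<close>, since the
  instances integrate over the whole space.\<close>

context
 fixes s p :: real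
 assumes s: "0 < s" "s <= 1" and p: "p > 1"
begin

lemmas frac = p_form_frac[OF s(1) _ p] and grad = p_form_grad[OF p]
lemmas eqs = seminorm_frac_eq[OF s(1) _ p] form_frac_eq[OF s(1) _ p] seminorm_grad_eq[OF p] form_grad_eq[OF p]

lemma dom_sp_subspace: "subspace (dom_sp s p :: ('a::euclidean_space => real) set)"
 using p_form.X[OF frac] p_form.X[OF grad] s by (cases "s = 1") auto

lemma seminorm_sp_nonneg: "seminorm_sp s p u >= 0"
 by (simp add: seminorm_sp_def)

lemma seminorm_sp_add:
 fixes u :: "'a::euclidean_space => real"
 assumes "u \<in> dom_sp s p" "v \<in> dom_sp s p" shows "seminorm_sp s p (u + v) <= seminorm_sp s p u + seminorm_sp s p v"
proof (cases "s = 1")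
 case True
 thus ?thesis using p_form.nrm_add[OF grad, of u v] assms by (simp add: eqs)
next
 case False
 hence "s < 1" using s by simp
 thus ?thesis using p_form.nrm_add[OF frac, of u v] assms by (simp add: eqs)
qed

lemma seminorm_sp_scale:
 fixes u :: "'a::euclidean_space => real"
 assumes "u \<in> dom_sp s p" shows "seminorm_sp s p (r *\<^sub>R u) = \<bar>r\<bar> * seminorm_sp s p u"
proof (cases "s = 1")
 case True
 thus ?thesis using p_form.nrm_scale[OF grad, of u] assms by (simp add: eqs)
next
 case False
 hence "s < 1" using s by simp
 thus ?thesis using p_form.nrm_scale[OF frac, of u] assms by (simp add: eqs)
qed

lemma form_sp_add:
 fixes u :: "'a::euclidean_space => real"
 assumes "u \<in> dom_sp s p" "v \<in> dom_sp s p" "w \<in> dom_sp s p"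
 shows "form_sp UNIV s p u (v + w) = form_sp UNIV s p u v + form_sp UNIV s p u w"
proof (cases "s = 1")
 case True
 thus ?thesis using p_form.frm_add[OF grad, of u v w] assms by (simp add: eqs)
next
 case False
 hence "s < 1" using s by simp
 thus ?thesis using p_form.frm_add[OF frac, of u v w] assms by (simp add: eqs)
qed

lemma form_sp_scale:
 fixes u :: "'a::euclidean_space => real"
 assumes "u \<in> dom_sp s p" "v \<in> dom_sp s p"
 shows "form_sp UNIV s p u (r *\<^sub>R v) = r * form_sp UNIV s p u v"
proof (cases "s = 1")
 case True
 thus ?thesis using p_form.frm_scale[OF grad, of u v] assms by (simp add: eqs)
next
 case False
 hence "s < 1" using s by simp
 thus ?thesis using p_form.frm_scale[OF frac, of u v] assms by (simp add: eqs)
qed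

lemma form_sp_self:
 fixes u :: "'a::euclidean_space => real"
 shows "form_sp UNIV s p u u = seminorm_sp s p u powr p / 2"
proof (cases "s = 1")
 case True
 thus ?thesis using p_form.frm_self[OF grad, of u] by (simp add: eqs)
next
 case False
 hence "s < 1" using s by simp
 thus ?thesis using p_form.frm_self[OF frac, of u] by (simp add: eqs)
qed

lemma form_sp_bound:
 fixes u :: "'a::euclidean_space => real"
 assumes "u \<in> dom_sp s p" "v \<in> dom_sp s p"
 shows "\<bar>form_sp UNIV s p u v\<bar> <= seminorm_sp s p u powr (p - 1) * seminorm_sp s p v"
proof (cases "s = 1")
 case True
 thus ?thesis using p_form.frm_bound[OF grad, of u v] assms by (simp add: eqs)
next
 case False
 hence "s < 1" using s by simp
 thus ?thesis using p_form.frm_bound[OF frac, of u v] assms by (simp add: eqs)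
qed

lemma form_sp_continuous:
 fixes u :: "'a::euclidean_space => real"
 assumes "u \<in> dom_sp s p" "e > 0"
 shows "\<exists>d>0. \<forall>v\<in>dom_sp s p. \<forall>h\<in>dom_sp s p. seminorm_sp s p (v - u) < d -->
  \<bar>form_sp UNIV s p v h - form_sp UNIV s p u h\<bar> <= e * seminorm_sp s p h"
proof (cases "s = 1")
 case True
 obtain d where "d > 0" "!!v h. v \<in> dom_sp s p ==> h \<in> dom_sp s p ==> seminorm_sp s p (v - u) < d ==>
  \<bar>form_sp UNIV s p v h - form_sp UNIV s p u h\<bar> <= e * seminorm_sp s p h"
  using p_form.frm_continuous[OF grad, of u e] assms True by (auto simp: eqs)
 thus ?thesis by blast
next
 case False
 hence s1: "s < 1" using s by simp
 obtain d where "d > 0" "!!v h. v \<in> dom_sp s p ==> h \<in> dom_sp s p ==> seminorm_sp s p (v - u) < d ==>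
  \<bar>form_sp UNIV s p v h - form_sp UNIV s p u h\<bar> <= e * seminorm_sp s p h"
  using p_form.frm_continuous[OF frac[OF s1], of u e] assms s1 by (auto simp: eqs)
 thus ?thesis by blast
qed

lemma seminorm_sp_frechet:
 fixes u :: "'a::euclidean_space => real"
 assumes "u \<in> dom_sp s p" "e > 0"
 shows "\<exists>d>0. \<forall>h\<in>dom_sp s p. seminorm_sp s p h < d -->
  \<bar>seminorm_sp s p (u + h) powr p / (2 * p) - seminorm_sp s p u powr p / (2 * p) - form_sp UNIV s p u h\<bar> <= e * seminorm_sp s p h"
proof (cases "s = 1")
 case True
 obtain d where "d > 0" "!!h. h \<in> dom_sp s p ==> seminorm_sp s p h < d ==>
  \<bar>seminorm_sp s p (u + h) powr p / (2 * p) - seminorm_sp s p u powr p / (2 * p) - form_sp UNIV s p u h\<bar> <= e * seminorm_sp s p h"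
  using p_form.nrm_frechet[OF grad, of u e] assms True by (auto simp: eqs)
 thus ?thesis by blast
next
 case False
 hence s1: "s < 1" using s by simp
 obtain d where "d > 0" "!!h. h \<in> dom_sp s p ==> seminorm_sp s p h < d ==>
  \<bar>seminorm_sp s p (u + h) powr p / (2 * p) - seminorm_sp s p u powr p / (2 * p) - form_sp UNIV s p u h\<bar> <= e * seminorm_sp s p h"
  using p_form.nrm_frechet[OF frac[OF s1], of u e] assms s1 by (auto simp: eqs)
 thus ?thesis by blast
qed

lemma form_sp_monotone:
 fixes u :: "'a::euclidean_space => real"
 assumes "u \<in> dom_sp s p" "v \<in> dom_sp s p"
 shows "form_sp UNIV s p u (u - v) - form_sp UNIV s p v (u - v) >= 0"
proof (cases "s = 1")
 case True
 thus ?thesis using p_form.frm_monotone(3)[OF grad, of u v] assms by (simp add: eqs)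
next
 case False
 hence "s < 1" using s by simp
 thus ?thesis using p_form.frm_monotone(3)[OF frac, of u v] assms by (simp add: eqs)
qed

lemma form_sp_S_plus:
 assumes "B > 0" "e > 0"
 shows "\<exists>d>0. \<forall>u\<in>dom_sp s p. \<forall>v\<in>dom_sp s p. seminorm_sp s p (u :: 'a::euclidean_space => real) <= B --> seminorm_sp s p v <= B -->
  form_sp UNIV s p u (u - v) - form_sp UNIV s p v (u - v) < d --> seminorm_sp s p (u - v) < e"
proof (cases "s = 1")
 case True
 obtain d where "d > 0" "!!u v :: 'a => real. u \<in> dom_sp s p ==> v \<in> dom_sp s p ==> seminorm_sp s p u <= B ==> seminorm_sp s p v <= B ==>
  form_sp UNIV s p u (u - v) - form_sp UNIV s p v (u - v) < d ==> seminorm_sp s p (u - v) < e"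
  using p_form.frm_S_plus[OF grad, of B e] assms True by (auto simp: eqs)
 thus ?thesis by blast
next
 case False
 hence s1: "s < 1" using s by simp
 obtain d where "d > 0" "!!u v :: 'a => real. u \<in> dom_sp s p ==> v \<in> dom_sp s p ==> seminorm_sp s p u <= B ==> seminorm_sp s p v <= B ==>
  form_sp UNIV s p u (u - v) - form_sp UNIV s p v (u - v) < d ==> seminorm_sp s p (u - v) < e"
  using p_form.frm_S_plus[OF frac[OF s1], of B e] assms s1 by (auto simp: eqs)
 thus ?thesis by blast
qed

end

section \<open>Finite seminorms of test functions\<close>

lemma nn_integral_norm_indicator:
 fixes l :: real and x :: "'a::euclidean_space"
 assumes "l > 0"
 shows "(\<integral>\<^sup>+y. indicator {..l} (norm (x - y)) \<partial>lborel) = ennreal (unit_ball_vol (real DIM('a)) * l ^ DIM('a))"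
proof -
 have "(\<integral>\<^sup>+y. indicator {..l} (norm (x - y)) \<partial>lborel) = (\<integral>\<^sup>+y. indicator (cball x l) y \<partial>lborel)"
  by (intro nn_integral_cong) (auto simp: indicator_def dist_norm)
 thus ?thesis using assms by (simp add: emeasure_cball)
qed

text \<open>Here \<open>\<bar>u x - u y\<bar>\<close> is simply bounded by
  \<open>\<bar>u x\<bar> + \<bar>u y\<bar>\<close>; the two halves agree by symmetry. Growth of
  order \<open>l ^ DIM('a)\<close> is what large distances need, where the gradient bound grows too
  fast.\<close>

lemma modulus_le_Lp:
 fixes u :: "'a::euclidean_space => real"
 assumes u: "Lp_mem lborel p u" and p: "p > 0" and l: "l > 0"
 shows "modulus p l u <= ennreal (2 * 2 powr p * unit_ball_vol (real DIM('a)) * (LINT x|lborel. \<bar>u x\<bar> powr p) * l ^ DIM('a))"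
proof -
 have [measurable]: "u \<in> borel_measurable borel" using u by (simp add: Lp_mem_def)
 define I where "I = (LINT x|lborel. \<bar>u x\<bar> powr p)"
 have I0: "I >= 0" by (simp add: I_def)
 have I: "(\<integral>\<^sup>+x. ennreal (\<bar>u x\<bar> powr p) \<partial>lborel) = ennreal I"
  unfolding I_def using u by (intro nn_integral_eq_integral) (auto simp: Lp_mem_def)
 define V where "V = unit_ball_vol (real DIM('a)) * l ^ DIM('a)"
 have V0: "V >= 0" using l by (simp add: V_def)
 let ?i = "%x y :: 'a. indicator {..l} (norm (x - y)) :: ennreal"
 have half: "(\<integral>\<^sup>+x. \<integral>\<^sup>+y. ?i x y * ennreal (\<bar>u x\<bar> powr p) \<partial>lborel \<partial>lborel) = ennreal (V * I)"
 proof -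
  have "(\<integral>\<^sup>+x. \<integral>\<^sup>+y. ?i x y * ennreal (\<bar>u x\<bar> powr p) \<partial>lborel \<partial>lborel) = (\<integral>\<^sup>+x. ennreal V * ennreal (\<bar>u x\<bar> powr p) \<partial>lborel)"
  proof (rule nn_integral_cong)
   fix x
   have "(\<integral>\<^sup>+y. ?i x y * ennreal (\<bar>u x\<bar> powr p) \<partial>lborel) = (\<integral>\<^sup>+y. ?i x y \<partial>lborel) * ennreal (\<bar>u x\<bar> powr p)"
    by (rule nn_integral_multc) measurable
   thus "(\<integral>\<^sup>+y. ?i x y * ennreal (\<bar>u x\<bar> powr p) \<partial>lborel) = ennreal V * ennreal (\<bar>u x\<bar> powr p)"
    by (simp add: nn_integral_norm_indicator[OF l] V_def)
  qed
  also have "... = ennreal V * ennreal I" unfolding I[symmetric] by (rule nn_integral_cmult) measurable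
  finally show ?thesis using V0 I0 by (simp add: ennreal_mult)
 qed
 have half2: "(\<integral>\<^sup>+x. \<integral>\<^sup>+y. ?i x y * ennreal (\<bar>u y\<bar> powr p) \<partial>lborel \<partial>lborel) = ennreal (V * I)"
 proof -
  have "(\<integral>\<^sup>+x. \<integral>\<^sup>+y. ?i x y * ennreal (\<bar>u y\<bar> powr p) \<partial>lborel \<partial>lborel) = (\<integral>\<^sup>+y. \<integral>\<^sup>+x. ?i x y * ennreal (\<bar>u y\<bar> powr p) \<partial>lborel \<partial>lborel)"
   by (rule lborel_pair.Fubini'[symmetric]) measurable
  also have "... = (\<integral>\<^sup>+y. \<integral>\<^sup>+x. ?i y x * ennreal (\<bar>u y\<bar> powr p) \<partial>lborel \<partial>lborel)"
   by (intro nn_integral_cong) (simp add: norm_minus_commute)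
  finally show ?thesis using half by simp
 qed
 have "modulus p l u <= (\<integral>\<^sup>+x. \<integral>\<^sup>+y. ennreal (2 powr p) * (?i x y * ennreal (\<bar>u x\<bar> powr p) + ?i x y * ennreal (\<bar>u y\<bar> powr p)) \<partial>lborel \<partial>lborel)"
  unfolding modulus_def
 proof (intro nn_integral_mono)
  fix x y
  have "\<bar>u x - u y\<bar> powr p <= (\<bar>u x\<bar> + \<bar>u y\<bar>) powr p" using p by (intro powr_mono2) auto
  also have "... <= 2 powr p * (\<bar>u x\<bar> powr p + \<bar>u y\<bar> powr p)" using p by (intro powr_add_le) auto
  finally have "ennreal (\<bar>u x - u y\<bar> powr p) <= ennreal (2 powr p * (\<bar>u x\<bar> powr p + \<bar>u y\<bar> powr p))" by (rule ennreal_leI)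
  also have "... = ennreal (2 powr p) * (ennreal (\<bar>u x\<bar> powr p) + ennreal (\<bar>u y\<bar> powr p))" by (simp add: ennreal_mult)
  finally show "?i x y * ennreal (\<bar>u x - u y\<bar> powr p) <= ennreal (2 powr p) * (?i x y * ennreal (\<bar>u x\<bar> powr p) + ?i x y * ennreal (\<bar>u y\<bar> powr p))"
   by (auto simp: indicator_def)
 qed
 also have "... = ennreal (2 powr p) * ((\<integral>\<^sup>+x. \<integral>\<^sup>+y. ?i x y * ennreal (\<bar>u x\<bar> powr p) \<partial>lborel \<partial>lborel) + (\<integral>\<^sup>+x. \<integral>\<^sup>+y. ?i x y * ennreal (\<bar>u y\<bar> powr p) \<partial>lborel \<partial>lborel))"
  by (simp add: nn_integral_cmult nn_integral_add)
 also have "... = ennreal (2 powr p * (V * I + V * I))"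
  unfolding half half2 using V0 I0 by (subst ennreal_plus[symmetric]) (auto simp: ennreal_mult'[symmetric])
 also have "2 powr p * (V * I + V * I) = 2 * 2 powr p * unit_ball_vol (real DIM('a)) * I * l ^ DIM('a)"
  by (simp add: V_def)
 finally show ?thesis by (simp add: I_def)
qed

lemma dyadic_shell_small:
 assumes "0 < d" "d <= (1::real)" obtains j :: nat where "d <= (1/2) ^ j" "(1/2) ^ Suc j < d"
proof -
 obtain n where n: "(1/2 :: real) ^ n < d" using real_arch_pow_inv[OF assms(1), of "1/2"] by auto
 define j where "j = (LEAST n. (1/2 :: real) ^ n < d)"
 have j: "(1/2) ^ j < d" unfolding j_def by (rule LeastI[of _ n]) (rule n)
 hence "j ~= 0" using assms by (cases j) auto
 then obtain i where i: "j = Suc i" by (cases j) auto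
 have "~ (1/2) ^ i < d" using not_less_Least[of i "%n. (1/2 :: real) ^ n < d"] i by (simp add: j_def)
 thus ?thesis using that[of i] j i by simp
qed

lemma dyadic_shell_large:
 assumes "d > (1::real)" obtains j :: nat where "2 ^ j < d" "d <= 2 ^ Suc j"
proof -
 obtain n where n: "d < (2 :: real) ^ n" using real_arch_pow[of 2 d] by auto
 define j where "j = (LEAST n. d <= (2 :: real) ^ n)"
 have j: "d <= 2 ^ j" unfolding j_def by (rule LeastI[of _ n]) (use n in simp)
 hence "j ~= 0" using assms by (cases j) auto
 then obtain i where i: "j = Suc i" by (cases j) auto
 have "~ d <= 2 ^ i" using not_less_Least[of i "%n. d <= (2 :: real) ^ n"] i by (simp add: j_def)
 thus ?thesis using that[of i] j i by simp
qed

text \<open>The kernel is summed over dyadic distances, with the bound of order 1 for small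
  distances and the bound of order 0 for large ones. The geometric ratios are
  \<open>2 powr (s * p - p)\<close> and \<open>2 powr (- (s * p))\<close>, both below 1 because
  \<open>0 < s < 1\<close>.\<close>

lemma gagliardo_integrable_of_modulus:
 fixes u :: "'a::euclidean_space => real"
 assumes u[measurable]: "u \<in> borel_measurable borel" and s: "0 < s" "s < 1" and p: "p > 1"
  and A: "A >= 0" "!!l. l > 0 ==> modulus p l u <= ennreal (A * l powr (real DIM('a) + p))"
  and B: "B >= 0" "!!l. l > 0 ==> modulus p l u <= ennreal (B * l ^ DIM('a))"
 shows "integrable lborel (gagliardo s p u)"
proof -
 let ?N = "real DIM('a)"
 define e where "e = ?N + s * p"
 have e: "e > 0" using s p by (simp add: e_def add_pos_pos)
 let ?w = "%l z. indicator {..l} (norm (fst z - snd z)) * ennreal (\<bar>u (fst z) - u (snd z)\<bar> powr p)"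
 have mod: "(\<integral>\<^sup>+z. ?w l z \<partial>(lborel \<Otimes>\<^sub>M lborel)) = modulus p l u" for l
 proof -
  have "?w l \<in> borel_measurable (lborel \<Otimes>\<^sub>M lborel)" by measurable
  from lborel.nn_integral_fst[OF this] show ?thesis by (simp add: modulus_def)
 qed
 \<comment> \<open>\<open>a j\<close> majorises the kernel where the distance lies between
   \<open>(1/2) ^ Suc j\<close> and \<open>(1/2) ^ j\<close>, and \<open>b j\<close> where it lies
   between \<open>2 ^ j\<close> and \<open>2 ^ Suc j\<close>. Only the outer radius is cut off, so
   the integrals are values of \<open>modulus\<close>.\<close>
 define a where "a j z = ennreal ((2 powr real (Suc j)) powr e) * ?w ((1/2) ^ j) z" for j :: nat and z
 define b where "b j z = ennreal ((1 / 2 ^ j) powr e) * ?w (2 ^ Suc j) z" for j :: nat and z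
 have [measurable]: "a j \<in> borel_measurable (lborel \<Otimes>\<^sub>M lborel)" "b j \<in> borel_measurable (lborel \<Otimes>\<^sub>M lborel)" for j
  unfolding a_def b_def by measurable
 have pt: "ennreal (gagliardo s p u z) <= (\<Sum>j. a j z + b j z)" for z
 proof -
  obtain x y where z: "z = (x, y)" by (cases z)
  define d where "d = norm (x - y)"
  have term_le: "a j z + b j z <= (\<Sum>j. a j z + b j z)" for j
   using sum_le_suminf[of "%j. a j z + b j z" "{j}"] by auto
  have g: "gagliardo s p u z = (1 / d) powr e * \<bar>u x - u y\<bar> powr p"
   by (simp add: z gagliardo_def d_def e_def powr_divide)
  consider "d = 0" | "0 < d" "d <= 1" | "d > 1" by (force simp: d_def)
  thus ?thesis
  proof cases
   case 1
   thus ?thesis by (simp add: g)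
  next
   case 2
   obtain j where j: "d <= (1/2) ^ j" "(1/2) ^ Suc j < d" using dyadic_shell_small[OF 2] by blast
   have "1 / d <= 2 powr real (Suc j)"
    using j(2) 2 unfolding powr_realpow[OF zero_less_numeral] by (simp add: field_simps power_divide)
   hence "(1 / d) powr e * \<bar>u x - u y\<bar> powr p <= (2 powr real (Suc j)) powr e * \<bar>u x - u y\<bar> powr p"
    using 2 e by (intro mult_right_mono powr_mono2) auto
   hence "ennreal (gagliardo s p u z) <= ennreal ((2 powr real (Suc j)) powr e) * ennreal (\<bar>u x - u y\<bar> powr p)"
    unfolding g by (subst ennreal_mult[symmetric]) (auto intro: ennreal_leI)
   also have "... = a j z" using j(1) by (simp add: a_def z d_def)
   also have "... <= a j z + b j z" by simp
   finally show ?thesis using term_le by (rule order_trans)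
  next
   case 3
   obtain j where j: "2 ^ j < d" "d <= 2 ^ Suc j" using dyadic_shell_large[OF 3] by blast
   have "1 / d <= 1 / 2 ^ j" using j(1) 3 by (intro divide_left_mono) auto
   hence "(1 / d) powr e * \<bar>u x - u y\<bar> powr p <= (1 / 2 ^ j) powr e * \<bar>u x - u y\<bar> powr p"
    using 3 e by (intro mult_right_mono powr_mono2) auto
   hence "ennreal (gagliardo s p u z) <= ennreal ((1 / 2 ^ j) powr e) * ennreal (\<bar>u x - u y\<bar> powr p)"
    unfolding g by (subst ennreal_mult[symmetric]) (auto intro: ennreal_leI)
   also have "... = b j z" using j(2) by (simp add: b_def z d_def)
   also have "... <= a j z + b j z" by simp
   finally show ?thesis using term_le by (rule order_trans)
  qed
 qed
 define ca where "ca = 2 powr e * A"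
 define ra where "ra = 2 powr (s * p - p)"
 define cb where "cb = 2 ^ DIM('a) * B"
 define rb where "rb = 2 powr (- (s * p))"
 have "s * p < p" using s p by simp
 hence ra: "0 <= ra" "ra < 1" using powr_less_mono[of "s * p - p" 0 2] by (auto simp: ra_def)
 have "s * p > 0" using s p by simp
 hence rb: "0 <= rb" "rb < 1" using powr_less_mono[of "- (s * p)" 0 2] by (auto simp: rb_def)
 have ia: "(\<integral>\<^sup>+z. a j z \<partial>(lborel \<Otimes>\<^sub>M lborel)) <= ennreal (ca * ra ^ j)" for j
 proof -
  have "(\<integral>\<^sup>+z. a j z \<partial>(lborel \<Otimes>\<^sub>M lborel)) = ennreal ((2 powr real (Suc j)) powr e) * modulus p ((1/2) ^ j) u"
   unfolding a_def mod[symmetric] by (rule nn_integral_cmult) measurable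
  also have "... <= ennreal ((2 powr real (Suc j)) powr e) * ennreal (A * ((1/2) ^ j) powr (?N + p))"
   by (intro mult_left_mono A) auto
  also have "... = ennreal ((2 powr real (Suc j)) powr e * (A * ((1/2) ^ j) powr (?N + p)))"
   using A by (simp add: ennreal_mult)
  also have "(2 powr real (Suc j)) powr e * (A * ((1/2) ^ j) powr (?N + p)) = ca * ra ^ j"
  proof -
   have "2 powr (- real j) = inverse (2 ^ j)" by (simp only: powr_minus powr_realpow[OF zero_less_numeral])
   hence h: "(1/2 :: real) ^ j = 2 powr (- real j)" by (simp add: power_one_over inverse_eq_divide)
   have "ra ^ j = 2 powr ((s * p - p) * real j)" unfolding ra_def by (subst powr_realpow[symmetric]) (auto simp: powr_powr)
   moreover have "(2 powr real (Suc j)) powr e * ((1/2) ^ j) powr (?N + p) = 2 powr e * 2 powr ((s * p - p) * real j)"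
    unfolding h powr_powr powr_add[symmetric] by (rule arg_cong[where f = "(powr) 2"]) (simp add: e_def algebra_simps)
   ultimately show ?thesis by (simp add: ca_def)
  qed
  finally show ?thesis .
 qed
 have ib: "(\<integral>\<^sup>+z. b j z \<partial>(lborel \<Otimes>\<^sub>M lborel)) <= ennreal (cb * rb ^ j)" for j
 proof -
  have "(\<integral>\<^sup>+z. b j z \<partial>(lborel \<Otimes>\<^sub>M lborel)) = ennreal ((1 / 2 ^ j) powr e) * modulus p (2 ^ Suc j) u"
   unfolding b_def mod[symmetric] by (rule nn_integral_cmult) measurable
  also have "... <= ennreal ((1 / 2 ^ j) powr e) * ennreal (B * (2 ^ Suc j) ^ DIM('a))"
   by (intro mult_left_mono B) auto
  also have "... = ennreal ((1 / 2 ^ j) powr e * (B * (2 ^ Suc j) ^ DIM('a)))"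
   using B by (simp add: ennreal_mult)
  also have "(1 / 2 ^ j) powr e * (B * (2 ^ Suc j) ^ DIM('a)) = cb * rb ^ j"
  proof -
   have "2 powr (- real j) = inverse (2 ^ j)" by (simp only: powr_minus powr_realpow[OF zero_less_numeral])
   hence h: "(1/2 ^ j :: real) = 2 powr (- real j)" by (simp add: inverse_eq_divide)
   have "rb ^ j = 2 powr (- (s * p) * real j)" unfolding rb_def by (subst powr_realpow[symmetric]) (auto simp: powr_powr)
   moreover have "((2::real) ^ j) ^ DIM('a) = 2 powr (real j * ?N)" using inv_vol_eq_powr[where ?'a='a, of j] by (simp add: inv_vol_def)
   moreover have "2 powr (- real j * e) * 2 powr (real j * ?N) = 2 powr (- (s * p) * real j)"
    unfolding powr_add[symmetric] by (rule arg_cong[where f = "(powr) 2"]) (simp add: e_def algebra_simps)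
   moreover have "(2 ^ Suc j :: real) ^ DIM('a) = 2 ^ DIM('a) * (2 ^ j) ^ DIM('a)" by (simp add: power_mult_distrib)
   ultimately show ?thesis unfolding h powr_powr by (simp add: cb_def)
  qed
  finally show ?thesis .
 qed
 have "(\<integral>\<^sup>+z. ennreal (gagliardo s p u z) \<partial>(lborel \<Otimes>\<^sub>M lborel)) <= (\<integral>\<^sup>+z. (\<Sum>j. a j z + b j z) \<partial>(lborel \<Otimes>\<^sub>M lborel))"
  by (intro nn_integral_mono pt)
 also have "... = (\<Sum>j. \<integral>\<^sup>+z. a j z + b j z \<partial>(lborel \<Otimes>\<^sub>M lborel))"
  by (rule nn_integral_suminf) measurable
 also have "... <= (\<Sum>j. ennreal (ca * ra ^ j + cb * rb ^ j))"
 proof (intro suminf_le summableI)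
  fix j
  have "(\<integral>\<^sup>+z. a j z + b j z \<partial>(lborel \<Otimes>\<^sub>M lborel)) = (\<integral>\<^sup>+z. a j z \<partial>(lborel \<Otimes>\<^sub>M lborel)) + (\<integral>\<^sup>+z. b j z \<partial>(lborel \<Otimes>\<^sub>M lborel))"
   by (rule nn_integral_add) measurable
  also have "... <= ennreal (ca * ra ^ j) + ennreal (cb * rb ^ j)" by (intro add_mono ia ib)
  also have "... = ennreal (ca * ra ^ j + cb * rb ^ j)"
   using A B ra rb by (intro ennreal_plus[symmetric]) (auto simp: ca_def cb_def)
  finally show "(\<integral>\<^sup>+z. a j z + b j z \<partial>(lborel \<Otimes>\<^sub>M lborel)) <= ennreal (ca * ra ^ j + cb * rb ^ j)" .
 qed
 also have "... = ennreal (\<Sum>j. ca * ra ^ j + cb * rb ^ j)"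
 proof (rule suminf_ennreal2)
  show "summable (%j. ca * ra ^ j + cb * rb ^ j)" using ra rb by (intro summable_add summable_mult summable_geometric) auto
 qed (use A B ra rb in \<open>auto simp: ca_def cb_def\<close>)
 finally have "(\<integral>\<^sup>+z. ennreal (gagliardo s p u z) \<partial>lborel) < \<infinity>"
  by (simp add: lborel_prod order.strict_trans1)
 thus ?thesis
  by (intro integrableI_nonneg) (auto simp: gagliardo_def borel_prod[symmetric] split: prod.splits)
qed

lemma continuous_on_norm_powr:
 assumes "continuous_on A f" "p > (0::real)" shows "continuous_on A (%x. norm (f x) powr p)"
 by (rule continuous_on_powr'[OF continuous_on_norm[OF assms(1)] continuous_on_const]) (use assms(2) in auto)

lemma test_function_Lp:
 assumes phi: "phi \<in> test_functions \<Omega>" and p: "p > 0"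
 shows "Lp_mem lborel p phi" "Lp_mem lborel p (classical_gradient phi)"
proof -
 obtain K where K: "compact K" "!!x. x \<notin> K ==> phi x = 0" "!!x v. x \<notin> K ==> frechet_derivative phi (at x) v = 0"
  by (rule test_functions_support_deriv[OF phi]) blast
 have c: "continuous_on UNIV phi" "continuous_on UNIV (classical_gradient phi)"
  using test_functionsD(2)[OF phi] continuous_classical_gradient[OF phi] by auto
 have "integrable lborel (%x. norm (phi x) powr p)"
  by (rule integrable_compact_support[OF continuous_on_norm_powr[OF c(1) p] K(1)]) (simp add: K(2))
 thus "Lp_mem lborel p phi" using c by (simp add: Lp_mem_def borel_measurable_continuous_onI)
 have "integrable lborel (%x. norm (classical_gradient phi x) powr p)"
  by (rule integrable_compact_support[OF continuous_on_norm_powr[OF c(2) p] K(1)]) (simp add: K(3) classical_gradient_def)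
 thus "Lp_mem lborel p (classical_gradient phi)" using c by (simp add: Lp_mem_def borel_measurable_continuous_onI)
qed

lemma Lp_mem_lebesgue_iff:
 fixes f :: "'a::euclidean_space => 'b::euclidean_space"
 assumes "f \<in> borel_measurable borel" shows "Lp_mem lebesgue p f \<longleftrightarrow> Lp_mem lborel p f" "Lp_norm lebesgue p f = Lp_norm lborel p f"
proof -
 have "(%x. norm (f x) powr p) \<in> borel_measurable borel" using assms by measurable
 from lebesgue_integral_borel[OF this] show "Lp_mem lebesgue p f \<longleftrightarrow> Lp_mem lborel p f" "Lp_norm lebesgue p f = Lp_norm lborel p f"
  using assms borel_imp_lebesgue_measurable[OF assms] by (auto simp: Lp_mem_def Lp_norm_def)
qed

text \<open>In the fractional case \<open>modulus_bound_gradient\<close> serves for small and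
  \<open>modulus_le_Lp\<close> for large distances.\<close>

lemma test_function_dom_sp:
 assumes phi: "phi \<in> test_functions \<Omega>" and s: "0 < s" "s <= 1" and p: "p > 1"
 shows "phi \<in> dom_sp s p"
proof -
 let ?g = "classical_gradient phi"
 have m: "phi \<in> borel_measurable borel" "?g \<in> borel_measurable borel"
  using test_function_Lp[OF phi, of p] p by (auto simp: Lp_mem_def)
 have wg: "has_weak_gradient phi ?g" by (rule has_weak_gradient_test_function[OF phi])
 have p0: "p > 0" using p by simp
 show ?thesis
 proof (cases "s = 1")
  case True
  have "Lp_mem lebesgue p ?g" using test_function_Lp(2)[OF phi p0] Lp_mem_lebesgue_iff(1)[OF m(2)] by blast
  thus ?thesis using wg True borel_imp_lebesgue_measurable[OF m(1)] by (auto simp: dom_sp_grad_iff)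
 next
  case False
  have "modulus_bound p 1 (2 ^ DIM('a) * (LINT x|lborel. norm (?g x) powr p)) phi"
   using test_function_Lp(2)[OF phi p0] by (intro modulus_bound_gradient m wg p) (simp add: Lp_mem_def)
  hence A: "2 ^ DIM('a) * (LINT x|lborel. norm (?g x) powr p) >= 0"
    "!!l. l > 0 ==> modulus p l phi <= ennreal (2 ^ DIM('a) * (LINT x|lborel. norm (?g x) powr p) * l powr (real DIM('a) + p))"
   by (auto simp: modulus_bound_def)
  have "integrable lborel (gagliardo s p phi)"
   by (rule gagliardo_integrable_of_modulus[OF m(1) s(1) _ p A _ modulus_le_Lp[OF test_function_Lp(1)[OF phi p0] p0]]) (use False s in auto)
  hence "integrable lebesgue (gagliardo s p phi)"
   using gagliardo_measurable[OF m(1), of s p] by (subst lebesgue_integral_borel(2)) (auto simp: borel_prod)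
  thus ?thesis using False s borel_imp_lebesgue_measurable[OF m(1)] by (auto simp: dom_sp_def finite_seminorm_def)
 qed
qed

lemma L1_le_Lp:
 fixes f :: "'x => 'v::euclidean_space"
 assumes p: "p > 1" and f: "Lp_mem M p f" and B: "B \<in> sets M" "emeasure M B < \<infinity>" and supp: "AE x in M. x \<notin> B --> f x = 0"
 shows "integrable M f" "(LINT x|M. norm (f x)) <= measure M B powr ((p - 1) / p) * Lp_norm M p f"
proof -
 let ?q = "p / (p - 1)"
 have [measurable]: "f \<in> borel_measurable M" using f by (simp add: Lp_mem_def)
 note [measurable] = B(1)
 have eq: "(%x. norm (indicat_real B x) powr ?q) = indicat_real B" by (auto simp: indicator_def)
 have iB: "integrable M (indicat_real B)" using B by (intro integrable_real_indicator) auto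
 have m: "Lp_mem M ?q (indicat_real B)" unfolding Lp_mem_def eq using iB by simp
 have n: "Lp_norm M ?q (indicat_real B) = measure M B powr ((p - 1) / p)"
  unfolding Lp_norm_def eq using p by simp
 have ae: "AE x in M. norm (indicat_real B x) * norm (f x) = norm (f x)" using supp by eventually_elim (auto simp: indicator_def)
 have int: "integrable M (%x. norm (f x))"
  by (rule integrable_cong_AE_imp[OF Hoelder_inequality(1)[OF p m f]]) (use ae in auto)
 thus "integrable M f" by (simp add: integrable_norm_iff)
 have "(LINT x|M. norm (f x)) = (LINT x|M. norm (indicat_real B x) * norm (f x))"
  using ae by (intro integral_cong_AE) auto
 thus "(LINT x|M. norm (f x)) <= measure M B powr ((p - 1) / p) * Lp_norm M p f"
  using Hoelder_inequality(2)[OF p m f] n by simp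
qed

lemma has_weak_gradient_cong_AE:
 fixes u :: "'a::euclidean_space => real"
 assumes ug: "has_weak_gradient u g" and m: "v \<in> borel_measurable lebesgue" "k \<in> borel_measurable lebesgue"
  and ae: "AE x in lebesgue. u x = v x" "AE x in lebesgue. g x = k x"
 shows "has_weak_gradient v k"
 unfolding has_weak_gradient_def
proof (intro conjI ballI allI)
 show "locally_integrable v" "locally_integrable k"
  using ug m ae by (auto simp: has_weak_gradient_def intro: locally_integrable_cong_AE)
 fix psi :: "'a => real" and w :: 'a assume psi: "psi \<in> test_functions UNIV"
 have [measurable]: "u \<in> borel_measurable lebesgue" "g \<in> borel_measurable lebesgue"
  using ug by (auto simp: has_weak_gradient_def intro: locally_integrable_measurable)
 note [measurable] = m
 have [measurable]: "psi \<in> borel_measurable lebesgue" "(%x. frechet_derivative psi (at x) w) \<in> borel_measurable lebesgue"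
  using test_functionsD(2,4)[OF psi] by (auto intro!: borel_imp_lebesgue_measurable borel_measurable_continuous_onI)
 have "(LINT x|lebesgue. v x * frechet_derivative psi (at x) w) = (LINT x|lebesgue. u x * frechet_derivative psi (at x) w)"
  using ae(1) by (intro integral_cong_AE) auto
 also have "... = - (LINT x|lebesgue. (g x \<bullet> w) * psi x)" using ug psi by (auto simp: has_weak_gradient_def)
 also have "(LINT x|lebesgue. (g x \<bullet> w) * psi x) = (LINT x|lebesgue. (k x \<bullet> w) * psi x)"
  using ae(2) by (intro integral_cong_AE) auto
 finally show "(LINT x|lebesgue. v x * frechet_derivative psi (at x) w) = - (LINT x|lebesgue. (k x \<bullet> w) * psi x)" .
qed

text \<open>For order 1 the constant is that of \<open>modulus_bound_gradient\<close>; for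
  fractional order the constant inside the seminorm is divided out again.\<close>

definition modulus_const :: "'a::euclidean_space itself => real => real => real" where
 "modulus_const _ s p = (if s = 1 then 2 ^ DIM('a) else 1 / frac_const DIM('a) s p)"

lemma modulus_const_pos: "0 < s ==> s <= 1 ==> p > 1 ==> modulus_const TYPE('a::euclidean_space) s p > 0"
 using frac_const_pos[of s p "DIM('a)"] by (auto simp: modulus_const_def)

lemma dom_sp_modulus_bound:
 fixes u :: "'a::euclidean_space => real"
 assumes s: "0 < s" "s <= 1" and p: "p > 1" and u: "u \<in> dom_sp s p"
  and v: "v \<in> borel_measurable borel" and uv: "AE x in lborel. u x = v x"
 shows "modulus_bound p s (modulus_const TYPE('a) s p * seminorm_sp s p u powr p) v"
proof (cases "s = 1")
 case True
 have wg: "has_weak_gradient u (weak_gradient u)" and mem: "Lp_mem lebesgue p (weak_gradient u)"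
  using dom_sp_gradD[of u p] u True by auto
 obtain g where g: "g \<in> borel_measurable borel" "AE x in lebesgue. weak_gradient u x = g x"
  using lebesgue_Borel_representative[of "weak_gradient u"] mem by (auto simp: Lp_mem_def)
 have vg: "has_weak_gradient v g"
  by (rule has_weak_gradient_cong_AE[OF wg]) (use v g uv in \<open>auto simp: AE_lebesgue_iff intro: borel_imp_lebesgue_measurable\<close>)
 have gm: "g \<in> borel_measurable lebesgue" by (rule borel_imp_lebesgue_measurable[OF g(1)])
 have "Lp_mem lebesgue p g" using mem g gm Lp_mem_cong_AE[of "weak_gradient u" lebesgue g p] by (auto simp: Lp_mem_def)
 hence gl: "Lp_mem lborel p g" using Lp_mem_lebesgue_iff(1)[OF g(1)] by blast
 have "Lp_norm lebesgue p (weak_gradient u) = Lp_norm lebesgue p g"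
  using mem g gm by (intro Lp_norm_cong_AE) (auto simp: Lp_mem_def)
 hence n: "Lp_norm lborel p g = Lp_norm lebesgue p (weak_gradient u)" using Lp_mem_lebesgue_iff(2)[OF g(1)] by simp
 have "(LINT x|lborel. norm (g x) powr p) = seminorm_sp s p u powr p"
  using p n Lp_norm_powr[of p lborel g] True by (simp add: seminorm_sp_def Lp_norm_def)
 thus ?thesis using modulus_bound_gradient[OF v g(1) vg p] gl True by (simp add: modulus_const_def Lp_mem_def)
next
 case False
 hence s1: "s < 1" using s by simp
 have gi: "integrable lebesgue (gagliardo s p u)" using u False s by (simp add: dom_sp_def finite_seminorm_def)
 have "AE z in lborel. gagliardo s p u z = gagliardo s p v z"
  using AE_lborel_fst_snd[OF uv] by eventually_elim (auto simp: gagliardo_def split: prod.splits)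
 hence ae: "AE z in lebesgue. gagliardo s p u z = gagliardo s p v z" by (simp add: AE_lebesgue_iff)
 have mv: "gagliardo s p v \<in> borel_measurable borel" using gagliardo_measurable[OF v, of s p] by (simp add: borel_prod)
 have mv': "gagliardo s p v \<in> borel_measurable lebesgue" by (rule borel_imp_lebesgue_measurable[OF mv])
 have "integrable lebesgue (gagliardo s p v)" by (rule integrable_cong_AE_imp[OF gi mv']) (use ae in auto)
 hence gv: "integrable lborel (gagliardo s p v)" using lebesgue_integral_borel(2)[OF mv] by blast
 have eq: "(LINT z|lebesgue. gagliardo s p u z) = (LINT z|lborel. gagliardo s p v z)"
  using integral_cong_AE[OF _ mv' ae] gi lebesgue_integral_borel(1)[OF mv] by (auto dest: borel_measurable_integrable)
 have c: "frac_const DIM('a) s p > 0" using s s1 p by (intro frac_const_pos) auto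
 have "(LINT z|lborel. gagliardo s p v z) >= 0"
  by (rule Bochner_Integration.integral_nonneg) (auto simp: gagliardo_def split: prod.splits)
 hence "seminorm_sp s p u powr p = frac_const DIM('a) s p * (LINT z|lborel. gagliardo s p v z)"
  using s s1 p c by (simp add: seminorm_sp_def eq powr_powr)
 hence "modulus_const TYPE('a) s p * seminorm_sp s p u powr p = (LINT z|lborel. gagliardo s p v z)"
  using s1 c by (simp add: modulus_const_def)
 thus ?thesis using modulus_bound_gagliardo[OF v p s(1) gv] by simp
qed

text \<open>The orders are strictly positive here: under the hypotheses of the final theorem, order
  0 would give \<open>pstar = p k\<close>, against \<open>p k <= phat < q < pstar\<close>.\<close>

locale energy_space =
 fixes \<Omega> :: "'a::euclidean_space set" and m :: nat and s p :: "nat => real" and R :: real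
 assumes open_\<Omega>: "open \<Omega>" and R: "R > 0" "\<Omega> \<subseteq> cball 0 R" and m: "m ~= 0"
  and s: "!!k. k \<in> {1..m} ==> 0 < s k" "!!k. k \<in> {1..m} ==> s k <= 1"
  and p: "!!k. k \<in> {1..m} ==> p k > 1"
begin

text \<open>The ambient space in which \<open>X\<close> is the closure of the test functions.
  Estimates are proved on \<open>Y\<close>; approximation by test functions enters where gradients
  outside \<open>\<Omega>\<close> and completeness are concerned.\<close>

definition Y :: "('a => real) set" where
 "Y = {u \<in> borel_measurable lebesgue. (AE x in lebesgue. x \<notin> \<Omega> --> u x = 0) & (\<forall>k\<in>{1..m}. u \<in> dom_sp (s k) (p k))}"

abbreviation X :: "('a => real) set" where "X \<equiv> X_mu \<Omega> m s p"
abbreviation N :: "('a => real) => real" where "N \<equiv> mu_norm m s p"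
abbreviation sn where "sn k \<equiv> seminorm_sp (s k) (p k)"
abbreviation fm where "fm k \<equiv> form_sp UNIV (s k) (p k)"

lemma dom_subspace: "k \<in> {1..m} ==> subspace (dom_sp (s k) (p k) :: ('a => real) set)"
 by (rule dom_sp_subspace[OF s(1) s(2) p])

lemma YD: "u \<in> Y ==> k \<in> {1..m} ==> u \<in> dom_sp (s k) (p k)"
 by (simp add: Y_def)

lemma Y_subspace: "subspace Y"
 unfolding subspace_def
proof (intro conjI ballI allI)
 have "(0::'a => real) \<in> dom_sp (s k) (p k)" if "k \<in> {1..m}" for k by (rule subspace_0[OF dom_subspace[OF that]])
 moreover have "(0::'a => real) \<in> borel_measurable lebesgue" by (simp add: zero_fun_def)
 ultimately show "0 \<in> Y" by (simp add: Y_def)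
next
 fix u v assume uv: "u \<in> Y" "v \<in> Y"
 have "u + v \<in> dom_sp (s k) (p k)" if "k \<in> {1..m}" for k
  by (rule subspace_add[OF dom_subspace[OF that] YD[OF uv(1) that] YD[OF uv(2) that]])
 moreover have "AE x in lebesgue. x \<notin> \<Omega> --> (u + v) x = 0"
 proof -
  have "AE x in lebesgue. x \<notin> \<Omega> --> u x = 0" "AE x in lebesgue. x \<notin> \<Omega> --> v x = 0" using uv by (auto simp: Y_def)
  thus ?thesis by eventually_elim auto
 qed
 moreover have "u + v \<in> borel_measurable lebesgue" using uv unfolding Y_def plus_fun_def by (auto intro: borel_measurable_add)
 ultimately show "u + v \<in> Y" by (simp add: Y_def)
next
 fix r and u assume u: "u \<in> Y"
 have "r *\<^sub>R u \<in> dom_sp (s k) (p k)" if "k \<in> {1..m}" for k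
  by (rule subspace_scale[OF dom_subspace[OF that] YD[OF u that]])
 moreover have "AE x in lebesgue. x \<notin> \<Omega> --> (r *\<^sub>R u) x = 0"
 proof -
  have "AE x in lebesgue. x \<notin> \<Omega> --> u x = 0" using u by (auto simp: Y_def)
  thus ?thesis by eventually_elim (auto simp: scaleR_fun_def)
 qed
 moreover have "r *\<^sub>R u \<in> borel_measurable lebesgue" using u unfolding Y_def scaleR_fun_def by auto
 ultimately show "r *\<^sub>R u \<in> Y" by (simp add: Y_def)
qed

lemma N_nonneg: "N u >= 0"
 unfolding mu_norm_def by (intro sum_nonneg) (simp add: seminorm_sp_def)

lemma N_add: "u \<in> Y ==> v \<in> Y ==> N (u + v) <= N u + N v"
 unfolding mu_norm_def sum.distrib[symmetric] by (rule sum_mono) (rule seminorm_sp_add[OF s(1) s(2) p YD YD])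

lemma N_scale: "u \<in> Y ==> N (r *\<^sub>R u) = \<bar>r\<bar> * N u"
 unfolding mu_norm_def sum_distrib_left by (rule sum.cong[OF refl]) (rule seminorm_sp_scale[OF s(1) s(2) p YD])

lemma N_minus_commute: "u \<in> Y ==> v \<in> Y ==> N (u - v) = N (v - u)"
 using N_scale[OF subspace_diff[OF Y_subspace], of v u "-1"] by simp

lemma seminorm_le_N: "k \<in> {1..m} ==> sn k u <= N u"
 unfolding mu_norm_def by (intro member_le_sum) (auto simp: seminorm_sp_def)

lemma test_in_Y: "phi \<in> test_functions \<Omega> ==> phi \<in> Y"
proof -
 assume phi: "phi \<in> test_functions \<Omega>"
 obtain K where K: "compact K" "K \<subseteq> \<Omega>" "!!x. x \<notin> K ==> phi x = 0" by (rule test_functions_support[OF phi]) blast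
 have "phi \<in> borel_measurable lebesgue"
  by (intro borel_imp_lebesgue_measurable borel_measurable_continuous_onI test_functionsD(2)[OF phi])
 moreover have "AE x in lebesgue. x \<notin> \<Omega> --> phi x = 0" using K by (intro AE_I2) auto
 moreover have "phi \<in> dom_sp (s k) (p k)" if "k \<in> {1..m}" for k
  by (rule test_function_dom_sp[OF phi s(1)[OF that] s(2)[OF that] p[OF that]])
 ultimately show ?thesis by (simp add: Y_def)
qed

lemma X_eq: "X = {u \<in> Y. \<exists>phi. (\<forall>n. phi n \<in> test_functions \<Omega>) & (%n. N (u - phi n)) \<longlonglongrightarrow> 0}"
 unfolding X_mu_def Y_def dom_sp_def fun_diff_def by auto

lemma X_Y: "u \<in> X ==> u \<in> Y"
 by (simp add: X_eq)

lemma X_I: "(%n. N (u - phi n)) \<longlonglongrightarrow> 0 ==> u \<in> Y ==> (!!n. phi n \<in> test_functions \<Omega>) ==> u \<in> X"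
 unfolding X_eq by blast

lemma test_in_X: "phi \<in> test_functions \<Omega> ==> phi \<in> X"
proof -
 assume phi: "phi \<in> test_functions \<Omega>"
 have "N (phi - phi) = 0" using N_scale[OF test_in_Y[OF phi], of 0] by simp
 thus ?thesis unfolding X_eq using phi test_in_Y[OF phi] by (auto intro!: exI[of _ "%_. phi"])
qed

lemma X_subspace: "subspace X"
 unfolding subspace_def
proof (intro conjI ballI allI)
 show "0 \<in> X" using test_in_X[OF test_functions_0] by (simp add: zero_fun_def)
next
 fix u v assume u: "u \<in> X" and v: "v \<in> X"
 obtain phi where phi: "!!n. phi n \<in> test_functions \<Omega>" "(%n. N (u - phi n)) \<longlonglongrightarrow> 0" using u unfolding X_eq by blast
 obtain psi where psi: "!!n. psi n \<in> test_functions \<Omega>" "(%n. N (v - psi n)) \<longlonglongrightarrow> 0" using v unfolding X_eq by blast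
 have t: "phi n + psi n \<in> test_functions \<Omega>" for n
  using test_functions_add[OF phi(1)[of n] psi(1)[of n]] by (simp add: plus_fun_def)
 have "(%n. N ((u + v) - (phi n + psi n))) \<longlonglongrightarrow> 0"
 proof (rule Lim_null_comparison)
  show "(%n. N (u - phi n) + N (v - psi n)) \<longlonglongrightarrow> 0" using tendsto_add[OF phi(2) psi(2)] by simp
  have "N ((u + v) - (phi n + psi n)) <= N (u - phi n) + N (v - psi n)" for n
  proof -
   have "N ((u - phi n) + (v - psi n)) <= N (u - phi n) + N (v - psi n)"
    by (intro N_add subspace_diff[OF Y_subspace] X_Y u v test_in_Y phi psi)
   moreover have "(u - phi n) + (v - psi n) = (u + v) - (phi n + psi n)" by (simp add: algebra_simps)
   ultimately show ?thesis by simp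
  qed
  thus "\<forall>\<^sub>F n in sequentially. norm (N ((u + v) - (phi n + psi n))) <= N (u - phi n) + N (v - psi n)"
   using N_nonneg by simp
 qed
 moreover have "u + v \<in> Y" by (rule subspace_add[OF Y_subspace X_Y[OF u] X_Y[OF v]])
 ultimately show "u + v \<in> X" using t by (rule_tac X_I)
next
 fix r and u assume u: "u \<in> X"
 obtain phi where phi: "!!n. phi n \<in> test_functions \<Omega>" "(%n. N (u - phi n)) \<longlonglongrightarrow> 0" using u unfolding X_eq by blast
 have t: "r *\<^sub>R phi n \<in> test_functions \<Omega>" for n
  using test_functions_scale[OF phi(1)[of n], of r] by (simp add: scaleR_fun_def)
 have "N (r *\<^sub>R u - r *\<^sub>R phi n) = \<bar>r\<bar> * N (u - phi n)" for n
  unfolding scaleR_diff_right[symmetric] by (intro N_scale subspace_diff[OF Y_subspace] X_Y u test_in_Y phi)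
 hence "(%n. N (r *\<^sub>R u - r *\<^sub>R phi n)) \<longlonglongrightarrow> 0" using tendsto_mult_left[OF phi(2), of "\<bar>r\<bar>"] by simp
 moreover have "r *\<^sub>R u \<in> Y" by (rule subspace_scale[OF Y_subspace X_Y[OF u]])
 ultimately show "r *\<^sub>R u \<in> X" using t by (rule_tac X_I)
qed

lemmas Y_diff = subspace_diff[OF Y_subspace] and Y_scale = subspace_scale[OF Y_subspace]

lemma \<Omega>_sets: "\<Omega> \<in> sets lebesgue" "emeasure lebesgue \<Omega> < \<infinity>"
proof -
 show "\<Omega> \<in> sets lebesgue" using open_\<Omega> by simp
 have "emeasure lebesgue \<Omega> <= emeasure lebesgue (cball (0::'a) R)" using R by (intro emeasure_mono) auto
 also have "... < \<infinity>" using emeasure_lborel_cball_finite[of "0::'a" R] by simp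
 finally show "emeasure lebesgue \<Omega> < \<infinity>" .
qed

text \<open>Gradients of test functions vanish off their supports, and convergence in the seminorm
  of index \<open>k\<close> passes this to the limit. It reconciles the seminorm, taken over the
  whole space, with the form, taken over \<open>\<Omega>\<close>.\<close>

lemma weak_gradient_outside:
 assumes u: "u \<in> X" and k: "k \<in> {1..m}" "s k = 1"
 shows "AE x in lebesgue. x \<notin> \<Omega> --> weak_gradient u x = 0"
proof -
 let ?p = "p k"
 have p1: "?p > 1" using p k by simp
 have dom: "w \<in> dom_sp 1 ?p" if "w \<in> Y" for w using YD[OF that k(1)] k(2) by simp
 obtain phi where phi: "!!n. phi n \<in> test_functions \<Omega>" "(%n. N (u - phi n)) \<longlonglongrightarrow> 0" using u unfolding X_eq by blast
 have mem: "Lp_mem lebesgue ?p (weak_gradient u)" by (rule dom_sp_gradD(2)[OF dom[OF X_Y[OF u]]])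
 let ?f = "%x. indicat_real (- \<Omega>) x * norm (weak_gradient u x) powr ?p"
 have m\<Omega>: "- \<Omega> \<in> sets lebesgue" using closed_Compl[OF open_\<Omega>] by (intro sets_completionI_sets) simp
 have int: "integrable lebesgue ?f"
  using integrable_mult_indicator[OF m\<Omega>, of "%x. norm (weak_gradient u x) powr ?p"] mem by (simp add: Lp_mem_def)
 have le: "(LINT x|lebesgue. ?f x) <= N (u - phi n) powr ?p" for n
 proof -
  have d: "u - phi n \<in> Y" by (intro Y_diff X_Y u test_in_Y phi)
  have md: "Lp_mem lebesgue ?p (weak_gradient (u - phi n))" by (rule dom_sp_gradD(2)[OF dom[OF d]])
  have 1: "AE x in lebesgue. weak_gradient (u - phi n) x = weak_gradient u x - weak_gradient (phi n) x"
   by (rule p_form.diff_AE[OF p_form_grad[OF p1] dom[OF X_Y[OF u]] dom[OF test_in_Y[OF phi(1)]]])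
  have 2: "AE x in lebesgue. weak_gradient (phi n) x = classical_gradient (phi n) x"
   by (rule weak_gradient_AE_eq[OF has_weak_gradient_test_function[OF phi(1)]])
  obtain K where K: "compact K" "K \<subseteq> \<Omega>" "!!x. x \<notin> K ==> phi n x = 0" "!!x v. x \<notin> K ==> frechet_derivative (phi n) (at x) v = 0"
   by (rule test_functions_support_deriv[OF phi(1)[of n]]) blast
  have 3: "classical_gradient (phi n) x = 0" if "x \<notin> \<Omega>" for x
  proof -
   have "x \<notin> K" using K(2) that by blast
   thus ?thesis by (simp add: classical_gradient_def K(4))
  qed
  have "(LINT x|lebesgue. ?f x) <= (LINT x|lebesgue. norm (weak_gradient (u - phi n) x) powr ?p)"
  proof (rule integral_mono_AE[OF int])
   show "AE x in lebesgue. ?f x <= norm (weak_gradient (u - phi n) x) powr ?p"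
    using 1 2 by eventually_elim (use 3 in \<open>auto simp: indicator_def\<close>)
  qed (use md in \<open>simp add: Lp_mem_def\<close>)
  also have "... = seminorm_sp (s k) ?p (u - phi n) powr ?p" using p1 k by (simp add: seminorm_sp_def powr_powr)
  also have "... <= N (u - phi n) powr ?p" using p1 seminorm_le_N[OF k(1)] by (intro powr_mono2) (auto simp: seminorm_sp_def)
  finally show ?thesis .
 qed
 have "(%n. N (u - phi n) powr ?p) \<longlonglongrightarrow> 0 powr ?p" using phi(2) p1 N_nonneg by (intro tendsto_powr') auto
 hence "(LINT x|lebesgue. ?f x) <= 0" using le p1 by (intro LIMSEQ_le_const) auto
 moreover have "(LINT x|lebesgue. ?f x) >= 0" by (intro Bochner_Integration.integral_nonneg) auto
 ultimately have "(LINT x|lebesgue. ?f x) = 0" by simp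
 hence "AE x in lebesgue. ?f x = 0" using int by (subst (asm) integral_nonneg_eq_0_iff_AE) auto
 thus ?thesis by eventually_elim (auto simp: indicator_def)
qed

text \<open>Only the form of order 1 is affected by the set, and there the gradient of
  \<open>v\<close> vanishes outside \<open>\<Omega>\<close>.\<close>

lemma form_sp_\<Omega>:
 assumes u: "u \<in> X" and v: "v \<in> X" and k: "k \<in> {1..m}"
 shows "form_sp \<Omega> (s k) (p k) u v = fm k u v"
proof (cases "s k = 1")
 case True
 have dom: "w \<in> dom_sp 1 (p k)" if "w \<in> Y" for w using YD[OF that k] True by simp
 have m: "weak_gradient u \<in> borel_measurable lebesgue" "weak_gradient v \<in> borel_measurable lebesgue"
  using dom_sp_gradD(2)[OF dom[OF X_Y[OF u]]] dom_sp_gradD(2)[OF dom[OF X_Y[OF v]]] by (auto simp: Lp_mem_def)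
 let ?f = "%x. norm (weak_gradient u x) powr (p k - 2) * (weak_gradient u x \<bullet> weak_gradient v x)"
 have mf: "?f \<in> borel_measurable lebesgue" using m by measurable
 have "(LINT x|lebesgue_on \<Omega>. ?f x) = (LINT x|lebesgue. indicat_real \<Omega> x *\<^sub>R ?f x)"
  using \<Omega>_sets by (subst integral_restrict_space) auto
 also have "... = (LINT x|lebesgue. ?f x)"
 proof (rule integral_cong_AE)
  show "AE x in lebesgue. indicat_real \<Omega> x *\<^sub>R ?f x = ?f x"
   using weak_gradient_outside[OF v k True] by eventually_elim (auto simp: indicator_def)
  show "(%x. indicat_real \<Omega> x *\<^sub>R ?f x) \<in> borel_measurable lebesgue"
   using \<Omega>_sets mf by (intro borel_measurable_scaleR borel_measurable_indicator) auto
 qed (rule mf)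
 finally show ?thesis using True by (simp add: form_sp_def lebesgue_on_UNIV_eq)
next
 case False
 thus ?thesis using s(1)[OF k] by (simp add: form_sp_def)
qed

lemma Borel_rep:
 assumes "u \<in> Y"
 obtains v where "v \<in> borel_measurable borel" "AE x in lebesgue. u x = v x" "AE x in lborel. u x = v x"
  "AE x in lborel. x \<notin> cball 0 R --> v x = 0"
proof -
 have "u \<in> borel_measurable lebesgue" using assms by (simp add: Y_def)
 then obtain v where v: "v \<in> borel_measurable borel" "AE x in lebesgue. u x = v x" "AE x in lborel. u x = v x"
  by (rule lebesgue_Borel_representative) blast
 have "AE x in lborel. x \<notin> \<Omega> --> u x = 0" using assms by (simp add: Y_def AE_lebesgue_iff)
 with v(3) have "AE x in lborel. x \<notin> cball 0 R --> v x = 0" by eventually_elim (use R in auto)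
 with v that show ?thesis by blast
qed

text \<open>The seminorm of index 1 alone controls the norm on the left, and it is one of the
  summands of \<open>N\<close>.\<close>

theorem Sobolev:
 assumes q: "p 1 <= q" and sub: "real DIM('a) * (1 / p 1 - 1 / q) < s 1"
 obtains C where "C > 0" "!!u. u \<in> Y ==> Lp_mem lebesgue q u & Lp_norm lebesgue q u <= C * N u"
proof -
 have k: "1 \<in> {1..m}" using m by simp
 note s1 = s(1)[OF k] s(2)[OF k] and p1 = p[OF k]
 obtain C where C: "C > 0" "!!(u :: 'a => real) A. u \<in> borel_measurable borel ==> modulus_bound (p 1) (s 1) A u ==>
   (AE x in lborel. x \<notin> cball 0 R --> u x = 0) ==> Lp_mem lborel q u & Lp_norm lborel q u <= C * A powr (1 / p 1)"
  using Sobolev_modulus[OF p1 q s1(1) sub R(1)] by blast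
 define c where "c = modulus_const TYPE('a) (s 1) (p 1)"
 have c: "c > 0" unfolding c_def by (rule modulus_const_pos[OF s1 p1])
 have "Lp_mem lebesgue q u & Lp_norm lebesgue q u <= C * c powr (1 / p 1) * N u" if u: "u \<in> Y" for u
 proof -
  obtain v where v: "v \<in> borel_measurable borel" "AE x in lebesgue. u x = v x" "AE x in lborel. u x = v x"
   "AE x in lborel. x \<notin> cball 0 R --> v x = 0"
   by (rule Borel_rep[OF u]) blast
  have mb: "modulus_bound (p 1) (s 1) (c * seminorm_sp (s 1) (p 1) u powr p 1) v"
   unfolding c_def by (rule dom_sp_modulus_bound[OF s1 p1 YD[OF u k] v(1,3)])
  have q': "Lp_mem lborel q v" "Lp_norm lborel q v <= C * (c * seminorm_sp (s 1) (p 1) u powr p 1) powr (1 / p 1)"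
   using C(2)[OF v(1) mb v(4)] by auto
  have um: "u \<in> borel_measurable lebesgue" using u by (simp add: Y_def)
  have vm: "v \<in> borel_measurable lebesgue" by (rule borel_imp_lebesgue_measurable[OF v(1)])
  have "Lp_mem lebesgue q u" using q'(1) Lp_mem_cong_AE[OF um vm v(2)] Lp_mem_lebesgue_iff(1)[OF v(1)] by blast
  moreover have "Lp_norm lebesgue q u = Lp_norm lborel q v"
   using Lp_norm_cong_AE[OF um vm v(2)] Lp_mem_lebesgue_iff(2)[OF v(1)] by simp
  moreover have "C * (c * seminorm_sp (s 1) (p 1) u powr p 1) powr (1 / p 1) = C * c powr (1 / p 1) * seminorm_sp (s 1) (p 1) u"
   using c p1 by (simp add: powr_mult powr_powr seminorm_sp_def)
  moreover have "... <= C * c powr (1 / p 1) * N u" using seminorm_le_N[OF k] C(1) by (intro mult_left_mono) auto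
  ultimately show ?thesis using q'(2) by (simp only: simp_thms)
 qed
 thus ?thesis using that[of "C * c powr (1 / p 1)"] C c by simp
qed

theorem compact_embedding:
 assumes q: "p 1 <= q" and sub: "real DIM('a) * (1 / p 1 - 1 / q) < s 1"
  and u: "!!n. u n \<in> Y" and bd: "!!n. N (u n) <= B"
 obtains k :: "nat => nat" where "strict_mono k" "!!e. e > 0 ==> \<exists>K. \<forall>i\<ge>K. \<forall>j\<ge>K. Lp_norm lebesgue q (u (k i) - u (k j)) < e"
proof -
 have k: "1 \<in> {1..m}" using m by simp
 note s1 = s(1)[OF k] s(2)[OF k] and p1 = p[OF k]
 define c where "c = modulus_const TYPE('a) (s 1) (p 1)"
 have c: "c > 0" unfolding c_def by (rule modulus_const_pos[OF s1 p1])
 have B: "B >= 0" using bd[of 0] N_nonneg order_trans by blast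
 \<comment> \<open>With \<open>2 * B\<close> in place of \<open>B\<close>, the same constant serves
   the sequence and its differences.\<close>
 define A where "A = c * (2 * B) powr p 1"
 have "\<forall>n. \<exists>v. v \<in> borel_measurable borel & (AE x in lebesgue. u n x = v x) & (AE x in lborel. u n x = v x) &
  (AE x in lborel. x \<notin> cball 0 R --> v x = 0)"
  using Borel_rep[OF u] by blast
 from choice[OF this] obtain v where v: "!!n. v n \<in> borel_measurable borel" "!!n. AE x in lebesgue. u n x = v n x"
  "!!n. AE x in lborel. u n x = v n x" "!!n. AE x in lborel. x \<notin> cball 0 R --> v n x = 0"
  by blast
 have mb: "modulus_bound (p 1) (s 1) A w'" if w: "w \<in> Y" "N w <= 2 * B" and w': "w' \<in> borel_measurable borel" "AE x in lborel. w x = w' x" for w w'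
 proof (rule modulus_bound_mono)
  show "modulus_bound (p 1) (s 1) (c * seminorm_sp (s 1) (p 1) w powr p 1) w'"
   unfolding c_def by (rule dom_sp_modulus_bound[OF s1 p1 YD[OF w(1) k] w'])
  have "seminorm_sp (s 1) (p 1) w <= 2 * B" using seminorm_le_N[OF k, of w] w(2) by simp
  thus "c * seminorm_sp (s 1) (p 1) w powr p 1 <= A"
   unfolding A_def using c p1 by (intro mult_left_mono powr_mono2) (auto simp: seminorm_sp_def)
 qed
 have b1: "modulus_bound (p 1) (s 1) A (v n)" for n
  by (rule mb[OF u _ v(1,3)]) (use bd[of n] B in linarith)
 have b2: "modulus_bound (p 1) (s 1) A (%x. v n x - v j x)" for n j
 proof (rule mb[OF Y_diff[OF u[of n] u[of j]]])
  have "N (u n - u j) <= N (u n) + N (u j)"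
   using N_add[OF u[of n] Y_scale[OF u[of j], of "-1"]] N_scale[OF u[of j], of "-1"] by simp
  thus "N (u n - u j) <= 2 * B" using bd[of n] bd[of j] by linarith
  show "(%x. v n x - v j x) \<in> borel_measurable borel" using v(1) by measurable
  show "AE x in lborel. (u n - u j) x = v n x - v j x"
   using v(3)[of n] v(3)[of j] by eventually_elim simp
 qed
 obtain r :: "nat => nat" where r: "strict_mono r" "!!e. e > 0 ==> \<exists>K. \<forall>i\<ge>K. \<forall>j\<ge>K. Lp_norm lborel q (%x. v (r i) x - v (r j) x) < e"
  by (rule compactness_modulus[where u = v, OF p1 q s1(1) sub R(1) v(1) v(4) b1 b2]) (rule that)
 have "Lp_norm lebesgue q (u i - u j) = Lp_norm lborel q (%x. v i x - v j x)" for i j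
 proof -
  have mv: "(%x. v i x - v j x) \<in> borel_measurable borel" using v(1) by measurable
  have "u i - u j \<in> borel_measurable lebesgue" using Y_diff[OF u[of i] u[of j]] by (simp add: Y_def)
  moreover have "AE x in lebesgue. (u i - u j) x = v i x - v j x"
   using v(2)[of i] v(2)[of j] by eventually_elim simp
  ultimately have "Lp_norm lebesgue q (u i - u j) = Lp_norm lebesgue q (%x. v i x - v j x)"
   using borel_imp_lebesgue_measurable[OF mv] by (intro Lp_norm_cong_AE)
  thus ?thesis using Lp_mem_lebesgue_iff(2)[OF mv] by simp
 qed
 with r that show ?thesis by simp
qed

end

text \<open>On a set of finite measure the sequence is Cauchy in mean, which yields an almost
  everywhere convergent subsequence; Fatou then gives convergence of the whole sequence in the p-th
  norm. The subsequence is returned as well, because \<open>dom_sp_frac_limit\<close> requires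
  one.\<close>

lemma Lp_complete:
 fixes f :: "nat => 'x => 'v::euclidean_space"
 assumes p: "p > 1" and f: "!!n. Lp_mem M p (f n)" and B: "B \<in> sets M" "emeasure M B < \<infinity>"
  and supp: "!!n. AE x in M. x \<notin> B --> f n x = 0"
  and cau: "!!e. e > 0 ==> \<exists>K. \<forall>i\<ge>K. \<forall>j\<ge>K. Lp_norm M p (%x. f i x - f j x) < e"
 obtains r g where "strict_mono (r :: nat => nat)" "g \<in> borel_measurable M" "AE x in M. (%n. f (r n) x) \<longlonglongrightarrow> g x"
  "AE x in M. x \<notin> B --> g x = 0"
  "Lp_mem M p g" "(%n. Lp_norm M p (%x. f n x - g x)) \<longlonglongrightarrow> 0"
proof -
 let ?c = "measure M B powr ((p - 1) / p)"
 have [measurable]: "f n \<in> borel_measurable M" for n using f by (simp add: Lp_mem_def)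
 have d: "Lp_mem M p (%x. f i x - f j x)" for i j using p by (intro Lp_mem_diff f) auto
 have sd: "AE x in M. x \<notin> B --> f i x - f j x = 0" for i j
  using supp[of i] supp[of j] by eventually_elim auto
 have L1: "integrable M (f n)" for n by (rule L1_le_Lp(1)[OF p f B supp])
 have c0: "?c + 1 > 0" using powr_ge_zero[of "measure M B" "(p - 1) / p"] by linarith
 obtain r where r: "strict_mono (r :: nat => nat)" "AE x in M. Cauchy (%i. f (r i) x)"
 proof (rule cauchy_L1_AE_cauchy_subseq[OF L1])
  fix e :: real assume "e > 0"
  hence "e / (?c + 1) > 0" using c0 by simp
  then obtain K where K: "!!i j. i >= K ==> j >= K ==> Lp_norm M p (%x. f i x - f j x) < e / (?c + 1)" using cau by blast
  have "(LINT x|M. norm (f i x - f j x)) < e" if "i >= K" "j >= K" for i j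
  proof -
   have "(LINT x|M. norm (f i x - f j x)) <= ?c * Lp_norm M p (%x. f i x - f j x)" by (rule L1_le_Lp(2)[OF p d B sd])
   also have "... <= (?c + 1) * Lp_norm M p (%x. f i x - f j x)" using Lp_norm_nonneg by (intro mult_right_mono) auto
   also have "... < e" using K[OF that] c0 by (simp add: field_simps)
   finally show ?thesis .
  qed
  thus "\<exists>N. \<forall>i\<ge>N. \<forall>j\<ge>N. (LINT x|M. norm (f i x - f j x)) < e" by blast
 qed (rule that)
 define g where "g x = lim (%i. f (r i) x)" for x
 have g[measurable]: "g \<in> borel_measurable M" unfolding g_def by measurable
 have conv: "AE x in M. (%n. f (r n) x) \<longlonglongrightarrow> g x"
  using r(2) by eventually_elim (simp add: g_def Cauchy_convergent_iff convergent_LIMSEQ_iff)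
 have "AE x in M. \<forall>n. x \<notin> B --> f n x = 0" using supp unfolding AE_all_countable by blast
 with conv have gs: "AE x in M. x \<notin> B --> g x = 0"
  by eventually_elim (auto dest: LIMSEQ_unique[OF _ tendsto_const])
 have lim: "Lp_mem M p (%x. f j x - g x) & Lp_norm M p (%x. f j x - g x) <= e"
  if K: "!!i. i >= K ==> Lp_norm M p (%x. f j x - f i x) <= e" for e j K
 proof -
  have ae: "AE x in M. (%n. f j x - f (r (n + K)) x) \<longlonglongrightarrow> f j x - g x"
   using conv
  proof eventually_elim
   case (elim x)
   thus ?case by (intro tendsto_intros LIMSEQ_ignore_initial_segment)
  qed
  have "r (n + K) >= K" for n using strict_mono_imp_increasing[OF r(1), of "n + K"] by simp
  hence "Lp_norm M p (%x. f j x - f (r (n + K)) x) <= e" for n by (rule K)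
  thus ?thesis using Lp_Fatou[OF _ d _ ae, of e] p by simp
 qed
 have mem: "Lp_mem M p g"
 proof -
  obtain K where K: "!!i j. i >= K ==> j >= K ==> Lp_norm M p (%x. f i x - f j x) < 1" using cau[of 1] by auto
  have "Lp_mem M p (%x. f K x - g x)" using lim[of K K 1] K[of K] by (simp add: less_imp_le)
  hence "Lp_mem M p (%x. f K x - (f K x - g x))" using p f by (intro Lp_mem_diff[where f = "f K" and g = "%x. f K x - g x"]) auto
  thus ?thesis by simp
 qed
 have "(%n. Lp_norm M p (%x. f n x - g x)) \<longlonglongrightarrow> 0"
 proof (rule LIMSEQ_I)
  fix e :: real assume e: "e > 0"
  obtain K where K: "!!i j. i >= K ==> j >= K ==> Lp_norm M p (%x. f i x - f j x) < e / 2" using cau[of "e / 2"] e by auto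
  have "Lp_norm M p (%x. f j x - g x) <= e / 2" if "j >= K" for j
   using lim[of K j "e / 2"] K[OF that] by (simp add: less_imp_le)
  hence "norm (Lp_norm M p (%x. f j x - g x) - 0) < e" if "j >= K" for j using that e Lp_norm_nonneg[of M p "%x. f j x - g x"] by fastforce
  thus "\<exists>no. \<forall>n\<ge>no. norm (Lp_norm M p (%x. f n x - g x) - 0) < e" by blast
 qed
 thus ?thesis using that r(1) g conv gs mem by blast
qed

text \<open>A test function and its directional derivatives are bounded, so both sides of the
  defining identity converge under convergence in mean.\<close>

lemma has_weak_gradient_limit:
 fixes w :: "nat => 'a::euclidean_space => real"
 assumes wg: "!!n. has_weak_gradient (w n) (g n)"
  and int: "!!n. integrable lebesgue (w n)" "integrable lebesgue u" "!!n. integrable lebesgue (g n)" "integrable lebesgue k"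
  and lim: "(%n. \<integral>x. norm (w n x - u x) \<partial>lebesgue) \<longlonglongrightarrow> 0" "(%n. \<integral>x. norm (g n x - k x) \<partial>lebesgue) \<longlonglongrightarrow> 0"
 shows "has_weak_gradient u k"
 unfolding has_weak_gradient_def
proof (intro conjI ballI allI)
 show "locally_integrable u" unfolding locally_integrable_def set_integrable_def
  using int(2) by (intro allI impI integrable_mult_indicator) (auto dest: compact_imp_closed)
 show "locally_integrable k" unfolding locally_integrable_def set_integrable_def
  using int(4) by (intro allI impI integrable_mult_indicator) (auto dest: compact_imp_closed)
 fix psi :: "'a => real" and v :: 'a assume psi: "psi \<in> test_functions UNIV"
 obtain K where K: "compact K" "!!x. x \<notin> K ==> psi x = 0" "!!x v. x \<notin> K ==> frechet_derivative psi (at x) v = 0"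
  by (rule test_functions_support_deriv[OF psi]) blast
 have bd: "\<exists>B>0. \<forall>x. \<bar>q x\<bar> <= B" if "continuous_on UNIV q" "!!x. x \<notin> K ==> q x = 0" for q :: "'a => real"
  by (rule bounded_of_compact_support[OF that(1) K(1) that(2)]) auto
 obtain B1 where B1: "!!x. \<bar>psi x\<bar> <= B1" using bd[OF test_functionsD(2)[OF psi] K(2)] by blast
 obtain B2 where B2: "!!x. \<bar>frechet_derivative psi (at x) v\<bar> <= B2" using bd[OF test_functionsD(4)[OF psi] K(3)] by blast
 have [measurable]: "psi \<in> borel_measurable lebesgue" "(%x. frechet_derivative psi (at x) v) \<in> borel_measurable lebesgue"
  using test_functionsD(2,4)[OF psi] by (auto intro!: borel_imp_lebesgue_measurable borel_measurable_continuous_onI)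
 have conv: "(%n. \<integral>x. a n x * q x \<partial>lebesgue) \<longlonglongrightarrow> (LINT x|lebesgue. b x * q x)"
  if a: "!!n. integrable lebesgue (a n)" "integrable lebesgue b" and l: "(%n. \<integral>x. norm (a n x - b x) \<partial>lebesgue) \<longlonglongrightarrow> 0"
   and q: "q \<in> borel_measurable lebesgue" "!!x. \<bar>q x\<bar> <= B" for a and b q :: "'a => real" and B
 proof (rule LIM_zero_cancel, rule Lim_null_comparison)
  have i: "integrable lebesgue (%x. a n x * q x)" "integrable lebesgue (%x. b x * q x)" for n
   using a q integrable_mult_bounded by blast+
  have "norm ((LINT x|lebesgue. a n x * q x) - (LINT x|lebesgue. b x * q x)) <= B * (LINT x|lebesgue. norm (a n x - b x))" for n
  proof -
   have "(LINT x|lebesgue. a n x * q x) - (LINT x|lebesgue. b x * q x) = (LINT x|lebesgue. (a n x - b x) * q x)"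
    using i by (simp add: left_diff_distrib)
   moreover have "norm (LINT x|lebesgue. (a n x - b x) * q x) <= (LINT x|lebesgue. B * norm (a n x - b x))"
   proof (rule Bochner_Integration.integral_norm_bound_integral)
    show "integrable lebesgue (%x. (a n x - b x) * q x)" using i by (simp add: left_diff_distrib)
    show "integrable lebesgue (%x. B * norm (a n x - b x))" using a by simp
    fix x show "norm ((a n x - b x) * q x) <= B * norm (a n x - b x)"
     using mult_left_mono[OF q(2)[of x], of "\<bar>a n x - b x\<bar>"] by (simp add: abs_mult mult.commute)
   qed
   ultimately show ?thesis by simp
  qed
  thus "\<forall>\<^sub>F n in sequentially. norm ((LINT x|lebesgue. a n x * q x) - (LINT x|lebesgue. b x * q x)) <= B * (LINT x|lebesgue. norm (a n x - b x))"
   by simp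
  show "(%n. B * (LINT x|lebesgue. norm (a n x - b x))) \<longlonglongrightarrow> 0" using tendsto_mult_left[OF l, of B] by simp
 qed
 have l2: "(%n. \<integral>x. norm (g n x \<bullet> v - k x \<bullet> v) \<partial>lebesgue) \<longlonglongrightarrow> 0"
 proof (rule Lim_null_comparison)
  show "(%n. norm v * (LINT x|lebesgue. norm (g n x - k x))) \<longlonglongrightarrow> 0" using tendsto_mult_left[OF lim(2), of "norm v"] by simp
  have "(LINT x|lebesgue. norm (g n x \<bullet> v - k x \<bullet> v)) <= (LINT x|lebesgue. norm v * norm (g n x - k x))" for n
  proof (rule integral_mono)
   show "integrable lebesgue (%x. norm (g n x \<bullet> v - k x \<bullet> v))" using int by simp
   show "integrable lebesgue (%x. norm v * norm (g n x - k x))" using int by simp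
   fix x show "norm (g n x \<bullet> v - k x \<bullet> v) <= norm v * norm (g n x - k x)"
    using Cauchy_Schwarz_ineq2[of "g n x - k x" v] by (simp add: inner_diff_left mult.commute)
  qed
  thus "\<forall>\<^sub>F n in sequentially. norm (LINT x|lebesgue. norm (g n x \<bullet> v - k x \<bullet> v)) <= norm v * (LINT x|lebesgue. norm (g n x - k x))"
   by (simp add: abs_of_nonneg[OF Bochner_Integration.integral_nonneg])
 qed
 have "(%n. \<integral>x. w n x * frechet_derivative psi (at x) v \<partial>lebesgue) \<longlonglongrightarrow> (LINT x|lebesgue. u x * frechet_derivative psi (at x) v)"
  by (rule conv[OF int(1,2) lim(1) _ B2]) measurable
 moreover have "(%n. - (LINT x|lebesgue. (g n x \<bullet> v) * psi x)) \<longlonglongrightarrow> - (LINT x|lebesgue. (k x \<bullet> v) * psi x)"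
  by (intro tendsto_minus conv[OF _ _ l2 _ B1]) (use int in auto)
 moreover have "(LINT x|lebesgue. w n x * frechet_derivative psi (at x) v) = - (LINT x|lebesgue. (g n x \<bullet> v) * psi x)" for n
  using wg[of n] psi by (simp add: has_weak_gradient_def)
 ultimately show "(LINT x|lebesgue. u x * frechet_derivative psi (at x) v) = - (LINT x|lebesgue. (k x \<bullet> v) * psi x)"
  using LIMSEQ_unique by simp blast
qed

lemma seminorm_frac_Lp: "0 < s ==> s < 1 ==> p > 1 ==>
  seminorm_sp s p (u :: 'a::euclidean_space => real) = frac_const DIM('a) s p powr (1 / p) * Lp_norm lebesgue p (quotient_sp s p u)"
 by (simp add: seminorm_frac_eq p_form.nrm_def[OF p_form_frac])

text \<open>Difference quotients converge almost everywhere as soon as the functions do, so Fatou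
  applied to \<open>w j - w i\<close> shows at once that \<open>u\<close> has finite seminorm and
  that the seminorms of \<open>w j - u\<close> tend to 0.\<close>

lemma dom_sp_frac_limit:
 fixes w :: "nat => 'a::euclidean_space => real"
 assumes s: "0 < s" "s < 1" and p: "p > 1" and w: "!!n. w n \<in> dom_sp s p" and u: "u \<in> borel_measurable lebesgue"
  and r: "strict_mono (r :: nat => nat)" and conv: "AE x in lebesgue. (%n. w (r n) x) \<longlonglongrightarrow> u x"
  and cau: "!!e. e > 0 ==> \<exists>K. \<forall>i\<ge>K. \<forall>j\<ge>K. seminorm_sp s p (w i - w j) < e"
 shows "u \<in> dom_sp s p" "(%n. seminorm_sp s p (w n - u)) \<longlonglongrightarrow> 0"
proof -
 define c where "c = frac_const DIM('a) s p powr (1 / p)"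
 have c: "c > 0" using frac_const_pos[of s p "DIM('a)"] s p by (simp add: c_def)
 have sub: "subspace (dom_sp s p :: ('a => real) set)" by (rule dom_sp_subspace) (use s p in auto)
 have sem: "seminorm_sp s p v = c * Lp_norm lebesgue p (quotient_sp s p v)" for v :: "'a => real"
  unfolding c_def by (rule seminorm_frac_Lp[OF s p])
 have dd: "w i - w j \<in> dom_sp s p" for i j by (rule subspace_diff[OF sub w w])
 have lim: "w j - u \<in> dom_sp s p & seminorm_sp s p (w j - u) <= e"
  if K: "!!i. i >= K ==> seminorm_sp s p (w j - w i) <= e" for e j K
 proof -
  have "AE z in lborel. (%n. w (r n) (fst z)) \<longlonglongrightarrow> u (fst z) & (%n. w (r n) (snd z)) \<longlonglongrightarrow> u (snd (z :: 'a \<times> 'a))"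
   by (rule AE_lborel_fst_snd) (use conv in \<open>simp add: AE_lebesgue_iff\<close>)
  hence ae: "AE z in lebesgue. (%n. quotient_sp s p (w j - w (r (n + K))) z) \<longlonglongrightarrow> quotient_sp s p (w j - u) z"
   unfolding AE_lebesgue_iff
  proof eventually_elim
   case (elim z)
   hence "(%n. w (r (n + K)) (fst z)) \<longlonglongrightarrow> u (fst z)" "(%n. w (r (n + K)) (snd z)) \<longlonglongrightarrow> u (snd z)"
    by (simp_all add: LIMSEQ_ignore_initial_segment[where f = "%n. w (r n) _"])
   thus ?case unfolding quotient_sp_def case_prod_unfold divide_inverse minus_apply by (intro tendsto_intros)
  qed
  have rK: "r (n + K) >= K" for n using strict_mono_imp_increasing[OF r, of "n + K"] by simp
  have "Lp_norm lebesgue p (quotient_sp s p (w j - w (r (n + K)))) <= e / c" for n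
   using K[OF rK[of n]] c by (simp add: sem field_simps)
  moreover have "Lp_mem lebesgue p (quotient_sp s p (w j - w (r (n + K))))" for n
   using dd dom_sp_frac_iff[OF s p] by blast
  moreover have jm: "w j - u \<in> borel_measurable lebesgue"
   unfolding fun_diff_def using w[of j] u by (intro borel_measurable_diff) (auto simp: dom_sp_def)
  moreover note quotient_sp_measurable[OF jm, of s p]
  ultimately have "Lp_mem lebesgue p (quotient_sp s p (w j - u))" "Lp_norm lebesgue p (quotient_sp s p (w j - u)) <= e / c"
   using Lp_Fatou[of p lebesgue "%n. quotient_sp s p (w j - w (r (n + K)))" "quotient_sp s p (w j - u)" "e / c"] p ae by simp_all
  thus ?thesis using jm c by (simp add: dom_sp_frac_iff[OF s p] sem field_simps)
 qed
 obtain K where K: "!!i j. i >= K ==> j >= K ==> seminorm_sp s p (w i - w j) < 1" using cau[of 1] by auto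
 have "w K - u \<in> dom_sp s p" using lim[of K K 1] K[of K] by (simp add: less_imp_le)
 from subspace_diff[OF sub w[of K] this] show "u \<in> dom_sp s p" by simp
 show "(%n. seminorm_sp s p (w n - u)) \<longlonglongrightarrow> 0"
 proof (rule LIMSEQ_I)
  fix e :: real assume e: "e > 0"
  obtain K where K: "!!i j. i >= K ==> j >= K ==> seminorm_sp s p (w i - w j) < e / 2" using cau[of "e / 2"] e by auto
  have "seminorm_sp s p (w j - u) <= e / 2" if "j >= K" for j
   using lim[of K j "e / 2"] K[OF that] by (simp add: less_imp_le)
  hence "norm (seminorm_sp s p (w j - u) - 0) < e" if "j >= K" for j using that e seminorm_sp_nonneg[of s p "w j - u"] s p by fastforce
  thus "\<exists>no. \<forall>n\<ge>no. norm (seminorm_sp s p (w n - u) - 0) < e" by blast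
 qed
qed

text \<open>The gradients converge in the p-th norm to some \<open>g\<close>. Their common support
  of finite measure turns this into convergence in mean, which identifies \<open>g\<close> as a weak
  gradient of \<open>u\<close>.\<close>

lemma dom_sp_grad_limit:
 fixes w :: "nat => 'a::euclidean_space => real"
 assumes p: "p > 1" and w: "!!n. w n \<in> dom_sp 1 p" "!!n. integrable lebesgue (w n)" and u: "integrable lebesgue u"
  and B: "B \<in> sets lebesgue" "emeasure lebesgue B < \<infinity>" and supp: "!!n. AE x in lebesgue. x \<notin> B --> weak_gradient (w n) x = 0"
  and lim: "(%n. \<integral>x. norm (w n x - u x) \<partial>lebesgue) \<longlonglongrightarrow> 0"
  and cau: "!!e. e > 0 ==> \<exists>K. \<forall>i\<ge>K. \<forall>j\<ge>K. seminorm_sp 1 p (w i - w j) < e"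
 shows "u \<in> dom_sp 1 p" "(%n. seminorm_sp 1 p (w n - u)) \<longlonglongrightarrow> 0"
proof -
 have sem: "seminorm_sp 1 p v = Lp_norm lebesgue p (weak_gradient v)" for v :: "'a => real"
  using p by (simp add: seminorm_grad_eq p_form.nrm_def[OF p_form_grad])
 have sub: "subspace (dom_sp 1 p :: ('a => real) set)" by (rule dom_sp_subspace) (use p in auto)
 have mem: "Lp_mem lebesgue p (weak_gradient (v :: 'a => real))" if "v \<in> dom_sp 1 p" for v by (rule dom_sp_gradD(2)[OF that])
 have gm: "weak_gradient v \<in> borel_measurable lebesgue" if "v \<in> dom_sp 1 p" for v :: "'a => real"
  using mem[OF that] by (simp add: Lp_mem_def)
 have d: "AE x in lebesgue. weak_gradient (v - v') x = weak_gradient v x - weak_gradient v' x"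
  if "v \<in> dom_sp 1 p" "v' \<in> dom_sp 1 p" for v v' :: "'a => real"
  by (rule p_form.diff_AE[OF p_form_grad[OF p] that])
 have dn: "seminorm_sp 1 p (v - v') = Lp_norm lebesgue p (%x. weak_gradient v x - weak_gradient v' x)"
  if "v \<in> dom_sp 1 p" "v' \<in> dom_sp 1 p" for v v' :: "'a => real"
  unfolding sem by (rule Lp_norm_cong_AE[OF gm[OF subspace_diff[OF sub that]] _ d[OF that]])
   (intro borel_measurable_diff gm that)
 obtain r g where g: "strict_mono (r :: nat => nat)" "g \<in> borel_measurable lebesgue"
  "AE x in lebesgue. (%n. weak_gradient (w (r n)) x) \<longlonglongrightarrow> g x" "AE x in lebesgue. x \<notin> B --> g x = 0"
  "Lp_mem lebesgue p g" "(%n. Lp_norm lebesgue p (%x. weak_gradient (w n) x - g x)) \<longlonglongrightarrow> 0"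
  by (rule Lp_complete[OF p mem[OF w(1)] B supp]) (use cau in \<open>simp add: dn[OF w(1) w(1)]\<close>)
 have dm: "Lp_mem lebesgue p (%x. weak_gradient (w n) x - g x)" for n using p by (intro Lp_mem_diff mem w g) auto
 have ds: "AE x in lebesgue. x \<notin> B --> weak_gradient (w n) x - g x = 0" for n
  using supp[of n] g(4) by eventually_elim auto
 have L1: "(%n. \<integral>x. norm (weak_gradient (w n) x - g x) \<partial>lebesgue) \<longlonglongrightarrow> 0"
 proof (rule Lim_null_comparison)
  show "(%n. measure lebesgue B powr ((p - 1) / p) * Lp_norm lebesgue p (%x. weak_gradient (w n) x - g x)) \<longlonglongrightarrow> 0"
   using tendsto_mult_left[OF g(6)] by fastforce
  show "\<forall>\<^sub>F n in sequentially. norm (LINT x|lebesgue. norm (weak_gradient (w n) x - g x)) <=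
    measure lebesgue B powr ((p - 1) / p) * Lp_norm lebesgue p (%x. weak_gradient (w n) x - g x)"
   using L1_le_Lp(2)[OF p dm B ds] by (simp add: abs_of_nonneg[OF Bochner_Integration.integral_nonneg])
 qed
 have wg: "has_weak_gradient u g"
  by (rule has_weak_gradient_limit[OF dom_sp_gradD(1)[OF w(1)] w(2) u L1_le_Lp(1)[OF p mem[OF w(1)] B supp] L1_le_Lp(1)[OF p g(5) B g(4)] lim L1])
 show ud: "u \<in> dom_sp 1 p" unfolding dom_sp_grad_iff using wg g(5) u by (auto dest: borel_measurable_integrable)
 have "seminorm_sp 1 p (w n - u) = Lp_norm lebesgue p (%x. weak_gradient (w n) x - g x)" for n
  unfolding dn[OF w(1) ud]
 proof (rule Lp_norm_cong_AE)
  show "AE x in lebesgue. weak_gradient (w n) x - weak_gradient u x = weak_gradient (w n) x - g x"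
   using weak_gradient_AE_eq[OF wg] by eventually_elim simp
 qed (intro borel_measurable_diff gm w ud g)+
 thus "(%n. seminorm_sp 1 p (w n - u)) \<longlonglongrightarrow> 0" using g(6) by simp
qed

context energy_space
begin

lemma X_closed:
 assumes w: "!!n. w n \<in> X" and u: "u \<in> Y" and lim: "(%n. N (w n - u)) \<longlonglongrightarrow> 0"
 shows "u \<in> X"
proof -
 have "\<forall>n. \<exists>phi. phi \<in> test_functions \<Omega> & N (w n - phi) < 1 / real (Suc n)"
 proof
  fix n
  obtain phi where phi: "!!j. phi j \<in> test_functions \<Omega>" "(%j. N (w n - phi j)) \<longlonglongrightarrow> 0" using w[of n] unfolding X_eq by blast
  have "\<forall>\<^sub>F j in sequentially. N (w n - phi j) < 1 / real (Suc n)" by (rule order_tendstoD(2)[OF phi(2)]) simp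
  then obtain j where "N (w n - phi j) < 1 / real (Suc n)" by (auto simp: eventually_sequentially)
  with phi(1) show "\<exists>phi. phi \<in> test_functions \<Omega> & N (w n - phi) < 1 / real (Suc n)" by blast
 qed
 from choice[OF this] obtain phi where phi: "!!n. phi n \<in> test_functions \<Omega>" "!!n. N (w n - phi n) < 1 / real (Suc n)" by blast
 have "(%n. N (u - phi n)) \<longlonglongrightarrow> 0"
 proof (rule Lim_null_comparison)
  show "(%n. N (w n - u) + 1 / real (Suc n)) \<longlonglongrightarrow> 0"
   using tendsto_add[OF lim LIMSEQ_inverse_real_of_nat] by (simp add: inverse_eq_divide)
  have "N (u - phi n) <= N (w n - u) + 1 / real (Suc n)" for n
  proof -
   have "N ((u - w n) + (w n - phi n)) <= N (u - w n) + N (w n - phi n)"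
    by (intro N_add Y_diff u X_Y w test_in_Y phi)
   moreover have "N (u - w n) = N (w n - u)" by (intro N_minus_commute u X_Y w)
   moreover have "(u - w n) + (w n - phi n) = u - phi n" by simp
   ultimately show ?thesis using phi(2)[of n] by simp
  qed
  thus "\<forall>\<^sub>F n in sequentially. norm (N (u - phi n)) <= N (w n - u) + 1 / real (Suc n)" using N_nonneg by simp
 qed
 thus ?thesis by (rule X_I[OF _ u phi(1)])
qed

text \<open>\<open>Sobolev\<close> with \<open>q = p 1\<close> acts as a Poincare inequality and
  provides a single limit function \<open>u\<close>; each seminorm is then treated separately, with
  that same \<open>u\<close>.\<close>

theorem X_complete:
 assumes w: "!!n :: nat. w n \<in> X" and cau: "!!e. e > 0 ==> \<exists>K. \<forall>i\<ge>K. \<forall>j\<ge>K. N (w i - w j) < e"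
 shows "\<exists>u\<in>X. (%n. N (w n - u)) \<longlonglongrightarrow> 0"
proof -
 have k1: "1 \<in> {1..m}" using m by simp
 note p1 = p[OF k1]
 have wd: "w i - w j \<in> Y" for i j by (intro Y_diff X_Y w)
 obtain C where C: "C > 0" "!!u. u \<in> Y ==> Lp_mem lebesgue (p 1) u & Lp_norm lebesgue (p 1) u <= C * N u"
  using Sobolev[of "p 1"] s(1)[OF k1] by auto
 have supp: "AE x in lebesgue. x \<notin> \<Omega> --> w n x = 0" for n using X_Y[OF w] by (simp add: Y_def)
 have mem: "Lp_mem lebesgue (p 1) (w n)" for n using C(2)[OF X_Y[OF w]] by blast
 obtain r u where u: "strict_mono (r :: nat => nat)" "u \<in> borel_measurable lebesgue" "AE x in lebesgue. (%n. w (r n) x) \<longlonglongrightarrow> u x"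
  "AE x in lebesgue. x \<notin> \<Omega> --> u x = 0" "Lp_mem lebesgue (p 1) u" "(%n. Lp_norm lebesgue (p 1) (%x. w n x - u x)) \<longlonglongrightarrow> 0"
 proof (rule Lp_complete[OF p1 mem \<Omega>_sets supp])
  fix e :: real assume "e > 0"
  hence "e / C > 0" using C by simp
  then obtain K where K: "!!i j. i >= K ==> j >= K ==> N (w i - w j) < e / C" using cau by blast
  have "Lp_norm lebesgue (p 1) (%x. w i x - w j x) < e" if "i >= K" "j >= K" for i j
  proof -
   have "Lp_norm lebesgue (p 1) (%x. w i x - w j x) <= C * N (w i - w j)" using C(2)[OF wd[of i j]] by (simp add: fun_diff_def)
   also have "... < e" using K[OF that] C(1) by (simp add: field_simps)
   finally show ?thesis .
  qed
  thus "\<exists>K. \<forall>i\<ge>K. \<forall>j\<ge>K. Lp_norm lebesgue (p 1) (%x. w i x - w j x) < e" by blast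
 qed (rule that)
 have dmem: "Lp_mem lebesgue (p 1) (%x. w n x - u x)" for n using p1 by (intro Lp_mem_diff mem u) auto
 have dsupp: "AE x in lebesgue. x \<notin> \<Omega> --> w n x - u x = 0" for n using supp[of n] u(4) by eventually_elim auto
 have L1: "(%n. \<integral>x. norm (w n x - u x) \<partial>lebesgue) \<longlonglongrightarrow> 0"
 proof (rule Lim_null_comparison)
  show "(%n. measure lebesgue \<Omega> powr ((p 1 - 1) / p 1) * Lp_norm lebesgue (p 1) (%x. w n x - u x)) \<longlonglongrightarrow> 0"
   using tendsto_mult_left[OF u(6)] by fastforce
  show "\<forall>\<^sub>F n in sequentially. norm (LINT x|lebesgue. norm (w n x - u x)) <=
    measure lebesgue \<Omega> powr ((p 1 - 1) / p 1) * Lp_norm lebesgue (p 1) (%x. w n x - u x)"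
   using L1_le_Lp(2)[OF p1 dmem \<Omega>_sets dsupp] by (simp add: abs_of_nonneg[OF Bochner_Integration.integral_nonneg])
 qed
 have k: "u \<in> dom_sp (s k) (p k) & (%n. sn k (w n - u)) \<longlonglongrightarrow> 0" if k: "k \<in> {1..m}" for k
 proof -
  have wk: "w n \<in> dom_sp (s k) (p k)" for n by (rule YD[OF X_Y[OF w] k])
  have ck: "\<exists>K. \<forall>i\<ge>K. \<forall>j\<ge>K. sn k (w i - w j) < e" if "e > 0" for e
   using cau[OF that] le_less_trans[OF seminorm_le_N[OF k]] by blast
  show ?thesis
  proof (cases "s k = 1")
   case True
   note T = True
   have wk': "w n \<in> dom_sp 1 (p k)" for n using wk T by simp
   have g0: "AE x in lebesgue. x \<notin> \<Omega> --> weak_gradient (w n) x = 0" for n by (rule weak_gradient_outside[OF w k T])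
   have iw: "integrable lebesgue (w n)" for n by (rule L1_le_Lp(1)[OF p1 mem \<Omega>_sets supp])
   have iu: "integrable lebesgue u" by (rule L1_le_Lp(1)[OF p1 u(5) \<Omega>_sets u(4)])
   have ck': "\<exists>K. \<forall>i\<ge>K. \<forall>j\<ge>K. seminorm_sp 1 (p k) (w i - w j) < e" if "e > 0" for e
    using ck[OF that] T by simp
   show ?thesis unfolding T using dom_sp_grad_limit[OF p[OF k] wk' iw iu \<Omega>_sets g0 L1 ck'] by blast
  next
   case False
   hence "s k < 1" using s(2)[OF k] by simp
   thus ?thesis using dom_sp_frac_limit[OF s(1)[OF k] _ p[OF k] wk u(2,1,3) ck] by blast
  qed
 qed
 hence uY: "u \<in> Y" using u by (simp add: Y_def)
 have "(%n. N (w n - u)) \<longlonglongrightarrow> 0" unfolding mu_norm_def using k by (intro tendsto_null_sum) blast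
 thus ?thesis using X_closed[where w = w, OF w uY] by blast
qed

end

section \<open>Superposition operators\<close>

text \<open>Rounding \<open>u x\<close> down to multiples of \<open>1 / real (Suc n)\<close> leaves
  countably many values, for which measurability in \<open>x\<close> suffices; continuity in the
  second argument gives the limit.\<close>

lemma superposition_measurable:
 fixes g :: "'x => real => real"
 assumes g: "!!t. (%x. g x t) \<in> borel_measurable M" "!!x. x \<in> space M ==> continuous_on UNIV (g x)"
  and u[measurable]: "u \<in> borel_measurable M"
 shows "(%x. g x (u x)) \<in> borel_measurable M"
proof (rule borel_measurable_LIMSEQ_metric)
 fix n
 have "(%x. \<lfloor>real (Suc n) * u x\<rfloor>) \<in> measurable M (count_space UNIV)" by measurable
 thus "(%x. g x (real_of_int \<lfloor>real (Suc n) * u x\<rfloor> / real (Suc n))) \<in> borel_measurable M"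
  by (rule measurable_compose_countable[OF g(1)])
next
 fix x assume x: "x \<in> space M"
 have "(%n. real_of_int \<lfloor>real (Suc n) * u x\<rfloor> / real (Suc n)) \<longlonglongrightarrow> u x"
 proof (rule LIM_zero_cancel, rule Lim_null_comparison)
  show "(%n. inverse (real (Suc n))) \<longlonglongrightarrow> 0" by (rule LIMSEQ_inverse_real_of_nat)
  have "norm (real_of_int \<lfloor>real (Suc n) * u x\<rfloor> / real (Suc n) - u x) <= inverse (real (Suc n))" for n
  proof -
   have "real_of_int \<lfloor>real (Suc n) * u x\<rfloor> / real (Suc n) - u x = (real_of_int \<lfloor>real (Suc n) * u x\<rfloor> - real (Suc n) * u x) / real (Suc n)"
    by (simp add: field_simps del: of_nat_Suc)
   moreover have "\<bar>real_of_int \<lfloor>real (Suc n) * u x\<rfloor> - real (Suc n) * u x\<bar> <= 1" by linarith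
   ultimately show ?thesis by (simp add: abs_divide inverse_eq_divide divide_right_mono del: of_nat_Suc)
  qed
  thus "\<forall>\<^sub>F n in sequentially. norm (real_of_int \<lfloor>real (Suc n) * u x\<rfloor> / real (Suc n) - u x) <= inverse (real (Suc n))" by simp
 qed
 thus "(%n. g x (real_of_int \<lfloor>real (Suc n) * u x\<rfloor> / real (Suc n))) \<longlonglongrightarrow> g x (u x)"
  using g(2)[OF x] by (auto simp: continuous_on_eq_continuous_at intro: isCont_tendsto_compose)
qed

lemma primitive_0 [simp]: "primitive f x 0 = 0"
 by (simp add: primitive_def zero_ereal_def)

lemma primitive_derivative:
 assumes "continuous_on UNIV (f x)"
 shows "(primitive f x has_real_derivative f x t) (at t)"
proof -
 have "((%t. LBINT tau=ereal 0..t. f x tau) has_vector_derivative f x t) (at t within {- \<bar>t\<bar> - 1..\<bar>t\<bar> + 1})"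
  by (rule interval_integral_FTC2) (use assms in \<open>auto intro: continuous_on_subset\<close>)
 moreover have "at t within {- \<bar>t\<bar> - 1..\<bar>t\<bar> + 1} = at t"
  by (rule at_within_interior) (auto simp: interior_atLeastAtMost_real)
 ultimately show ?thesis
  by (simp add: has_real_derivative_iff_has_vector_derivative primitive_def[abs_def] zero_ereal_def)
qed

text \<open>With the pair of point and integration variable as the parameter,
  \<open>superposition_measurable\<close> yields joint measurability of \<open>f\<close>;
  integrating out one variable preserves measurability.\<close>

lemma primitive_measurable:
 fixes f :: "'x => real => real"
 assumes f: "!!t. (%x. f x t) \<in> borel_measurable M" "!!x. x \<in> space M ==> continuous_on UNIV (f x)"
 shows "(%x. primitive f x t) \<in> borel_measurable M"
proof -
 have "(%z. f (fst z) (snd z)) \<in> borel_measurable (M \<Otimes>\<^sub>M lborel)"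
  by (rule superposition_measurable[where g = "%z. f (fst z)"]) (auto intro: measurable_compose[OF measurable_fst f(1)] f(2) simp: space_pair_measure)
 hence [measurable]: "(%z. f (fst z) (snd z)) \<in> borel_measurable (M \<Otimes>\<^sub>M lborel)" .
 have "(%x. \<integral>y. indicator A y *\<^sub>R f x y \<partial>lborel) \<in> borel_measurable M" if [measurable]: "A \<in> sets borel" for A :: "real set"
 proof (rule lborel.borel_measurable_lebesgue_integral)
  have "(%z. indicator A (snd z) *\<^sub>R f (fst z) (snd z)) \<in> borel_measurable (M \<Otimes>\<^sub>M lborel)" by measurable
  thus "(%(x, y). indicator A y *\<^sub>R f x y) \<in> borel_measurable (M \<Otimes>\<^sub>M lborel)" by (simp add: case_prod_unfold)
 qed
 thus ?thesis
  unfolding primitive_def interval_lebesgue_integral_def set_lebesgue_integral_def zero_ereal_def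
  by (cases "t >= 0") auto
qed

text \<open>Continuity and growth are required at every point of the space, not almost everywhere;
  the final theorem arranges this by changing the nonlinearity on a null set.\<close>

locale nemytskii =
 fixes M :: "'x measure" and f :: "'x => real => real" and q a b :: real
 assumes M: "emeasure M (space M) < \<infinity>" and q: "q > 1" and ab: "a >= 0" "b >= 0"
  and f_measurable: "!!t. (%x. f x t) \<in> borel_measurable M"
  and f_continuous: "!!x. x \<in> space M ==> continuous_on UNIV (f x)"
  and growth: "!!x t. x \<in> space M ==> \<bar>f x t\<bar> <= a + b * \<bar>t\<bar> powr (q - 1)"
begin

abbreviation q' :: real where "q' \<equiv> q / (q - 1)"

lemma q'_gt_1: "q' > 1" and q'_mult: "(q - 1) * q' = q"
 using q by (auto simp: field_simps)

lemma f_superposition [measurable (raw)]: "u \<in> borel_measurable M ==> (%x. f x (u x)) \<in> borel_measurable M"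
 by (rule superposition_measurable[OF f_measurable f_continuous])

lemma primitive_continuous: "x \<in> space M ==> continuous_on UNIV (primitive f x)"
 using primitive_derivative[of f x, OF f_continuous] by (intro DERIV_continuous_on) auto

lemma primitive_superposition [measurable (raw)]: "u \<in> borel_measurable M ==> (%x. primitive f x (u x)) \<in> borel_measurable M"
 by (rule superposition_measurable[OF primitive_measurable[OF f_measurable f_continuous] primitive_continuous])

text \<open>The mean value theorem for increments of either sign. The intermediate point is not
  chosen measurably; only the bound on \<open>z\<close> is used later.\<close>

lemma primitive_increment:
 assumes x: "x \<in> space M"
 obtains z where "\<bar>z\<bar> <= \<bar>t\<bar>" "primitive f x (v + t) - primitive f x v = f x (v + z) * t"
proof -
 note D = primitive_derivative[of f x, OF f_continuous[OF x]]
 consider "t = 0" | "t > 0" | "t < 0" by linarith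
 thus ?thesis
 proof cases
  case 1 thus ?thesis using that[of 0] by simp
 next
  case 2
  obtain y where "v < y" "y < v + t" "primitive f x (v + t) - primitive f x v = (v + t - v) * f x y"
   using MVT2[of v "v + t" "primitive f x" "f x"] D 2 by auto
  thus ?thesis using that[of "y - v"] by (simp add: mult.commute)
 next
  case 3
  obtain y where "v + t < y" "y < v" "primitive f x v - primitive f x (v + t) = (v - (v + t)) * f x y"
   using MVT2[of "v + t" v "primitive f x" "f x"] D 3 by auto
  thus ?thesis using that[of "y - v"] by (simp add: mult.commute)
 qed
qed

lemma primitive_growth:
 assumes x: "x \<in> space M"
 shows "\<bar>primitive f x t\<bar> <= a * \<bar>t\<bar> + b * \<bar>t\<bar> powr q"
proof -
 obtain z where z: "\<bar>z\<bar> <= \<bar>t\<bar>" "primitive f x (0 + t) - primitive f x 0 = f x (0 + z) * t"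
  by (rule primitive_increment[OF x])
 have "\<bar>f x z\<bar> <= a + b * \<bar>t\<bar> powr (q - 1)"
  using growth[OF x, of z] z(1) q ab by (intro order_trans[OF growth[OF x]] add_left_mono mult_left_mono powr_mono2) auto
 hence "\<bar>f x z * t\<bar> <= (a + b * \<bar>t\<bar> powr (q - 1)) * \<bar>t\<bar>" by (simp add: abs_mult mult_right_mono)
 also have "\<bar>t\<bar> powr (q - 1) * \<bar>t\<bar> = \<bar>t\<bar> powr q"
  using q by (cases "t = 0") (auto simp: powr_mult_base[of "\<bar>t\<bar>" "q - 1"] mult.commute)
 hence "(a + b * \<bar>t\<bar> powr (q - 1)) * \<bar>t\<bar> = a * \<bar>t\<bar> + b * \<bar>t\<bar> powr q" by (simp add: algebra_simps)
 finally show ?thesis using z(2) by simp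
qed

lemma const_integrable: "integrable M (%_. c :: real)"
 using M by (intro finite_measure.integrable_const finite_measureI) auto

lemma growth_powr:
 assumes "A >= 0" "B >= 0" "y >= 0" "\<bar>v\<bar> <= A + B * y powr (q - 1)"
 shows "\<bar>v\<bar> powr q' <= 2 powr q' * (A powr q' + B powr q' * y powr q)"
proof -
 have "\<bar>v\<bar> powr q' <= (A + B * y powr (q - 1)) powr q'" using assms q'_gt_1 by (intro powr_mono2) auto
 also have "... <= 2 powr q' * (A powr q' + (B * y powr (q - 1)) powr q')" using assms q'_gt_1 by (intro powr_add_le) auto
 also have "(B * y powr (q - 1)) powr q' = B powr q' * y powr q" using assms q'_mult by (simp add: powr_mult powr_powr)
 finally show ?thesis .
qed

text \<open>The bound is explicit in the norm of \<open>u\<close>, so that bounded sequences have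
  uniformly bounded images in the dual space.\<close>

lemma superposition_Lp:
 assumes u: "Lp_mem M q u"
 shows "Lp_mem M q' (%x. f x (u x))"
  "(LINT x|M. \<bar>f x (u x)\<bar> powr q') <= 2 powr q' * (a powr q' * measure M (space M) + b powr q' * Lp_norm M q u powr q)"
proof -
 have [measurable]: "u \<in> borel_measurable M" and iu: "integrable M (%x. \<bar>u x\<bar> powr q)" using u by (simp_all add: Lp_mem_def)
 let ?B = "%x. 2 powr q' * (a powr q' + b powr q' * \<bar>u x\<bar> powr q)"
 have iB: "integrable M ?B" using iu const_integrable by (intro integrable_mult_right integrable_add) auto
 have le: "\<bar>f x (u x)\<bar> powr q' <= ?B x" if "x \<in> space M" for x by (rule growth_powr[OF ab _ growth[OF that]]) simp
 have i: "integrable M (%x. \<bar>f x (u x)\<bar> powr q')"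
  by (rule Bochner_Integration.integrable_bound[OF iB]) (auto intro!: AE_I2 order_trans[OF le])
 thus "Lp_mem M q' (%x. f x (u x))" by (simp add: Lp_mem_def)
 have "(LINT x|M. \<bar>f x (u x)\<bar> powr q') <= (LINT x|M. ?B x)" by (rule integral_mono[OF i iB le])
 also have "... = 2 powr q' * (a powr q' * measure M (space M) + b powr q' * Lp_norm M q u powr q)"
  using q iu const_integrable by (simp add: Lp_norm_powr mult.commute)
 finally show "(LINT x|M. \<bar>f x (u x)\<bar> powr q') <= 2 powr q' * (a powr q' * measure M (space M) + b powr q' * Lp_norm M q u powr q)" .
qed

lemma Lp_integrable: "r >= 1 ==> Lp_mem M r u ==> integrable M (u :: 'x => real)"
proof -
 assume r: "r >= 1" and u: "Lp_mem M r u"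
 have "integrable M (%x. 1 + \<bar>u x\<bar> powr r)" using u const_integrable by (simp add: Lp_mem_def)
 thus "integrable M u"
 proof (rule Bochner_Integration.integrable_bound)
  have "\<bar>u x\<bar> <= 1 + \<bar>u x\<bar> powr r" for x
   using powr_mono[OF r, of "\<bar>u x\<bar>"] by (cases "\<bar>u x\<bar> <= 1") (auto intro: add_increasing2)
  thus "AE x in M. norm (u x) <= norm (1 + \<bar>u x\<bar> powr r)" by (intro AE_I2) (simp add: abs_of_nonneg)
 qed (use u in \<open>simp add: Lp_mem_def\<close>)
qed

lemma primitive_integrable:
 assumes u: "Lp_mem M q u" shows "integrable M (%x. primitive f x (u x))"
proof (rule Bochner_Integration.integrable_bound)
 have [measurable]: "u \<in> borel_measurable M" and iu: "integrable M (%x. \<bar>u x\<bar> powr q)" using u by (simp_all add: Lp_mem_def)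
 show "integrable M (%x. a * \<bar>u x\<bar> + b * \<bar>u x\<bar> powr q)" using iu Lp_integrable[OF _ u] q by simp
 show "(%x. primitive f x (u x)) \<in> borel_measurable M" by measurable
 show "AE x in M. norm (primitive f x (u x)) <= norm (a * \<bar>u x\<bar> + b * \<bar>u x\<bar> powr q)"
  using primitive_growth ab by (intro AE_I2) (simp add: abs_of_nonneg)
qed

lemma f_mult_integrable:
 assumes "Lp_mem M q u" "Lp_mem M q h"
 shows "integrable M (%x. f x (u x) * h x)" "\<bar>\<integral>x. f x (u x) * h x \<partial>M\<bar> <= Lp_norm M q' (%x. f x (u x)) * Lp_norm M q h"
 using Hoelder_inner(1,2)[OF q superposition_Lp(1)[OF assms(1)] assms(2)] by simp_all

text \<open>Dominated convergence with the variable majorant \<open>1 + \<bar>u\<bar>\<^sup>q + \<bar>h\<bar>\<^sup>q\<close>: the part of \<open>\<bar>rho x (h x)\<bar>\<close> that exceeds a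
 multiple of \<open>\<bar>h x\<bar>\<^sup>q\<close> has a fixed majorant, and the multiple of \<open>\<bar>h x\<bar>\<^sup>q\<close> is small in mean.\<close>

lemma superposition_small:
 assumes u: "Lp_mem M q u" and A: "A >= 0" "B >= 0"
  and meas: "!!h. h \<in> borel_measurable M ==> (%x. rho x (h x)) \<in> borel_measurable M"
  and cont: "!!x. x \<in> space M ==> isCont (rho x) 0" "!!x. x \<in> space M ==> rho x 0 = (0 :: real)"
  and bd: "!!x t. x \<in> space M ==> \<bar>rho x t\<bar> <= A + B * (\<bar>u x\<bar> + \<bar>t\<bar>) powr (q - 1)"
  and e: "e > 0"
 obtains d where "d > 0" "!!h. Lp_mem M q h ==> Lp_norm M q h < d ==> Lp_mem M q' (%x. rho x (h x)) & Lp_norm M q' (%x. rho x (h x)) <= e"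
proof -
 have um[measurable]: "u \<in> borel_measurable M" and iu: "integrable M (%x. \<bar>u x\<bar> powr q)" using u by (simp_all add: Lp_mem_def)
 define C1 where "C1 = 2 powr q' * A powr q'"
 define C2 where "C2 = 2 powr q' * (B powr q' * 2 powr q)"
 have C: "C1 >= 0" "C2 >= 0" by (simp_all add: C1_def C2_def)
 have pt: "\<bar>rho x t\<bar> powr q' <= C1 + C2 * \<bar>u x\<bar> powr q + C2 * \<bar>t\<bar> powr q" if x: "x \<in> space M" for x t
 proof -
  have "\<bar>rho x t\<bar> powr q' <= 2 powr q' * (A powr q' + B powr q' * (\<bar>u x\<bar> + \<bar>t\<bar>) powr q)"
   by (rule growth_powr[OF A _ bd[OF x]]) simp
  also have "... <= 2 powr q' * (A powr q' + B powr q' * (2 powr q * (\<bar>u x\<bar> powr q + \<bar>t\<bar> powr q)))"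
   using q by (intro mult_left_mono add_left_mono powr_add_le) auto
  finally show ?thesis by (simp add: C1_def C2_def algebra_simps)
 qed
 have ib: "integrable M (%x. C1 + C2 * \<bar>u x\<bar> powr q)" using iu const_integrable by simp
 have mem: "Lp_mem M q' (%x. rho x (h x))" if h: "Lp_mem M q h" for h
 proof -
  have [measurable]: "(%x. rho x (h x)) \<in> borel_measurable M" using h by (intro meas) (simp add: Lp_mem_def)
  have "integrable M (%x. C1 + C2 * \<bar>u x\<bar> powr q + C2 * \<bar>h x\<bar> powr q)" using ib h by (simp add: Lp_mem_def)
  hence "integrable M (%x. \<bar>rho x (h x)\<bar> powr q')"
   by (rule Bochner_Integration.integrable_bound) (auto intro!: AE_I2 order_trans[OF pt])
  thus ?thesis by (simp add: Lp_mem_def)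
 qed
 have "\<exists>d>0. \<forall>h. Lp_mem M q h --> Lp_norm M q h < d --> Lp_norm M q' (%x. rho x (h x)) <= e"
 proof (rule ccontr)
  assume not: "~ ?thesis"
  have "\<forall>n. \<exists>h. Lp_mem M q h & Lp_norm M q h < inverse (real (Suc n)) & ~ Lp_norm M q' (%x. rho x (h x)) <= e"
  proof
   fix n
   have "inverse (real (Suc n)) > 0" by simp
   thus "\<exists>h. Lp_mem M q h & Lp_norm M q h < inverse (real (Suc n)) & ~ Lp_norm M q' (%x. rho x (h x)) <= e"
    using not by blast
  qed
  from choice[OF this] obtain h where h: "!!n. Lp_mem M q (h n)" "!!n. Lp_norm M q (h n) < inverse (real (Suc n))"
   "!!n. ~ Lp_norm M q' (%x. rho x (h n x)) <= e" by blast
  have h0: "(%n. Lp_norm M q (h n)) \<longlonglongrightarrow> 0"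
  proof (rule Lim_null_comparison[OF _ LIMSEQ_inverse_real_of_nat])
   show "\<forall>\<^sub>F n in sequentially. norm (Lp_norm M q (h n)) <= inverse (real (Suc n))"
    using h(2) Lp_norm_nonneg by (simp add: less_imp_le)
  qed
  obtain r where r: "strict_mono r" "AE x in M. (%n. h (r n) x) \<longlonglongrightarrow> 0"
   using Lp_AE_subseq[OF _ h(1) h0] q by auto
  have [measurable]: "h n \<in> borel_measurable M" for n using h(1) by (simp add: Lp_mem_def)
  have [measurable]: "(%x. rho x (h n x)) \<in> borel_measurable M" for n by (rule meas) measurable
  define k where "k n x = max 0 (\<bar>rho x (h (r n) x)\<bar> powr q' - C2 * \<bar>h (r n) x\<bar> powr q)" for n x
  have km[measurable]: "k n \<in> borel_measurable M" for n unfolding k_def[abs_def] by measurable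
  have k0: "AE x in M. (%n. k n x) \<longlonglongrightarrow> 0" using r(2) AE_space
  proof eventually_elim
   case (elim x)
   have "(%n. rho x (h (r n) x)) \<longlonglongrightarrow> rho x 0" by (rule isCont_tendsto_compose[OF cont(1)[OF elim(2)] elim(1)])
   hence 1: "(%n. \<bar>rho x (h (r n) x)\<bar> powr q') \<longlonglongrightarrow> 0 powr q'"
    using q'_gt_1 cont(2)[OF elim(2)] by (intro tendsto_powr') (auto intro: tendsto_rabs_zero)
   have 2: "(%n. \<bar>h (r n) x\<bar> powr q) \<longlonglongrightarrow> 0 powr q"
    using q elim(1) by (intro tendsto_powr') (auto intro: tendsto_rabs_zero)
   have "(%n. k n x) \<longlonglongrightarrow> max 0 (0 powr q' - C2 * 0 powr q)"
    unfolding k_def by (intro tendsto_intros 1 2)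
   thus ?case by simp
  qed
  have kle: "k n x <= C1 + C2 * \<bar>u x\<bar> powr q" "k n x >= 0" if "x \<in> space M" for n x
   using pt[OF that, of "h (r n) x"] C by (auto simp: k_def)
  have k_int: "integrable M (k n)" for n
  proof (rule Bochner_Integration.integrable_bound[OF ib km])
   show "AE x in M. norm (k n x) <= norm (C1 + C2 * \<bar>u x\<bar> powr q)"
   proof (rule AE_I2)
    fix x assume "x \<in> space M"
    from kle[OF this, of n] show "norm (k n x) <= norm (C1 + C2 * \<bar>u x\<bar> powr q)" by simp
   qed
  qed
  have klim: "(%n. \<integral>x. k n x \<partial>M) \<longlonglongrightarrow> (LINT x|M. 0)"
   by (rule integral_dominated_convergence[where w = "%x. C1 + C2 * \<bar>u x\<bar> powr q"])
    (use ib k0 kle in \<open>auto intro!: AE_I2\<close>)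
  have "(LINT x|M. \<bar>rho x (h (r n) x)\<bar> powr q') <= (LINT x|M. k n x) + C2 * Lp_norm M q (h (r n)) powr q" for n
  proof -
   have ih: "integrable M (%x. C2 * \<bar>h (r n) x\<bar> powr q)" using h(1) by (simp add: Lp_mem_def)
   have "(LINT x|M. \<bar>rho x (h (r n) x)\<bar> powr q') <= (LINT x|M. k n x + C2 * \<bar>h (r n) x\<bar> powr q)"
    by (rule integral_mono) (use mem[OF h(1)] k_int ih in \<open>auto simp: Lp_mem_def k_def\<close>)
   also have "... = (LINT x|M. k n x) + C2 * Lp_norm M q (h (r n)) powr q"
    using k_int ih q by (simp add: Lp_norm_powr)
   finally show ?thesis .
  qed
  note le = this
  have "(%n. (LINT x|M. k n x) + C2 * Lp_norm M q (h (r n)) powr q) \<longlonglongrightarrow> 0"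
  proof -
   have "(%n. Lp_norm M q (h (r n)) powr q) \<longlonglongrightarrow> 0 powr q"
    using q Lp_norm_nonneg LIMSEQ_subseq_LIMSEQ[OF h0 r(1)] by (intro tendsto_powr') (auto simp: o_def)
   thus ?thesis using tendsto_add[OF klim tendsto_mult_left[of _ "0 powr q" _ C2]] by simp
  qed
  hence "\<forall>\<^sub>F n in sequentially. (LINT x|M. k n x) + C2 * Lp_norm M q (h (r n)) powr q < e powr q'"
   by (rule order_tendstoD(2)) (use e in simp)
  then obtain n where "(LINT x|M. k n x) + C2 * Lp_norm M q (h (r n)) powr q < e powr q'"
   unfolding eventually_sequentially by blast
  with le[of n] have "(LINT x|M. norm (rho x (h (r n) x)) powr q') < e powr q'" by simp
  hence "Lp_norm M q' (%x. rho x (h (r n) x)) <= e" using q'_gt_1 e by (subst Lp_norm_le_iff) auto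
  thus False using h(3) by blast
 qed
 thus ?thesis using that mem by blast
qed

lemma growth_shift: "x \<in> space M ==> \<bar>z\<bar> <= \<bar>t\<bar> ==> \<bar>f x (v + z) - f x v\<bar> <= 2 * a + 2 * b * (\<bar>v\<bar> + \<bar>t\<bar>) powr (q - 1)"
proof -
 assume x: "x \<in> space M" and z: "\<bar>z\<bar> <= \<bar>t\<bar>"
 have "b * \<bar>v + z\<bar> powr (q - 1) <= b * (\<bar>v\<bar> + \<bar>t\<bar>) powr (q - 1)" "b * \<bar>v\<bar> powr (q - 1) <= b * (\<bar>v\<bar> + \<bar>t\<bar>) powr (q - 1)"
  using z q ab by (auto intro!: mult_left_mono powr_mono2)
 thus ?thesis using growth[OF x, of "v + z"] growth[OF x, of v] by linarith
qed

text \<open>\<open>superposition_small\<close> for the increment of \<open>f\<close> at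
  \<open>u\<close>, whose growth is controlled by \<open>growth_shift\<close>.\<close>

lemma superposition_continuous:
 assumes u: "Lp_mem M q u" and e: "e > 0"
 obtains d where "d > 0" "!!h. Lp_mem M q h ==> Lp_norm M q h < d ==>
  Lp_mem M q' (%x. f x (u x + h x) - f x (u x)) & Lp_norm M q' (%x. f x (u x + h x) - f x (u x)) <= e"
proof (rule superposition_small[OF u _ _ _ _ _ _ e, where rho = "%x t. f x (u x + t) - f x (u x)" and A = "2 * a" and B = "2 * b"])
 have [measurable]: "u \<in> borel_measurable M" using u by (simp add: Lp_mem_def)
 show "(%x. f x (u x + h x) - f x (u x)) \<in> borel_measurable M" if [measurable]: "h \<in> borel_measurable M" for h
  by measurable
 show "isCont (%t. f x (u x + t) - f x (u x)) 0" if "x \<in> space M" for x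
 proof -
  have "isCont (f x) (u x + 0)" using f_continuous[OF that] by (simp add: continuous_on_eq_continuous_at)
  hence "isCont (%t. f x (u x + t)) 0" by (rule isCont_o2[where f = "%t. u x + t", rotated]) simp
  thus ?thesis by simp
 qed
 show "\<bar>f x (u x + t) - f x (u x)\<bar> <= 2 * a + 2 * b * (\<bar>u x\<bar> + \<bar>t\<bar>) powr (q - 1)" if "x \<in> space M" for x t
  by (rule growth_shift[OF that]) simp
qed (use ab that in auto)

text \<open>Here \<open>rho\<close> is the difference quotient of the primitive minus its limit, set
  to 0 at \<open>t = 0\<close>. The remainder is the integral of \<open>rho x (h x) * h x\<close>,
  so Hoelder and \<open>superposition_small\<close> make it small relative to the norm of
  \<open>h\<close>.\<close>

lemma primitive_frechet:
 assumes u: "Lp_mem M q u" and e: "e > 0"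
 obtains d where "d > 0" "!!h. Lp_mem M q h ==> Lp_norm M q h < d ==>
  \<bar>(LINT x|M. primitive f x (u x + h x)) - (LINT x|M. primitive f x (u x)) - (LINT x|M. f x (u x) * h x)\<bar> <= e * Lp_norm M q h"
proof -
 define rho where "rho x t = (if t = 0 then 0 else (primitive f x (u x + t) - primitive f x (u x)) / t - f x (u x))" for x t
 have um[measurable]: "u \<in> borel_measurable M" using u by (simp add: Lp_mem_def)
 obtain d where d: "d > 0" "!!h. Lp_mem M q h ==> Lp_norm M q h < d ==> Lp_mem M q' (%x. rho x (h x)) & Lp_norm M q' (%x. rho x (h x)) <= e"
 proof (rule superposition_small[OF u _ _ _ _ _ _ e, where rho = rho and A = "2 * a" and B = "2 * b"])
  show "(%x. rho x (h x)) \<in> borel_measurable M" if [measurable]: "h \<in> borel_measurable M" for h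
   unfolding rho_def by measurable
  show "isCont (rho x) 0" if x: "x \<in> space M" for x
  proof -
   have "((%t. (primitive f x (u x + t) - primitive f x (u x)) / t) \<longlongrightarrow> f x (u x)) (at 0)"
    using primitive_derivative[of f x, OF f_continuous[OF x]] by (simp add: DERIV_def)
   hence "((%t. (primitive f x (u x + t) - primitive f x (u x)) / t - f x (u x)) \<longlongrightarrow> 0) (at 0)"
    by (rule LIM_zero)
   hence "(rho x \<longlongrightarrow> 0) (at 0)"
    by (rule tendsto_cong[THEN iffD1, rotated]) (auto simp: rho_def eventually_at_filter)
   thus ?thesis by (simp add: isCont_def rho_def)
  qed
  show "\<bar>rho x t\<bar> <= 2 * a + 2 * b * (\<bar>u x\<bar> + \<bar>t\<bar>) powr (q - 1)" if x: "x \<in> space M" for x t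
  proof (cases "t = 0")
   case False
   obtain z where z: "\<bar>z\<bar> <= \<bar>t\<bar>" "primitive f x (u x + t) - primitive f x (u x) = f x (u x + z) * t"
    by (rule primitive_increment[OF x])
   thus ?thesis using growth_shift[OF x z(1), of "u x"] False by (simp add: rho_def)
  qed (use ab in \<open>simp add: rho_def\<close>)
 qed (use ab in \<open>auto simp: rho_def\<close>)
 have "\<bar>(LINT x|M. primitive f x (u x + h x)) - (LINT x|M. primitive f x (u x)) - (LINT x|M. f x (u x) * h x)\<bar> <= e * Lp_norm M q h"
  if h: "Lp_mem M q h" "Lp_norm M q h < d" for h
 proof -
  note rho = d(2)[OF h]
  have uh: "Lp_mem M q (%x. u x + h x)" using q u h by (intro Lp_mem_add) auto
  note i = primitive_integrable[OF u] primitive_integrable[OF uh] f_mult_integrable(1)[OF u h(1)]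
  have "(LINT x|M. primitive f x (u x + h x)) - (LINT x|M. primitive f x (u x)) - (LINT x|M. f x (u x) * h x)
   = (LINT x|M. primitive f x (u x + h x) - primitive f x (u x) - f x (u x) * h x)" using i by simp
  also have "... = (LINT x|M. rho x (h x) * h x)" by (intro Bochner_Integration.integral_cong refl) (auto simp: rho_def field_simps)
  also have "\<bar>...\<bar> <= Lp_norm M q' (%x. rho x (h x)) * Lp_norm M q h"
   using Hoelder_inner(2)[OF q conjunct1[OF rho] h(1)] by simp
  also have "... <= e * Lp_norm M q h" using rho Lp_norm_nonneg by (intro mult_right_mono) auto
  finally show ?thesis .
 qed
 with d(1) that show ?thesis by blast
qed

end

section \<open>Geometry and compactness of the energy\<close>

lemma Lp_restrict:
 assumes S: "S \<in> sets lebesgue" and u: "Lp_mem lebesgue r u" and r: "r > 0"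
 shows "Lp_mem (lebesgue_on S) r u" "Lp_norm (lebesgue_on S) r u <= Lp_norm lebesgue r u"
proof -
 have m: "u \<in> borel_measurable lebesgue" and i: "integrable lebesgue (%x. norm (u x) powr r)" using u by (simp_all add: Lp_mem_def)
 have i2: "integrable lebesgue (%x. indicat_real S x *\<^sub>R norm (u x) powr r)" by (rule integrable_mult_indicator[OF S i])
 show "Lp_mem (lebesgue_on S) r u"
  unfolding Lp_mem_def using m i2 S by (simp add: integrable_restrict_space measurable_restrict_space1)
 have "(LINT x|lebesgue_on S. norm (u x) powr r) = (LINT x|lebesgue. indicat_real S x *\<^sub>R norm (u x) powr r)"
  using S by (simp add: integral_restrict_space)
 also have "... <= (LINT x|lebesgue. norm (u x) powr r)"
  by (rule integral_mono[OF i2 i]) (auto simp: indicator_def)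
 finally show "Lp_norm (lebesgue_on S) r u <= Lp_norm lebesgue r u"
  unfolding Lp_norm_def using r by (intro powr_mono2 Bochner_Integration.integral_nonneg) auto
qed

text \<open>Provides one radius that works for all indices \<open>k\<close> simultaneously.\<close>

lemma finite_uniform_positive:
 assumes "finite K" "!!k. k \<in> K ==> \<exists>d>0. Q k d" and anti: "!!k d d'. Q k d ==> 0 < d' ==> d' <= d ==> Q k (d' :: real)"
 shows "\<exists>d>0. \<forall>k\<in>K. Q k d"
 using assms(1,2)
proof (induction K)
 case empty
 show ?case using zero_less_one by blast
next
 case (insert k K)
 obtain d1 where "d1 > 0" "\<forall>k\<in>K. Q k d1" using insert by blast
 moreover obtain d2 where "d2 > 0" "Q k d2" using insert by blast
 ultimately show ?case using anti[of _ d1 "min d1 d2"] anti[of k d2 "min d1 d2"] by (intro exI[of _ "min d1 d2"]) auto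
qed

text \<open>\<open>P\<close> stands for the largest exponent. \<open>small\<close> condenses the
  behaviour at 0 together with the growth condition, \<open>AR\<close> is the Ambrosetti-Rabinowitz
  inequality, and \<open>super\<close> is the lower bound on the primitive that makes the energy
  unbounded below.\<close>

locale mountain_pass_problem = energy_space \<Omega> m s p R + nemytskii "lebesgue_on \<Omega>" f q a b
 for \<Omega> :: "'a::euclidean_space set" and m s p R f q a b +
 fixes P \<theta> r \<theta>' a3 :: real and a4 :: "'a => real"
 assumes nonempty: "\<Omega> ~= {}"
  and P: "!!k. k \<in> {1..m} ==> p k <= P" "P < q"
  and subcritical: "real DIM('a) * (1 / p 1 - 1 / q) < s 1"
  and small: "!!eps. eps > 0 ==> \<exists>C\<ge>0. \<forall>x\<in>\<Omega>. \<forall>t. \<bar>primitive f x t\<bar> <= eps * \<bar>t\<bar> powr P + C * \<bar>t\<bar> powr q"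
  and AR: "\<theta> > P" "r >= 0" "!!x t. x \<in> \<Omega> ==> \<bar>t\<bar> > r ==> \<theta> * primitive f x t <= f x t * t"
  and super: "\<theta>' > P" "a3 > 0" "integrable (lebesgue_on \<Omega>) a4"
   "!!x t. x \<in> \<Omega> ==> primitive f x t >= a3 * \<bar>t\<bar> powr \<theta>' - a4 x"
begin

abbreviation M where "M \<equiv> lebesgue_on \<Omega>"
abbreviation J where "J \<equiv> energy \<Omega> m s p f"

definition DJ :: "('a => real) => ('a => real) => real" where
 "DJ u h = (\<Sum>k = 1..m. fm k u h) - (LINT x|M. f x (u x) * h x)"

lemma k1: "1 \<in> {1..m}" using m by simp
lemma P_gt_1: "P > 1" using P(1)[OF k1] p[OF k1] by simp

text \<open>Lowering the target exponent below \<open>q\<close> keeps the subcriticality condition.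
  The exponents needed later are \<open>P\<close> and \<open>q\<close>.\<close>

lemma embedding:
 assumes t: "p 1 <= t" "t <= q"
 obtains C where "C > 0" "!!u. u \<in> Y ==> Lp_mem M t u & Lp_norm M t u <= C * N u"
proof -
 have "1 / q <= 1 / t" using t p[OF k1] q by (intro divide_left_mono mult_pos_pos) auto
 hence "real DIM('a) * (1 / p 1 - 1 / t) <= real DIM('a) * (1 / p 1 - 1 / q)" by (intro mult_left_mono) auto
 hence sub: "real DIM('a) * (1 / p 1 - 1 / t) < s 1" using subcritical by linarith
 obtain C where C: "C > 0" "!!u. u \<in> Y ==> Lp_mem lebesgue t u & Lp_norm lebesgue t u <= C * N u"
  by (rule Sobolev[OF t(1) sub]) (rule that)
 have "Lp_mem M t u & Lp_norm M t u <= C * N u" if "u \<in> Y" for u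
  using Lp_restrict[OF \<Omega>_sets(1), of t u] C(2)[OF that] t(1) p[OF k1] by linarith
 with C(1) show ?thesis by (rule that)
qed

lemma q_ge: "p 1 <= q" "p 1 <= P" "P <= q" using P(1)[OF k1] P(2) by simp_all

lemma DJ_forms: "u \<in> Y ==> v \<in> Y ==> w \<in> Y ==>
  (\<Sum>k = 1..m. fm k u (v + w)) = (\<Sum>k = 1..m. fm k u v) + (\<Sum>k = 1..m. fm k u w)"
 unfolding sum.distrib[symmetric] by (rule sum.cong[OF refl]) (rule form_sp_add[OF s(1) s(2) p YD YD YD])

lemma Lp_mem_q: "u \<in> Y ==> Lp_mem M q u"
 by (rule embedding[OF q_ge(1) order_refl]) blast

lemma DJ_add: "u \<in> Y ==> v \<in> Y ==> w \<in> Y ==> DJ u (v + w) = DJ u v + DJ u w"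
 unfolding DJ_def using f_mult_integrable(1)[OF Lp_mem_q Lp_mem_q, of u v] f_mult_integrable(1)[OF Lp_mem_q Lp_mem_q, of u w]
 by (simp add: DJ_forms[simplified] distrib_left)

lemma DJ_scale: "u \<in> Y ==> v \<in> Y ==> DJ u (t *\<^sub>R v) = t * DJ u v"
proof -
 assume u: "u \<in> Y" and v: "v \<in> Y"
 have "(\<Sum>k = 1..m. fm k u (t *\<^sub>R v)) = t * (\<Sum>k = 1..m. fm k u v)"
  unfolding sum_distrib_left by (rule sum.cong[OF refl]) (rule form_sp_scale[OF s(1) s(2) p YD[OF u] YD[OF v]])
 moreover have "(LINT x|M. f x (u x) * (t *\<^sub>R v) x) = t * (LINT x|M. f x (u x) * v x)"
  by (simp add: scaleR_fun_def mult.left_commute)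
 ultimately show ?thesis by (simp add: DJ_def right_diff_distrib)
qed

lemma forms_bound: "u \<in> Y ==> h \<in> Y ==>
  \<bar>\<Sum>k = 1..m. fm k u h\<bar> <= (\<Sum>k = 1..m. sn k u powr (p k - 1)) * N h"
proof -
 assume u: "u \<in> Y" and h: "h \<in> Y"
 have "\<bar>\<Sum>k = 1..m. fm k u h\<bar> <= (\<Sum>k = 1..m. \<bar>fm k u h\<bar>)" by (rule sum_abs)
 also have "... <= (\<Sum>k = 1..m. sn k u powr (p k - 1) * N h)"
 proof (rule sum_mono)
  fix k assume k: "k \<in> {1..m}"
  have "\<bar>fm k u h\<bar> <= sn k u powr (p k - 1) * sn k h"
   by (rule form_sp_bound[OF s(1)[OF k] s(2)[OF k] p[OF k] YD[OF u k] YD[OF h k]])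
  also have "... <= sn k u powr (p k - 1) * N h" by (intro mult_left_mono seminorm_le_N k) simp
  finally show "\<bar>fm k u h\<bar> <= sn k u powr (p k - 1) * N h" .
 qed
 finally show ?thesis by (simp add: sum_distrib_right)
qed

lemma DJ_bound: "u \<in> Y ==> \<exists>C. \<forall>h\<in>Y. \<bar>DJ u h\<bar> <= C * N h"
proof -
 assume u: "u \<in> Y"
 obtain C where C: "C > 0" "!!u. u \<in> Y ==> Lp_mem M q u & Lp_norm M q u <= C * N u" by (rule embedding[OF q_ge(1) order_refl]) blast
 define K where "K = Lp_norm M q' (%x. f x (u x))"
 have "\<bar>DJ u h\<bar> <= ((\<Sum>k = 1..m. sn k u powr (p k - 1)) + K * C) * N h" if h: "h \<in> Y" for h
 proof -
  have "\<bar>\<integral>x. f x (u x) * h x \<partial>M\<bar> <= K * Lp_norm M q h"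
   unfolding K_def by (rule f_mult_integrable(2)[OF Lp_mem_q[OF u] Lp_mem_q[OF h]])
  also have "... <= K * (C * N h)" using C(2)[OF h] by (intro mult_left_mono) (auto simp: K_def Lp_norm_nonneg)
  finally have "\<bar>DJ u h\<bar> <= (\<Sum>k = 1..m. sn k u powr (p k - 1)) * N h + K * (C * N h)"
   using forms_bound[OF u h] unfolding DJ_def by linarith
  thus ?thesis by (simp add: distrib_right mult.assoc)
 qed
 thus ?thesis by blast
qed

lemma DJ_cont:
 assumes u: "u \<in> Y" and e: "e > 0"
 shows "\<exists>d>0. \<forall>v\<in>Y. N (v - u) < d --> (\<forall>h\<in>Y. \<bar>DJ v h - DJ u h\<bar> <= e * N h)"
proof -
 obtain C where C: "C > 0" "!!u. u \<in> Y ==> Lp_mem M q u & Lp_norm M q u <= C * N u" by (rule embedding[OF q_ge(1) order_refl]) blast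
 have "e / (2 * C) > 0" using e C by simp
 then obtain d1 where d1: "d1 > 0" "!!h. Lp_mem M q h ==> Lp_norm M q h < d1 ==>
  Lp_mem M q' (%x. f x (u x + h x) - f x (u x)) & Lp_norm M q' (%x. f x (u x + h x) - f x (u x)) <= e / (2 * C)"
  using superposition_continuous[OF Lp_mem_q[OF u]] by blast
 have "\<exists>d>0. \<forall>k\<in>{1..m}. \<forall>v\<in>Y. \<forall>h\<in>Y. sn k (v - u) < d -->
   \<bar>fm k v h - fm k u h\<bar> <= e / 2 * sn k h"
 proof (rule finite_uniform_positive)
  fix k assume k: "k \<in> {1..m}"
  show "\<exists>d>0. \<forall>v\<in>Y. \<forall>h\<in>Y. sn k (v - u) < d -->
   \<bar>fm k v h - fm k u h\<bar> <= e / 2 * sn k h"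
   using form_sp_continuous[OF s(1)[OF k] s(2)[OF k] p[OF k] YD[OF u k] half_gt_zero[OF e]] YD[OF _ k] by blast
 qed (auto dest: less_le_trans)
 then obtain d2 where d2: "d2 > 0" "!!k v h. k \<in> {1..m} ==> v \<in> Y ==> h \<in> Y ==> sn k (v - u) < d2 ==>
   \<bar>fm k v h - fm k u h\<bar> <= e / 2 * sn k h" by blast
 have "\<bar>DJ v h - DJ u h\<bar> <= e * N h" if v: "v \<in> Y" "N (v - u) < min d2 (d1 / C)" and h: "h \<in> Y" for v h
 proof -
  have vu: "v - u \<in> Y" by (rule Y_diff[OF v(1) u])
  have "Lp_norm M q (v - u) <= C * N (v - u)" using C(2)[OF vu] by blast
  also have "... < d1" using v(2) C(1) by (simp add: field_simps)
  finally have "Lp_norm M q (v - u) < d1" .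
  from d1(2)[OF Lp_mem_q[OF vu] this]
  have D: "Lp_mem M q' (%x. f x (v x) - f x (u x))" "Lp_norm M q' (%x. f x (v x) - f x (u x)) <= e / (2 * C)" by simp_all
  have "\<bar>(LINT x|M. f x (v x) * h x) - (LINT x|M. f x (u x) * h x)\<bar> = \<bar>\<integral>x. (f x (v x) - f x (u x)) * h x \<partial>M\<bar>"
   using f_mult_integrable(1)[OF Lp_mem_q[OF u] Lp_mem_q[OF h]] f_mult_integrable(1)[OF Lp_mem_q[OF v(1)] Lp_mem_q[OF h]]
   by (simp add: left_diff_distrib)
  also have "... <= Lp_norm M q' (%x. f x (v x) - f x (u x)) * Lp_norm M q h"
   using Hoelder_inner(2)[OF q D(1) Lp_mem_q[OF h]] by simp
  also have "... <= e / (2 * C) * (C * N h)" using D(2) C e conjunct2[OF C(2)[OF h]] Lp_norm_nonneg by (intro mult_mono) auto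
  also have "... = e / 2 * N h" using C(1) by simp
  finally have 1: "\<bar>(LINT x|M. f x (v x) * h x) - (LINT x|M. f x (u x) * h x)\<bar> <= e / 2 * N h" .
  have "\<bar>(\<Sum>k = 1..m. fm k v h) - (\<Sum>k = 1..m. fm k u h)\<bar> <=
    (\<Sum>k = 1..m. \<bar>fm k v h - fm k u h\<bar>)"
   unfolding sum_subtractf[symmetric] by (rule sum_abs)
  also have "... <= (\<Sum>k = 1..m. e / 2 * sn k h)"
  proof (rule sum_mono)
   fix k assume k: "k \<in> {1..m}"
   have "sn k (v - u) < d2" using seminorm_le_N[OF k, of "v - u"] v(2) by simp
   thus "\<bar>fm k v h - fm k u h\<bar> <= e / 2 * sn k h"
    by (rule d2(2)[OF k v(1) h])
  qed
  also have "... = e / 2 * N h" by (simp add: mu_norm_def sum_distrib_left)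
  finally have "\<bar>DJ v h - DJ u h\<bar> <= e / 2 * N h + e / 2 * N h" using 1 unfolding DJ_def by linarith
  thus ?thesis by simp
 qed
 moreover have "min d2 (d1 / C) > 0" using d1 d2 C by simp
 ultimately show ?thesis by blast
qed

lemma J_frechet:
 assumes u: "u \<in> Y" and e: "e > 0"
 shows "\<exists>d>0. \<forall>h\<in>Y. N h < d --> \<bar>J (u + h) - J u - DJ u h\<bar> <= e * N h"
proof -
 obtain C where C: "C > 0" "!!u. u \<in> Y ==> Lp_mem M q u & Lp_norm M q u <= C * N u" by (rule embedding[OF q_ge(1) order_refl]) blast
 have "e / (2 * C) > 0" using e C by simp
 then obtain d1 where d1: "d1 > 0" "!!h. Lp_mem M q h ==> Lp_norm M q h < d1 ==>
  \<bar>(LINT x|M. primitive f x (u x + h x)) - (LINT x|M. primitive f x (u x)) - (LINT x|M. f x (u x) * h x)\<bar> <= e / (2 * C) * Lp_norm M q h"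
  using primitive_frechet[OF Lp_mem_q[OF u]] by blast
 let ?T = "%k h. sn k (u + h) powr p k / (2 * p k) - sn k u powr p k / (2 * p k) - fm k u h"
 have "\<exists>d>0. \<forall>k\<in>{1..m}. \<forall>h\<in>Y. sn k h < d --> \<bar>?T k h\<bar> <= e / 2 * sn k h"
 proof (rule finite_uniform_positive)
  fix k assume k: "k \<in> {1..m}"
  show "\<exists>d>0. \<forall>h\<in>Y. sn k h < d --> \<bar>?T k h\<bar> <= e / 2 * sn k h"
   using seminorm_sp_frechet[OF s(1)[OF k] s(2)[OF k] p[OF k] YD[OF u k] half_gt_zero[OF e]] YD[OF _ k] by blast
 qed (auto dest: less_le_trans)
 then obtain d2 where d2: "d2 > 0" "!!k h. k \<in> {1..m} ==> h \<in> Y ==> sn k h < d2 ==>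
   \<bar>?T k h\<bar> <= e / 2 * sn k h" by blast
 have "\<bar>J (u + h) - J u - DJ u h\<bar> <= e * N h" if h: "h \<in> Y" "N h < min d2 (d1 / C)" for h
 proof -
  have "Lp_norm M q h <= C * N h" using C(2)[OF h(1)] by blast
  also have "... < d1" using h(2) C(1) by (simp add: field_simps)
  finally have "Lp_norm M q h < d1" .
  from d1(2)[OF Lp_mem_q[OF h(1)] this]
  have "\<bar>(LINT x|M. primitive f x (u x + h x)) - (LINT x|M. primitive f x (u x)) - (LINT x|M. f x (u x) * h x)\<bar> <= e / (2 * C) * Lp_norm M q h" .
  also have "... <= e / (2 * C) * (C * N h)" using C e conjunct2[OF C(2)[OF h(1)]] by (intro mult_left_mono) auto
  also have "... = e / 2 * N h" using C(1) by simp
  finally have 1: "\<bar>(LINT x|M. primitive f x (u x + h x)) - (LINT x|M. primitive f x (u x)) - (LINT x|M. f x (u x) * h x)\<bar> <= e / 2 * N h" .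
  have "\<bar>\<Sum>k = 1..m. ?T k h\<bar> <= (\<Sum>k = 1..m. \<bar>?T k h\<bar>)" by (rule sum_abs)
  also have "... <= (\<Sum>k = 1..m. e / 2 * sn k h)"
  proof (rule sum_mono)
   fix k assume k: "k \<in> {1..m}"
   have "sn k h < d2" using seminorm_le_N[OF k, of h] h(2) by simp
   thus "\<bar>?T k h\<bar> <= e / 2 * sn k h" by (rule d2(2)[OF k h(1)])
  qed
  also have "... = e / 2 * N h" by (simp add: mu_norm_def sum_distrib_left)
  finally have 2: "\<bar>\<Sum>k = 1..m. ?T k h\<bar> <= e / 2 * N h" .
  have "J (u + h) - J u - DJ u h = (\<Sum>k = 1..m. ?T k h) -
    ((LINT x|M. primitive f x (u x + h x)) - (LINT x|M. primitive f x (u x)) - (LINT x|M. f x (u x) * h x))"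
   unfolding energy_def DJ_def by (simp add: sum_subtractf)
  hence "\<bar>J (u + h) - J u - DJ u h\<bar> <= e / 2 * N h + e / 2 * N h" using 1 2 by linarith
  thus ?thesis by simp
 qed
 moreover have "min d2 (d1 / C) > 0" using d1 d2 C by simp
 ultimately show ?thesis by blast
qed

sublocale C1_functional X N J DJ
proof
 show "subspace X" by (rule X_subspace)
 show "0 <= N u" for u by (rule N_nonneg)
 show "N (u + v) <= N u + N v" if "u \<in> X" "v \<in> X" for u v by (rule N_add[OF X_Y X_Y]) (fact that)+
 show "N (t *\<^sub>R u) = \<bar>t\<bar> * N u" if "u \<in> X" for u t by (rule N_scale[OF X_Y[OF that]])
 show "\<exists>l\<in>X. (%n. N (w n - l)) \<longlonglongrightarrow> 0" if "!!n :: nat. w n \<in> X" "!!e. e > 0 ==> \<exists>K. \<forall>i\<ge>K. \<forall>j\<ge>K. N (w i - w j) < e" for w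
  by (rule X_complete) (fact that)+
 show "DJ u (v + w) = DJ u v + DJ u w" if "u \<in> X" "v \<in> X" "w \<in> X" for u v w by (rule DJ_add[OF X_Y X_Y X_Y]) (fact that)+
 show "DJ u (t *\<^sub>R v) = t * DJ u v" if "u \<in> X" "v \<in> X" for u v t by (rule DJ_scale[OF X_Y X_Y]) (fact that)+
 show "\<exists>C. \<forall>h\<in>X. \<bar>DJ u h\<bar> <= C * N h" if "u \<in> X" for u using DJ_bound[OF X_Y[OF that]] X_Y by blast
 show "\<exists>d>0. \<forall>v\<in>X. N (v - u) < d --> (\<forall>h\<in>X. \<bar>DJ v h - DJ u h\<bar> <= e * N h)" if "u \<in> X" "e > 0" for u e
  using DJ_cont[OF X_Y[OF that(1)] that(2)] X_Y by blast
 show "\<exists>d>0. \<forall>h\<in>X. N h < d --> \<bar>J (u + h) - J u - DJ u h\<bar> <= e * N h" if "u \<in> X" "e > 0" for u e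
  using J_frechet[OF X_Y[OF that(1)] that(2)] X_Y by blast
qed

end

section \<open>Mountain pass geometry and the Palais-Smale condition\<close>

context mountain_pass_problem
begin

text \<open>The largest summand is at least the average. This replaces comparisons between sums of
  different powers by a single power of the norm.\<close>

lemma large_seminorm:
 obtains k where "k \<in> {1..m}" "N u / real m <= sn k u"
proof -
 have "\<exists>k\<in>{1..m}. N u / real m <= sn k u"
 proof (rule ccontr)
  assume not: "~ ?thesis"
  have "(\<Sum>k = 1..m. sn k u) < (\<Sum>k = 1..m. N u / real m)"
   by (rule sum_strict_mono) (use not m in \<open>auto simp: not_le\<close>)
  hence "N u < (\<Sum>k = 1..m. N u / real m)" by (simp only: mu_norm_def)
  thus False using m by simp
 qed
 thus ?thesis using that by blast
qed

lemma Lp_primitive_bound: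
 assumes u: "u \<in> Y" and b: "!!x t. x \<in> \<Omega> ==> \<bar>primitive f x t\<bar> <= eps * \<bar>t\<bar> powr P + C * \<bar>t\<bar> powr q"
 shows "(LINT x|M. primitive f x (u x)) <= eps * Lp_norm M P u powr P + C * Lp_norm M q u powr q"
proof -
 have mP: "Lp_mem M P u" by (rule embedding[OF q_ge(2) q_ge(3)]) (use u in blast)
 note i = mP Lp_mem_q[OF u]
 have "(LINT x|M. primitive f x (u x)) <= (LINT x|M. eps * \<bar>u x\<bar> powr P + C * \<bar>u x\<bar> powr q)"
 proof (rule integral_mono)
  show "integrable M (%x. primitive f x (u x))" by (rule primitive_integrable[OF Lp_mem_q[OF u]])
  show "integrable M (%x. eps * \<bar>u x\<bar> powr P + C * \<bar>u x\<bar> powr q)" using i by (simp add: Lp_mem_def)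
  show "primitive f x (u x) <= eps * \<bar>u x\<bar> powr P + C * \<bar>u x\<bar> powr q" if "x \<in> space M" for x
   using b[of x "u x"] that by simp
 qed
 also have "... = eps * Lp_norm M P u powr P + C * Lp_norm M q u powr q"
  using i q P_gt_1 by (simp add: Lp_mem_def Lp_norm_powr)
 finally show ?thesis .
qed

text \<open>For norm at most 1 the smallest of the powers is the one with exponent \<open>P\<close>,
  so the homogeneous part is at least \<open>c * rho powr P\<close>. The nonlinear part takes at
  most half of this: a quarter through \<open>eps\<close>, and a quarter through the higher power
  \<open>q\<close> of a small radius.\<close>

lemma mountain_ring: obtains rho bet where "rho > 0" "bet > 0" "!!w. w \<in> X ==> N w = rho ==> bet <= J w"
proof -
 \<comment> \<open>\<open>1 / (2 * P)\<close> is a lower bound for the coefficients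
   \<open>1 / (2 * p k)\<close>, and \<open>real m powr P\<close> pays for keeping only one large
   seminorm.\<close>
 define c where "c = 1 / (2 * P * real m powr P)"
 have c: "c > 0" using P_gt_1 m by (simp add: c_def)
 obtain C1 where C1: "C1 > 0" "!!u. u \<in> Y ==> Lp_mem M P u & Lp_norm M P u <= C1 * N u" by (rule embedding[OF q_ge(2,3)]) blast
 obtain C2 where C2: "C2 > 0" "!!u. u \<in> Y ==> Lp_mem M q u & Lp_norm M q u <= C2 * N u" by (rule embedding[OF q_ge(1) order_refl]) blast
 define eps where "eps = c / (4 * C1 powr P)"
 have eps: "eps > 0" using c C1 by (simp add: eps_def)
 obtain K where K: "K >= 0" "!!x t. x \<in> \<Omega> ==> \<bar>primitive f x t\<bar> <= eps * \<bar>t\<bar> powr P + K * \<bar>t\<bar> powr q"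
  using small[OF eps] by blast
 define L where "L = K * C2 powr q"
 have L: "L >= 0" using K by (simp add: L_def)
 \<comment> \<open>Solves \<open>(L + 1) * rho powr (q - P) <= c / 4\<close>; the \<open>+ 1\<close>
   allows \<open>L = 0\<close>.\<close>
 define rho where "rho = min 1 ((c / (4 * (L + 1))) powr (1 / (q - P)))"
 have rho: "0 < rho" "rho <= 1" using c L by (auto simp: rho_def)
 have "rho powr (q - P) <= ((c / (4 * (L + 1))) powr (1 / (q - P))) powr (q - P)"
  using rho P by (intro powr_mono2) (auto simp: rho_def)
 also have "... = c / (4 * (L + 1))" using P c L by (simp add: powr_powr)
 finally have "L * rho powr (q - P) <= L * (c / (4 * (L + 1)))" using L by (rule mult_left_mono)
 also have "... <= c / 4" using L c by (simp add: field_simps)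
 finally have r1: "L * rho powr (q - P) <= c / 4" .
 have r2: "L * rho powr q <= c / 4 * rho powr P"
 proof -
  have "rho powr q = rho powr (q - P) * rho powr P" by (simp add: powr_add[symmetric])
  hence "L * rho powr q = L * rho powr (q - P) * rho powr P" by (simp add: mult.assoc)
  also have "... <= c / 4 * rho powr P" by (rule mult_right_mono[OF r1]) simp
  finally show ?thesis .
 qed
 have "c / 2 * rho powr P <= J w" if w: "w \<in> X" "N w = rho" for w
 proof -
  have wY: "w \<in> Y" by (rule X_Y[OF w(1)])
  obtain k where k: "k \<in> {1..m}" "N w / real m <= sn k w" by (rule large_seminorm)
  let ?a = "%k. sn k w"
  have a1: "0 <= ?a k" "?a k <= 1" using seminorm_le_N[OF k(1), of w] w(2) rho by (auto simp: seminorm_sp_def)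
  have pk: "p k > 1" "p k <= P" using p[OF k(1)] P(1)[OF k(1)] by auto
  have "c * rho powr P = 1 / (2 * P) * (rho / real m) powr P" using rho m by (simp add: c_def powr_divide)
  also have "... <= 1 / (2 * P) * ?a k powr P"
   using k(2) w(2) rho P_gt_1 by (intro mult_left_mono powr_mono2) auto
  also have "... <= 1 / (2 * P) * ?a k powr p k"
   using a1 pk P_gt_1 by (intro mult_left_mono powr_mono') auto
  also have "... <= 1 / (2 * p k) * ?a k powr p k"
   using pk by (intro mult_right_mono divide_left_mono) auto
  also have "... <= (\<Sum>k = 1..m. 1 / (2 * p k) * ?a k powr p k)"
   by (rule member_le_sum[OF k(1)]) (use p in \<open>force simp: less_imp_le\<close>)+
  finally have 1: "c * rho powr P <= (\<Sum>k = 1..m. 1 / (2 * p k) * ?a k powr p k)" .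
  have "(LINT x|M. primitive f x (w x)) <= eps * Lp_norm M P w powr P + K * Lp_norm M q w powr q"
   by (rule Lp_primitive_bound[OF wY K(2)])
  also have "... <= eps * (C1 * rho) powr P + K * (C2 * rho) powr q"
   using C1(2)[OF wY] C2(2)[OF wY] w(2) eps K(1) P_gt_1 q Lp_norm_nonneg
   by (intro add_mono mult_left_mono powr_mono2) auto
  also have "... = c / 4 * rho powr P + L * rho powr q"
   using C1(1) C2(1) rho by (simp add: powr_mult eps_def L_def)
  also have "... <= c / 2 * rho powr P" using r2 by simp
  finally show ?thesis using 1 unfolding energy_def by simp
 qed
 moreover have "c / 2 * rho powr P > 0" using c rho by simp
 ultimately show ?thesis using that rho(1) by blast
qed

text \<open>Along multiples \<open>t *\<^sub>R phi\<close> of a bump with \<open>t >= 1\<close>, the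
  homogeneous part grows at most like \<open>t powr P\<close>, while \<open>super\<close> makes the
  nonlinear part grow like \<open>t powr \<theta>'\<close> with the larger exponent.\<close>

lemma beyond_the_ring: obtains e where "e \<in> X" "rho < N e" "J e < 0"
proof -
 obtain x0 where "x0 \<in> \<Omega>" using nonempty by blast
 then obtain c d where cd: "x0 \<in> box c d" "cbox c d \<subseteq> \<Omega>" by (rule open_contains_cbox[OF open_\<Omega>])
 define phi where "phi = box_bump c d 1"
 have phiT: "phi \<in> test_functions \<Omega>" unfolding phi_def by (rule box_bump_test) (use cd in auto)
 note phiX = test_in_X[OF phiT] and phiY = test_in_Y[OF phiT]
 have phim: "phi \<in> borel_measurable M" using Lp_mem_q[OF phiY] by (simp add: Lp_mem_def)
 have nz: "~ (AE x in M. phi x = 0)"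
 proof
  assume "AE x in M. phi x = 0"
  hence "AE x in lebesgue. x \<in> \<Omega> --> phi x = 0" using \<Omega>_sets(1) by (subst (asm) AE_restrict_space_iff) auto
  hence "AE x in lborel. x \<in> \<Omega> --> phi x = 0" by (simp add: AE_lebesgue_iff)
  hence "AE x in lborel. x \<notin> box c d"
   by eventually_elim (use cd box_subset_cbox[of c d] box_bump_pos_iff[of 1 c d] in \<open>auto simp: phi_def\<close>)
  hence "emeasure lborel (box c d) = 0" using AE_iff_measurable[of "box c d" lborel "%x. x \<notin> box c d"] by simp
  moreover have "emeasure lborel (box c d) > 0" using cd(1) by (auto simp: emeasure_lborel_box_eq box_eq_empty mem_box inner_diff_left intro!: prod_pos)
  ultimately show False by simp
 qed
 have lp_pos: "(LINT x|M. \<bar>phi x\<bar> powr t) > 0" if "integrable M (%x. \<bar>phi x\<bar> powr t)" for t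
 proof -
  have "(LINT x|M. \<bar>phi x\<bar> powr t) ~= 0"
   using nz by (subst integral_nonneg_eq_0_iff_AE[OF that]) simp_all
  moreover have "(LINT x|M. \<bar>phi x\<bar> powr t) >= 0" by (rule Bochner_Integration.integral_nonneg) auto
  ultimately show ?thesis by linarith
 qed
 \<comment> \<open>The exponent \<open>\<theta>'\<close> is not compared with \<open>q\<close>, so
   integrability is obtained from \<open>0 <= phi <= 1\<close> on a set of finite measure.\<close>
 have it: "integrable M (%x. \<bar>phi x\<bar> powr \<theta>')"
 proof (rule Bochner_Integration.integrable_bound[OF const_integrable[of 1]])
  show "(%x. \<bar>phi x\<bar> powr \<theta>') \<in> borel_measurable M" using phim by measurable
  have "\<bar>phi x\<bar> powr \<theta>' <= 1" for x
   using powr_mono2[of \<theta>' "\<bar>phi x\<bar>" 1] box_bump_bounds[of c d 1 x] super(1) P_gt_1 by (simp add: phi_def)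
  thus "AE x in M. norm (\<bar>phi x\<bar> powr \<theta>') <= norm (1 :: real)" by simp
 qed
 define I where "I = (LINT x|M. \<bar>phi x\<bar> powr \<theta>')"
 have I: "I > 0" unfolding I_def by (rule lp_pos[OF it])
 have Nphi: "N phi > 0"
 proof -
  obtain C where C: "C > 0" "!!u. u \<in> Y ==> Lp_mem M q u & Lp_norm M q u <= C * N u" by (rule embedding[OF q_ge(1) order_refl]) blast
  have "Lp_norm M q phi > 0" using lp_pos[of q] Lp_mem_q[OF phiY] by (simp add: Lp_norm_def Lp_mem_def)
  also have "... <= C * N phi" using C(2)[OF phiY] by blast
  finally show ?thesis using C(1) by (simp add: zero_less_mult_iff)
 qed
 define A where "A = (\<Sum>k = 1..m. 1 / (2 * p k) * sn k phi powr p k)"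
 define D where "D = (LINT x|M. a4 x)"
 have A: "A >= 0" unfolding A_def by (rule sum_nonneg) (use p in \<open>force simp: less_imp_le\<close>)
 have J_le: "J (t *\<^sub>R phi) <= t powr P * A - a3 * t powr \<theta>' * I + D" if t: "t >= 1" for t
 proof -
  have tY: "t *\<^sub>R phi \<in> Y" by (rule Y_scale[OF phiY])
  have "(\<Sum>k = 1..m. 1 / (2 * p k) * sn k (t *\<^sub>R phi) powr p k) <= (\<Sum>k = 1..m. t powr P * (1 / (2 * p k) * sn k phi powr p k))"
  proof (rule sum_mono)
   fix k assume k: "k \<in> {1..m}"
   have "sn k (t *\<^sub>R phi) = t * sn k phi"
    using seminorm_sp_scale[OF s(1)[OF k] s(2)[OF k] p[OF k] YD[OF phiY k], of t] t by simp
   hence "sn k (t *\<^sub>R phi) powr p k = t powr p k * sn k phi powr p k"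
    using t by (simp add: powr_mult seminorm_sp_def)
   also have "... <= t powr P * sn k phi powr p k"
    using t P(1)[OF k] by (intro mult_right_mono powr_mono) auto
   finally have "1 / (2 * p k) * sn k (t *\<^sub>R phi) powr p k <= 1 / (2 * p k) * (t powr P * sn k phi powr p k)"
    using p[OF k] by (intro mult_left_mono) auto
   thus "1 / (2 * p k) * sn k (t *\<^sub>R phi) powr p k <= t powr P * (1 / (2 * p k) * sn k phi powr p k)"
    by (simp only: mult.left_commute)
  qed
  hence 1: "(\<Sum>k = 1..m. 1 / (2 * p k) * sn k (t *\<^sub>R phi) powr p k) <= t powr P * A"
   by (simp only: A_def sum_distrib_left)
  have "(LINT x|M. a3 * t powr \<theta>' * \<bar>phi x\<bar> powr \<theta>' - a4 x) <= (LINT x|M. primitive f x ((t *\<^sub>R phi) x))"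
  proof (rule integral_mono)
   show "integrable M (%x. a3 * t powr \<theta>' * \<bar>phi x\<bar> powr \<theta>' - a4 x)" using it super(3) by simp
   show "integrable M (%x. primitive f x ((t *\<^sub>R phi) x))" by (rule primitive_integrable[OF Lp_mem_q[OF tY]])
   show "a3 * t powr \<theta>' * \<bar>phi x\<bar> powr \<theta>' - a4 x <= primitive f x ((t *\<^sub>R phi) x)" if "x \<in> space M" for x
    using super(4)[of x "t * phi x"] that t by (simp add: scaleR_fun_def abs_mult powr_mult mult.assoc)
  qed
  hence "a3 * t powr \<theta>' * I - D <= (LINT x|M. primitive f x ((t *\<^sub>R phi) x))" using it super(3) by (simp add: I_def D_def)
  with 1 show ?thesis unfolding energy_def by linarith
 qed
 \<comment> \<open>From \<open>t1\<close> on, \<open>a3 * I * t powr (\<theta>' - P)\<close> is at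
   least \<open>A + \<bar>D\<bar> + 1\<close>, which outweighs the homogeneous part and the integral
   of \<open>a4\<close>.\<close>
 define t1 where "t1 = ((A + \<bar>D\<bar> + 1) / (a3 * I)) powr (1 / (\<theta>' - P))"
 define t where "t = max (max 1 t1) (\<bar>rho\<bar> / N phi + 1)"
 have t: "t >= 1" "t >= t1" "t > \<bar>rho\<bar> / N phi" by (auto simp: t_def)
 have "t1 powr (\<theta>' - P) = (A + \<bar>D\<bar> + 1) / (a3 * I)" unfolding t1_def using super(1,2) I A by (simp add: powr_powr)
 moreover have "t1 powr (\<theta>' - P) <= t powr (\<theta>' - P)" using t super(1) by (intro powr_mono2) (auto simp: t1_def)
 ultimately have "(A + \<bar>D\<bar> + 1) / (a3 * I) <= t powr (\<theta>' - P)" by simp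
 hence "A + \<bar>D\<bar> + 1 <= a3 * I * t powr (\<theta>' - P)" using super(2) I by (simp add: pos_divide_le_eq mult.commute)
 hence "t powr P * (A + \<bar>D\<bar> + 1) <= t powr P * (a3 * I * t powr (\<theta>' - P))" by (rule mult_left_mono) simp
 also have "... = a3 * t powr \<theta>' * I"
 proof -
  have "t powr \<theta>' = t powr P * t powr (\<theta>' - P)" by (simp add: powr_add[symmetric])
  thus ?thesis by simp
 qed
 finally have "t powr P * A + t powr P * (\<bar>D\<bar> + 1) <= a3 * t powr \<theta>' * I" by (simp add: distrib_left)
 moreover have "1 * (\<bar>D\<bar> + 1) <= t powr P * (\<bar>D\<bar> + 1)"
  using t(1) P_gt_1 by (intro mult_right_mono ge_one_powr_ge_zero) auto
 ultimately have "J (t *\<^sub>R phi) < 0" using J_le[OF t(1)] abs_ge_self[of D] unfolding distrib_left by linarith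
 moreover have "rho < N (t *\<^sub>R phi)"
 proof -
  have "\<bar>rho\<bar> < t * N phi" using t(3) Nphi by (simp add: field_simps)
  moreover have "N (t *\<^sub>R phi) = t * N phi" using energy_space.N_scale[OF energy_space_axioms phiY, of t] t(1) by simp
  ultimately show ?thesis by linarith
 qed
 moreover have "t *\<^sub>R phi \<in> X" by (rule subspace_scale[OF X_subspace phiX])
 ultimately show ?thesis using that by blast
qed

text \<open>In \<open>J w - DJ w w / \<theta>\<close> the nonlinear terms are bounded below by
  \<open>AR\<close>, and since the form of \<open>w\<close> with itself is half a p-th power, each
  power keeps a coefficient of at least \<open>kap\<close>. The right-hand side grows only linearly
  in the norm, so the smallest exponent \<open>p0 > 1\<close> gives a bound.\<close>

lemma Palais_Smale_bounded:
 assumes b: "b0 >= 0" and E: "E >= 0"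
 obtains B where "B > 0" "!!w. w \<in> X ==> \<bar>J w\<bar> <= b0 ==> \<bar>DJ w w\<bar> <= E * N w ==> N w <= B"
proof -
 define kap where "kap = 1 / (2 * P) - 1 / (2 * \<theta>)"
 have \<theta>: "\<theta> > 1" using AR(1) P_gt_1 by simp
 have kap: "kap > 0" unfolding kap_def using AR(1) P_gt_1 by (simp add: field_simps)
 \<comment> \<open>Bounds \<open>f x t * t\<close> and the primitive on
   \<open>\<bar>t\<bar> <= r\<close>, the range about which \<open>AR\<close> says nothing.\<close>
 define K0 where "K0 = (a + b * r powr (q - 1)) * r + (a * r + b * r powr q)"
 have K0: "K0 >= 0" using ab AR(2) by (simp add: K0_def)
 have pt: "- K0 <= f x t * t / \<theta> - primitive f x t" if x: "x \<in> \<Omega>" for x t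
 proof (cases "\<bar>t\<bar> > r")
  case True
  have "primitive f x t <= f x t * t / \<theta>" using AR(3)[OF x True] \<theta> by (simp add: field_simps)
  thus ?thesis using K0 by linarith
 next
  case False
  have x': "x \<in> space M" using x by simp
  have "\<bar>f x t\<bar> <= a + b * r powr (q - 1)"
   using False ab q by (intro order_trans[OF growth[OF x']] add_left_mono mult_left_mono powr_mono2) auto
  hence "\<bar>f x t * t\<bar> <= (a + b * r powr (q - 1)) * r" using False ab AR(2) unfolding abs_mult by (intro mult_mono) auto
  moreover have "\<bar>f x t * t / \<theta>\<bar> <= \<bar>f x t * t\<bar>" using \<theta> by (simp add: divide_le_eq mult_le_cancel_left1)
  moreover have "\<bar>primitive f x t\<bar> <= a * r + b * r powr q"
   using False ab q by (intro order_trans[OF primitive_growth[OF x']] add_mono mult_left_mono powr_mono2) auto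
  ultimately show ?thesis unfolding K0_def by linarith
 qed
 define K1 where "K1 = b0 + K0 * measure M (space M)"
 have K1: "K1 >= 0" using b K0 by (simp add: K1_def)
 define p0 where "p0 = Min (p ` {1..m})"
 have p0: "p0 > 1" "!!k. k \<in> {1..m} ==> p0 <= p k"
  using m p by (auto simp: p0_def)
 define H where "H = (K1 + E * real m) / kap"
 \<comment> \<open>If the norm exceeded \<open>B\<close>, then \<open>y = N w / real m\<close> would
   exceed both 1 and \<open>H powr (1 / (p0 - 1))\<close>, contradicting
   \<open>y powr (p0 - 1) <= H\<close>.\<close>
 define B where "B = real m * (H powr (1 / (p0 - 1)) + 1)"
 have B: "B > 0" using m by (simp add: B_def add_nonneg_pos)
 have "N w <= B" if w: "w \<in> X" "\<bar>J w\<bar> <= b0" "\<bar>DJ w w\<bar> <= E * N w" for w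
 proof -
  have wY: "w \<in> Y" by (rule X_Y[OF w(1)])
  have N0: "N w >= 0" by (rule energy_space.N_nonneg[OF energy_space_axioms])
  let ?a = "%k. sn k w"
  have i1: "integrable M (%x. f x (w x) * w x)" by (rule f_mult_integrable(1)[OF Lp_mem_q Lp_mem_q]) (rule wY)+
  have i2: "integrable M (%x. primitive f x (w x))" by (rule primitive_integrable[OF Lp_mem_q[OF wY]])
  have "(LINT x|M. - K0) <= (LINT x|M. f x (w x) * w x / \<theta> - primitive f x (w x))"
   using i1 i2 const_integrable pt by (intro integral_mono) auto
  hence L: "- (K0 * measure M (space M)) <= (LINT x|M. f x (w x) * w x) / \<theta> - (LINT x|M. primitive f x (w x))"
   using i1 i2 by (simp add: mult.commute)
  have "(\<Sum>k = 1..m. kap * ?a k powr p k) <= (\<Sum>k = 1..m. 1 / (2 * p k) * ?a k powr p k - fm k w w / \<theta>)"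
  proof (rule sum_mono)
   fix k assume k: "k \<in> {1..m}"
   have "kap <= 1 / (2 * p k) - 1 / (2 * \<theta>)"
    unfolding kap_def using P(1)[OF k] p[OF k] by (intro diff_right_mono divide_left_mono) auto
   hence "kap * ?a k powr p k <= (1 / (2 * p k) - 1 / (2 * \<theta>)) * ?a k powr p k" by (rule mult_right_mono) simp
   also have "... = 1 / (2 * p k) * ?a k powr p k - fm k w w / \<theta>"
    by (simp add: form_sp_self[OF s(1)[OF k] s(2)[OF k] p[OF k]] left_diff_distrib)
   finally show "kap * ?a k powr p k <= 1 / (2 * p k) * ?a k powr p k - fm k w w / \<theta>" .
  qed
  also have "... = J w + (LINT x|M. primitive f x (w x)) - (DJ w w + (LINT x|M. f x (w x) * w x)) / \<theta>"
   unfolding energy_def DJ_def by (simp add: sum_subtractf sum_divide_distrib)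
  also have "... <= J w - DJ w w / \<theta> + K0 * measure M (space M)" using L by (simp add: add_divide_distrib)
  also have "... <= K1 + E * N w"
  proof -
   have "\<bar>DJ w w / \<theta>\<bar> <= \<bar>DJ w w\<bar>" using \<theta> by (simp add: divide_le_eq mult_le_cancel_left1)
   thus ?thesis using w(2,3) unfolding K1_def by linarith
  qed
  finally have S: "(\<Sum>k = 1..m. kap * ?a k powr p k) <= K1 + E * N w" .
  show ?thesis
  proof (rule ccontr)
   assume not: "~ N w <= B"
   define y where "y = N w / real m"
   have y: "y > H powr (1 / (p0 - 1)) + 1" "N w = y * real m" using not m by (auto simp: y_def B_def field_simps)
   hence y1: "y > 1" "y > H powr (1 / (p0 - 1))" using powr_ge_zero[of H "1 / (p0 - 1)"] by linarith+
   obtain k where k: "k \<in> {1..m}" "y <= ?a k" unfolding y_def by (rule large_seminorm)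
   have "kap * y powr p0 <= kap * ?a k powr p k"
   proof (intro mult_left_mono)
    have "y powr p0 <= y powr p k" using y1 p0(2)[OF k(1)] by (intro powr_mono) auto
    also have "... <= ?a k powr p k" using y1 k(2) p[OF k(1)] by (intro powr_mono2) auto
    finally show "y powr p0 <= ?a k powr p k" .
   qed (use kap in simp)
   also have "... <= (\<Sum>k = 1..m. kap * ?a k powr p k)" by (rule member_le_sum[OF k(1)]) (use kap in auto)
   also have "... <= K1 + E * (y * real m)" using S y by simp
   also have "... <= (K1 + E * real m) * y"
    using mult_left_mono[of 1 y K1] K1 y1 by (simp add: distrib_right mult.assoc mult.commute[of y])
   finally have "y powr p0 <= H * y" using kap by (simp add: H_def field_simps)
   moreover have "y powr p0 = y powr (p0 - 1) * y" using y1 by (simp add: powr_mult_base[of y "p0 - 1"] mult.commute)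
   ultimately have "y powr (p0 - 1) <= H" using y1 by simp
   moreover have "(H powr (1 / (p0 - 1))) powr (p0 - 1) < y powr (p0 - 1)" using y1 p0 by (intro powr_less_mono2) auto
   moreover have "H >= 0" using K1 E kap by (simp add: H_def)
   ultimately show False using p0 by (simp add: powr_powr)
  qed
 qed
 with B show ?thesis by (rule that)
qed

lemma Lp_mem_lebesgue: "u \<in> Y ==> Lp_mem lebesgue q u"
 by (rule Sobolev[OF q_ge(1) subcritical]) blast

text \<open>Testing the derivatives at \<open>w i\<close> and \<open>w j\<close> with
  \<open>w i - w j\<close> expresses the sum of all monotonicity gaps through small quantities.
  Every gap is nonnegative, so each one is bounded by the sum, and \<open>form_sp_S_plus\<close>
  turns a small gap into a small seminorm for each index separately.\<close>

lemma Palais_Smale: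
 fixes w :: "nat => 'a => real"
 assumes w: "!!n. w n \<in> X" and J: "!!n. \<bar>J (w n)\<bar> <= b0"
  and D: "!!n h. h \<in> X ==> \<bar>DJ (w n) h\<bar> <= eps n * N h" and eps: "eps \<longlonglongrightarrow> 0"
 shows "\<exists>r. strict_mono (r :: nat => nat) & (\<forall>d>0. \<exists>K. \<forall>i\<ge>K. \<forall>j\<ge>K. N (w (r i) - w (r j)) < d)"
proof -
 have N0: "N u >= 0" for u by (rule energy_space.N_nonneg[OF energy_space_axioms])
 have wY: "w n \<in> Y" for n by (rule X_Y[OF w])
 have b0: "b0 >= 0" using J[of 0] by linarith
 obtain E where E: "!!n. \<bar>eps n\<bar> <= E" using convergent_imp_Bseq[of eps] eps by (auto simp: Bseq_def convergent_def)
 have E0: "E >= 0" using E[of 0] by linarith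
 obtain B where B: "B > 0" "!!w. w \<in> X ==> \<bar>J w\<bar> <= b0 ==> \<bar>DJ w w\<bar> <= E * N w ==> N w <= B"
  by (rule Palais_Smale_bounded[OF b0 E0]) blast
 have NB: "N (w n) <= B" for n
 proof (rule B(2)[OF w J])
  have "eps n * N (w n) <= E * N (w n)" using E[of n] N0 by (intro mult_right_mono) auto
  thus "\<bar>DJ (w n) (w n)\<bar> <= E * N (w n)" using D[OF w[of n], of n] by linarith
 qed
 obtain r :: "nat => nat" where r: "strict_mono r" "!!e. e > 0 ==> \<exists>K. \<forall>i\<ge>K. \<forall>j\<ge>K. Lp_norm lebesgue q (w (r i) - w (r j)) < e"
  by (rule compact_embedding[where u = w, OF q_ge(1) subcritical wY NB]) (rule that)
 obtain C where C: "C > 0" "!!u. u \<in> Y ==> Lp_mem M q u & Lp_norm M q u <= C * N u" by (rule embedding[OF q_ge(1) order_refl]) blast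
 define F where "F = (2 powr q' * (a powr q' * measure M (space M) + b powr q' * (C * B) powr q)) powr (1 / q')"
 have F0: "F >= 0" by (simp add: F_def)
 have F: "Lp_norm M q' (%x. f x (w n x)) <= F" for n
 proof -
  have "Lp_norm M q (w n) <= C * B" using C(2)[OF wY[of n]] mult_left_mono[OF NB[of n], of C] C(1) by linarith
  hence "Lp_norm M q (w n) powr q <= (C * B) powr q" using q Lp_norm_nonneg by (intro powr_mono2) auto
  hence "2 powr q' * (a powr q' * measure M (space M) + b powr q' * Lp_norm M q (w n) powr q) <=
    2 powr q' * (a powr q' * measure M (space M) + b powr q' * (C * B) powr q)"
   by (intro mult_left_mono add_left_mono) auto
  from order_trans[OF superposition_Lp(2)[OF Lp_mem_q[OF wY[of n]]] this]
  have "(LINT x|M. norm (f x (w n x)) powr q') <= 2 powr q' * (a powr q' * measure M (space M) + b powr q' * (C * B) powr q)"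
   by (simp only: real_norm_def)
  thus ?thesis unfolding Lp_norm_def F_def
   using q by (intro powr_mono2 Bochner_Integration.integral_nonneg) auto
 qed
 let ?S = "%k u v. fm k u (u - v) - fm k v (u - v)"
 have S_le: "?S k0 (w i) (w j) <= (\<bar>eps i\<bar> + \<bar>eps j\<bar>) * (2 * B) + 2 * F * Lp_norm M q (w i - w j)" if k0: "k0 \<in> {1..m}" for k0 i j
 proof -
  let ?h = "w i - w j"
  have hX: "?h \<in> X" by (rule subspace_diff[OF X_subspace w w])
  have hY: "?h \<in> Y" by (rule X_Y[OF hX])
  have "?S k0 (w i) (w j) <= (\<Sum>k = 1..m. ?S k (w i) (w j))"
  proof (rule member_le_sum[OF k0])
   fix k assume "k \<in> {1..m} - {k0}"
   hence k: "k \<in> {1..m}" by blast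
   show "0 <= ?S k (w i) (w j)" by (rule form_sp_monotone[OF s(1)[OF k] s(2)[OF k] p[OF k] YD[OF wY k] YD[OF wY k]])
  qed simp
  also have "... = DJ (w i) ?h - DJ (w j) ?h + (LINT x|M. f x (w i x) * ?h x) - (LINT x|M. f x (w j x) * ?h x)"
   unfolding DJ_def sum_subtractf by linarith
  also have "... <= (\<bar>eps i\<bar> + \<bar>eps j\<bar>) * (2 * B) + 2 * F * Lp_norm M q ?h"
  proof -
   have "N ?h <= N (w i) + N (w j)"
    using energy_space.N_add[OF energy_space_axioms wY[of i] Y_scale[OF wY[of j], of "-1"]]
     energy_space.N_scale[OF energy_space_axioms wY[of j], of "-1"] by simp
   hence Nh: "N ?h <= 2 * B" using NB[of i] NB[of j] by linarith
   have d: "\<bar>DJ (w n) ?h\<bar> <= \<bar>eps n\<bar> * (2 * B)" for n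
   proof -
    have "\<bar>DJ (w n) ?h\<bar> <= eps n * N ?h" by (rule D[OF hX])
    also have "... <= \<bar>eps n\<bar> * N ?h" using N0 by (intro mult_right_mono) auto
    also have "... <= \<bar>eps n\<bar> * (2 * B)" using Nh by (intro mult_left_mono) auto
    finally show ?thesis .
   qed
   have g: "\<bar>\<integral>x. f x (w n x) * ?h x \<partial>M\<bar> <= F * Lp_norm M q ?h" for n
   proof -
    have "\<bar>\<integral>x. f x (w n x) * ?h x \<partial>M\<bar> <= Lp_norm M q' (%x. f x (w n x)) * Lp_norm M q ?h"
     by (rule f_mult_integrable(2)[OF Lp_mem_q[OF wY] Lp_mem_q[OF hY]])
    also have "... <= F * Lp_norm M q ?h" by (rule mult_right_mono[OF F Lp_norm_nonneg])
    finally show ?thesis .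
   qed
   show ?thesis using d[of i] d[of j] g[of i] g[of j] unfolding distrib_right by linarith
  qed
  finally show ?thesis .
 qed
 have "\<exists>K. \<forall>i\<ge>K. \<forall>j\<ge>K. N (w (r i) - w (r j)) < d" if d: "d > 0" for d
 proof -
  have dm: "d / real m > 0" using d m by simp
  have "\<exists>eta>0. \<forall>k\<in>{1..m}. \<forall>i j. ?S k (w i) (w j) < eta --> sn k (w i - w j) < d / real m"
  proof (rule finite_uniform_positive)
   fix k assume k: "k \<in> {1..m}"
   have "sn k (w i) <= B" for i using seminorm_le_N[OF k, of "w i"] NB[of i] by linarith
   note bd = this
   obtain eta where eta: "eta > 0" "\<forall>u\<in>dom_sp (s k) (p k). \<forall>v\<in>dom_sp (s k) (p k). sn k (u :: 'a => real) <= B -->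
     sn k v <= B --> ?S k u v < eta --> sn k (u - v) < d / real m"
    using form_sp_S_plus[OF s(1)[OF k] s(2)[OF k] p[OF k] B(1) dm] by blast
   have "\<forall>i j. ?S k (w i) (w j) < eta --> sn k (w i - w j) < d / real m"
    using eta(2)[rule_format, OF YD[OF wY k] YD[OF wY k] bd bd] by blast
   with eta(1) show "\<exists>eta>0. \<forall>i j. ?S k (w i) (w j) < eta --> sn k (w i - w j) < d / real m" by blast
  next
   fix k and d1 d2 :: real
   assume "\<forall>i j. ?S k (w i) (w j) < d1 --> sn k (w i - w j) < d / real m" "d2 <= d1"
   thus "\<forall>i j. ?S k (w i) (w j) < d2 --> sn k (w i - w j) < d / real m"
    by (blast intro: less_le_trans)
  qed simp
  then obtain eta where eta: "eta > 0" "!!k i j. k \<in> {1..m} ==> ?S k (w i) (w j) < eta ==> sn k (w i - w j) < d / real m"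
   by blast
  \<comment> \<open>The thresholds make the two terms of \<open>S_le\<close> at most
    \<open>eta / 4\<close> and \<open>eta / 2\<close>, which together stay below
    \<open>eta\<close>.\<close>
  have "eta / (16 * B) > 0" using eta(1) B(1) by simp
  from LIMSEQ_D[OF eps this] obtain K1 where K1: "!!n. n >= K1 ==> \<bar>eps n\<bar> < eta / (16 * B)" by auto
  have "eta / (4 * (F + 1)) > 0" using eta(1) F0 by simp
  from r(2)[OF this] obtain K2 where K2: "!!i j. i >= K2 ==> j >= K2 ==> Lp_norm lebesgue q (w (r i) - w (r j)) < eta / (4 * (F + 1))" by blast
  have "N (w (r i) - w (r j)) < d" if ij: "i >= max K1 K2" "j >= max K1 K2" for i j
  proof -
   have ri: "r i >= K1" "r j >= K1" using strict_mono_imp_increasing[OF r(1), of i] strict_mono_imp_increasing[OF r(1), of j] ij by auto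
   have "(\<bar>eps (r i)\<bar> + \<bar>eps (r j)\<bar>) * (2 * B) <= (eta / (16 * B) + eta / (16 * B)) * (2 * B)"
    using K1[OF ri(1)] K1[OF ri(2)] B(1) by (intro mult_right_mono add_mono) auto
   also have "... = eta / 4" using B(1) by (simp add: field_simps)
   finally have 1: "(\<bar>eps (r i)\<bar> + \<bar>eps (r j)\<bar>) * (2 * B) <= eta / 4" .
   have hq: "Lp_mem lebesgue q (w (r i) - w (r j))"
    by (rule Lp_mem_lebesgue[OF Y_diff[OF wY wY]])
   have "Lp_norm M q (w (r i) - w (r j)) <= Lp_norm lebesgue q (w (r i) - w (r j))"
    by (rule Lp_restrict(2)[OF \<Omega>_sets(1) hq]) (use q in simp)
   also have "... <= eta / (4 * (F + 1))" using K2[of i j] ij by simp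
   finally have "2 * F * Lp_norm M q (w (r i) - w (r j)) <= 2 * F * (eta / (4 * (F + 1)))" using F0 by (intro mult_left_mono) auto
   also have "... <= eta / 2" using F0 eta(1) by (simp add: field_simps)
   finally have 2: "2 * F * Lp_norm M q (w (r i) - w (r j)) <= eta / 2" .
   have "?S k (w (r i)) (w (r j)) < eta" if "k \<in> {1..m}" for k using S_le[OF that, of "r i" "r j"] 1 2 eta(1) by linarith
   hence "sn k (w (r i) - w (r j)) < d / real m" if "k \<in> {1..m}" for k using eta(2) that by blast
   hence "(\<Sum>k = 1..m. sn k (w (r i) - w (r j))) < (\<Sum>k = 1..m. d / real m)"
    using m by (intro sum_strict_mono) auto
   thus ?thesis using m by (simp add: mu_norm_def)
  qed
  thus ?thesis by blast
 qed
 with r(1) show ?thesis by blast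
qed

theorem solution_exists: "\<exists>u. weak_solution \<Omega> m s p f u & mountain_pass_type \<Omega> m s p f u"
proof -
 obtain rho bet where ring: "rho > 0" "bet > 0" "!!w. w \<in> X ==> N w = rho ==> bet <= J w" by (rule mountain_ring) blast
 obtain e where e: "e \<in> X" "rho < N e" "J e < 0" by (rule beyond_the_ring) blast
 have pk: "p k > 0" if "k \<in> {1..m}" for k using p[OF that] by simp
 have sem0: "sn k (0 :: 'a => real) = 0" if "k \<in> {1..m}" for k
  using seminorm_sp_scale[OF s(1)[OF that] s(2)[OF that] p[OF that] subspace_0[OF dom_subspace[OF that]], of 0] by simp
 have J0: "J 0 = 0" unfolding energy_def using sem0 by (simp add: zero_fun_def)
 obtain u where u: "u \<in> X" "J u = (INF sig\<in>paths e. peak sig)" "bet <= J u" "!!h. h \<in> X ==> DJ u h = 0"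
 proof (rule mountain_pass[where e = e and rho = rho and bet = bet])
  show "J e < bet" "J 0 < bet" using e(3) J0 ring(2) by auto
  show "bet <= J w" if "w \<in> X" "N w = rho" for w by (rule ring(3)[OF that])
  show "\<exists>r. strict_mono (r :: nat => nat) & (\<forall>d>0. \<exists>K. \<forall>i\<ge>K. \<forall>j\<ge>K. N (w (r i) - w (r j)) < d)"
   if "!!n. w n \<in> X" "!!n. \<bar>J (w n)\<bar> <= b" "!!n h. h \<in> X ==> \<bar>DJ (w n) h\<bar> <= eps n * N h" "eps \<longlonglongrightarrow> 0" for w eps b
   by (rule Palais_Smale[OF that])
 qed (rule ring e that; assumption?)+
 have "weak_solution \<Omega> m s p f u"
  unfolding weak_solution_def
 proof (intro conjI ballI)
  show "u \<in> X" by (rule u(1))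
  fix v assume v: "v \<in> X"
  show "integrable M (%x. f x (u x) * v x)" by (rule f_mult_integrable(1)[OF Lp_mem_q[OF X_Y[OF u(1)]] Lp_mem_q[OF X_Y[OF v]]])
  have "(\<Sum>k = 1..m. form_sp \<Omega> (s k) (p k) u v) = (\<Sum>k = 1..m. fm k u v)"
   by (rule sum.cong[OF refl]) (rule form_sp_\<Omega>[OF u(1) v])
  also have "... = (LINT x|M. f x (u x) * v x)" using u(4)[OF v] by (simp add: DJ_def)
  finally show "(\<Sum>k = 1..m. form_sp \<Omega> (s k) (p k) u v) = (LINT x|M. f x (u x) * v x)" .
 qed
 moreover have "critical_point \<Omega> m s p J u"
  unfolding critical_point_def
 proof (intro conjI allI impI)
  show "u \<in> X" by (rule u(1))
  fix eps :: real assume "eps > 0"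
  from frechet[OF u(1) this] obtain d where d: "d > 0" "!!h. h \<in> X ==> N h < d ==> \<bar>J (u + h) - J u - DJ u h\<bar> <= eps * N h" by blast
  have "\<bar>J (%x. u x + h x) - J u\<bar> <= eps * N h" if "h \<in> X" "N h < d" for h
   using d(2)[OF that] u(4)[OF that(1)] by (simp add: plus_fun_def)
  with d(1) show "\<exists>dlt>0. \<forall>h\<in>X. N h < dlt --> \<bar>J (%x. u x + h x) - J u\<bar> <= eps * N h" by blast
 qed
 moreover have "J (%x. 0) = 0" using J0 by (simp add: zero_fun_def)
 moreover have "paths_to \<Omega> m s p e = paths e" by (simp add: paths_to_def paths_def fun_diff_def zero_fun_def)
 hence "J u = (INF sig\<in>paths_to \<Omega> m s p e. SUP t\<in>{0..1}. J (sig t))" using u(2) by (simp add: peak_def)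
 moreover have "J e < bet" using e(3) ring(2) by simp
 ultimately show ?thesis unfolding mountain_pass_type_def using ring e u(3) by blast
qed

end

text \<open>For \<open>\<bar>t\<bar> < d\<close> the behaviour at 0 gives the first term. For larger
  \<open>\<bar>t\<bar>\<close> the linear part of the growth is absorbed into the q-th power, since
  there \<open>\<bar>t\<bar> <= d powr (1 - q) * \<bar>t\<bar> powr q\<close>; this is the origin of
  \<open>C\<close>.\<close>

lemma (in nemytskii) primitive_small:
 assumes P: "1 < P" "P < q"
  and lim: "!!e. e > 0 ==> \<exists>d>0. \<forall>x\<in>space M. \<forall>t. t ~= 0 --> \<bar>t\<bar> < d --> \<bar>f x t\<bar> <= e * \<bar>t\<bar> powr (P - 1)"
  and e: "e > 0"
 shows "\<exists>C\<ge>0. \<forall>x\<in>space M. \<forall>t. \<bar>primitive f x t\<bar> <= e * \<bar>t\<bar> powr P + C * \<bar>t\<bar> powr q"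
proof -
 obtain d where d: "d > 0" "!!x t. x \<in> space M ==> t ~= 0 ==> \<bar>t\<bar> < d ==> \<bar>f x t\<bar> <= e * \<bar>t\<bar> powr (P - 1)"
  using lim[OF e] by blast
 \<comment> \<open>The hypothesis \<open>lim\<close> speaks only of nonzero arguments; continuity
   supplies the value at 0, where the intermediate point of the mean value theorem may lie.\<close>
 have f0: "f x 0 = 0" if x: "x \<in> space M" for x
 proof -
  have c: "isCont (f x) 0" using f_continuous[OF x] by (simp add: continuous_on_eq_continuous_at)
  have "((%t. \<bar>t\<bar> powr (P - 1)) \<longlongrightarrow> \<bar>0\<bar> powr (P - 1)) (at (0 :: real))"
   using P by (intro tendsto_powr' tendsto_intros) auto
  hence z: "((%t. e * \<bar>t\<bar> powr (P - 1)) \<longlongrightarrow> 0) (at 0)" using tendsto_mult_left[of _ 0 _ e] by simp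
  have "(f x \<longlongrightarrow> 0) (at 0)"
  proof (rule Lim_null_comparison[OF _ z])
   have "\<forall>\<^sub>F t in at 0. t ~= 0 & \<bar>t\<bar> < d" unfolding eventually_at using d(1) by (intro exI[of _ d]) auto
   thus "\<forall>\<^sub>F t in at 0. norm (f x t) <= e * \<bar>t\<bar> powr (P - 1)"
    by eventually_elim (use d(2)[OF x] in auto)
  qed
  thus ?thesis using c LIM_unique by (auto simp: isCont_def)
 qed
 define C where "C = a * d powr (1 - q) + b"
 have C: "C >= 0" using ab by (simp add: C_def)
 have "\<bar>primitive f x t\<bar> <= e * \<bar>t\<bar> powr P + C * \<bar>t\<bar> powr q" if x: "x \<in> space M" for x t
 proof (cases "\<bar>t\<bar> < d")
  case True
  obtain z where z: "\<bar>z\<bar> <= \<bar>t\<bar>" "primitive f x (0 + t) - primitive f x 0 = f x (0 + z) * t"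
   by (rule primitive_increment[OF x])
  have "\<bar>f x z\<bar> <= e * \<bar>z\<bar> powr (P - 1)"
   using d(2)[OF x, of z] f0[OF x] z(1) True by (cases "z = 0") auto
  also have "... <= e * \<bar>t\<bar> powr (P - 1)" using z(1) P e by (intro mult_left_mono powr_mono2) auto
  finally have "\<bar>f x z * t\<bar> <= e * \<bar>t\<bar> powr (P - 1) * \<bar>t\<bar>" unfolding abs_mult by (rule mult_right_mono) simp
  also have "\<bar>t\<bar> powr (P - 1) * \<bar>t\<bar> = \<bar>t\<bar> powr P"
   using P by (cases "t = 0") (auto simp: powr_mult_base[of "\<bar>t\<bar>" "P - 1"] mult.commute)
  hence "e * \<bar>t\<bar> powr (P - 1) * \<bar>t\<bar> = e * \<bar>t\<bar> powr P" by (simp add: mult.assoc)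
  finally have "\<bar>primitive f x t\<bar> <= e * \<bar>t\<bar> powr P" using z(2) by simp
  also have "... <= e * \<bar>t\<bar> powr P + C * \<bar>t\<bar> powr q" using C by simp
  finally show ?thesis .
 next
  case False
  hence t: "\<bar>t\<bar> >= d" by simp
  have "\<bar>t\<bar> = \<bar>t\<bar> powr (1 - q) * \<bar>t\<bar> powr q" using t d(1) by (simp add: powr_add[symmetric])
  also have "... <= d powr (1 - q) * \<bar>t\<bar> powr q" using t d(1) q by (intro mult_right_mono powr_mono2') auto
  finally have "a * \<bar>t\<bar> <= a * (d powr (1 - q) * \<bar>t\<bar> powr q)" using ab by (intro mult_left_mono) auto
  hence "a * \<bar>t\<bar> + b * \<bar>t\<bar> powr q <= C * \<bar>t\<bar> powr q" by (simp add: C_def distrib_right)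
  moreover have "0 <= e * \<bar>t\<bar> powr P" using e by simp
  ultimately show ?thesis using primitive_growth[OF x, of t] by linarith
 qed
 with C show ?thesis by blast
qed

text \<open>Subsets of null sets are Lebesgue measurable by completeness, so nothing has to be known
  about \<open>h\<close> on \<open>Z\<close>.\<close>

lemma lebesgue_on_measurable_cong_null:
 fixes g h :: "'a::euclidean_space => real"
 assumes g: "g \<in> borel_measurable (lebesgue_on S)" and S: "S \<in> sets lebesgue" and Z: "Z \<in> null_sets lebesgue"
  and eq: "!!x. x \<in> S ==> x \<notin> Z ==> h x = g x"
 shows "h \<in> borel_measurable (lebesgue_on S)"
 unfolding borel_measurable_iff_greater
proof
 fix c
 have 1: "{x \<in> S. c < g x} \<in> sets lebesgue"
  using g S unfolding borel_measurable_iff_greater by (auto simp: sets_restrict_space_iff)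
 have 2: "{x \<in> S. c < h x} \<inter> Z \<in> null_sets lebesgue" by (rule null_sets_completion_subset[OF _ Z]) auto
 have 3: "{x \<in> S. c < h x} = ({x \<in> S. c < g x} - Z) \<union> ({x \<in> S. c < h x} \<inter> Z)" using eq by auto
 have "{x \<in> S. c < h x} \<in> sets lebesgue"
  by (subst 3) (intro sets.Un sets.Diff 1 null_setsD2[OF 2] null_setsD2[OF Z])
 thus "{x \<in> space (lebesgue_on S). c < h x} \<in> sets (lebesgue_on S)"
  using S by (auto simp: sets_restrict_space_iff)
qed

lemma lebesgue_on_cong_null:
 fixes g h :: "'a::euclidean_space => real"
 assumes g: "integrable (lebesgue_on S) g" and S: "S \<in> sets lebesgue" and Z: "Z \<in> null_sets lebesgue"
  and eq: "!!x. x \<in> S ==> x \<notin> Z ==> h x = g x"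
 shows "integrable (lebesgue_on S) h" "(LINT x|lebesgue_on S. h x) = (LINT x|lebesgue_on S. g x)"
proof -
 have gm: "g \<in> borel_measurable (lebesgue_on S)" using g by simp
 have hm: "h \<in> borel_measurable (lebesgue_on S)" by (rule lebesgue_on_measurable_cong_null[OF gm S Z eq])
 have "AE x in lebesgue. x \<notin> Z" using Z by (rule AE_not_in)
 hence "AE x in lebesgue. x \<in> S --> g x = h x" by eventually_elim (use eq in auto)
 hence ae: "AE x in lebesgue_on S. g x = h x" using S by (subst AE_restrict_space_iff) auto
 hence ae': "AE x in lebesgue_on S. h x = g x" by eventually_elim simp
 show "integrable (lebesgue_on S) h" by (rule integrable_cong_AE_imp[OF g hm ae])
 show "(LINT x|lebesgue_on S. h x) = (LINT x|lebesgue_on S. g x)"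
  by (rule integral_cong_AE[OF hm gm ae'])
qed

text \<open>The nonlinearity enters this notion only through energies of elements of
  \<open>X_mu\<close>. Closure under addition is required because criticality compares the energy at
  \<open>u + h\<close> with that at \<open>u\<close>.\<close>

lemma mountain_pass_type_cong:
 assumes "!!w. w \<in> X_mu \<Omega> m s p ==> energy \<Omega> m s p f w = energy \<Omega> m s p g w"
  and "!!u v. u \<in> X_mu \<Omega> m s p ==> v \<in> X_mu \<Omega> m s p ==> (%x. u x + v x) \<in> X_mu \<Omega> m s p"
  and "(%x. 0) \<in> X_mu \<Omega> m s p"
  and u: "mountain_pass_type \<Omega> m s p f u"
 shows "mountain_pass_type \<Omega> m s p g u"
proof -
 have uX: "u \<in> X_mu \<Omega> m s p" using u by (simp add: mountain_pass_type_def critical_point_def)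
 have path: "(SUP t\<in>{0..1}. energy \<Omega> m s p f (sig t)) = (SUP t\<in>{0..1}. energy \<Omega> m s p g (sig t))" if "sig \<in> paths_to \<Omega> m s p e" for sig e
  using that by (intro SUP_cong refl assms(1)) (auto simp: paths_to_def)
 have inf: "(INF sig\<in>paths_to \<Omega> m s p e. SUP t\<in>{0..1}. energy \<Omega> m s p f (sig t)) =
   (INF sig\<in>paths_to \<Omega> m s p e. SUP t\<in>{0..1}. energy \<Omega> m s p g (sig t))" for e
  by (intro INF_cong refl path)
 have cp: "critical_point \<Omega> m s p (energy \<Omega> m s p g) u"
  using u assms(1)[OF uX] assms(1)[OF assms(2)[OF uX]] unfolding mountain_pass_type_def critical_point_def by simp
 obtain rho bet e where *: "rho > 0" "bet > 0" "e \<in> X_mu \<Omega> m s p"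
  "!!w. w \<in> X_mu \<Omega> m s p ==> mu_norm m s p w = rho ==> energy \<Omega> m s p f w >= bet"
  "mu_norm m s p e > rho" "energy \<Omega> m s p f e < bet" "energy \<Omega> m s p f (%x. 0) = 0"
  "energy \<Omega> m s p f u = (INF sig\<in>paths_to \<Omega> m s p e. SUP t\<in>{0..1}. energy \<Omega> m s p f (sig t))"
  "energy \<Omega> m s p f u >= bet"
  using u unfolding mountain_pass_type_def by blast
 have "\<forall>w\<in>X_mu \<Omega> m s p. mu_norm m s p w = rho --> energy \<Omega> m s p g w >= bet"
  using *(4) assms(1) by fastforce
 moreover have "energy \<Omega> m s p g e < bet" using *(6) assms(1)[OF *(3)] by simp
 moreover have "energy \<Omega> m s p g (%x. 0) = 0" using *(7) assms(1)[OF assms(3)] by simp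
 moreover have "energy \<Omega> m s p g u = (INF sig\<in>paths_to \<Omega> m s p e. SUP t\<in>{0..1}. energy \<Omega> m s p g (sig t))"
  using *(8) inf assms(1)[OF uX] by simp
 moreover have "energy \<Omega> m s p g u >= bet" using *(9) assms(1)[OF uX] by simp
 ultimately show ?thesis unfolding mountain_pass_type_def using cp *(1,2,3,5) by blast
qed

theorem corollary1p7:
  fixes \<Omega> :: "(real ^ 'n) set"
    and m :: nat
    and s p :: "nat \<Rightarrow> real"
    and pstar phat :: real
    and f :: "real ^ 'n \<Rightarrow> real \<Rightarrow> real"
  assumes "CARD('n) \<ge> 2"
    and "bounded \<Omega>" and "open \<Omega>" and "\<Omega> \<noteq> {}" and "smooth_boundary \<Omega>"
    and "m \<noteq> 0"
    and "\<forall>k\<in>{1..m}. s k \<in> {0..1}"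
    and "\<forall>k\<in>{1..m}. p k \<in> {1<..<real CARD('n)}"
    and "\<forall>k\<in>{1..m}. pstar = real CARD('n) * p k / (real CARD('n) - s k * p k)"
    and "phat = Max (p ` {1..m})"
    and "caratheodory \<Omega> f"
    and "\<exists>a1>0. \<exists>a2>0. \<exists>q\<in>{phat<..<pstar}.
           AE x in lebesgue_on \<Omega>. \<forall>t. \<bar>f x t\<bar> \<le> a1 + a2 * \<bar>t\<bar> powr (q - 1)"
    and "\<exists>Z\<in>null_sets lebesgue.
           uniform_limit (\<Omega> - Z) (\<lambda>t x. f x t / (\<bar>t\<bar> powr (phat - 2) * t)) (\<lambda>x. 0) (at 0)"
    and "\<exists>\<theta>>phat. \<exists>r\<ge>0.
           AE x in lebesgue_on \<Omega>. \<forall>t. \<bar>t\<bar> > r \<longrightarrow>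
             0 < \<theta> * primitive f x t \<and> \<theta> * primitive f x t \<le> f x t * t"
    and "\<exists>\<theta>'>phat. \<exists>a3>0. \<exists>a4. integrable (lebesgue_on \<Omega>) a4 \<and>
           (AE x in lebesgue_on \<Omega>. \<forall>t. primitive f x t \<ge> a3 * \<bar>t\<bar> powr \<theta>' - a4 x)"
  shows "\<exists>u. weak_solution \<Omega> m s p f u \<and> mountain_pass_type \<Omega> m s p f u"
proof -
 let ?N = "real CARD('n)"
 have k1: "1 \<in> {1..m}" using assms(6) by simp
 have s: "0 <= s k" "s k <= 1" and p: "1 < p k" "p k < ?N" if "k \<in> {1..m}" for k
  using bspec[OF assms(7) that] bspec[OF assms(8) that] by simp_all
 note ps = bspec[OF assms(9)]
 have phat: "p k <= phat" if "k \<in> {1..m}" for k unfolding assms(10) by (rule Max_ge) (use that in auto)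
 obtain a1 a2 q where qs: "a1 > 0" "a2 > 0" "phat < q" "q < pstar"
  "AE x in lebesgue_on \<Omega>. \<forall>t. \<bar>f x t\<bar> <= a1 + a2 * \<bar>t\<bar> powr (q - 1)" using assms(12) by auto
 obtain Z0 where Z0: "Z0 \<in> null_sets lebesgue"
  "uniform_limit (\<Omega> - Z0) (%t x. f x t / (\<bar>t\<bar> powr (phat - 2) * t)) (%x. 0) (at 0)" using assms(13) by auto
 obtain \<theta> r where AR: "\<theta> > phat" "r >= 0"
  "AE x in lebesgue_on \<Omega>. \<forall>t. \<bar>t\<bar> > r --> 0 < \<theta> * primitive f x t & \<theta> * primitive f x t <= f x t * t" using assms(14) by auto
 obtain \<theta>' a3 a4 where super: "\<theta>' > phat" "a3 > 0" "integrable (lebesgue_on \<Omega>) a4"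
  "AE x in lebesgue_on \<Omega>. \<forall>t. primitive f x t >= a3 * \<bar>t\<bar> powr \<theta>' - a4 x" using assms(15) by auto
 have car: "!!t. (%x. f x t) \<in> borel_measurable (lebesgue_on \<Omega>)" "AE x in lebesgue_on \<Omega>. continuous_on UNIV (f x)"
  using assms(11) by (auto simp: caratheodory_def)
 have \<Omega>: "\<Omega> \<in> sets lebesgue" using assms(3) by simp
 obtain R0 where R0: "\<Omega> \<subseteq> cball 0 R0" using assms(2) by (auto simp: bounded_iff subset_iff)
 define R where "R = max 1 R0"
 have R: "R > 0" "\<Omega> \<subseteq> cball 0 R" using R0 by (auto simp: R_def)
 have den: "?N - s k * p k > 0" if "k \<in> {1..m}" for k
 proof -
  have "s k * p k <= 1 * p k" using s[OF that] p[OF that] by (intro mult_right_mono) auto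
  thus ?thesis using p[OF that] by linarith
 qed
 \<comment> \<open>For order 0 the critical exponent collapses to \<open>p k\<close>, leaving no
   room for \<open>q\<close> between \<open>phat\<close> and \<open>pstar\<close>.\<close>
 have s0: "0 < s k" if k: "k \<in> {1..m}" for k
 proof (rule ccontr)
  assume "~ 0 < s k"
  hence "s k = 0" using s[OF k] by simp
  hence "pstar = p k" using ps[OF k] by simp
  thus False using phat[OF k] qs by simp
 qed
 have q1: "q > 1" using phat[OF k1] p[OF k1] qs by simp
 \<comment> \<open>This is \<open>q < pstar\<close> rewritten through
   \<open>1 / pstar = 1 / p 1 - s 1 / ?N\<close>.\<close>
 have sub: "?N * (1 / p 1 - 1 / q) < s 1"
 proof -
  have "1 / pstar < 1 / q" using qs q1 by (intro divide_strict_left_mono) auto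
  moreover have "1 / pstar = 1 / p 1 - s 1 / ?N" using ps[OF k1] p[OF k1] by (simp add: diff_divide_distrib)
  ultimately have "1 / p 1 - 1 / q < s 1 / ?N" by linarith
  hence "?N * (1 / p 1 - 1 / q) < ?N * (s 1 / ?N)" by (intro mult_strict_left_mono) auto
  thus ?thesis by simp
 qed
 interpret energy_space \<Omega> m s p R
 proof
  show "open \<Omega>" "R > 0" "\<Omega> \<subseteq> cball 0 R" "m ~= 0" using assms(3,6) R by auto
  show "0 < s k" "s k <= 1" "1 < p k" if "k \<in> {1..m}" for k by (rule s0[OF that] s(2)[OF that] p(1)[OF that])+
 qed
 define good where "good x \<longleftrightarrow> continuous_on UNIV (f x) & (\<forall>t. \<bar>f x t\<bar> <= a1 + a2 * \<bar>t\<bar> powr (q - 1)) &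
   (\<forall>t. \<bar>t\<bar> > r --> 0 < \<theta> * primitive f x t & \<theta> * primitive f x t <= f x t * t) &
   (\<forall>t. primitive f x t >= a3 * \<bar>t\<bar> powr \<theta>' - a4 x)" for x
 have "AE x in lebesgue_on \<Omega>. good x" using car(2) qs(5) AR(3) super(4) by eventually_elim (auto simp: good_def)
 hence "AE x in lebesgue. x \<in> \<Omega> --> good x" using \<Omega> by (subst (asm) AE_restrict_space_iff) auto
 then obtain Z1 where Z1: "Z1 \<in> null_sets lebesgue" "{x. ~ (x \<in> \<Omega> --> good x)} \<subseteq> Z1"
  by (auto simp: eventually_ae_filter)
 define Z where "Z = Z0 \<union> Z1"
 have Z: "Z \<in> null_sets lebesgue" using Z0 Z1 by (simp add: Z_def null_sets.Un)
 \<comment> \<open>A nonempty open set is not negligible, so some point of \<open>\<Omega>\<close>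
   satisfies all the hypotheses.\<close>
 have "~ \<Omega> \<subseteq> Z"
 proof
  assume "\<Omega> \<subseteq> Z"
  hence "\<Omega> \<in> null_sets lebesgue" using Z by (rule null_sets_completion_subset)
  thus False using open_not_negligible[OF assms(3,4)] by (simp add: negligible_iff_null_sets)
 qed
 then obtain x1 where x1: "x1 \<in> \<Omega>" "x1 \<notin> Z" by blast
 \<comment> \<open>Off the null set \<open>Z\<close> every a.e. hypothesis holds; copying \<open>f\<close> from the good point \<open>x1\<close> to \<open>Z\<close>
  makes them hold everywhere and does not change the problem.\<close>
 define tau where "tau x = (if x \<in> Z then x1 else x)" for x
 have tau: "tau x \<in> \<Omega> - Z" if "x \<in> \<Omega>" for x using that x1 by (simp add: tau_def)
 have good: "good (tau x)" if "x \<in> \<Omega>" for x using tau[OF that] Z1(2) by (auto simp: Z_def)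
 define g where "g x = f (tau x)" for x
 have prim: "primitive g x t = primitive f (tau x) t" for x t by (simp add: primitive_def g_def)
 have M: "emeasure (lebesgue_on \<Omega>) (space (lebesgue_on \<Omega>)) < \<infinity>"
  using \<Omega>_sets by (simp add: emeasure_restrict_space)
 interpret nemytskii "lebesgue_on \<Omega>" g q a1 a2
 proof
  show "emeasure (lebesgue_on \<Omega>) (space (lebesgue_on \<Omega>)) < \<infinity>" by (rule M)
  show "(%x. g x t) \<in> borel_measurable (lebesgue_on \<Omega>)" for t
   by (rule lebesgue_on_measurable_cong_null[OF car(1) \<Omega> Z]) (simp add: g_def tau_def)
  show "continuous_on UNIV (g x)" if "x \<in> space (lebesgue_on \<Omega>)" for x using good[of x] that by (simp add: good_def g_def)
  show "\<bar>g x t\<bar> <= a1 + a2 * \<bar>t\<bar> powr (q - 1)" if "x \<in> space (lebesgue_on \<Omega>)" for x t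
   using good[of x] that by (simp add: good_def g_def)
 qed (use q1 qs in auto)
 have phat1: "1 < phat" using phat[OF k1] p[OF k1] by simp
 \<comment> \<open>The radius is uniform in \<open>x\<close> because every \<open>tau x\<close> lies
   in the set on which the limit is uniform.\<close>
 have near0: "\<exists>d>0. \<forall>x\<in>space (lebesgue_on \<Omega>). \<forall>t. t ~= 0 --> \<bar>t\<bar> < d --> \<bar>g x t\<bar> <= e * \<bar>t\<bar> powr (phat - 1)" if e: "e > 0" for e
 proof -
  have "\<forall>\<^sub>F t in at 0. \<forall>x\<in>\<Omega> - Z0. dist (f x t / (\<bar>t\<bar> powr (phat - 2) * t)) 0 < e"
   using uniform_limitD[OF Z0(2) e] .
  then obtain d where d: "d > 0" "!!t x. t ~= 0 ==> dist t 0 < d ==> x \<in> \<Omega> - Z0 ==> dist (f x t / (\<bar>t\<bar> powr (phat - 2) * t)) 0 < e"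
   unfolding eventually_at by blast
  have "\<bar>g x t\<bar> <= e * \<bar>t\<bar> powr (phat - 1)" if x: "x \<in> space (lebesgue_on \<Omega>)" and t: "t ~= 0" "\<bar>t\<bar> < d" for x t
  proof -
   have "tau x \<in> \<Omega> - Z0" using tau[of x] x by (simp add: Z_def)
   with d(2)[of t "tau x"] t have "\<bar>g x t\<bar> / (\<bar>t\<bar> powr (phat - 2) * \<bar>t\<bar>) < e" by (simp add: g_def abs_mult)
   moreover have "\<bar>t\<bar> powr (phat - 2) * \<bar>t\<bar> = \<bar>t\<bar> powr (phat - 1)"
    using powr_mult_base[of "\<bar>t\<bar>" "phat - 2"] by (simp add: mult.commute)
   ultimately show ?thesis using t by (simp add: divide_less_eq)
  qed
  with d(1) show ?thesis by blast
 qed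
 \<comment> \<open>The function \<open>a4\<close> has to be copied along with \<open>f\<close>,
   since the primitive of \<open>g\<close> at \<open>x\<close> is that of \<open>f\<close> at
   \<open>tau x\<close>.\<close>
 interpret mountain_pass_problem \<Omega> m s p R g q a1 a2 phat \<theta> r \<theta>' a3 "%x. a4 (tau x)"
 proof
  show "\<Omega> ~= {}" "phat < q" "\<theta> > phat" "r >= 0" "\<theta>' > phat" "a3 > 0" by (rule assms(4) qs AR super)+
  show "p k <= phat" if "k \<in> {1..m}" for k by (rule phat[OF that])
  show "real DIM(real ^ 'n) * (1 / p 1 - 1 / q) < s 1" using sub by simp
  show "\<exists>C\<ge>0. \<forall>x\<in>\<Omega>. \<forall>t. \<bar>primitive g x t\<bar> <= eps * \<bar>t\<bar> powr phat + C * \<bar>t\<bar> powr q" if "eps > 0" for eps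
   using primitive_small[OF phat1 qs(3) near0 that] by simp
  show "\<theta> * primitive g x t <= g x t * t" if "x \<in> \<Omega>" "\<bar>t\<bar> > r" for x t
   using good[OF that(1)] that(2) by (simp add: good_def prim) (simp add: g_def)
  show "integrable (lebesgue_on \<Omega>) (%x. a4 (tau x))"
   by (rule lebesgue_on_cong_null(1)[OF super(3) \<Omega> Z]) (simp add: tau_def)
  show "a3 * \<bar>t\<bar> powr \<theta>' - a4 (tau x) <= primitive g x t" if "x \<in> \<Omega>" for x t
   using good[OF that] by (simp add: good_def prim)
 qed
 obtain u where u: "weak_solution \<Omega> m s p g u" "mountain_pass_type \<Omega> m s p g u" using solution_exists by blast
 have off: "f x = g x" if "x \<notin> Z" for x using that by (simp add: g_def tau_def)
 have "weak_solution \<Omega> m s p f u"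
  unfolding weak_solution_def
 proof (intro conjI ballI)
  show "u \<in> X" using u(1) by (simp add: weak_solution_def)
  fix v assume v: "v \<in> X"
  have i: "integrable (lebesgue_on \<Omega>) (%x. g x (u x) * v x)"
   and e: "(\<Sum>k = 1..m. form_sp \<Omega> (s k) (p k) u v) = (LINT x|lebesgue_on \<Omega>. g x (u x) * v x)"
   using u(1) v unfolding weak_solution_def by blast+
  have eq: "f x (u x) * v x = g x (u x) * v x" if "x \<in> \<Omega>" "x \<notin> Z" for x using off[OF that(2)] by simp
  show "integrable (lebesgue_on \<Omega>) (%x. f x (u x) * v x)" by (rule lebesgue_on_cong_null(1)[OF i \<Omega> Z eq])
  show "(\<Sum>k = 1..m. form_sp \<Omega> (s k) (p k) u v) = (LINT x|lebesgue_on \<Omega>. f x (u x) * v x)"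
   unfolding e by (rule lebesgue_on_cong_null(2)[OF i \<Omega> Z eq, symmetric])
 qed
 moreover have "mountain_pass_type \<Omega> m s p f u"
 proof (rule mountain_pass_type_cong[OF _ _ _ u(2)])
  fix w assume w: "w \<in> X"
  have i: "integrable (lebesgue_on \<Omega>) (%x. primitive g x (w x))" by (rule primitive_integrable[OF Lp_mem_q[OF X_Y[OF w]]])
  have "(LINT x|lebesgue_on \<Omega>. primitive f x (w x)) = (LINT x|lebesgue_on \<Omega>. primitive g x (w x))"
   by (rule lebesgue_on_cong_null(2)[OF i \<Omega> Z]) (simp add: prim tau_def)
  thus "energy \<Omega> m s p g w = energy \<Omega> m s p f w" by (simp add: energy_def)
 next
  show "(%x. v x + w x) \<in> X" if "v \<in> X" "w \<in> X" for v w using subspace_add[OF X_subspace that] by (simp add: plus_fun_def)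
  show "(%x. 0) \<in> X" using subspace_0[OF X_subspace] by (simp add: zero_fun_def)
 qed
 ultimately show ?thesis by blast
qed

end
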